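(* Let $r\in[\frac13,\frac35)$, $\rho=1-\frac53 r$, and let $\mathcal{R}=(r_i,\rho_i)_{i\ge1}$ be the constant sequence of matching pairs $(r_i,\rho_i)=(r,\rho)$ for all $i$. Let $\beta\in(0,\frac13)$ with $\beta>\frac1{9r}$, let $\mu=\mu_l$ and $d_S=\frac{\ln 9}{-\ln(\beta r)}$. Then there exists a nonconstant periodic function $G:\mathbb{R}\to\mathbb{R}$ with period $T=-\ln\sqrt{\beta r}$ such that, as $x\to\infty$, $$N_D^{\mu_l,\mathcal{R}}(x)=G\left(\frac{\ln x}{2}\right)x^{\frac12 d_S}+\mathcal{O}(x^{\frac12}).$$
   Context: Stretched Sierpinski Gasket. Fix $\alpha\in(0,1)$. Let $p_1,p_2,p_3\in\mathbb{R}^2$ be the vertices of an equilateral triangle of side length 1, $\mathcal{A}=\{1,2,3\}$, $G_i(x)=\frac{1-\alpha}{2}(x-p_i)+p_i$, and for $\{i,j,k\}=\{1,2,3\}$ let $e_i=\{\lambda G_j(p_k)+(1-\lambda)G_k(p_j):\lambda\in(0,1)\}$ (open segment). $K$ is the unique nonempty compact set with $K=G_1(K)\cup G_2(K)\cup G_3(K)\cup e_1\cup e_2\cup e_3$. For $w=w_1\cdots w_m\in\mathcal{A}^m$, $m\in\mathbb{N}_0$, put $|w|=m$, $G_w=G_{w_1}\circ\cdots\circ G_{w_m}$ ($G_w=\mathrm{id}$ for the empty word), $e_i^w=G_w(e_i)$; $V_0=\{p_1,p_2,p_3\}$. Energy. A matching pair is $(r,\rho)$ with $r,\rho>0$ and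 $\frac53 r+\rho=1$. For a sequence of matching pairs $\mathcal{R}=(r_i,\rho_i)_{i\ge1}$ put $\delta_m=r_1\cdots r_m$ ($\delta_0=1$), $\gamma_m=r_1\cdots r_{m-1}\rho_m$. For $u:K\to\mathbb{R}$ let $Q_0(u,u)=(u(p_1)-u(p_2))^2+(u(p_2)-u(p_3))^2+(u(p_3)-u(p_1))^2$, $Q_m(u,u)=\sum_{w\in\mathcal{A}^m}Q_0(u\circ G_w,u\circ G_w)$, and $\mathcal{D}^I_k(u,u)=\sum_{w\in\mathcal{A}^{k-1},\,i\in\mathcal{A}}\int_0^1\big(\frac{d(u\circ\xi_{e_i^w})}{dx}\big)^2dx$, where $\xi_{e}:(0,1)\to e$ is the affine parametrization of the segment $e$. Define $$\mathcal{E}_{\mathcal{R}}(u,u)=\lim_{m\to\infty}\frac1{\delta_m}Q_m(u,u)+\sum_{k=1}^\infty\frac1{\gamma_k}\mathcal{D}^I_k(u,u)$$ on $\mathcal{D}_{\mathcal{R}}=\{u\in C(K):\ u\circ\xi_{e_i^w}\in H^1(0,1)\text{ for all } i\in\mathcal{A},\,w\in\bigcup_m\mathcal{A}^m,\ \mathcal{E}_{\mathcal{R}}(u,u)<\infty\}$, extended to a bilinear form by polarization. Let $\mathcal{D}_{\mathcal{R}}^0=\{u\in\mathcal{D}_{\mathcal{R}}: u|_{V_0}\equiv0\}$. Measure. For $\beta\in(0,\frac13)$, $\mu_l$ is the Borel probability measure on $K$ carried by the union of all $e_i^w$ with $\mu_l|_{e_i^w}=a\beta^{|w|}\frac{\lambda^1}{\lambda^1(e_i^w)}$,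 where $\lambda^1$ is one-dimensional Lebesgue measure (length) and $a=\frac13-\beta$. Operators. It is known that $(\mathcal{E}_{\mathcal{R}},\mathcal{D}_{\mathcal{R}}^0)$ is a regular Dirichlet form on $L^2(K,\mu_l|_{K\setminus V_0})$ whose associated self-adjoint operator $-\Delta_D^{\mu_l,\mathcal{R}}$ has discrete nonnegative spectrum. $N_D^{\mu_l,\mathcal{R}}(x)$ is the number of its eigenvalues $\le x$, counted with multiplicity. *)

theory Defs
  imports "HOL-Analysis.Analysis" "HOL-Library.Function_Algebras" "HOL-Library.Landau_Symbols"
begin

(* The alphabet {1,2,3} is the type 3 (where 3 = 0).  For each i, the two other
   letters are i + 1 and i + 2. *)

definition equilateral :: "(3 \<Rightarrow> real^2) \<Rightarrow> bool" where
  "equilateral p \<longleftrightarrow> (\<forall>i j. i \<noteq> j \<longrightarrow> dist (p i) (p j) = 1)"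

definition Gmap :: "real \<Rightarrow> (3 \<Rightarrow> real^2) \<Rightarrow> 3 \<Rightarrow> real^2 \<Rightarrow> real^2" where
  "Gmap \<alpha> p i x = ((1 - \<alpha>) / 2) *\<^sub>R (x - p i) + p i"

fun Gword :: "real \<Rightarrow> (3 \<Rightarrow> real^2) \<Rightarrow> 3 list \<Rightarrow> real^2 \<Rightarrow> real^2" where
  "Gword \<alpha> p [] = id"
| "Gword \<alpha> p (i # w) = Gmap \<alpha> p i \<circ> Gword \<alpha> p w"

definition seg :: "real \<Rightarrow> (3 \<Rightarrow> real^2) \<Rightarrow> 3 \<Rightarrow> real \<Rightarrow> real^2" where
  "seg \<alpha> p i t = t *\<^sub>R Gmap \<alpha> p (i + 1) (p (i + 2)) + (1 - t) *\<^sub>R Gmap \<alpha> p (i + 2) (p (i + 1))"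

definition edge :: "real \<Rightarrow> (3 \<Rightarrow> real^2) \<Rightarrow> 3 \<Rightarrow> (real^2) set" where
  "edge \<alpha> p i = seg \<alpha> p i ` {0<..<1}"

definition SSG :: "real \<Rightarrow> (3 \<Rightarrow> real^2) \<Rightarrow> (real^2) set" where
  "SSG \<alpha> p = (THE K. K \<noteq> {} \<and> compact K \<and>
     K = (\<Union>i. Gmap \<alpha> p i ` K) \<union> (\<Union>i. edge \<alpha> p i))"

definition V0 :: "(3 \<Rightarrow> real^2) \<Rightarrow> (real^2) set" where
  "V0 p = range p"

definition edge_word :: "real \<Rightarrow> (3 \<Rightarrow> real^2) \<Rightarrow> 3 list \<Rightarrow> 3 \<Rightarrow> (real^2) set" where
  "edge_word \<alpha> p w i = Gword \<alpha> p w ` edge \<alpha> p i"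

definition \<xi> :: "real \<Rightarrow> (3 \<Rightarrow> real^2) \<Rightarrow> 3 list \<Rightarrow> 3 \<Rightarrow> real \<Rightarrow> real^2" where
  "\<xi> \<alpha> p w i t = Gword \<alpha> p w (seg \<alpha> p i t)"

definition test_function :: "(real \<Rightarrow> real) \<Rightarrow> bool" where
  "test_function \<phi> \<longleftrightarrow> (\<forall>n. ((deriv ^^ n) \<phi>) differentiable_on UNIV) \<and>
     (\<exists>a b. 0 < a \<and> b < 1 \<and> (\<forall>x. x \<notin> {a..b} \<longrightarrow> \<phi> x = 0))"

definition L2_01 :: "(real \<Rightarrow> real) set" where
  "L2_01 = {f. set_borel_measurable lborel {0<..<1} f \<and>
     set_integrable lborel {0<..<1} (\<lambda>x. (f x)\<^sup>2)}"

definition is_weak_deriv :: "(real \<Rightarrow> real) \<Rightarrow> (real \<Rightarrow> real) \<Rightarrow> bool" where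
  "is_weak_deriv f g \<longleftrightarrow> (\<forall>\<phi>. test_function \<phi> \<longrightarrow>
     (LINT x:{0<..<1}|lborel. f x * deriv \<phi> x) = - (LINT x:{0<..<1}|lborel. g x * \<phi> x))"

definition H1_01 :: "(real \<Rightarrow> real) set" where
  "H1_01 = {f \<in> L2_01. \<exists>g \<in> L2_01. is_weak_deriv f g}"

(* Weak derivatives are unique almost everywhere; this picks a representative. *)
definition weak_deriv :: "(real \<Rightarrow> real) \<Rightarrow> real \<Rightarrow> real" where
  "weak_deriv f = (SOME g. g \<in> L2_01 \<and> is_weak_deriv f g)"

(* A sequence of matching pairs is R :: nat => real * real with R i = (r_i, rho_i)
   for i >= 1; the value R 0 is never used. *)

definition \<delta> :: "(nat \<Rightarrow> real \<times> real) \<Rightarrow> nat \<Rightarrow> real" where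
  "\<delta> R m = (\<Prod>i=1..m. fst (R i))"

definition \<gamma> :: "(nat \<Rightarrow> real \<times> real) \<Rightarrow> nat \<Rightarrow> real" where
  "\<gamma> R m = (\<Prod>i=1..m - 1. fst (R i)) * snd (R m)"

definition Q0 :: "(3 \<Rightarrow> real^2) \<Rightarrow> (real^2 \<Rightarrow> real) \<Rightarrow> real" where
  "Q0 p u = (u (p 1) - u (p 2))\<^sup>2 + (u (p 2) - u (p 3))\<^sup>2 + (u (p 3) - u (p 1))\<^sup>2"

definition Q :: "real \<Rightarrow> (3 \<Rightarrow> real^2) \<Rightarrow> nat \<Rightarrow> (real^2 \<Rightarrow> real) \<Rightarrow> real" where
  "Q \<alpha> p m u = (\<Sum>w | length w = m. Q0 p (u \<circ> Gword \<alpha> p w))"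

definition DI :: "real \<Rightarrow> (3 \<Rightarrow> real^2) \<Rightarrow> nat \<Rightarrow> (real^2 \<Rightarrow> real) \<Rightarrow> real" where
  "DI \<alpha> p k u = (\<Sum>w | length w = k - 1. \<Sum>i\<in>UNIV.
     LINT x:{0<..<1}|lborel. (weak_deriv (u \<circ> \<xi> \<alpha> p w i) x)\<^sup>2)"

(* The series is shifted so that its k-th term is the one of index Suc k.  The limit
   exists in [0,\<infinity>] whenever R consists of matching pairs and the series is finite;
   if the series is infinite, so is the sum, whatever the value of lim. *)
definition energy ::
  "real \<Rightarrow> (3 \<Rightarrow> real^2) \<Rightarrow> (nat \<Rightarrow> real \<times> real) \<Rightarrow> (real^2 \<Rightarrow> real) \<Rightarrow> ennreal" where
  "energy \<alpha> p R u = lim (\<lambda>m. ennreal (Q \<alpha> p m u / \<delta> R m))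
     + (\<Sum>k. ennreal (DI \<alpha> p (Suc k) u / \<gamma> R (Suc k)))"

(* A function on K is represented by its extension by 0 to the plane, so that distinct
   elements of the domain are distinct functions on K. *)
definition form_dom ::
  "real \<Rightarrow> (3 \<Rightarrow> real^2) \<Rightarrow> (nat \<Rightarrow> real \<times> real) \<Rightarrow> (real^2 \<Rightarrow> real) set" where
  "form_dom \<alpha> p R = {u. continuous_on (SSG \<alpha> p) u \<and> (\<forall>x. x \<notin> SSG \<alpha> p \<longrightarrow> u x = 0) \<and>
     (\<forall>w i. u \<circ> \<xi> \<alpha> p w i \<in> H1_01) \<and> energy \<alpha> p R u < \<infinity>}"

definition form_dom0 ::
  "real \<Rightarrow> (3 \<Rightarrow> real^2) \<Rightarrow> (nat \<Rightarrow> real \<times> real) \<Rightarrow> (real^2 \<Rightarrow> real) set" where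
  "form_dom0 \<alpha> p R = {u \<in> form_dom \<alpha> p R. \<forall>x\<in>V0 p. u x = 0}"

definition energy_form :: "real \<Rightarrow> (3 \<Rightarrow> real^2) \<Rightarrow> (nat \<Rightarrow> real \<times> real)
    \<Rightarrow> (real^2 \<Rightarrow> real) \<Rightarrow> (real^2 \<Rightarrow> real) \<Rightarrow> real" where
  "energy_form \<alpha> p R u v =
     (enn2real (energy \<alpha> p R (\<lambda>x. u x + v x)) - enn2real (energy \<alpha> p R (\<lambda>x. u x - v x))) / 4"

(* One-dimensional Lebesgue measure (length) on the segment edge_word \<alpha> p w i: the affine
   parametrization stretches lengths by the distance of the endpoints. *)
definition edge_length :: "real \<Rightarrow> (3 \<Rightarrow> real^2) \<Rightarrow> 3 list \<Rightarrow> 3 \<Rightarrow> (real^2) set \<Rightarrow> ennreal" where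
  "edge_length \<alpha> p w i B = ennreal (dist (\<xi> \<alpha> p w i 0) (\<xi> \<alpha> p w i 1)) *
     emeasure lborel {t \<in> {0<..<1}. \<xi> \<alpha> p w i t \<in> B}"

definition mu_l :: "real \<Rightarrow> (3 \<Rightarrow> real^2) \<Rightarrow> real \<Rightarrow> (real^2) measure" where
  "mu_l \<alpha> p \<beta> = measure_of (SSG \<alpha> p) (sets (restrict_space borel (SSG \<alpha> p)))
     (\<lambda>B. \<Sum>m. \<Sum>w | length w = m. \<Sum>i\<in>UNIV. ennreal ((1 / 3 - \<beta>) * \<beta> ^ m) *
        (edge_length \<alpha> p w i B / edge_length \<alpha> p w i (edge_word \<alpha> p w i)))"

definition L2_fun :: "(real^2) measure \<Rightarrow> (real^2 \<Rightarrow> real) set" where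
  "L2_fun M = {f \<in> borel_measurable M. integrable M (\<lambda>x. (f x)\<^sup>2)}"

(* Graph of the nonnegative self-adjoint operator associated with the form on the
   L2 space of K minus V0: u is mapped to f iff E(u,v) = <f,v> for all v in the form domain. *)
definition dirichlet_op :: "real \<Rightarrow> (3 \<Rightarrow> real^2) \<Rightarrow> (nat \<Rightarrow> real \<times> real)
    \<Rightarrow> (real^2) measure \<Rightarrow> ((real^2 \<Rightarrow> real) \<times> (real^2 \<Rightarrow> real)) set" where
  "dirichlet_op \<alpha> p R \<mu> = (let M = restrict_space \<mu> (SSG \<alpha> p - V0 p) in
     {(u, f). u \<in> form_dom0 \<alpha> p R \<and> f \<in> L2_fun M \<and>
        (\<forall>v \<in> form_dom0 \<alpha> p R. energy_form \<alpha> p R u v = (LINT x|M. f x * v x))})"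

definition eigenspace :: "real \<Rightarrow> (3 \<Rightarrow> real^2) \<Rightarrow> (nat \<Rightarrow> real \<times> real)
    \<Rightarrow> (real^2) measure \<Rightarrow> real \<Rightarrow> (real^2 \<Rightarrow> real) set" where
  "eigenspace \<alpha> p R \<mu> \<kappa> = {u. (u, \<lambda>x. \<kappa> * u x) \<in> dirichlet_op \<alpha> p R \<mu>}"

definition eigenvalues :: "real \<Rightarrow> (3 \<Rightarrow> real^2) \<Rightarrow> (nat \<Rightarrow> real \<times> real)
    \<Rightarrow> (real^2) measure \<Rightarrow> real set" where
  "eigenvalues \<alpha> p R \<mu> = {\<kappa>. \<exists>u \<in> eigenspace \<alpha> p R \<mu> \<kappa>. u \<noteq> (\<lambda>x. 0)}"

definition multiplicity_of :: "real \<Rightarrow> (3 \<Rightarrow> real^2) \<Rightarrow> (nat \<Rightarrow> real \<times> real)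
    \<Rightarrow> (real^2) measure \<Rightarrow> real \<Rightarrow> nat" where
  "multiplicity_of \<alpha> p R \<mu> \<kappa> =
     vector_space.dim (\<lambda>(c::real) (u::real^2 \<Rightarrow> real) x. c * u x) (eigenspace \<alpha> p R \<mu> \<kappa>)"

(* sum and dim are 0 in the infinite case, which does not occur: the spectrum is
   discrete, so only finitely many eigenvalues lie below x, with finite multiplicities. *)
definition N_D :: "real \<Rightarrow> (3 \<Rightarrow> real^2) \<Rightarrow> (nat \<Rightarrow> real \<times> real)
    \<Rightarrow> (real^2) measure \<Rightarrow> real \<Rightarrow> nat" where
  "N_D \<alpha> p R \<mu> x = (\<Sum>\<kappa> \<in> {\<kappa> \<in> eigenvalues \<alpha> p R \<mu>. \<kappa> \<le> x}. multiplicity_of \<alpha> p R \<mu> \<kappa>)"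

lemma vector_space_fun: "vector_space (\<lambda>(c::real) (u::real^2 \<Rightarrow> real) x. c * u x)"
  by unfold_locales (auto simp: fun_eq_iff algebra_simps)

end

theory Submission
  imports Defs
begin

text \<open>Put \<open>c = \<beta> * r\<close>. Extending functions by zero from the three cells, and conversely imposing
  finitely many conditions (on the vertices of the cells and on about \<open>sqrt x\<close> points of the edges),
  bounds the counting function from both sides: \<open>3 * N (c * x) \<le> N x \<le> 3 * N (c * x) + O(sqrt x)\<close>.
  As \<open>1 / 9 < c\<close>, \<open>N (x / c ^ m) / 3 ^ m\<close> converges to some \<open>F x\<close> with \<open>F (x / c) = 3 * F x\<close> and
  \<open>N x - F x = O(sqrt x)\<close>; the periodic function is \<open>F\<close> divided by the power of \<open>x\<close>.

  If that function were constant, \<open>F\<close> would be continuous. But an eigenfunction that is antisymmetric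
  under the symmetry group of the triangle satisfies the Neumann condition at the vertices besides the
  Dirichlet one, so its copies in the \<open>3 ^ n\<close> cells of level \<open>n\<close>, extended by zero, are independent
  eigenfunctions for \<open>\<kappa> / c ^ n\<close>, and \<open>F\<close> jumps at \<open>\<kappa>\<close>.

  The energy is handled as the increasing limit of quadratic forms in point values (dyadic increments
  on the edges); these forms are self-similar and symmetric by construction.\<close>

subsection \<open>Linear algebra\<close>

text \<open>The factor \<open>c\<close> comes from scaling: carrying a function from the gasket into
  a cell multiplies its energy by \<open>1 / r\<close> and its mass by \<beta>, hence eigenvalues by
  \<open>1 / (\<beta> * r)\<close>. The normalised error \<open>sqrt (x / c ^ m) / 3 ^ m\<close> is
  summable exactly when \<open>3 * sqrt c > 1\<close>. No spectral theorem is invoked. Eigenvectors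
  are constrained minimisers, and the analytic input is one estimate: the mass is at most a small
  multiple of the energy plus finitely many squared point values. It follows by iterating
  self-similarity and drives both the minimisation and the dimension counts. The delicate point is
  the jump. A Dirichlet eigenfunction extended by zero from a cell is in general no eigenfunction,
  since test functions need not vanish at the vertices of the cell. The equation has to hold against
  all functions of finite energy. Antisymmetry achieves this: antisymmetrising a test function
  changes its pairing with an antisymmetric function by a constant factor only, and the result
  vanishes at each vertex because a reflection fixes that vertex.\<close>

instantiation "fun" :: (type, real_vector) real_vector
begin

text \<open>Pointwise scaling on function types makes \<open>subspace\<close>,
  \<open>independent\<close> and \<open>dim\<close> available for spaces of functions. It is the
  scaling that occurs in \<open>multiplicity_of\<close>, so both notions of dimension agree.\<close>

definition scaleR_fun :: "real \<Rightarrow> ('a \<Rightarrow> 'b) \<Rightarrow> 'a \<Rightarrow> 'b"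
  where "scaleR_fun c f = (\<lambda>x. c *\<^sub>R f x)"

instance
  by standard (auto simp: scaleR_fun_def fun_eq_iff scaleR_add_right scaleR_add_left)

end

text \<open>Gaussian elimination: the pivot \<open>i0\<close> is removed from the remaining
  equations, and \<open>c0\<close> then solves equation \<open>j\<close>. All dimension counts below
  rest on this form, in which functionals are set against the coefficients of a finite
  family.\<close>

lemma homogeneous_system:
  fixes A :: "'j \<Rightarrow> 'i \<Rightarrow> real"
  assumes "finite J" "finite I" "card J < card I"
  shows "\<exists>c. (\<exists>i\<in>I. c i \<noteq> 0) \<and> (\<forall>j\<in>J. (\<Sum>i\<in>I. A j i * c i) = 0)"
  using assms
proof (induction J arbitrary: I A rule: finite_induct)
  case empty
  then have "I \<noteq> {}" by auto
  then show ?case by (intro exI[of _ "\<lambda>_. 1"]) auto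
next
  case (insert j J)
  show ?case
  proof (cases "\<forall>i\<in>I. A j i = 0")
    case True
    obtain c where "\<exists>i\<in>I. c i \<noteq> 0" "\<forall>k\<in>J. (\<Sum>i\<in>I. A k i * c i) = 0"
      using insert.IH[of I A] insert.prems insert.hyps by auto
    with True show ?thesis by (intro exI[of _ c]) auto
  next
    case False
    then obtain i0 where i0: "i0 \<in> I" "A j i0 \<noteq> 0" by auto
    define I' where "I' = I - {i0}"
    have fin: "finite I'" "i0 \<notin> I'" and I: "I = insert i0 I'"
      using i0 insert.prems by (auto simp: I'_def)
    have "card J < card I'"
      using insert.prems insert.hyps fin I by simp
    from insert.IH[OF fin(1) this, of "\<lambda>k i. A k i - A k i0 * A j i / A j i0"]
    obtain c where c: "\<exists>i\<in>I'. c i \<noteq> 0"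
      "\<forall>k\<in>J. (\<Sum>i\<in>I'. (A k i - A k i0 * A j i / A j i0) * c i) = 0" by blast
    define c0 where "c0 = - (\<Sum>i\<in>I'. A j i * c i) / A j i0"
    define c' where "c' = c(i0 := c0)"
    have s: "(\<Sum>i\<in>I. A k i * c' i) = A k i0 * c0 + (\<Sum>i\<in>I'. A k i * c i)" for k
    proof -
      have "(\<Sum>i\<in>I'. A k i * c' i) = (\<Sum>i\<in>I'. A k i * c i)"
        using fin by (intro sum.cong) (auto simp: c'_def)
      then show ?thesis using fin unfolding I by (simp add: c'_def)
    qed
    have "(\<Sum>i\<in>I. A k i * c' i) = 0" if "k \<in> J" for k
    proof -
      have "(\<Sum>i\<in>I'. (A k i - A k i0 * A j i / A j i0) * c i)
        = (\<Sum>i\<in>I'. A k i * c i) - A k i0 / A j i0 * (\<Sum>i\<in>I'. A j i * c i)"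
        by (simp add: algebra_simps sum_subtractf sum_distrib_left)
      then show ?thesis using c(2) that unfolding s c0_def by simp
    qed
    moreover have "(\<Sum>i\<in>I. A j i * c' i) = 0"
      using i0 unfolding s c0_def by simp
    moreover have "\<exists>i\<in>I. c' i \<noteq> 0"
      using c(1) fin unfolding I c'_def by auto
    ultimately show ?thesis by (intro exI[of _ c']) auto
  qed
qed

subsection \<open>Symmetric forms\<close>

text \<open>The form lives on a subspace \<open>H\<close> because an energy is bilinear only on
  functions of finite energy, while the type contains all functions.\<close>

locale sym_form =
  fixes H :: "'v::real_vector set" and P :: "'v \<Rightarrow> 'v \<Rightarrow> real"
  assumes sub: "subspace H"
    and sym: "u \<in> H \<Longrightarrow> v \<in> H \<Longrightarrow> P u v = P v u"
    and lin: "u \<in> H \<Longrightarrow> v \<in> H \<Longrightarrow> w \<in> H \<Longrightarrow> P (a *\<^sub>R u + b *\<^sub>R v) w = a * P u w + b * P v w"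
    and nonneg: "u \<in> H \<Longrightarrow> 0 \<le> P u u"
begin

lemma comb_in: "u \<in> H \<Longrightarrow> v \<in> H \<Longrightarrow> a *\<^sub>R u + b *\<^sub>R v \<in> H"
  by (simp add: sub subspace_add subspace_mul)

lemma add_in: "u \<in> H \<Longrightarrow> v \<in> H \<Longrightarrow> u + v \<in> H"
  by (simp add: sub subspace_add)

lemma diff_in: "u \<in> H \<Longrightarrow> v \<in> H \<Longrightarrow> u - v \<in> H"
  by (simp add: sub subspace_diff)

lemma scale_in: "u \<in> H \<Longrightarrow> a *\<^sub>R u \<in> H"
  by (simp add: sub subspace_mul)

lemma zero_in: "0 \<in> H"
  by (simp add: sub subspace_0)

lemma sum_in: "(\<And>i. i \<in> I \<Longrightarrow> e i \<in> H) \<Longrightarrow> (\<Sum>i\<in>I. c i *\<^sub>R e i) \<in> H"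
  by (simp add: sub subspace_sum subspace_mul)

lemma add_left: "u \<in> H \<Longrightarrow> v \<in> H \<Longrightarrow> w \<in> H \<Longrightarrow> P (u + v) w = P u w + P v w"
  using lin[of u v w 1 1] by simp

lemma diff_left: "u \<in> H \<Longrightarrow> v \<in> H \<Longrightarrow> w \<in> H \<Longrightarrow> P (u - v) w = P u w - P v w"
  using lin[of u v w 1 "-1"] by simp

lemma scale_left: "u \<in> H \<Longrightarrow> w \<in> H \<Longrightarrow> P (a *\<^sub>R u) w = a * P u w"
  using lin[of u u w a 0] by simp

lemma zero_left: "w \<in> H \<Longrightarrow> P 0 w = 0"
  using scale_left[of w w 0] by simp

lemma add_right: "u \<in> H \<Longrightarrow> v \<in> H \<Longrightarrow> w \<in> H \<Longrightarrow> P w (u + v) = P w u + P w v"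
  using add_left[of u v w] by (simp add: sym add_in)

lemma diff_right: "u \<in> H \<Longrightarrow> v \<in> H \<Longrightarrow> w \<in> H \<Longrightarrow> P w (u - v) = P w u - P w v"
  using diff_left[of u v w] by (simp add: sym diff_in)

lemma scale_right: "u \<in> H \<Longrightarrow> w \<in> H \<Longrightarrow> P w (a *\<^sub>R u) = a * P w u"
  using scale_left[of u w a] by (simp add: sym scale_in)

lemma sum_left:
  assumes "finite I" "\<And>i. i \<in> I \<Longrightarrow> e i \<in> H" "w \<in> H"
  shows "P (\<Sum>i\<in>I. c i *\<^sub>R e i) w = (\<Sum>i\<in>I. c i * P (e i) w)"
  using assms
proof (induction I rule: finite_induct)
  case empty
  then show ?case by (simp add: zero_left)
next
  case (insert i I)
  then show ?case by (simp add: add_left scale_left scale_in sum_in)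
qed

lemma sum_right:
  assumes "finite I" "\<And>i. i \<in> I \<Longrightarrow> e i \<in> H" "w \<in> H"
  shows "P w (\<Sum>i\<in>I. c i *\<^sub>R e i) = (\<Sum>i\<in>I. c i * P w (e i))"
  using sum_left[OF assms, where c = c] assms by (simp add: sym sum_in cong: sum.cong)

lemma square_add: "u \<in> H \<Longrightarrow> v \<in> H \<Longrightarrow> P (u + v) (u + v) = P u u + 2 * P u v + P v v"
  by (simp add: add_left add_right add_in sym[of v u])

lemma square_diff: "u \<in> H \<Longrightarrow> v \<in> H \<Longrightarrow> P (u - v) (u - v) = P u u - 2 * P u v + P v v"
  by (simp add: diff_left diff_right diff_in sym[of v u])

lemma square_scale: "u \<in> H \<Longrightarrow> P (a *\<^sub>R u) (a *\<^sub>R u) = a\<^sup>2 * P u u"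
  by (simp add: scale_left scale_right scale_in power2_eq_square)

lemma cauchy_schwarz:
  assumes u: "u \<in> H" and v: "v \<in> H"
  shows "(P u v)\<^sup>2 \<le> P u u * P v v"
proof -
  have q: "0 \<le> P u u - 2 * t * P u v + t\<^sup>2 * P v v" for t
    using nonneg[of "u - t *\<^sub>R v"] u v
    by (simp add: square_diff scale_in scale_right scale_left diff_in power2_eq_square algebra_simps)
  show ?thesis
  proof (cases "P v v = 0")
    case True
    have "P u v = 0"
    proof (rule ccontr)
      assume n: "P u v \<noteq> 0"
      \<comment> \<open>For \<open>P v v = 0\<close> the polynomial in \<open>q\<close> is linear in
        \<open>t\<close>, and this value of \<open>t\<close> makes it equal to
        \<open>-1\<close>.\<close>
      have "0 \<le> P u u - 2 * ((P u u + 1) / (2 * P u v)) * P u v" 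
        using q[of "(P u u + 1) / (2 * P u v)"] True by simp
      then show False using n by (simp add: field_simps)
    qed
    then show ?thesis using True by simp
  next
    case False
    then have pos: "P v v > 0" using nonneg[OF v] by simp
    have "0 \<le> P u u - (P u v)\<^sup>2 / P v v"
      using q[of "P u v / P v v"] pos by (simp add: power2_eq_square field_simps)
    then show ?thesis using pos by (simp add: field_simps)
  qed
qed

text \<open>\<open>P\<close> is continuous along sequences converging in its own seminorm: after
  expanding around \<open>X n\<close>, the cross term vanishes by Cauchy-Schwarz.\<close>

lemma square_limit:
  assumes X: "\<And>n. X n \<in> H" and u: "u \<in> H"
    and d: "(\<lambda>n. P (X n - u) (X n - u)) \<longlonglongrightarrow> 0" and l: "(\<lambda>n. P (X n) (X n)) \<longlonglongrightarrow> l"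
  shows "P u u = l"
proof -
  have "(\<lambda>n. P (X n) (X n) * P (X n - u) (X n - u)) \<longlonglongrightarrow> l * 0"
    by (intro tendsto_mult d l)
  then have a: "(\<lambda>n. sqrt (P (X n) (X n) * P (X n - u) (X n - u))) \<longlonglongrightarrow> 0"
    using tendsto_real_sqrt by fastforce
  have b: "norm (P (X n) (X n - u)) \<le> sqrt (P (X n) (X n) * P (X n - u) (X n - u))" for n
    using cauchy_schwarz[OF X diff_in[OF X u]] by (intro real_le_rsqrt) simp
  have m: "(\<lambda>n. P (X n) (X n - u)) \<longlonglongrightarrow> 0"
    by (rule Lim_null_comparison[OF _ a]) (simp add: b del: real_norm_def)
  have "(\<lambda>n. P (X n) (X n) - 2 * P (X n) (X n - u) + P (X n - u) (X n - u))
      \<longlonglongrightarrow> l - 2 * 0 + 0"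
    by (rule tendsto_add[OF tendsto_diff[OF l tendsto_mult[OF tendsto_const m]] d])
  moreover have "P (X n) (X n) - 2 * P (X n) (X n - u) + P (X n - u) (X n - u) = P u u" for n
    using square_diff[OF X diff_in[OF X u], of n n] by simp
  ultimately show ?thesis by (simp add: LIMSEQ_const_iff)
qed

end

lemma quadratic_nonneg_imp_linear_zero:
  fixes b c :: real
  assumes "\<And>t. 0 \<le> 2 * t * b + t\<^sup>2 * c"
  shows "b = 0"
proof (rule ccontr)
  assume "b \<noteq> 0"
  define k where "k = \<bar>c\<bar> + 1"
  have k: "k > 0" "c < 2 * k" by (auto simp: k_def)
  have "0 \<le> 2 * (- b / k) * b + (- b / k)\<^sup>2 * c" by (rule assms)
  also have "\<dots> = b\<^sup>2 * (c - 2 * k) / k\<^sup>2" using k(1) by (simp add: field_simps power2_eq_square)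
  also have "\<dots> < 0" using k \<open>b \<noteq> 0\<close> by (intro divide_neg_pos mult_pos_neg) auto
  finally show False by simp
qed

lemma common_convergent_subsequence:
  fixes f :: "'k \<Rightarrow> nat \<Rightarrow> real"
  assumes "finite \<Phi>" "\<And>k. k \<in> \<Phi> \<Longrightarrow> bounded (range (f k))"
  shows "\<exists>s::nat \<Rightarrow> nat. strict_mono s \<and> (\<forall>k\<in>\<Phi>. convergent (f k \<circ> s))"
  using assms
proof (induction \<Phi> rule: finite_induct)
  case empty
  show ?case by (intro exI[of _ id]) (auto simp: strict_mono_def)
next
  case (insert k \<Phi>)
  then have "\<exists>s::nat \<Rightarrow> nat. strict_mono s \<and> (\<forall>k\<in>\<Phi>. convergent (f k \<circ> s))"
    by (intro insert.IH) simp
  then obtain s :: "nat \<Rightarrow> nat" where s: "strict_mono s" "\<forall>k\<in>\<Phi>. convergent (f k \<circ> s)" by blast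
  have "bounded (range (f k \<circ> s))"
    by (rule bounded_subset[OF insert.prems[of k]]) auto
  from bounded_imp_convergent_subsequence[OF this]
  obtain l t where t: "strict_mono t" "((f k \<circ> s) \<circ> t) \<longlonglongrightarrow> l" by (elim exE conjE)
  have "convergent (f j \<circ> (s \<circ> t))" if "j \<in> insert k \<Phi>" for j
  proof (cases "j = k")
    case True
    then show ?thesis using t(2) unfolding convergent_def comp_assoc by auto
  next
    case False
    then have "convergent (f j \<circ> s)" using s that by auto
    from convergent_subseq_convergent[OF this t(1)] show ?thesis by (simp add: comp_assoc)
  qed
  then show ?case using strict_mono_o[OF s(1) t(1)] by blast
qed

subsection \<open>Eigenvalue counting for a pair of forms\<close>

text \<open>The abstract setting of the weak eigenvalue problem
  \<open>E u v = \<kappa> * L u v\<close>. The assumption \<open>compact\<close> plays the part of a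
  compact embedding: up to a small multiple of the energy, \<open>L\<close> sees only finitely many
  bounded functionals, later point evaluations. Completeness is asked for \<open>E\<close> alone, as
  \<open>E\<close> dominates \<open>L\<close> by \<open>L_le_E\<close>.\<close>

locale form_pair = E: sym_form H E + L: sym_form H L
  for H :: "'v::real_vector set" and E L :: "'v \<Rightarrow> 'v \<Rightarrow> real" +
  fixes bdd :: "('v \<Rightarrow> real) \<Rightarrow> bool"
  defines "bdd \<psi> \<equiv> (\<forall>u\<in>H. \<forall>v\<in>H. \<forall>a b. \<psi> (a *\<^sub>R u + b *\<^sub>R v) = a * \<psi> u + b * \<psi> v) \<and>
      (\<exists>C\<ge>0. \<forall>u\<in>H. (\<psi> u)\<^sup>2 \<le> C * E u u)"
  assumes L_zero: "u \<in> H \<Longrightarrow> L u u = 0 \<Longrightarrow> u = 0"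
    and compact: "\<epsilon> > 0 \<Longrightarrow> \<exists>\<Phi> C. finite \<Phi> \<and> (\<forall>\<psi>\<in>\<Phi>. bdd \<psi>) \<and> 0 \<le> C \<and>
      (\<forall>u\<in>H. L u u \<le> \<epsilon> * E u u + C * (\<Sum>\<psi>\<in>\<Phi>. (\<psi> u)\<^sup>2))"
    and complete: "(\<And>n. X n \<in> H) \<Longrightarrow>
      (\<And>e. e > 0 \<Longrightarrow> \<exists>N. \<forall>m\<ge>N. \<forall>n\<ge>N. E (X m - X n) (X m - X n) < e) \<Longrightarrow>
      \<exists>u\<in>H. (\<lambda>n. E (X n - u) (X n - u)) \<longlonglongrightarrow> 0"
begin

lemma bdd_comb:
  assumes "bdd \<psi>" "u \<in> H" "v \<in> H"
  shows "\<psi> (a *\<^sub>R u + b *\<^sub>R v) = a * \<psi> u + b * \<psi> v"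
  using assms unfolding bdd_def by blast

lemma bdd_bound: "bdd \<psi> \<Longrightarrow> \<exists>C\<ge>0. \<forall>u\<in>H. (\<psi> u)\<^sup>2 \<le> C * E u u"
  unfolding bdd_def by blast

lemma bdd_diff: "bdd \<psi> \<Longrightarrow> u \<in> H \<Longrightarrow> v \<in> H \<Longrightarrow> \<psi> (u - v) = \<psi> u - \<psi> v"
  using bdd_comb[of \<psi> u v 1 "-1"] by simp

lemma linear_sum:
  assumes lin: "\<And>u v a b. u \<in> H \<Longrightarrow> v \<in> H \<Longrightarrow> \<psi> (a *\<^sub>R u + b *\<^sub>R v) = a * \<psi> u + b * \<psi> v"
    and "finite I" "\<And>i. i \<in> I \<Longrightarrow> e i \<in> H"
  shows "\<psi> (\<Sum>i\<in>I. c i *\<^sub>R e i) = (\<Sum>i\<in>I. c i * \<psi> (e i) :: real)"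
  using assms(2,3)
proof (induction I rule: finite_induct)
  case empty
  then show ?case using lin[OF E.zero_in E.zero_in, of 0 0] by simp
next
  case (insert i I)
  have "\<psi> (c i *\<^sub>R e i + 1 *\<^sub>R (\<Sum>i\<in>I. c i *\<^sub>R e i)) = c i * \<psi> (e i) + 1 * \<psi> (\<Sum>i\<in>I. c i *\<^sub>R e i)"
    using insert.prems by (intro lin E.sum_in) auto
  then show ?case using insert by simp
qed

lemma bdd_sum:
  assumes "bdd \<psi>" "finite I" "\<And>i. i \<in> I \<Longrightarrow> e i \<in> H"
  shows "\<psi> (\<Sum>i\<in>I. c i *\<^sub>R e i) = (\<Sum>i\<in>I. c i * \<psi> (e i))"
  by (rule linear_sum[OF bdd_comb[OF assms(1)] assms(2,3)])

text \<open>A Poincare inequality: the functionals that \<open>compact\<close> supplies for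
  \<open>\<epsilon> = 1\<close> are themselves bounded by the energy.\<close>

lemma L_le_E: "\<exists>C\<ge>0. \<forall>u\<in>H. L u u \<le> C * E u u"
proof -
  obtain \<Phi> C where F: "finite \<Phi>" "\<forall>\<psi>\<in>\<Phi>. bdd \<psi>" "0 \<le> C"
    and le: "\<forall>u\<in>H. L u u \<le> 1 * E u u + C * (\<Sum>\<psi>\<in>\<Phi>. (\<psi> u)\<^sup>2)"
    using compact[of 1] zero_less_one by blast
  have "\<forall>\<psi>\<in>\<Phi>. \<exists>D\<ge>0. \<forall>u\<in>H. (\<psi> u)\<^sup>2 \<le> D * E u u"
    using F(2) bdd_bound by blast
  from bchoice[OF this] obtain D where D0: "\<forall>\<psi>\<in>\<Phi>. 0 \<le> D \<psi> \<and> (\<forall>u\<in>H. (\<psi> u)\<^sup>2 \<le> D \<psi> * E u u)" ..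
  have D: "0 \<le> D \<psi>" "u \<in> H \<Longrightarrow> (\<psi> u)\<^sup>2 \<le> D \<psi> * E u u" if "\<psi> \<in> \<Phi>" for \<psi> u
    using bspec[OF D0 that] by simp_all
  have "L u u \<le> (1 + C * sum D \<Phi>) * E u u" if u: "u \<in> H" for u
  proof -
    have "(\<Sum>\<psi>\<in>\<Phi>. (\<psi> u)\<^sup>2) \<le> (\<Sum>\<psi>\<in>\<Phi>. D \<psi> * E u u)"
      using D(2)[OF _ u] by (rule sum_mono)
    then have "C * (\<Sum>\<psi>\<in>\<Phi>. (\<psi> u)\<^sup>2) \<le> C * (sum D \<Phi> * E u u)"
      using F(3) by (intro mult_left_mono) (auto simp: sum_distrib_right)
    then show ?thesis using bspec[OF le u] by (simp add: algebra_simps)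
  qed
  moreover have "0 \<le> 1 + C * sum D \<Phi>" using F(3) D(1) by (simp add: sum_nonneg)
  ultimately show ?thesis by blast
qed

lemma L_pos: "u \<in> H \<Longrightarrow> u \<noteq> 0 \<Longrightarrow> 0 < L u u"
  using L_zero L.nonneg by fastforce

lemma bdd_L:
  assumes b: "b \<in> H"
  shows "bdd (\<lambda>u. L u b)"
proof -
  obtain C where C: "0 \<le> C" "\<forall>u\<in>H. L u u \<le> C * E u u" using L_le_E by blast
  have "(L u b)\<^sup>2 \<le> (C * L b b) * E u u" if u: "u \<in> H" for u
  proof -
    have "(L u b)\<^sup>2 \<le> L u u * L b b" using u b by (rule L.cauchy_schwarz)
    also have "\<dots> \<le> (C * E u u) * L b b"
      using bspec[OF C(2) u] L.nonneg[OF b] by (rule mult_right_mono)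
    finally show ?thesis by (simp add: mult_ac)
  qed
  moreover have "0 \<le> C * L b b" using C(1) L.nonneg[OF b] by simp
  ultimately show ?thesis unfolding bdd_def using L.lin b by blast
qed

text \<open>The direct method on the \<open>L\<close>-unit sphere of \<open>W\<close>. The
  minimising sequence converges in energy, not merely weakly: along a subsequence the finitely many
  functionals of \<open>compact\<close> converge, and the parallelogram law turns this into the
  Cauchy property.\<close>

lemma minimiser_exists:
  assumes \<Psi>: "\<And>\<psi>. \<psi> \<in> \<Psi> \<Longrightarrow> bdd \<psi>"
    and W: "W = {u \<in> H. \<forall>\<psi>\<in>\<Psi>. \<psi> u = 0}" and w: "w \<in> W" "w \<noteq> 0"
  shows "\<exists>u\<in>W. L u u = 1 \<and> (\<forall>v\<in>W. E u u * L v v \<le> E v v)"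
proof -
  have WH: "W \<subseteq> H" using W by auto
  have Wcomb: "a *\<^sub>R u + b *\<^sub>R v \<in> W" if "u \<in> W" "v \<in> W" for a b u v
    using that \<Psi> by (auto simp: W E.comb_in bdd_comb)
  have Wadd: "u + v \<in> W" if "u \<in> W" "v \<in> W" for u v using Wcomb[OF that, of 1 1] by simp
  have Wscale: "a *\<^sub>R u \<in> W" if "u \<in> W" for a u using Wcomb[OF that that, of a 0] by simp
  define S where "S = (\<lambda>u. E u u) ` {u \<in> W. L u u = 1}"
  define \<kappa> where "\<kappa> = Inf S"
  have normalise: "\<exists>u\<in>W. L u u = 1 \<and> E u u = E v v / L v v" if v: "v \<in> W" "v \<noteq> 0" for v
  proof -
    have vH: "v \<in> H" and p: "0 < L v v" using v WH L_pos by auto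
    show ?thesis
      using p vH Wscale[OF v(1), of "1 / sqrt (L v v)"]
      by (intro bexI[of _ "(1 / sqrt (L v v)) *\<^sub>R v"])
         (auto simp: L.square_scale E.square_scale power_divide)
  qed
  have ne: "S \<noteq> {}" using normalise[OF w] unfolding S_def by blast
  have bb: "bdd_below S" using E.nonneg WH by (intro bdd_belowI[of _ 0]) (auto simp: S_def)
  have \<kappa>0: "0 \<le> \<kappa>" unfolding \<kappa>_def using E.nonneg WH ne by (intro cInf_greatest) (auto simp: S_def)
  have low: "\<kappa> * L v v \<le> E v v" if v: "v \<in> W" for v
  proof (cases "v = 0")
    case True
    then show ?thesis using E.zero_left[OF E.zero_in] L.zero_left[OF E.zero_in] by simp
  next
    case False
    have "0 < L v v" using v WH L_pos False by auto
    moreover have "E v v / L v v \<in> S" using normalise[OF v False] unfolding S_def by force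
    then have "\<kappa> \<le> E v v / L v v" unfolding \<kappa>_def using bb by (rule cInf_lower)
    ultimately show ?thesis by (simp add: field_simps)
  qed
  have "\<exists>u\<in>W. L u u = 1 \<and> E u u < \<kappa> + 1 / real (Suc n)" for n
    using cInf_lessD[OF ne, of "\<kappa> + 1 / real (Suc n)"] by (auto simp: \<kappa>_def S_def)
  then obtain X where X: "\<And>n. X n \<in> W" "\<And>n. L (X n) (X n) = 1"
    "\<And>n. E (X n) (X n) < \<kappa> + 1 / real (Suc n)" by metis
  have XH: "X n \<in> H" for n using X WH by auto
  \<comment> \<open>With this \<epsilon> the term \<open>\<kappa> * L d d\<close> in
    \<open>key\<close> costs at most half of \<open>E d d\<close> and is absorbed on the
    left.\<close>
  have "0 < 1 / (2 * (\<kappa> + 1))" using \<kappa>0 by simp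
  from compact[OF this] obtain \<Phi> C where F: "finite \<Phi>" "\<forall>\<psi>\<in>\<Phi>. bdd \<psi>" "0 \<le> C"
    and cmp: "\<forall>u\<in>H. L u u \<le> 1 / (2 * (\<kappa> + 1)) * E u u + C * (\<Sum>\<psi>\<in>\<Phi>. (\<psi> u)\<^sup>2)"
    by blast
  have bd: "bounded (range (\<lambda>n. \<psi> (X n)))" if k: "\<psi> \<in> \<Phi>" for \<psi>
  proof -
    obtain D where D: "0 \<le> D" "\<forall>u\<in>H. (\<psi> u)\<^sup>2 \<le> D * E u u"
      using bdd_bound F(2) k by blast
    have "norm (\<psi> (X n)) \<le> sqrt (D * (\<kappa> + 1))" for n
    proof -
      have "(\<psi> (X n))\<^sup>2 \<le> D * E (X n) (X n)" using bspec[OF D(2) XH] .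
      also have "\<dots> \<le> D * (\<kappa> + 1)"
      proof -
        have "1 / real (Suc n) \<le> 1" by simp
        then show ?thesis using X(3)[of n] D(1) by (intro mult_left_mono) linarith+
      qed
      finally show ?thesis by (intro real_le_rsqrt) simp
    qed
    then show ?thesis unfolding bounded_iff by blast
  qed
  obtain s :: "nat \<Rightarrow> nat" where s: "strict_mono s"
    and conv: "\<forall>\<psi>\<in>\<Phi>. convergent ((\<lambda>n. \<psi> (X n)) \<circ> s)"
    using common_convergent_subsequence[of \<Phi> "\<lambda>\<psi> n. \<psi> (X n)", OF F(1) bd] by blast
  define Y where "Y = X \<circ> s"
  have YW: "Y n \<in> W" and YH: "Y n \<in> H" and YL: "L (Y n) (Y n) = 1" for n
    using X XH by (auto simp: Y_def)
  have YE: "E (Y n) (Y n) \<le> \<kappa> + 1 / real (Suc n)" for n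
  proof -
    have "n \<le> s n" using s by (rule seq_suble)
    then have "1 / real (Suc (s n)) \<le> 1 / real (Suc n)" by (simp add: frac_le)
    then show ?thesis using X(3)[of "s n"] by (simp add: Y_def)
  qed
  have cauchy_fun: "\<exists>N. \<forall>m\<ge>N. \<forall>n\<ge>N. (\<Sum>\<psi>\<in>\<Phi>. (\<psi> (Y m - Y n))\<^sup>2) < e" if e: "e > 0" for e
  proof -
    define e' where "e' = e / (real (card \<Phi>) + 1)"
    have e': "e' > 0" using e by (simp add: e'_def)
    have "\<forall>\<psi>\<in>\<Phi>. \<exists>N. \<forall>m\<ge>N. \<forall>n\<ge>N. (\<psi> (Y m - Y n))\<^sup>2 < e'"
    proof
      fix \<psi> assume k: "\<psi> \<in> \<Phi>"
      then have "Cauchy (\<lambda>n. \<psi> (Y n))"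
        using conv by (auto simp: Y_def o_def dest!: bspec intro: convergent_Cauchy)
      moreover have "0 < sqrt e'" using e' by simp
      ultimately obtain N where N: "\<And>m n. m \<ge> N \<Longrightarrow> n \<ge> N \<Longrightarrow> \<bar>\<psi> (Y m) - \<psi> (Y n)\<bar> < sqrt e'"
        unfolding Cauchy_def dist_real_def by meson
      have "(\<psi> (Y m - Y n))\<^sup>2 < e'" if "m \<ge> N" "n \<ge> N" for m n
      proof -
        have "\<bar>\<psi> (Y m) - \<psi> (Y n)\<bar>\<^sup>2 < (sqrt e')\<^sup>2" using N[OF that] by (intro power_strict_mono) auto
        then show ?thesis using e' bdd_diff[OF _ YH YH] F(2) k by simp
      qed
      then show "\<exists>N. \<forall>m\<ge>N. \<forall>n\<ge>N. (\<psi> (Y m - Y n))\<^sup>2 < e'" by blast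
    qed
    then obtain N where N: "\<And>\<psi> m n. \<psi> \<in> \<Phi> \<Longrightarrow> m \<ge> N \<psi> \<Longrightarrow> n \<ge> N \<psi> \<Longrightarrow> (\<psi> (Y m - Y n))\<^sup>2 < e'"
      by metis
    have "(\<Sum>\<psi>\<in>\<Phi>. (\<psi> (Y m - Y n))\<^sup>2) < e" if "m \<ge> sum N \<Phi>" "n \<ge> sum N \<Phi>" for m n
    proof -
      have "N \<psi> \<le> sum N \<Phi>" if "\<psi> \<in> \<Phi>" for \<psi> using that F(1) by (simp add: member_le_sum)
      then have "(\<Sum>\<psi>\<in>\<Phi>. (\<psi> (Y m - Y n))\<^sup>2) \<le> real (card \<Phi>) * e'"
        using N that by (intro sum_bounded_above) (meson le_trans less_imp_le)
      also have "\<dots> < e" using e by (simp add: e'_def field_simps)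
      finally show ?thesis .
    qed
    then show ?thesis by blast
  qed
  have key: "E (Y m - Y n) (Y m - Y n)
      \<le> 4 * (1 / real (Suc m) + 1 / real (Suc n)) + 2 * \<kappa> * C * (\<Sum>\<psi>\<in>\<Phi>. (\<psi> (Y m - Y n))\<^sup>2)" for m n
  proof -
    define d where "d = Y m - Y n"
    define T where "T = (\<Sum>\<psi>\<in>\<Phi>. (\<psi> d)\<^sup>2)"
    have dH: "d \<in> H" by (simp add: d_def E.diff_in YH)
    \<comment> \<open>The parallelogram law for both forms. Minimality of \<kappa> bounds the energy
      of the sum from below by \<open>\<kappa> * (4 - L d d)\<close>, which leaves only
      \<open>\<kappa> * L d d\<close> and the two minimisation errors for
      \<open>E d d\<close>.\<close>
    have par: "E d d + E (Y m + Y n) (Y m + Y n) = 2 * E (Y m) (Y m) + 2 * E (Y n) (Y n)"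
      "L d d + L (Y m + Y n) (Y m + Y n) = 4"
      by (simp_all add: d_def E.square_diff E.square_add L.square_diff L.square_add YH YL)
    have "\<kappa> * (4 - L d d) \<le> E (Y m + Y n) (Y m + Y n)"
    proof -
      have "4 - L d d = L (Y m + Y n) (Y m + Y n)" using par(2) by simp
      then show ?thesis using low[OF Wadd[OF YW YW], of m n] by simp
    qed
    then have 1: "E d d \<le> 2 * (1 / real (Suc m) + 1 / real (Suc n)) + \<kappa> * L d d"
      using par(1) YE[of m] YE[of n] by (simp add: algebra_simps)
    have "\<kappa> * L d d \<le> \<kappa> * (1 / (2 * (\<kappa> + 1)) * E d d + C * T)"
      using bspec[OF cmp dH] \<kappa>0 by (intro mult_left_mono) (auto simp: T_def)
    also have "\<dots> = (\<kappa> / (\<kappa> + 1)) * E d d / 2 + \<kappa> * C * T"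
      using \<kappa>0 by (simp add: field_simps)
    also have "\<dots> \<le> 1 * E d d / 2 + \<kappa> * C * T"
      using \<kappa>0 E.nonneg[OF dH] by (intro add_right_mono divide_right_mono mult_right_mono) auto
    finally show ?thesis using 1 unfolding d_def T_def by simp
  qed
  have "\<exists>N. \<forall>m\<ge>N. \<forall>n\<ge>N. E (Y m - Y n) (Y m - Y n) < e" if e: "e > 0" for e
  proof -
    have "0 < e / (4 * (\<kappa> * C + 1))"
      using e \<kappa>0 F(3) by (intro divide_pos_pos mult_pos_pos add_nonneg_pos) auto
    from cauchy_fun[OF this] obtain N1 where
      N1: "\<And>m n. m \<ge> N1 \<Longrightarrow> n \<ge> N1 \<Longrightarrow> (\<Sum>\<psi>\<in>\<Phi>. (\<psi> (Y m - Y n))\<^sup>2) < e / (4 * (\<kappa> * C + 1))" by blast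
    obtain N2 where N2: "1 / real (Suc N2) < e / 16"
      using reals_Archimedean[of "e / 16"] e by (auto simp: inverse_eq_divide)
    have "E (Y m - Y n) (Y m - Y n) < e" if "m \<ge> max N1 N2" "n \<ge> max N1 N2" for m n
    proof -
      have "1 / real (Suc m) \<le> 1 / real (Suc N2)" "1 / real (Suc n) \<le> 1 / real (Suc N2)"
        using that by (auto intro!: frac_le)
      then have a: "4 * (1 / real (Suc m) + 1 / real (Suc n)) < e / 2" using N2 by simp
      have "2 * \<kappa> * C * (\<Sum>\<psi>\<in>\<Phi>. (\<psi> (Y m - Y n))\<^sup>2) \<le> 2 * \<kappa> * C * (e / (4 * (\<kappa> * C + 1)))"
        using N1[of m n] that \<kappa>0 F(3) by (intro mult_left_mono) auto
      also have "\<dots> = ((\<kappa> * C) / (\<kappa> * C + 1)) * (e / 2)"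
      proof -
        have "2 * z * (e / (4 * (z + 1))) = (z / (z + 1)) * (e / 2)" if "0 \<le> z" for z
          using that by (simp add: field_simps)
        from this[of "\<kappa> * C"] show ?thesis using \<kappa>0 F(3) by (simp add: mult.assoc)
      qed
      also have "\<dots> \<le> 1 * (e / 2)"
        using mult_nonneg_nonneg[OF \<kappa>0 F(3)] e by (intro mult_right_mono) (auto simp: divide_le_eq_1)
      finally show ?thesis using key[of m n] a by simp
    qed
    then show ?thesis by blast
  qed
  from complete[OF YH this] obtain u where u: "u \<in> H" and lim: "(\<lambda>n. E (Y n - u) (Y n - u)) \<longlonglongrightarrow> 0"
    by blast
  obtain D where D: "0 \<le> D" "\<forall>v\<in>H. L v v \<le> D * E v v" using L_le_E by blast
  have DLim: "(\<lambda>n. D' * E (Y n - u) (Y n - u)) \<longlonglongrightarrow> 0" for D'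
    using tendsto_mult[OF tendsto_const lim, of D'] by simp
  have limL: "(\<lambda>n. L (Y n - u) (Y n - u)) \<longlonglongrightarrow> 0"
    by (rule Lim_null_comparison[OF _ DLim[of D]])
       (simp add: D(2) L.nonneg E.diff_in YH u)
  have Luu: "L u u = 1" by (rule L.square_limit[OF YH u limL]) (simp add: YL)
  have "(\<lambda>n. \<kappa> + 1 / real (Suc n)) \<longlonglongrightarrow> \<kappa> + 0"
    by (intro tendsto_add tendsto_const LIMSEQ_Suc lim_1_over_n)
  then have up: "(\<lambda>n. \<kappa> + 1 / real (Suc n)) \<longlonglongrightarrow> \<kappa>" by simp
  have lowY: "\<kappa> \<le> E (Y n) (Y n)" for n using low[OF YW[of n]] by (simp add: YL)
  have "(\<lambda>n. E (Y n) (Y n)) \<longlonglongrightarrow> \<kappa>"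
    by (rule tendsto_sandwich[OF _ _ tendsto_const up]) (simp_all add: lowY YE del: of_nat_Suc)
  from E.square_limit[OF YH u lim this] have Euu: "E u u = \<kappa>" .
  have uW: "u \<in> W"
    unfolding W
  proof (intro CollectI conjI u ballI)
    fix \<psi> assume k: "\<psi> \<in> \<Psi>"
    obtain D' where D': "0 \<le> D'" "\<forall>v\<in>H. (\<psi> v)\<^sup>2 \<le> D' * E v v"
      using bdd_bound \<Psi> k by blast
    have z: "\<psi> (Y n) = 0" for n
      using YW[of n] k unfolding W by blast
    have "(\<psi> u)\<^sup>2 \<le> D' * E (Y n - u) (Y n - u)" for n
      using bspec[OF D'(2) E.diff_in[OF YH u], of n] bdd_diff[OF \<Psi>[OF k] YH u, of n] z[of n]
      by simp
    then have "(\<psi> u)\<^sup>2 \<le> 0"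
      by (intro LIMSEQ_le_const[OF DLim[of D']]) blast
    then show "\<psi> u = 0" by simp
  qed
  show ?thesis using uW Luu Euu low by (intro bexI[of _ u]) auto
qed

text \<open>The equation holds against \<open>W\<close> only. Each application extends it
  separately: by orthogonality in \<open>spectral_basis\<close>, by symmetry in
  \<open>neumann_eigenfunction_exists\<close>.\<close>

lemma minimiser_euler_lagrange:
  assumes \<Psi>: "\<And>\<psi>. \<psi> \<in> \<Psi> \<Longrightarrow> bdd \<psi>" and W: "W = {u \<in> H. \<forall>\<psi>\<in>\<Psi>. \<psi> u = 0}"
    and u: "u \<in> W" "L u u = 1" "\<And>v. v \<in> W \<Longrightarrow> E u u * L v v \<le> E v v" and v: "v \<in> W"
  shows "E u v = E u u * L u v"
proof -
  have uH: "u \<in> H" and vH: "v \<in> H" using u v W by auto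
  have "0 \<le> 2 * t * (E u v - E u u * L u v) + t\<^sup>2 * (E v v - E u u * L v v)" for t
  proof -
    have "1 *\<^sub>R u + t *\<^sub>R v \<in> W" using u v \<Psi> by (auto simp: W E.comb_in bdd_comb simp del: scaleR_one)
    then have "u + t *\<^sub>R v \<in> W" by simp
    from u(3)[OF this] show ?thesis
      by (simp add: E.square_add L.square_add E.scale_in uH vH E.scale_left L.scale_left
            E.scale_right L.scale_right u(2) power2_eq_square algebra_simps)
  qed
  from quadratic_nonneg_imp_linear_zero[OF this] show ?thesis by simp
qed

section \<open>Eigenspaces, the counting function and its variational bounds\<close>

definition ES :: "real \<Rightarrow> 'v set" where
  "ES \<kappa> = {u \<in> H. \<forall>v\<in>H. E u v = \<kappa> * L u v}"

definition counting :: "real \<Rightarrow> nat" where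
  "counting x = (\<Sum>\<kappa> \<in> {\<kappa>. (\<exists>u\<in>ES \<kappa>. u \<noteq> 0) \<and> \<kappa> \<le> x}. dim (ES \<kappa>))"

lemma ES_orthogonal: "u \<in> ES \<kappa> \<Longrightarrow> v \<in> ES \<kappa>' \<Longrightarrow> \<kappa> \<noteq> \<kappa>' \<Longrightarrow> L u v = 0"
  unfolding ES_def using E.sym[of u v] L.sym[of u v] by fastforce

lemma ES_subspace: "subspace (ES \<kappa>)"
  unfolding subspace_def ES_def
  by (auto simp: E.zero_in E.zero_left L.zero_left E.add_in E.add_left L.add_left E.scale_in
      E.scale_left L.scale_left algebra_simps)

definition orthonormal :: "'v set \<Rightarrow> bool" where
  "orthonormal B \<longleftrightarrow> finite B \<and> B \<subseteq> H \<and> (\<forall>b\<in>B. \<forall>b'\<in>B. L b b' = (if b = b' then 1 else 0))"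

lemma orthonormal_coeff:
  assumes "orthonormal B" "b \<in> B"
  shows "L (\<Sum>b\<in>B. c b *\<^sub>R b) b = c b"
proof -
  have "L (\<Sum>b\<in>B. c b *\<^sub>R b) b = (\<Sum>b'\<in>B. c b' * L b' b)"
    using assms by (intro L.sum_left) (auto simp: orthonormal_def)
  also have "\<dots> = (\<Sum>b'\<in>B. if b' = b then c b' else 0)"
    using assms by (intro sum.cong) (auto simp: orthonormal_def)
  finally show ?thesis using assms by (simp add: orthonormal_def)
qed

lemma orthonormal_independent: "orthonormal B \<Longrightarrow> independent B"
proof
  assume B: "orthonormal B" and "dependent B"
  then obtain c where c: "(\<Sum>b\<in>B. c b *\<^sub>R b) = 0" "\<exists>b\<in>B. c b \<noteq> 0"
    unfolding orthonormal_def by (auto simp: real_vector.dependent_finite)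
  then obtain b where b: "b \<in> B" "c b \<noteq> 0" by auto
  then have "b \<in> H" using B by (auto simp: orthonormal_def)
  then show False using orthonormal_coeff[OF B b(1), of c] b(2) c(1) L.zero_left by simp
qed

text \<open>Expanding one argument of \<open>E u u\<close> suffices:
  \<open>E b u = \<kappa> * L b u\<close> as \<open>b\<close> is an eigenvector, and
  \<open>L b u\<close> is the coefficient of \<open>b\<close>.\<close>

lemma span_energy_le:
  assumes B: "orthonormal B" and ev: "\<And>b. b \<in> B \<Longrightarrow> \<exists>\<kappa>\<le>x. b \<in> ES \<kappa>"
    and u: "u = (\<Sum>b\<in>B. c b *\<^sub>R b)"
  shows "E u u \<le> x * L u u"
proof -
  have fin: "finite B" and BH: "\<And>b. b \<in> B \<Longrightarrow> b \<in> H" using B by (auto simp: orthonormal_def)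
  have uH: "u \<in> H" unfolding u by (intro E.sum_in BH)
  have "E u u = (\<Sum>b\<in>B. c b * E b u)" unfolding u
    by (rule E.sum_left[OF fin BH]) (use uH u in auto)
  moreover have "L u u = (\<Sum>b\<in>B. c b * L b u)" unfolding u
    by (rule L.sum_left[OF fin BH]) (use uH u in auto)
  moreover have "c b * E b u \<le> x * (c b * L b u)" if b: "b \<in> B" for b
  proof -
    obtain \<kappa> where k: "\<kappa> \<le> x" "b \<in> ES \<kappa>" using ev b by blast
    have "L b u = c b"
      using orthonormal_coeff[OF B b, of c] L.sym[OF uH BH[OF b]] u by simp
    moreover have "E b u = \<kappa> * L b u" using k(2) uH by (auto simp: ES_def)
    moreover have "\<kappa> * (c b * c b) \<le> x * (c b * c b)" using k(1) by (intro mult_right_mono) auto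
    ultimately show ?thesis by (simp add: mult_ac)
  qed
  ultimately show ?thesis by (simp add: sum_distrib_left sum_mono)
qed

text \<open>Discreteness of the spectrum. More than \<open>card \<Phi>\<close> orthonormal
  eigenvectors would admit a nonzero combination annihilated by \<Phi>, and for it
  \<open>compact\<close> gives \<open>L u u \<le> L u u / 2\<close>.\<close>

lemma orthonormal_card_bound:
  "\<exists>n. \<forall>B. orthonormal B \<longrightarrow> (\<forall>b\<in>B. \<exists>\<kappa>\<le>x. b \<in> ES \<kappa>) \<longrightarrow> card B \<le> n"
proof -
  have "0 < 1 / (2 * (\<bar>x\<bar> + 1))" by simp
  from compact[OF this] obtain \<Phi> C where F: "finite \<Phi>" "\<forall>\<psi>\<in>\<Phi>. bdd \<psi>"
    and cmp: "\<forall>u\<in>H. L u u \<le> 1 / (2 * (\<bar>x\<bar> + 1)) * E u u + C * (\<Sum>\<psi>\<in>\<Phi>. (\<psi> u)\<^sup>2)"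
    by blast
  have "card B \<le> card \<Phi>" if B: "orthonormal B" "\<And>b. b \<in> B \<Longrightarrow> \<exists>\<kappa>\<le>x. b \<in> ES \<kappa>" for B
  proof (rule ccontr)
    assume "\<not> card B \<le> card \<Phi>"
    then have "card \<Phi> < card B" by simp
    moreover have fin: "finite B" and BH: "\<And>b. b \<in> B \<Longrightarrow> b \<in> H" using B by (auto simp: orthonormal_def)
    ultimately obtain c where c: "\<exists>b\<in>B. c b \<noteq> 0" "\<forall>\<psi>\<in>\<Phi>. (\<Sum>b\<in>B. \<psi> b * c b) = 0"
      using homogeneous_system[OF F(1) fin, of "\<lambda>\<psi> b. \<psi> b"] by blast
    define u where "u = (\<Sum>b\<in>B. c b *\<^sub>R b)"
    have uH: "u \<in> H" unfolding u_def by (intro E.sum_in BH)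
    have "\<psi> u = 0" if "\<psi> \<in> \<Phi>" for \<psi>
      using c(2) that F(2) bdd_sum[where e = "\<lambda>b. b" and I = B and c = c, OF bspec[OF F(2) that] fin BH] by (simp add: u_def mult_ac)
    then have "(\<psi> u)\<^sup>2 = 0" if "\<psi> \<in> \<Phi>" for \<psi> using that by simp
    then have "(\<Sum>\<psi>\<in>\<Phi>. (\<psi> u)\<^sup>2) = 0" by (rule sum.neutral[rule_format])
    then have "L u u \<le> 1 / (2 * (\<bar>x\<bar> + 1)) * E u u" using bspec[OF cmp uH] by simp
    also have "\<dots> \<le> 1 / (2 * (\<bar>x\<bar> + 1)) * (x * L u u)"
      using span_energy_le[OF B(1) B(2) u_def] by (intro mult_left_mono) auto
    also have "\<dots> = (x / (\<bar>x\<bar> + 1)) * (L u u / 2)" by (simp add: field_simps)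
    also have "\<dots> \<le> 1 * (L u u / 2)"
      using L.nonneg[OF uH] by (intro mult_right_mono) (auto simp: divide_le_eq_1)
    finally have "L u u = 0" using L.nonneg[OF uH] by simp
    then have "u = 0" using L_zero uH by simp
    moreover obtain b where b: "b \<in> B" "c b \<noteq> 0" using c by blast
    ultimately show False using orthonormal_coeff[OF B(1) b(1), of c] L.zero_left[OF BH] b
      by (simp add: u_def)
  qed
  then show ?thesis by blast
qed

text \<open>The substitute for the spectral theorem. \<open>B\<close> is a largest orthonormal
  family of eigenvectors below \<open>x\<close>, which exists by
  \<open>orthonormal_card_bound\<close>. A nonzero \<open>v\<close> violating the last clause would
  push the minimum of the Rayleigh quotient on the orthogonal complement down to at most
  \<open>x\<close>, and the minimiser would enlarge the family.\<close>

lemma spectral_basis: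
  "\<exists>B. orthonormal B \<and> card B = counting x \<and> (\<forall>b\<in>B. \<exists>\<kappa>\<le>x. b \<in> ES \<kappa>) \<and>
    (\<forall>v\<in>H. (\<forall>b\<in>B. L v b = 0) \<longrightarrow> E v v \<le> x * L v v \<longrightarrow> v = 0)"
proof -
  define good where "good B \<longleftrightarrow> orthonormal B \<and> (\<forall>b\<in>B. \<exists>\<kappa>\<le>x. b \<in> ES \<kappa>)" for B
  obtain n where n: "\<And>B. good B \<Longrightarrow> card B \<le> n"
    using orthonormal_card_bound[of x] unfolding good_def by blast
  have "good {}" by (simp add: good_def orthonormal_def)
  then have "\<exists>B. good B \<and> (\<forall>B'. good B' \<longrightarrow> card B' \<le> card B)"
    using n by (intro ex_has_greatest_nat[of good "{}" card "Suc n"]) (auto simp: less_Suc_eq_le)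
  then obtain B where B: "good B" and max: "\<And>B'. good B' \<Longrightarrow> card B' \<le> card B" by blast
  have on: "orthonormal B" and ev: "\<And>b. b \<in> B \<Longrightarrow> \<exists>\<kappa>\<le>x. b \<in> ES \<kappa>" using B by (auto simp: good_def)
  have fin: "finite B" and BH: "\<And>b. b \<in> B \<Longrightarrow> b \<in> H" using on by (auto simp: orthonormal_def)
  have perp: "v = 0" if v: "v \<in> H" "\<And>b. b \<in> B \<Longrightarrow> L v b = 0" "E v v \<le> x * L v v" for v
  proof (rule ccontr)
    assume nz: "v \<noteq> 0"
    define \<Psi> where "\<Psi> = (\<lambda>b u. L u b) ` B"
    define W where "W = {u \<in> H. \<forall>\<psi>\<in>\<Psi>. \<psi> u = 0}"
    have \<Psi>: "bdd \<psi>" if "\<psi> \<in> \<Psi>" for \<psi> using that bdd_L BH by (auto simp: \<Psi>_def)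
    have vW: "v \<in> W" using v by (auto simp: W_def \<Psi>_def)
    from minimiser_exists[OF \<Psi> W_def vW nz] obtain u where
      u: "u \<in> W" "L u u = 1" "\<And>v. v \<in> W \<Longrightarrow> E u u * L v v \<le> E v v" by blast
    have uH: "u \<in> H" and uB: "\<And>b. b \<in> B \<Longrightarrow> L u b = 0" using u by (auto simp: W_def \<Psi>_def)
    define \<kappa> where "\<kappa> = E u u"
    have "\<kappa> * L v v \<le> x * L v v" using u(3)[OF vW] v(3) by (simp add: \<kappa>_def)
    then have kx: "\<kappa> \<le> x" using L_pos[OF v(1) nz] by simp
    \<comment> \<open>\<open>h\<close> is split into its projection \<open>g\<close> onto the span
      of \<open>B\<close> and a remainder in \<open>W\<close>. The Euler-Lagrange equation covers
      the remainder; on \<open>g\<close> both sides vanish because \<open>u\<close> is orthogonal to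
      the eigenvectors in \<open>B\<close>.\<close>
    have "E u h = \<kappa> * L u h" if h: "h \<in> H" for h
    proof -
      define c where "c b = L h b" for b
      define g where "g = (\<Sum>b\<in>B. c b *\<^sub>R b)"
      have gH: "g \<in> H" unfolding g_def by (intro E.sum_in BH)
      have "h - g \<in> W"
        using h gH by (auto simp: W_def \<Psi>_def E.diff_in L.diff_left BH g_def c_def orthonormal_coeff[OF on])
      then have 1: "E u (h - g) = \<kappa> * L u (h - g)"
        unfolding \<kappa>_def using minimiser_euler_lagrange[OF \<Psi> W_def u(1,2,3)] by blast
      have "L u g = 0" unfolding g_def using uB by (simp add: L.sum_right[OF fin BH uH])
      moreover have "E u b = 0" if b: "b \<in> B" for b
      proof -
        obtain \<kappa>' where "b \<in> ES \<kappa>'" using ev[OF b] by blast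
        then show ?thesis using uB[OF b] uH BH[OF b]
          by (simp add: ES_def E.sym[of u b] L.sym[of u b])
      qed
      then have "E u g = 0" unfolding g_def by (simp add: E.sum_right[OF fin BH uH])
      ultimately show ?thesis using 1 by (simp add: E.diff_right L.diff_right h gH uH)
    qed
    then have uE: "u \<in> ES \<kappa>" using uH by (simp add: ES_def)
    have uB': "u \<notin> B" using uB u(2) by fastforce
    have "good (insert u B)"
    proof -
      have "L b b' = (if b = b' then 1 else 0)" if bb: "b \<in> insert u B" "b' \<in> insert u B" for b b'
      proof (cases "b \<in> B \<and> b' \<in> B")
        case True
        then show ?thesis using on by (simp add: orthonormal_def)
      next
        case False
        then consider "b = u" "b' = u" | "b = u" "b' \<in> B" | "b \<in> B" "b' = u" using bb by blast
        then show ?thesis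
        proof cases
          case 1
          then show ?thesis using u(2) by simp
        next
          case 2
          then show ?thesis using uB[of b'] uB' by auto
        next
          case 3
          then show ?thesis using uB[of b] uB' L.sym[OF uH BH[of b]] by auto
        qed
      qed
      then have "orthonormal (insert u B)" unfolding orthonormal_def using fin uH BH by blast
      then show ?thesis unfolding good_def using ev uE kx by blast
    qed
    from max[OF this] show False using uB' fin by simp
  qed
  have "counting x = card B"
  proof -
    define K where "K = {\<kappa>. (\<exists>u\<in>ES \<kappa>. u \<noteq> 0) \<and> \<kappa> \<le> x}"
    \<comment> \<open>The part of an eigenvector orthogonal to \<open>B\<close> stays in the
      eigenspace, so its energy is \<kappa> times its mass and \<open>perp\<close> annihilates it.
      Hence \<open>B\<close> meets the eigenspace in a basis.\<close>
    have dimES: "dim (ES \<kappa>) = card (B \<inter> ES \<kappa>)" and sp: "ES \<kappa> \<subseteq> span (B \<inter> ES \<kappa>)" if k: "\<kappa> \<le> x" for \<kappa>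
    proof -
      show sp: "ES \<kappa> \<subseteq> span (B \<inter> ES \<kappa>)"
      proof
        fix u assume u: "u \<in> ES \<kappa>"
        define D where "D = B \<inter> ES \<kappa>"
        have onD: "orthonormal D" using on by (auto simp: orthonormal_def D_def)
        define g where "g = (\<Sum>b\<in>D. L u b *\<^sub>R b)"
        have gsp: "g \<in> span D" unfolding g_def by (intro span_sum span_scale span_base)
        have "g \<in> ES \<kappa>" unfolding g_def
          by (intro subspace_sum[OF ES_subspace] subspace_mul[OF ES_subspace]) (auto simp: D_def)
        then have w: "u - g \<in> ES \<kappa>" using u ES_subspace subspace_diff by blast
        then have wH: "u - g \<in> H" and uH: "u \<in> H" and gH: "g \<in> H" using u \<open>g \<in> ES \<kappa>\<close> by (auto simp: ES_def)
        have "L (u - g) b = 0" if b: "b \<in> B" for b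
        proof (cases "b \<in> ES \<kappa>")
          case True
          then have "L g b = L u b"
            unfolding g_def using b by (intro orthonormal_coeff[OF onD]) (simp add: D_def)
          then show ?thesis using b uH gH BH by (simp add: L.diff_left)
        next
          case False
          obtain \<kappa>' where "b \<in> ES \<kappa>'" using ev[OF b] by blast
          then show ?thesis using False w ES_orthogonal by blast
        qed
        moreover have "E (u - g) (u - g) \<le> x * L (u - g) (u - g)"
        proof -
          have "E (u - g) (u - g) = \<kappa> * L (u - g) (u - g)" using w wH by (auto simp: ES_def)
          then show ?thesis using k L.nonneg[OF wH] by (simp add: mult_right_mono)
        qed
        ultimately have "u - g = 0" using perp wH by blast
        then show "u \<in> span (B \<inter> ES \<kappa>)" using gsp by (simp add: D_def)
      qed
      have "independent (B \<inter> ES \<kappa>)"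
        using orthonormal_independent[OF on] by (rule independent_mono) auto
      then show "dim (ES \<kappa>) = card (B \<inter> ES \<kappa>)"
        using sp by (intro dim_unique[of "B \<inter> ES \<kappa>"]) auto
    qed
    have nzB: "b \<noteq> 0" if "b \<in> B" for b
      using that on L.zero_left[OF E.zero_in] by (auto simp: orthonormal_def)
    \<comment> \<open>A nonzero vector belongs to at most one eigenspace. \<open>f\<close> records
      the eigenvalue of \<open>b\<close>, and the sum in \<open>counting\<close> runs over the
      fibres of \<open>f\<close>.\<close>
    define f where "f b = (SOME \<kappa>. \<kappa> \<le> x \<and> b \<in> ES \<kappa>)" for b
    have f: "f b \<le> x" "b \<in> ES (f b)" if "b \<in> B" for b
      using someI_ex[of "\<lambda>\<kappa>. \<kappa> \<le> x \<and> b \<in> ES \<kappa>"] ev[OF that] by (auto simp: f_def)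
    have f_unique: "\<kappa> = f b" if "b \<in> B" "b \<in> ES \<kappa>" for b \<kappa>
    proof (rule ccontr)
      assume "\<kappa> \<noteq> f b"
      then have "L b b = 0" using ES_orthogonal that f by blast
      then show False using nzB that L_zero BH by blast
    qed
    have K: "K = f ` B"
    proof
      show "f ` B \<subseteq> K" using f nzB by (auto simp: K_def)
      show "K \<subseteq> f ` B"
      proof
        fix \<kappa> assume "\<kappa> \<in> K"
        then obtain u where u: "u \<in> ES \<kappa>" "u \<noteq> 0" "\<kappa> \<le> x" by (auto simp: K_def)
        have "B \<inter> ES \<kappa> \<noteq> {}"
        proof
          assume e: "B \<inter> ES \<kappa> = {}"
          have "u \<in> span {}" using sp[OF u(3)] u(1) unfolding e by blast
          then show False using u(2) by simp
        qed
        then show "\<kappa> \<in> f ` B" using f_unique by auto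
      qed
    qed
    have "counting x = (\<Sum>\<kappa>\<in>f ` B. card (B \<inter> ES \<kappa>))"
      unfolding counting_def K_def[symmetric] unfolding K
    proof (rule sum.cong[OF refl])
      fix \<kappa> assume "\<kappa> \<in> f ` B"
      then have "\<kappa> \<le> x" using f(1) by blast
      then show "dim (ES \<kappa>) = card (B \<inter> ES \<kappa>)" by (rule dimES)
    qed
    also have "\<dots> = (\<Sum>\<kappa>\<in>f ` B. card {b \<in> B. f b = \<kappa>})"
    proof (rule sum.cong[OF refl])
      fix \<kappa> assume "\<kappa> \<in> f ` B"
      have "B \<inter> ES \<kappa> = {b \<in> B. f b = \<kappa>}"
      proof (intro equalityI subsetI)
        fix b assume "b \<in> B \<inter> ES \<kappa>"
        then show "b \<in> {b \<in> B. f b = \<kappa>}" using f_unique[of b \<kappa>] by simp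
      next
        fix b assume "b \<in> {b \<in> B. f b = \<kappa>}"
        then show "b \<in> B \<inter> ES \<kappa>" using f(2)[of b] by auto
      qed
      then show "card (B \<inter> ES \<kappa>) = card {b \<in> B. f b = \<kappa>}" by simp
    qed
    also have "\<dots> = card B"
    proof -
      have "card B = (\<Sum>b\<in>B. 1)" by simp
      also have "\<dots> = (\<Sum>\<kappa>\<in>f ` B. \<Sum>b\<in>{b \<in> B. f b = \<kappa>}. 1)" by (rule sum.image_gen[OF fin])
      finally show ?thesis by simp
    qed
    finally show ?thesis .
  qed
  then have card: "card B = counting x" by simp
  show ?thesis
  proof (intro exI[of _ B] conjI ballI impI)
    show "orthonormal B" by (rule on)
    show "card B = counting x" by (rule card)
    show "\<exists>\<kappa>\<le>x. b \<in> ES \<kappa>" if "b \<in> B" for b using that by (rule ev)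
    show "v = 0" if "v \<in> H" "\<forall>b\<in>B. L v b = 0" "E v v \<le> x * L v v" for v
      by (rule perp[OF that(1) _ that(3)]) (rule bspec[OF that(2)])
  qed
qed

text \<open>One half of the min-max principle: a trial family larger than the spectral basis has a
  nonzero combination orthogonal to it, against the last clause of \<open>spectral_basis\<close>.
  The family is indexed and independence is phrased through coefficients, which suits copies of
  functions in several cells.\<close>

lemma counting_lower:
  assumes I: "finite I" and e: "\<And>i. i \<in> I \<Longrightarrow> e i \<in> H"
    and le: "\<And>c. E (\<Sum>i\<in>I. c i *\<^sub>R e i) (\<Sum>i\<in>I. c i *\<^sub>R e i)
      \<le> x * L (\<Sum>i\<in>I. c i *\<^sub>R e i) (\<Sum>i\<in>I. c i *\<^sub>R e i)"
    and ind: "\<And>c i. (\<Sum>i\<in>I. c i *\<^sub>R e i) = 0 \<Longrightarrow> i \<in> I \<Longrightarrow> c i = 0"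
  shows "card I \<le> counting x"
proof (rule ccontr)
  assume "\<not> card I \<le> counting x"
  obtain B where B: "orthonormal B" "card B = counting x"
    "\<forall>v\<in>H. (\<forall>b\<in>B. L v b = 0) \<longrightarrow> E v v \<le> x * L v v \<longrightarrow> v = 0"
    using spectral_basis[of x] by (elim exE conjE) (rule that)
  have fin: "finite B" and BH: "\<And>b. b \<in> B \<Longrightarrow> b \<in> H" using B by (auto simp: orthonormal_def)
  have "card B < card I" using B(2) \<open>\<not> card I \<le> counting x\<close> by simp
  from homogeneous_system[OF fin I this, of "\<lambda>b i. L (e i) b"]
  obtain c where c: "\<exists>i\<in>I. c i \<noteq> 0" "\<forall>b\<in>B. (\<Sum>i\<in>I. L (e i) b * c i) = 0" by blast
  have "(\<Sum>i\<in>I. c i *\<^sub>R e i) = 0"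
  proof (rule B(3)[rule_format])
    show "(\<Sum>i\<in>I. c i *\<^sub>R e i) \<in> H" by (intro E.sum_in e)
    show "L (\<Sum>i\<in>I. c i *\<^sub>R e i) b = 0" if "b \<in> B" for b
      using c(2) that by (simp add: L.sum_left[OF I e BH] mult.commute)
  qed (rule le)
  moreover obtain i where "i \<in> I" "c i \<noteq> 0" using c(1) by blast
  ultimately show False using ind[of c i] by simp
qed

text \<open>The other half: with fewer conditions than eigenvalues, some nonzero combination of
  eigenvectors meets all conditions, and every such combination has Rayleigh quotient at most
  \<open>x\<close>.\<close>

lemma counting_upper:
  assumes J: "finite J"
    and lin: "\<And>j u v a b. j \<in> J \<Longrightarrow> u \<in> H \<Longrightarrow> v \<in> H \<Longrightarrow>
      \<psi> j (a *\<^sub>R u + b *\<^sub>R v) = a * \<psi> j u + b * \<psi> j v"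
    and zero: "\<And>u. u \<in> H \<Longrightarrow> (\<And>j. j \<in> J \<Longrightarrow> \<psi> j u = 0) \<Longrightarrow> E u u \<le> x * L u u \<Longrightarrow> u = 0"
  shows "counting x \<le> card J"
proof (rule ccontr)
  assume "\<not> counting x \<le> card J"
  obtain B where B: "orthonormal B" "card B = counting x" "\<forall>b\<in>B. \<exists>\<kappa>\<le>x. b \<in> ES \<kappa>"
    using spectral_basis[of x] by (elim exE conjE) (rule that)
  have fin: "finite B" and BH: "\<And>b. b \<in> B \<Longrightarrow> b \<in> H" using B by (auto simp: orthonormal_def)
  have "card J < card B" using B(2) \<open>\<not> counting x \<le> card J\<close> by simp
  from homogeneous_system[OF J fin this, of "\<lambda>j b. \<psi> j b"]
  obtain c where c: "\<exists>b\<in>B. c b \<noteq> 0" "\<forall>j\<in>J. (\<Sum>b\<in>B. \<psi> j b * c b) = 0" by blast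
  define u where "u = (\<Sum>b\<in>B. c b *\<^sub>R b)"
  have uH: "u \<in> H" unfolding u_def by (intro E.sum_in BH)
  have "\<psi> j u = 0" if "j \<in> J" for j
    using c(2) that linear_sum[where \<psi> = "\<psi> j" and e = "\<lambda>b. b" and I = B and c = c, OF lin[OF that] fin BH] by (simp add: u_def mult.commute)
  then have "u = 0" using zero uH span_energy_le[OF B(1) bspec[OF B(3)] u_def] by blast
  moreover obtain b where b: "b \<in> B" "c b \<noteq> 0" using c by blast
  ultimately show False using orthonormal_coeff[OF B(1) b(1), of c] L.zero_left[OF BH] b
    by (simp add: u_def)
qed

text \<open>The trial family is the spectral basis below \<open>y\<close> joined with eigenvectors
  for \<open>x\<close>. Cross terms cancel since \<open>E w u = x * L w u\<close> for
  \<open>w\<close> in the eigenspace. A vector \<open>u\<close> common to both spans satisfies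
  \<open>x * L u u = E u u \<le> y * L u u\<close>, hence is zero.\<close>

lemma counting_jump:
  assumes I: "finite I" and e: "\<And>i. i \<in> I \<Longrightarrow> e i \<in> ES x" and y: "y < x"
    and ind: "\<And>c i. (\<Sum>i\<in>I. c i *\<^sub>R e i) = 0 \<Longrightarrow> i \<in> I \<Longrightarrow> c i = 0"
  shows "counting y + card I \<le> counting x"
proof -
  obtain B where B: "orthonormal B" "card B = counting y" "\<forall>b\<in>B. \<exists>\<kappa>\<le>y. b \<in> ES \<kappa>"
    using spectral_basis[of y] by (elim exE conjE) (rule that)
  have fin: "finite B" and BH: "\<And>b. b \<in> B \<Longrightarrow> b \<in> H" using B by (auto simp: orthonormal_def)
  have eH: "e i \<in> H" if "i \<in> I" for i using e[OF that] by (simp add: ES_def)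
  define f where "f = case_sum (\<lambda>b. b) e"
  have split: "\<exists>u w. (\<Sum>i\<in>B <+> I. c i *\<^sub>R f i) = u + w \<and> u = (\<Sum>b\<in>B. c (Inl b) *\<^sub>R b) \<and>
      w = (\<Sum>i\<in>I. c (Inr i) *\<^sub>R e i) \<and> u \<in> H \<and> w \<in> ES x" for c
  proof -
    have "(\<Sum>i\<in>B <+> I. c i *\<^sub>R f i) = (\<Sum>b\<in>B. c (Inl b) *\<^sub>R b) + (\<Sum>i\<in>I. c (Inr i) *\<^sub>R e i)"
      using fin I by (simp add: sum.Plus f_def)
    moreover have "(\<Sum>b\<in>B. c (Inl b) *\<^sub>R b) \<in> H" by (intro E.sum_in BH)
    moreover have "(\<Sum>i\<in>I. c (Inr i) *\<^sub>R e i) \<in> ES x"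
      by (intro subspace_sum[OF ES_subspace] subspace_mul[OF ES_subspace] e)
    ultimately show ?thesis by blast
  qed
  have le: "E u u \<le> y * L u u" if "u = (\<Sum>b\<in>B. c b *\<^sub>R b)" for u c
    using span_energy_le[OF B(1) bspec[OF B(3)] that] by blast
  have "card (B <+> I) \<le> counting x"
  proof (rule counting_lower[where e = f])
    show "finite (B <+> I)" using fin I by simp
    show "f i \<in> H" if "i \<in> B <+> I" for i using that BH eH by (auto simp: f_def)
  next
    fix c
    obtain u w where s: "(\<Sum>i\<in>B <+> I. c i *\<^sub>R f i) = u + w" and u: "u = (\<Sum>b\<in>B. c (Inl b) *\<^sub>R b)"
      and H: "u \<in> H" "w \<in> ES x" using split by blast
    have wH: "w \<in> H" and ww: "E w w = x * L w w" and wu: "E w u = x * L w u"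
      using H by (auto simp: ES_def)
    have "E u u \<le> x * L u u"
      using le[OF u] y L.nonneg[OF H(1)] by (meson mult_right_mono less_imp_le order_trans)
    then show "E (\<Sum>i\<in>B <+> I. c i *\<^sub>R f i) (\<Sum>i\<in>B <+> I. c i *\<^sub>R f i)
      \<le> x * L (\<Sum>i\<in>B <+> I. c i *\<^sub>R f i) (\<Sum>i\<in>B <+> I. c i *\<^sub>R f i)"
      unfolding s E.square_add[OF H(1) wH] L.square_add[OF H(1) wH]
      using ww wu E.sym[OF H(1) wH] L.sym[OF H(1) wH] by (simp add: algebra_simps)
  next
    fix c i assume z: "(\<Sum>i\<in>B <+> I. c i *\<^sub>R f i) = 0" and i: "i \<in> B <+> I"
    obtain u w where s: "(\<Sum>i\<in>B <+> I. c i *\<^sub>R f i) = u + w" and u: "u = (\<Sum>b\<in>B. c (Inl b) *\<^sub>R b)"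
      and w: "w = (\<Sum>i\<in>I. c (Inr i) *\<^sub>R e i)" and H: "u \<in> H" "w \<in> ES x" using split by blast
    have "u = (-1) *\<^sub>R w" using z s by (simp add: eq_neg_iff_add_eq_0)
    then have "u \<in> ES x" using subspace_mul[OF ES_subspace H(2), of "-1"] by simp
    then have "x * L u u = E u u" using H(1) by (simp add: ES_def)
    then have "x * L u u \<le> y * L u u" using le[OF u] by simp
    then have "u = 0" using y L_pos[OF H(1)] by (meson mult_less_cancel_right_pos not_le)
    then have "w = 0" using z s by simp
    show "c i = 0"
    proof (cases i)
      case (Inl b)
      then have "b \<in> B" using i by auto
      then show ?thesis using orthonormal_coeff[OF B(1), of b "\<lambda>b. c (Inl b)"] \<open>u = 0\<close> u Inl
          L.zero_left[OF BH] by simp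
    next
      case (Inr k)
      then show ?thesis using ind[of "\<lambda>i. c (Inr i)" k] \<open>w = 0\<close> w i by auto
    qed
  qed
  then show ?thesis using fin I B(2) by (simp add: card_Plus)
qed

end

subsection \<open>The renewal argument\<close>

lemma renewal:
  fixes N :: "real \<Rightarrow> nat" and c C \<kappa> dS T :: real
  assumes c: "1 / 9 < c" "c < 1" and C: "0 \<le> C" and \<kappa>: "0 < \<kappa>"
    and lower: "\<And>x. 0 < x \<Longrightarrow> 3 * N (c * x) \<le> N x"
    and upper: "\<And>x. 0 < x \<Longrightarrow> real (N x) \<le> 3 * real (N (c * x)) + C * (sqrt x + 1)"
    and jump: "\<And>n y. y < \<kappa> / c ^ n \<Longrightarrow> N y + 3 ^ n \<le> N (\<kappa> / c ^ n)"
    and dS: "dS = ln 9 / (- ln c)" and T: "T = - ln (sqrt c)"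
  shows "\<exists>G :: real \<Rightarrow> real. \<not> G constant_on UNIV \<and> (\<forall>t. G (t + T) = G t) \<and>
    (\<lambda>x. real (N x) - G (ln x / 2) * x powr (dS / 2)) \<in> O[at_top](\<lambda>x. x powr (1 / 2))"
proof -
  have c0: "0 < c" using c by simp
  \<comment> \<open>The ratio of consecutive errors \<open>sqrt (x / c ^ m) / 3 ^ m\<close>. It is
    below 1 because \<open>1 / 9 < c\<close>, and \<open>1 / 3 \<le> q\<close> lets the same series
    absorb the additive constant in \<open>upper\<close>.\<close>
  define q where "q = 1 / (3 * sqrt c)"
  have "sqrt (1 / 9) < sqrt c" using c(1) by simp
  then have s3: "1 < 3 * sqrt c" by (simp add: real_sqrt_divide)
  have q: "0 < q" "q < 1" "1 / 3 \<le> q"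
    using s3 c c0 by (auto simp: q_def field_simps real_le_lsqrt)
  \<comment> \<open>The sum of \<open>C * q ^ m\<close> over \<open>m \<ge> 1\<close>.\<close>
  define D where "D = C * q / (1 - q)"
  have D: "0 \<le> D" using C q by (simp add: D_def)
  define F where "F m x = real (N (x / c ^ m)) / 3 ^ m" for m x
  have mono: "F m x \<le> F (Suc m) x" if "0 < x" for m x
    using lower[of "x / c ^ Suc m"] that c0 by (simp add: F_def field_simps)
  have step: "F (Suc m) x \<le> F m x + C * (sqrt x + 1) * q ^ Suc m" if x: "0 < x" for m x
  proof -
    have "real (N (x / c ^ Suc m)) \<le> 3 * real (N (x / c ^ m)) + C * (sqrt (x / c ^ Suc m) + 1)"
      using upper[of "x / c ^ Suc m"] x c0 by simp
    then have "F (Suc m) x \<le> F m x + C * ((sqrt (x / c ^ Suc m) + 1) / 3 ^ Suc m)"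
      by (simp add: F_def field_simps)
    moreover have "(sqrt (x / c ^ Suc m) + 1) / 3 ^ Suc m \<le> (sqrt x + 1) * q ^ Suc m"
    proof -
      have "sqrt (x / c ^ Suc m) / 3 ^ Suc m = sqrt x * q ^ Suc m"
        by (simp only: q_def real_sqrt_divide real_sqrt_power power_divide power_mult_distrib power_one) simp
      moreover have "(1 / 3) ^ Suc m \<le> q ^ Suc m" using q by (intro power_mono) auto
      ultimately show ?thesis by (simp add: add_divide_distrib distrib_right power_divide del: power_Suc)
    qed
    ultimately show ?thesis using mult_left_mono[OF _ C] by fastforce
  qed
  \<comment> \<open>Keeping the exact partial sum of the series, in the form
    \<open>1 - q ^ m\<close>, lets the induction close.\<close>
  have bound: "F m x \<le> real (N x) + D * (sqrt x + 1) * (1 - q ^ m)" if x: "0 < x" for m x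
  proof (induction m)
    case 0
    then show ?case by (simp add: F_def)
  next
    case (Suc m)
    have "C * q = D * (1 - q)" using q by (simp add: D_def)
    then have "C * (sqrt x + 1) * q ^ Suc m = (D * (1 - q)) * ((sqrt x + 1) * q ^ m)"
      unfolding \<open>C * q = D * (1 - q)\<close>[symmetric] by (simp add: mult_ac)
    also have "\<dots> = D * (sqrt x + 1) * (q ^ m - q ^ Suc m)" by (simp add: algebra_simps)
    finally have "C * (sqrt x + 1) * q ^ Suc m = D * (sqrt x + 1) * (q ^ m - q ^ Suc m)" .
    then show ?case using step[OF x, of m] Suc by (simp add: algebra_simps)
  qed
  have ub: "F m x \<le> real (N x) + D * (sqrt x + 1)" if x: "0 < x" for m x
  proof -
    have "D * (sqrt x + 1) * (1 - q ^ m) \<le> D * (sqrt x + 1) * 1"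
      using D x q by (intro mult_left_mono mult_nonneg_nonneg) auto
    then show ?thesis using bound[OF x, of m] by simp
  qed
  define \<Phi> where "\<Phi> x = lim (\<lambda>m. F m x)" for x
  have lim: "(\<lambda>m. F m x) \<longlonglongrightarrow> \<Phi> x" if x: "0 < x" for x
  proof -
    have "incseq (\<lambda>m. F m x)" using mono[OF x] by (intro incseq_SucI)
    then obtain L where "(\<lambda>m. F m x) \<longlonglongrightarrow> L" using incseq_convergent ub[OF x] by blast
    then show ?thesis unfolding \<Phi>_def by (simp add: limI)
  qed
  have \<Phi>_le: "\<Phi> x \<le> real (N x) + D * (sqrt x + 1)" if x: "0 < x" for x
    by (rule LIMSEQ_le_const2[OF lim[OF x]]) (use ub[OF x] in blast)
  have \<Phi>_ge: "real (N x) \<le> \<Phi> x" if x: "0 < x" for x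
  proof (rule LIMSEQ_le_const[OF lim[OF x]], intro exI allI impI)
    fix m
    show "real (N x) \<le> F m x"
      using lift_Suc_mono_le[of "\<lambda>m. F m x" 0 m] mono[OF x] by (simp add: F_def)
  qed
  have scale: "\<Phi> (x / c) = 3 * \<Phi> x" if x: "0 < x" for x
  proof -
    have "(\<lambda>m. 3 * F (Suc m) x) \<longlonglongrightarrow> 3 * \<Phi> x"
      by (intro tendsto_mult tendsto_const LIMSEQ_Suc lim x)
    moreover have "3 * F (Suc m) x = F m (x / c)" for m
      using c0 by (simp add: F_def)
    ultimately show ?thesis using lim[of "x / c"] x c0 LIMSEQ_unique by simp
  qed
  \<comment> \<open>At level \<open>m\<close> the count jumps by at least \<open>3 ^ m\<close> at
    \<open>\<kappa> / c ^ m\<close>; after division by \<open>3 ^ m\<close> a jump of 1 remains,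
    uniformly in \<open>m\<close>.\<close>
  have jump_lim: "\<Phi> y + 1 \<le> \<Phi> \<kappa>" if y: "0 < y" "y < \<kappa>" for y
  proof (rule LIMSEQ_le[OF tendsto_add[OF lim[OF y(1)] tendsto_const] lim[OF \<kappa>]], intro exI allI impI)
    fix m
    have "y / c ^ m < \<kappa> / c ^ m" using y c0 by (simp add: divide_strict_right_mono)
    then have "N (y / c ^ m) + 3 ^ m \<le> N (\<kappa> / c ^ m)" by (rule jump)
    then have "real (N (y / c ^ m) + 3 ^ m) \<le> real (N (\<kappa> / c ^ m))"
      by (simp only: of_nat_le_iff)
    then have "real (N (y / c ^ m) + 3 ^ m) / 3 ^ m \<le> real (N (\<kappa> / c ^ m)) / 3 ^ m"
      by (rule divide_right_mono) simp
    then show "F m y + 1 \<le> F m \<kappa>" by (simp add: F_def add_divide_distrib)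
  qed
  \<comment> \<open>The exponent satisfies \<open>c powr d = 1 / 3\<close>, so
    \<open>x powr d\<close> gains the factor 3 when \<open>x\<close> is divided by \<open>c\<close>,
    as \<Phi> does.\<close>
  define d where "d = dS / 2"
  have lnc: "ln c < 0" using c c0 by simp
  have "ln (9::real) = 2 * ln 3" using ln_realpow[of 3 2] by simp
  then have dc: "d * ln c = - ln 3" using lnc by (simp add: d_def dS field_simps)
  \<comment> \<open>In the variable \<open>t\<close> with \<open>x = exp (2 * t)\<close>, division
    of \<open>x\<close> by \<open>c\<close> is the shift of \<open>t\<close> by
    \<open>T\<close>.\<close>
  define G where "G t = \<Phi> (exp (2 * t)) * exp (- (2 * d * t))" for t
  have GF: "G (ln x / 2) * x powr (dS / 2) = \<Phi> x" if "0 < x" for x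
    using that by (simp add: G_def powr_def d_def exp_minus field_simps)
  have "G (t + T) = G t" for t
  proof -
    have T2: "2 * T = - ln c" using c0 by (simp add: T ln_sqrt)
    have e1: "exp (2 * (t + T)) = exp (2 * t) / c"
      using c0 T2 by (simp add: distrib_left exp_diff)
    have "2 * d * (t + T) = 2 * d * t + d * (2 * T)" by (simp add: algebra_simps)
    then have e2: "exp (- (2 * d * (t + T))) = exp (- (2 * d * t)) / 3"
      unfolding T2 using dc by (simp add: exp_diff)
    show ?thesis unfolding G_def e1 e2 using scale[of "exp (2 * t)"] by simp
  qed
  moreover have "\<not> G constant_on UNIV"
  proof
    assume "G constant_on UNIV"
    then obtain g where g: "\<And>t. G t = g" by (auto simp: constant_on_def)
    have \<Phi>g: "\<Phi> x = g * x powr d" if "0 < x" for x using GF[OF that] g by (simp add: d_def)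
    have "((\<lambda>y. g * y powr d) \<longlongrightarrow> g * \<kappa> powr d) (at_left \<kappa>)"
      using \<kappa> by (intro tendsto_intros) auto
    moreover have "g * \<kappa> powr d - 1 < g * \<kappa> powr d" by simp
    ultimately have "\<forall>\<^sub>F y in at_left \<kappa>. g * \<kappa> powr d - 1 < g * y powr d"
      by (rule order_tendstoD(1))
    moreover have "\<forall>\<^sub>F y in at_left \<kappa>. y \<in> {0<..<\<kappa>}"
      using \<kappa> by (rule eventually_at_left_real)
    ultimately have "\<forall>\<^sub>F y in at_left \<kappa>. False"
    proof eventually_elim
      case (elim y)
      then show ?case using jump_lim[of y] \<Phi>g[of y] \<Phi>g[OF \<kappa>] by simp
    qed
    then show False by simp
  qed
  moreover have "(\<lambda>x. real (N x) - G (ln x / 2) * x powr (dS / 2)) \<in> O[at_top](\<lambda>x. x powr (1 / 2))"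
  proof (rule bigoI[where c = "2 * D"])
    show "\<forall>\<^sub>F x in at_top. norm (real (N x) - G (ln x / 2) * x powr (dS / 2))
      \<le> 2 * D * norm (x powr (1 / 2) :: real)"
      using eventually_ge_at_top[of 1]
    proof eventually_elim
      case (elim x)
      then have x: "0 < x" and "1 \<le> sqrt x" by auto
      have "\<bar>real (N x) - \<Phi> x\<bar> \<le> D * (sqrt x + 1)"
        using \<Phi>_le[OF x] \<Phi>_ge[OF x] by simp
      also have "\<dots> \<le> D * (2 * sqrt x)" using \<open>1 \<le> sqrt x\<close> D by (intro mult_left_mono) auto
      finally show ?case using x by (simp add: GF powr_half_sqrt)
    qed
  qed
  ultimately show ?thesis by blast
qed

subsection \<open>Smooth cutoff functions\<close>

text \<open>The classical flat function \<open>exp (- 1 / x)\<close>. The negative powers make the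
  family closed under differentiation up to linear combinations.\<close>

definition flat :: "nat \<Rightarrow> real \<Rightarrow> real" where
  "flat n x = (if 0 < x then exp (- 1 / x) / x ^ n else 0)"

lemma flat_tendsto_0: "(flat n \<longlongrightarrow> 0) (at 0)"
proof (rule filterlim_split_at)
  have "\<forall>\<^sub>F x in at_left 0. flat n x = 0"
    by (auto simp: eventually_at_filter flat_def)
  then show "(flat n \<longlongrightarrow> 0) (at_left 0)" by (rule tendsto_eventually)
  have "((\<lambda>x::real. (inverse x) ^ n / exp (inverse x)) \<longlongrightarrow> 0) (at_right 0)"
    by (rule filterlim_compose[OF tendsto_power_div_exp_0 filterlim_inverse_at_top_right])
  moreover have "\<forall>\<^sub>F x in at_right 0. (inverse x) ^ n / exp (inverse x) = flat n x"
    by (auto simp: eventually_at_filter flat_def exp_minus field_simps)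
  ultimately show "(flat n \<longlongrightarrow> 0) (at_right 0)" by (rule Lim_transform_eventually)
qed

lemma has_real_derivative_flat:
  "(flat n has_real_derivative flat (n + 2) x - real n * flat (n + 1) x) (at x)"
proof -
  consider "x < 0" | "x = 0" | "x > 0" by linarith
  then show ?thesis
  proof cases
    case 1
    have "((\<lambda>x. 0) has_real_derivative 0) (at x)" by simp
    then have "(flat n has_real_derivative 0) (at x)"
      by (rule has_field_derivative_transform_within_open[where S = "{..<0}"]) (use 1 in \<open>auto simp: flat_def\<close>)
    then show ?thesis using 1 by (simp add: flat_def)
  next
    case 2
    have "((\<lambda>h. (flat n h - flat n 0) / (h - 0)) \<longlongrightarrow> 0) (at 0)"
      by (rule Lim_transform_eventually[OF flat_tendsto_0[of "Suc n"]])
         (auto simp: flat_def eventually_at_filter intro!: always_eventually)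
    then show ?thesis using 2 by (simp add: has_field_derivative_iff flat_def)
  next
    case 3
    have "((\<lambda>x. exp (- 1 / x) / x ^ n) has_real_derivative
        (exp (- 1 / x) * (1 / x\<^sup>2) * x ^ n - exp (- 1 / x) * (real n * x ^ (n - 1))) / (x ^ n * x ^ n)) (at x)"
      using 3 by (auto intro!: derivative_eq_intros simp: power2_eq_square)
    moreover have "(exp (- 1 / x) * (1 / x\<^sup>2) * x ^ n - exp (- 1 / x) * (real n * x ^ (n - 1))) / (x ^ n * x ^ n)
        = flat (n + 2) x - real n * flat (n + 1) x"
      using 3 by (cases n) (auto simp: flat_def field_simps power2_eq_square)
    ultimately have "((\<lambda>x. exp (- 1 / x) / x ^ n) has_real_derivative flat (n + 2) x - real n * flat (n + 1) x) (at x)"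
      by simp
    then show ?thesis
      by (rule has_field_derivative_transform_within_open[where S = "{0<..}"]) (use 3 in \<open>auto simp: flat_def\<close>)
  qed
qed

text \<open>Closure under differentiation gives all orders of the iterated \<open>deriv\<close>
  demanded by \<open>test_function\<close> at once, without formulas for them.\<close>

inductive_set flat_algebra :: "(real \<Rightarrow> real) set" where
  flat: "(\<lambda>x. flat n (c * x + d)) \<in> flat_algebra"
| const: "(\<lambda>x. c) \<in> flat_algebra"
| add: "f \<in> flat_algebra \<Longrightarrow> g \<in> flat_algebra \<Longrightarrow> (\<lambda>x. f x + g x) \<in> flat_algebra"
| mult: "f \<in> flat_algebra \<Longrightarrow> g \<in> flat_algebra \<Longrightarrow> (\<lambda>x. f x * g x) \<in> flat_algebra"

lemma flat_algebra_deriv: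
  "f \<in> flat_algebra \<Longrightarrow> \<exists>g\<in>flat_algebra. \<forall>x. (f has_real_derivative g x) (at x)"
proof (induction rule: flat_algebra.induct)
  case (flat n c d)
  have "((\<lambda>x. flat n (c * x + d)) has_real_derivative
      (flat (n + 2) (c * x + d) + (- real n) * flat (n + 1) (c * x + d)) * c) (at x)" for x
  proof (rule DERIV_chain2[where f = "flat n" and g = "\<lambda>x. c * x + d"])
    show "(flat n has_real_derivative flat (n + 2) (c * x + d) + (- real n) * flat (n + 1) (c * x + d))
        (at (c * x + d))"
      using has_real_derivative_flat[of n "c * x + d"] by simp
  qed (auto intro!: derivative_eq_intros)
  moreover have "(\<lambda>x. (flat (n + 2) (c * x + d) + (- real n) * flat (n + 1) (c * x + d)) * c) \<in> flat_algebra"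
    by (intro flat_algebra.intros)
  ultimately show ?case by (intro bexI[of _ "\<lambda>x. (flat (n + 2) (c * x + d) + (- real n) * flat (n + 1) (c * x + d)) * c"] allI)
next
  case (const c)
  show ?case by (intro bexI[of _ "\<lambda>x. 0"] flat_algebra.const) auto
next
  case (add f g)
  then obtain f' g' where "f' \<in> flat_algebra" "\<And>x. (f has_real_derivative f' x) (at x)"
    "g' \<in> flat_algebra" "\<And>x. (g has_real_derivative g' x) (at x)" by blast
  then show ?case
    by (intro bexI[of _ "\<lambda>x. f' x + g' x"] flat_algebra.add) (auto intro!: derivative_eq_intros)
next
  case (mult f g)
  then obtain f' g' where "f' \<in> flat_algebra" "\<And>x. (f has_real_derivative f' x) (at x)"
    "g' \<in> flat_algebra" "\<And>x. (g has_real_derivative g' x) (at x)" by blast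
  with mult.hyps show ?case
    by (intro bexI[of _ "\<lambda>x. f' x * g x + g' x * f x"] flat_algebra.add flat_algebra.mult)
       (auto intro!: derivative_eq_intros)
qed

lemma flat_algebra_iterated_deriv:
  assumes "f \<in> flat_algebra" shows "(deriv ^^ n) f \<in> flat_algebra"
proof (induction n)
  case (Suc n)
  obtain g where "g \<in> flat_algebra" "\<forall>x. ((deriv ^^ n) f has_real_derivative g x) (at x)"
    using flat_algebra_deriv[OF Suc] by blast
  then have "deriv ((deriv ^^ n) f) = g" by (intro ext DERIV_imp_deriv) simp
  with \<open>g \<in> flat_algebra\<close> show ?case by simp
qed (use assms in simp)

lemma flat_algebra_differentiable: "f \<in> flat_algebra \<Longrightarrow> f differentiable_on UNIV"
  using flat_algebra_deriv[of f] unfolding differentiable_on_def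
  by (auto simp: real_differentiable_def)

lemma flat_algebra_continuous: "f \<in> flat_algebra \<Longrightarrow> continuous_on S f"
  using flat_algebra_deriv[of f] DERIV_isCont continuous_at_imp_continuous_on by blast

text \<open>A cutoff is the integral of a bump and is not exhibited as a member of
  \<open>flat_algebra\<close>; membership of its first derivative settles all higher ones.\<close>

lemma test_function_antiderivative:
  assumes g: "g \<in> flat_algebra" and d: "\<And>x. (\<phi> has_real_derivative g x) (at x)"
    and ab: "0 < a" "b < 1" and z: "\<And>x. x \<notin> {a..b} \<Longrightarrow> \<phi> x = 0"
  shows "test_function \<phi>" "deriv \<phi> = g"
proof -
  show dg: "deriv \<phi> = g" using d by (intro ext DERIV_imp_deriv)
  have "(deriv ^^ n) \<phi> differentiable_on UNIV" for n
  proof (cases n)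
    case 0
    have "\<phi> differentiable at x" for x
      using d[of x] by (auto simp: real_differentiable_def)
    then show ?thesis using 0 by (simp add: differentiable_on_def)
  next
    case (Suc m)
    have "(deriv ^^ n) \<phi> = (deriv ^^ m) g" unfolding Suc funpow_Suc_right comp_def dg ..
    then show ?thesis using flat_algebra_differentiable[OF flat_algebra_iterated_deriv[OF g, of m]] by simp
  qed
  then show "test_function \<phi>" unfolding test_function_def using ab z by blast
qed

lemma smooth_ramp:
  "\<exists>\<theta> b. (\<forall>c d. (\<lambda>x. b (c * x + d)) \<in> flat_algebra) \<and> (\<forall>x. (\<theta> has_real_derivative b x) (at x)) \<and>
    (\<forall>x. 0 \<le> b x) \<and> (\<forall>x. x \<notin> {0<..<1} \<longrightarrow> b x = 0) \<and> (\<forall>x\<le>0. \<theta> x = (0::real)) \<and> (\<forall>x\<ge>1. \<theta> x = 1) \<and>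
    (\<forall>x. 0 \<le> \<theta> x \<and> \<theta> x \<le> 1)"
proof -
  define b0 where "b0 x = flat 0 x * flat 0 (1 - x)" for x
  have alg: "(\<lambda>x. b0 (c * x + d)) \<in> flat_algebra" for c d
    unfolding b0_def
    using flat_algebra.mult[OF flat_algebra.flat[of 0 c d] flat_algebra.flat[of 0 "- c" "1 - d"]]
    by (simp add: algebra_simps)
  have cont: "continuous_on S b0" for S using flat_algebra_continuous[OF alg[of 1 0]] by simp
  have nn: "0 \<le> b0 x" and pos: "x \<in> {0<..<1} \<Longrightarrow> 0 < b0 x" and z: "x \<notin> {0<..<1} \<Longrightarrow> b0 x = 0" for x
    by (auto simp: b0_def flat_def)
  \<comment> \<open>Starting at \<open>-1\<close> leaves room to the left of 0, so that the
    derivative at 0 is two-sided.\<close>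
  define H where "H x = integral {-1..x} b0" for x
  have z0: "H x = 0" if "x \<le> 0" for x
  proof -
    have "H x = integral {-1..x} (\<lambda>_. 0)"
      unfolding H_def using that by (intro Henstock_Kurzweil_Integration.integral_cong) (auto simp: z)
    then show ?thesis by simp
  qed
  have D: "(H has_real_derivative b0 x) (at x)" for x
  proof (cases "x < 0")
    case True
    have "((\<lambda>x. 0) has_real_derivative 0) (at x)" by simp
    then have "(H has_real_derivative 0) (at x)"
      by (rule has_field_derivative_transform_within_open[where S = "{..<0}"]) (use True z0 in auto)
    then show ?thesis using True by (simp add: z)
  next
    case False
    then have "(H has_real_derivative b0 x) (at x within {-1..x + 1})"
      unfolding H_def by (intro integral_has_real_derivative cont) auto
    moreover have "at x within {-1..x + 1} = at x" using False by (intro at_within_interior) auto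
    ultimately show ?thesis by simp
  qed
  have mono: "H x \<le> H y" if "x \<le> y" for x y
    by (rule DERIV_nonneg_imp_nondecreasing[OF that]) (use D nn in blast)
  have H1: "0 < H 1"
  proof -
    obtain y where "0 < y" "y < 1" "H 1 - H 0 = (1 - 0) * b0 y"
      using MVT2[of 0 1 H b0] D by auto
    then have "H 0 < H 1" using pos[of y] by simp
    then show ?thesis using z0[of 0] by simp
  qed
  have Hc: "H x = H 1" if "1 \<le> x" for x
  proof (cases "x = 1")
    case False
    then have "1 < x" using that by simp
    then obtain y where "1 < y" "H x - H 1 = (x - 1) * b0 y"
      using MVT2[of 1 x H b0] D by auto
    then show ?thesis using z[of y] by simp
  qed simp
  show ?thesis
  proof (rule exI[of _ "\<lambda>x. H x / H 1"], rule exI[of _ "\<lambda>x. b0 x * (1 / H 1)"], intro conjI allI impI)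
    show "(\<lambda>x. b0 (c * x + d) * (1 / H 1)) \<in> flat_algebra" for c d
      by (intro flat_algebra.mult alg flat_algebra.const)
    show "((\<lambda>x. H x / H 1) has_real_derivative b0 x * (1 / H 1)) (at x)" for x
      using DERIV_cdivide[OF D[of x], of "H 1"] by simp
    show "0 \<le> b0 x * (1 / H 1)" for x using nn H1 by simp
    show "b0 x * (1 / H 1) = 0" if "x \<notin> {0<..<1}" for x using z[OF that] by simp
    show "H x / H 1 = 0" if "x \<le> 0" for x using z0[OF that] by simp
    show "H x / H 1 = 1" if "1 \<le> x" for x using Hc[OF that] H1 by simp
    show "0 \<le> H x / H 1" for x
      using mono[of "min x 0" x] z0[of "min x 0"] H1 by simp
    show "H x / H 1 \<le> 1" for x
      using mono[of x "max x 1"] Hc[of "max x 1"] H1 by simp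
  qed
qed

subsection \<open>Integration on the unit interval\<close>

abbreviation U01 :: "real measure" where "U01 \<equiv> restrict_space lborel {0<..<1}"

lemma set_integrable_U01: "set_integrable lborel {0<..<1} f \<longleftrightarrow> integrable U01 f"
  for f :: "real \<Rightarrow> real"
  unfolding set_integrable_def by (subst integrable_restrict_space) auto

lemma set_integral_U01: "(LINT x:{0<..<1}|lborel. f x) = (LINT x|U01. f x)"
  for f :: "real \<Rightarrow> real"
  by (simp add: set_lebesgue_integral_def integral_restrict_space)

lemma L2_01_iff: "f \<in> L2_01 \<longleftrightarrow> f \<in> borel_measurable U01 \<and> integrable U01 (\<lambda>x. (f x)\<^sup>2)"
  by (simp add: L2_01_def set_borel_measurable_def borel_measurable_restrict_space_iff set_integrable_U01)

lemma finite_measure_U01: "finite_measure U01"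
  by standard (simp add: emeasure_restrict_space space_restrict_space)

lemma measure_U01 [simp]: "measure U01 {0<..<1} = 1"
  by (simp add: measure_restrict_space)

lemma integrable_U01_const [simp]: "integrable U01 (\<lambda>x. c::real)"
  using finite_measure_U01 by (rule finite_measure.integrable_const)

lemma integral_U01_const [simp]: "(LINT x|U01. c) = (c::real)"
  by (simp add: space_restrict_space)

lemma integrable_U01_bounded:
  fixes f :: "real \<Rightarrow> real"
  assumes "f \<in> borel_measurable U01" "\<And>x. 0 < x \<Longrightarrow> x < 1 \<Longrightarrow> \<bar>f x\<bar> \<le> B"
  shows "integrable U01 f"
  by (rule Bochner_Integration.integrable_bound[OF integrable_U01_const[of B] assms(1)])
     (auto simp: space_restrict_space intro!: AE_I2 order_trans[OF assms(2)])

lemma measurable_U01_continuous: "continuous_on {0..1} f \<Longrightarrow> f \<in> borel_measurable U01"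
  for f :: "real \<Rightarrow> real"
  by (subst measurable_cong_sets[OF _ refl, of _ "restrict_space borel {0<..<1}"])
     (auto intro!: borel_measurable_continuous_on_restrict continuous_on_subset[of "{0..1}"] sets_restrict_space_cong)

lemma integrable_U01_continuous:
  fixes f :: "real \<Rightarrow> real"
  assumes "continuous_on {0..1} f" shows "integrable U01 f"
proof -
  have "bounded (f ` {0..1})" using assms by (intro compact_imp_bounded compact_continuous_image) auto
  then obtain B where "\<forall>x\<in>{0..1}. \<bar>f x\<bar> \<le> B" by (auto simp: bounded_iff)
  then show ?thesis using assms by (intro integrable_U01_bounded[of _ B] measurable_U01_continuous) auto
qed

lemma integral_U01_FTC:
  fixes F f :: "real \<Rightarrow> real"
  assumes D: "\<And>x. (F has_real_derivative f x) (at x)" and f: "continuous_on {0..1} f"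
  shows "(LINT x|U01. f x) = F 1 - F 0"
proof -
  have "(LINT x|U01. f x) = integral {0<..<1} f"
    unfolding set_integral_U01[symmetric]
    using integrable_U01_continuous[OF f] unfolding set_integrable_U01[symmetric]
    by (rule set_borel_integral_eq_integral)
  also have "\<dots> = integral {0..1} f" by (simp add: integral_open_interval_real)
  also have "\<dots> = F 1 - F 0"
    by (intro integral_unique fundamental_theorem_of_calculus)
       (auto intro!: has_field_derivative_at_within D simp flip: has_real_derivative_iff_has_vector_derivative)
  finally show ?thesis .
qed

lemma L2_mult_integrable:
  assumes "f \<in> L2_01" "g \<in> L2_01" shows "integrable U01 (\<lambda>x. f x * g x)"
proof (rule Bochner_Integration.integrable_bound)
  show "integrable U01 (\<lambda>x. (f x)\<^sup>2 + (g x)\<^sup>2)" using assms by (auto simp: L2_01_iff)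
  show "(\<lambda>x. f x * g x) \<in> borel_measurable U01" using assms by (auto simp: L2_01_iff)
  have "\<bar>a * b\<bar> \<le> \<bar>a\<^sup>2 + b\<^sup>2\<bar>" for a b :: real
    using sum_squares_bound[of a b] sum_squares_bound[of a "- b"] by (simp add: abs_le_iff)
  then show "AE x in U01. norm (f x * g x) \<le> norm ((f x)\<^sup>2 + (g x)\<^sup>2)" by (simp add: AE_I2)
qed

lemma L2_const: "(\<lambda>x. c) \<in> L2_01"
  by (simp add: L2_01_iff)

lemma L2_integrable: "f \<in> L2_01 \<Longrightarrow> integrable U01 f"
  using L2_mult_integrable[OF _ L2_const[of 1]] by simp

lemma L2_bounded:
  assumes "f \<in> borel_measurable U01" "\<And>x. 0 < x \<Longrightarrow> x < 1 \<Longrightarrow> \<bar>f x\<bar> \<le> B" shows "f \<in> L2_01"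
  unfolding L2_01_iff
proof
  show "integrable U01 (\<lambda>x. (f x)\<^sup>2)"
  proof (rule integrable_U01_bounded[of _ "B\<^sup>2"])
    show "\<bar>(f x)\<^sup>2\<bar> \<le> B\<^sup>2" if "0 < x" "x < 1" for x
      using power_mono[OF assms(2)[OF that], of 2] by simp
  qed (use assms in simp)
qed (rule assms)

lemma L2_continuous: "continuous_on {0..1} f \<Longrightarrow> f \<in> L2_01"
  by (auto simp: L2_01_iff measurable_U01_continuous intro!: integrable_U01_continuous continuous_intros)

lemma L2_add: "f \<in> L2_01 \<Longrightarrow> g \<in> L2_01 \<Longrightarrow> (\<lambda>x. f x + g x) \<in> L2_01"
  using L2_mult_integrable[of f g] by (auto simp: L2_01_iff power2_sum mult.assoc)

lemma L2_scale: "f \<in> L2_01 \<Longrightarrow> (\<lambda>x. c * f x) \<in> L2_01"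
  by (auto simp: L2_01_iff power_mult_distrib)

lemma L2_diff: "f \<in> L2_01 \<Longrightarrow> g \<in> L2_01 \<Longrightarrow> (\<lambda>x. f x - g x) \<in> L2_01"
  using L2_add[OF _ L2_scale[of g "-1"]] by simp

lemma L2_integral_square:
  assumes "f \<in> L2_01" shows "(LINT x|U01. f x)\<^sup>2 \<le> (LINT x|U01. (f x)\<^sup>2)"
proof -
  define m where "m = (LINT x|U01. f x)"
  have "0 \<le> (LINT x|U01. (f x - m)\<^sup>2)" by (rule integral_nonneg_AE) auto
  also have "\<dots> = (LINT x|U01. (f x)\<^sup>2 - 2 * m * f x + m\<^sup>2)"
    by (rule Bochner_Integration.integral_cong) (auto simp: power2_eq_square algebra_simps)
  also have "\<dots> = (LINT x|U01. (f x)\<^sup>2) - 2 * m * m + m\<^sup>2"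
    using assms L2_integrable[OF assms] by (simp add: L2_01_iff m_def space_restrict_space)
  finally show ?thesis by (simp add: m_def power2_eq_square)
qed

subsection \<open>Weak derivatives\<close>

text \<open>The kernel \<open>b ((x - p) / e) / e\<close> has mass one by the fundamental theorem
  for its primitive, a rescaled \<theta>, so the integral is an average of \<open>f\<close> over
  \<open>{p..p + e}\<close>.\<close>

lemma approximate_identity:
  assumes b: "\<And>c d. (\<lambda>x. b (c * x + d)) \<in> flat_algebra" and \<theta>: "\<And>x. (\<theta> has_real_derivative b x) (at x)"
    and nn: "\<And>x. 0 \<le> b x" and z: "\<And>x. x \<notin> {0<..<1} \<Longrightarrow> b x = 0"
    and \<theta>0: "\<And>x. x \<le> 0 \<Longrightarrow> \<theta> x = 0" and \<theta>1: "\<And>x. 1 \<le> x \<Longrightarrow> \<theta> x = (1::real)"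
    and f: "continuous_on {0..1} f" and e: "0 < e" and p: "0 \<le> p" "p + e \<le> 1"
    and close: "\<And>x. p \<le> x \<Longrightarrow> x \<le> p + e \<Longrightarrow> \<bar>f x - y\<bar> \<le> \<eta>"
  shows "\<bar>(LINT x|U01. f x * (b ((x - p) / e) / e)) - y\<bar> \<le> \<eta>"
proof -
  define B where "B x = b ((x - p) / e) / e" for x
  have "(\<lambda>x. b (1 / e * x + (- p / e)) * (1 / e)) \<in> flat_algebra"
    by (intro flat_algebra.mult b flat_algebra.const)
  moreover have "1 / e * x + (- p / e) = (x - p) / e" for x by (simp add: diff_divide_distrib)
  ultimately have "B \<in> flat_algebra" by (simp add: B_def[abs_def])
  then have Bc: "continuous_on {0..1} B" by (rule flat_algebra_continuous)
  have "((\<lambda>x. \<theta> ((x - p) / e)) has_real_derivative B x) (at x)" for x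
  proof -
    have "((\<lambda>x. (x - p) / e) has_real_derivative 1 / e) (at x)" using e by (auto intro!: derivative_eq_intros)
    from DERIV_chain2[where f = \<theta>, OF \<theta> this] show ?thesis by (simp add: B_def)
  qed
  from integral_U01_FTC[OF this Bc] have B1: "(LINT x|U01. B x) = 1"
    using e p \<theta>0[of "(0 - p) / e"] \<theta>1[of "(1 - p) / e"] by (simp add: field_simps)
  have Bnn: "0 \<le> B x" for x using nn e by (simp add: B_def)
  have fB: "integrable U01 (\<lambda>x. (f x - y) * B x)" "integrable U01 (\<lambda>x. f x * B x)" "integrable U01 B"
    by (intro integrable_U01_continuous continuous_intros f Bc)+
  have "(LINT x|U01. f x * B x) - y = (LINT x|U01. (f x - y) * B x)"
    using fB B1 by (simp add: left_diff_distrib)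
  also have "\<bar>\<dots>\<bar> \<le> (LINT x|U01. \<bar>(f x - y) * B x\<bar>)" by (rule integral_abs_bound)
  also have "\<dots> \<le> (LINT x|U01. \<eta> * B x)"
  proof (rule integral_mono)
    show "\<bar>(f x - y) * B x\<bar> \<le> \<eta> * B x" for x
    proof (cases "p < x \<and> x < p + e")
      case True
      then show ?thesis using close[of x] Bnn[of x] by (simp add: abs_mult mult_right_mono)
    next
      case False
      then have "B x = 0" using e z[of "(x - p) / e"] by (auto simp: B_def field_simps)
      then show ?thesis by simp
    qed
  qed (use fB in auto)
  also have "\<dots> = \<eta>" using B1 by simp
  finally show ?thesis by (simp add: B_def)
qed

text \<open>The test functions are smoothed indicators of \<open>{s<..<t}\<close>. Their derivatives
  are differences of two approximate identities concentrating at \<open>s\<close> and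
  \<open>t\<close>, which recover the point values of the continuous \<open>f\<close>.\<close>

lemma weak_deriv_FTC:
  assumes f: "continuous_on {0..1} f" and g: "g \<in> L2_01" and w: "is_weak_deriv f g"
    and st: "0 \<le> s" "s < t" "t \<le> 1"
  shows "f t - f s = (LINT x|U01. indicator {s<..<t} x * g x)"
proof -
  obtain \<theta> b where R: "\<forall>c d. (\<lambda>x. b (c * x + d)) \<in> flat_algebra"
    "\<forall>x. (\<theta> has_real_derivative b x) (at x)" "\<forall>x. 0 \<le> b x" "\<forall>x. x \<notin> {0<..<1} \<longrightarrow> b x = 0"
    "\<forall>x\<le>0. \<theta> x = (0::real)" "\<forall>x\<ge>1. \<theta> x = 1" "\<forall>x. 0 \<le> \<theta> x \<and> \<theta> x \<le> 1"
    using smooth_ramp by (elim exE conjE) (rule that)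
  note b = R(1)[rule_format] and \<theta> = R(2)[rule_format] and nn = R(3)[rule_format]
    and z = R(4)[rule_format] and \<theta>0 = R(5)[rule_format] and \<theta>1 = R(6)[rule_format]
    and \<theta>b = R(7)[rule_format]
  \<comment> \<open>The 5 keeps the rising ramp on \<open>{p n..p n + e n}\<close> and the falling
    ramp on \<open>{q n..q n + e n}\<close> apart. Both stay strictly inside
    \<open>{s<..<t}\<close>, so the support is compact in the open unit interval even for
    \<open>s = 0\<close> and \<open>t = 1\<close>.\<close>
  define e where "e n = (t - s) / real (n + 5)" for n :: nat
  have e: "0 < e n" "2 * e n < (t - s) / 2" for n
  proof -
    show "0 < e n" using st by (simp add: e_def)
    have "e n \<le> (t - s) / 5" unfolding e_def using st by (intro divide_left_mono) auto
    then show "2 * e n < (t - s) / 2" using st by simp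
  qed
  have elim: "e \<longlonglongrightarrow> 0"
    unfolding e_def by (rule LIMSEQ_ignore_initial_segment[OF lim_const_over_n])
  define p q where "p n = s + e n" and "q n = t - 2 * e n" for n
  define \<phi> where "\<phi> n x = \<theta> ((x - p n) / e n) - \<theta> ((x - q n) / e n)" for n x
  define B where "B c n x = b ((x - c n) / e n) / e n" for c :: "nat \<Rightarrow> real" and n x
  have aff: "1 / e n * x + (- c / e n) = (x - c) / e n" for n x c by (simp add: diff_divide_distrib)
  have Balg: "B c n \<in> flat_algebra" for c n
    using flat_algebra.mult[OF b[of "1 / e n" "- c n / e n"] flat_algebra.const[of "1 / e n"]]
    unfolding aff B_def[abs_def] by simp
  have \<theta>D: "((\<lambda>x. \<theta> ((x - c n) / e n)) has_real_derivative B c n x) (at x)" for c n x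
  proof -
    have "((\<lambda>x. (x - c n) / e n) has_real_derivative 1 / e n) (at x)"
      using e[of n] by (auto intro!: derivative_eq_intros)
    from DERIV_chain2[where f = \<theta>, OF \<theta> this] show ?thesis by (simp add: B_def)
  qed
  have \<phi>': "(\<lambda>x. B p n x + (-1) * B q n x) \<in> flat_algebra" for n
    by (intro flat_algebra.add flat_algebra.mult flat_algebra.const Balg)
  have \<phi>D: "(\<phi> n has_real_derivative B p n x + (-1) * B q n x) (at x)" for n x
    unfolding \<phi>_def using DERIV_diff[OF \<theta>D[of p n x] \<theta>D[of q n x]] by simp
  have \<phi>0: "\<phi> n x = 0" if "x \<notin> {p n..q n + e n}" for n x
  proof (cases "x < p n")
    case True
    moreover have "p n < q n" using e[of n] by (simp add: p_def q_def field_simps)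
    ultimately have "(x - p n) / e n \<le> 0" "(x - q n) / e n \<le> 0"
      using e[of n] by (auto intro: divide_nonpos_pos)
    then show ?thesis by (simp add: \<phi>_def \<theta>0)
  next
    case False
    then have "q n + e n < x" using that by simp
    moreover have "p n < q n" using e[of n] by (simp add: p_def q_def field_simps)
    ultimately have "1 \<le> (x - p n) / e n" "1 \<le> (x - q n) / e n"
      using e[of n] by (auto simp: le_divide_eq)
    then show ?thesis by (simp add: \<phi>_def \<theta>1)
  qed
  have ab: "0 < p n" "q n + e n < 1" for n using e[of n] st by (auto simp: p_def q_def)
  have test: "test_function (\<phi> n)" "deriv (\<phi> n) = (\<lambda>x. B p n x + (-1) * B q n x)" for n
    using test_function_antiderivative[OF \<phi>' \<phi>D ab \<phi>0] by auto
  have Bc: "continuous_on S (B c n)" for S c n by (rule flat_algebra_continuous[OF Balg])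
  have eq: "(LINT x|U01. f x * B p n x) - (LINT x|U01. f x * B q n x) = - (LINT x|U01. g x * \<phi> n x)" for n
  proof -
    have "(LINT x|U01. f x * deriv (\<phi> n) x) = - (LINT x|U01. g x * \<phi> n x)"
      using w test(1)[of n] unfolding is_weak_deriv_def set_integral_U01 by blast
    moreover have "(LINT x|U01. f x * deriv (\<phi> n) x) = (LINT x|U01. f x * B p n x - f x * B q n x)"
      unfolding test(2) by (simp add: algebra_simps)
    moreover have "\<dots> = (LINT x|U01. f x * B p n x) - (LINT x|U01. f x * B q n x)"
      by (intro Bochner_Integration.integral_diff integrable_U01_continuous continuous_intros f Bc)
    ultimately show ?thesis by simp
  qed
  have lim: "(\<lambda>n. LINT x|U01. f x * B c n x) \<longlonglongrightarrow> f l"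
    if l: "0 \<le> l" "l \<le> 1" and c: "\<And>n. 0 \<le> c n" "\<And>n. c n + e n \<le> 1" "\<And>n. \<bar>c n - l\<bar> \<le> 2 * e n" for c l
  proof (rule LIMSEQ_I)
    fix \<eta> :: real assume \<eta>: "0 < \<eta>"
    obtain d where d: "0 < d" "\<And>x. x \<in> {0..1} \<Longrightarrow> \<bar>x - l\<bar> < d \<Longrightarrow> \<bar>f x - f l\<bar> < \<eta> / 2"
      using f l \<eta> unfolding continuous_on_iff dist_real_def
      by (metis atLeastAtMost_iff half_gt_zero)
    have "\<forall>\<^sub>F n in sequentially. e n < d / 3"
      using elim d(1) by (auto intro!: order_tendstoD)
    then obtain N where N: "\<And>n. n \<ge> N \<Longrightarrow> e n < d / 3" by (auto simp: eventually_sequentially)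
    have "norm ((LINT x|U01. f x * B c n x) - f l) < \<eta>" if n: "n \<ge> N" for n
    proof -
      have "\<bar>(LINT x|U01. f x * (b ((x - c n) / e n) / e n)) - f l\<bar> \<le> \<eta> / 2"
      proof (rule approximate_identity[OF b \<theta> nn z \<theta>0 \<theta>1 f e(1) c(1) c(2)])
        fix x assume x: "c n \<le> x" "x \<le> c n + e n"
        have "\<bar>x - l\<bar> < d" using x c(3)[of n] N[OF n] by linarith
        moreover have "x \<in> {0..1}" using x c(1,2)[of n] by auto
        ultimately show "\<bar>f x - f l\<bar> \<le> \<eta> / 2" using d(2) by fastforce
      qed
      then show ?thesis using \<eta> by (simp add: B_def)
    qed
    then show "\<exists>N. \<forall>n\<ge>N. norm ((LINT x|U01. f x * B c n x) - f l) < \<eta>" by blast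
  qed
  have "(\<lambda>n. (LINT x|U01. f x * B p n x) - (LINT x|U01. f x * B q n x)) \<longlonglongrightarrow> f s - f t"
  proof (intro tendsto_diff lim)
    show "\<bar>p n - s\<bar> \<le> 2 * e n" "p n + e n \<le> 1" "0 \<le> p n" for n using e[of n] st by (auto simp: p_def)
    show "\<bar>q n - t\<bar> \<le> 2 * e n" "q n + e n \<le> 1" "0 \<le> q n" for n using e[of n] st by (auto simp: q_def)
  qed (use st in auto)
  moreover have "(\<lambda>n. - (LINT x|U01. g x * \<phi> n x)) \<longlonglongrightarrow> - (LINT x|U01. g x * indicator {s<..<t} x)"
  proof (intro tendsto_minus integral_dominated_convergence[where w = "\<lambda>x. \<bar>g x\<bar>"])
    show "integrable U01 (\<lambda>x. \<bar>g x\<bar>)" using L2_integrable[OF g] by simp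
    have [measurable]: "g \<in> borel_measurable U01" using g by (simp add: L2_01_iff)
    have [measurable]: "\<phi> n \<in> borel_measurable U01" for n
      using \<phi>D[of n] by (intro measurable_U01_continuous continuous_at_imp_continuous_on) (auto intro: DERIV_isCont)
    show "(\<lambda>x. g x * \<phi> n x) \<in> borel_measurable U01" for n by measurable
    show "(\<lambda>x. g x * indicator {s<..<t} x) \<in> borel_measurable U01"
      by (intro borel_measurable_times borel_measurable_indicator) (use g st in \<open>auto simp: L2_01_iff sets_restrict_space_iff\<close>)
    have "\<bar>\<phi> n x\<bar> \<le> 1" for n x
      using \<theta>b[of "(x - p n) / e n"] \<theta>b[of "(x - q n) / e n"] by (auto simp: \<phi>_def)
    then show "AE x in U01. norm (g x * \<phi> n x) \<le> \<bar>g x\<bar>" for n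
      by (intro AE_I2) (auto simp: abs_mult mult_left_le)
    have "(\<lambda>n. \<phi> n x) \<longlonglongrightarrow> indicator {s<..<t} x" for x
    proof (cases "x \<in> {s<..<t}")
      case True
      have "\<forall>\<^sub>F n in sequentially. e n < min (x - s) (t - x) / 2"
        using elim True by (intro order_tendstoD(2)) auto
      then have "\<forall>\<^sub>F n in sequentially. \<phi> n x = 1"
      proof eventually_elim
        case (elim n)
        then have "1 \<le> (x - p n) / e n" "(x - q n) / e n \<le> 0"
          using e[of n] by (auto simp: p_def q_def le_divide_eq intro!: divide_nonpos_pos)
        then show ?case by (simp add: \<phi>_def \<theta>0 \<theta>1)
      qed
      then show ?thesis using True by (intro tendsto_eventually) simp
    next
      case False
      have "\<phi> n x = 0" for n
        using False e[of n] by (intro \<phi>0) (auto simp: p_def q_def)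
      then show ?thesis using False by simp
    qed
    then show "AE x in U01. (\<lambda>n. g x * \<phi> n x) \<longlonglongrightarrow> g x * indicator {s<..<t} x"
      by (intro AE_I2 tendsto_mult tendsto_const)
  qed
  ultimately have "f s - f t = - (LINT x|U01. g x * indicator {s<..<t} x)"
    unfolding eq by (rule LIMSEQ_unique)
  then show ?thesis by (simp add: mult.commute)
qed

interpretation L2: sym_form L2_01 "\<lambda>f g. LINT x|U01. f x * g x"
proof
  show "subspace L2_01"
    using L2_const[of 0] L2_add L2_scale
    by (auto simp: subspace_def plus_fun_def scaleR_fun_def zero_fun_def)
  show "(LINT x|U01. (a *\<^sub>R u + b *\<^sub>R v) x * w x) = a * (LINT x|U01. u x * w x) + b * (LINT x|U01. v x * w x)"
    if "u \<in> L2_01" "v \<in> L2_01" "w \<in> L2_01" for u v w a b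
  proof -
    have "(LINT x|U01. (a *\<^sub>R u + b *\<^sub>R v) x * w x) = (LINT x|U01. a * (u x * w x) + b * (v x * w x))"
      by (simp add: plus_fun_def scaleR_fun_def algebra_simps)
    then show ?thesis using that by (simp add: L2_mult_integrable)
  qed
qed (auto simp: mult.commute intro!: integral_nonneg_AE)

text \<open>Riesz-Fischer for representatives: along a fast subsequence the increments are summable
  in L1, so it converges almost everywhere, and Fatou's lemma transfers the Cauchy estimate to the
  limit.\<close>

lemma L2_complete:
  assumes g: "\<And>n. g n \<in> L2_01"
    and cauchy: "\<And>e. 0 < e \<Longrightarrow> \<exists>N. \<forall>m\<ge>N. \<forall>n\<ge>N. (LINT x|U01. (g m x - g n x)\<^sup>2) < e"
  shows "\<exists>h\<in>L2_01. (\<lambda>n. LINT x|U01. (g n x - h x)\<^sup>2) \<longlonglongrightarrow> 0"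
proof -
  have [measurable]: "g n \<in> borel_measurable U01" for n using g by (simp add: L2_01_iff)
  have gi: "integrable U01 (\<lambda>x. (g m x - g n x)\<^sup>2)" for m n
    using L2_diff[OF g g] by (simp add: L2_01_iff)
  have "\<forall>k. \<exists>N. \<forall>m\<ge>N. \<forall>n\<ge>N. (LINT x|U01. (g m x - g n x)\<^sup>2) < (1 / 4) ^ k"
    using cauchy by simp
  then obtain N where N: "\<forall>k. \<forall>m\<ge>N k. \<forall>n\<ge>N k. (LINT x|U01. (g m x - g n x)\<^sup>2) < (1 / 4) ^ k"
    by (rule choice[THEN exE])
  \<comment> \<open>Partial sums put both \<open>s k\<close> and \<open>s (Suc k)\<close> beyond
    \<open>N k\<close>, so consecutive members obey the estimate; the summand \<open>k\<close> makes
    the indices tend to infinity.\<close>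
  define s where "s k = (\<Sum>j\<le>k. N j) + k" for k
  have s1: "N k \<le> s k" for k
    unfolding s_def by (intro trans_le_add1 member_le_sum) auto
  have s: "N k \<le> s k" "N k \<le> s (Suc k)" "k \<le> s k" for k
    using s1[of k] by (auto simp: s_def)
  define h where "h k = g (s k)" for k
  have [measurable]: "h n \<in> borel_measurable U01" for n by (simp add: h_def)
  have d: "(LINT x|U01. \<bar>h (Suc k) x - h k x\<bar>) \<le> (1 / 2) ^ k" for k
  proof -
    have "(LINT x|U01. \<bar>h (Suc k) x - h k x\<bar>)\<^sup>2 \<le> (LINT x|U01. \<bar>h (Suc k) x - h k x\<bar>\<^sup>2)"
      using gi[of "s (Suc k)" "s k"] by (intro L2_integral_square) (simp add: L2_01_iff h_def)
    also have "\<dots> \<le> (1 / 4) ^ k" using N[rule_format, OF s(2) s(1)] by (simp add: h_def less_imp_le)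
    also have "\<dots> = ((1 / 2) ^ k)\<^sup>2" by (simp add: power2_eq_square flip: power_mult_distrib)
    finally show ?thesis by (rule power2_le_imp_le) simp
  qed
  have di: "integrable U01 (\<lambda>x. \<bar>h (Suc k) x - h k x\<bar>)" for k
    using L2_integrable[OF L2_diff[OF g g]] by (simp add: h_def)
  have "(\<integral>\<^sup>+x. (\<Sum>k. ennreal \<bar>h (Suc k) x - h k x\<bar>) \<partial>U01) = (\<Sum>k. \<integral>\<^sup>+x. ennreal \<bar>h (Suc k) x - h k x\<bar> \<partial>U01)"
    by (rule nn_integral_suminf) simp
  also have "\<dots> = (\<Sum>k. ennreal (LINT x|U01. \<bar>h (Suc k) x - h k x\<bar>))"
    using di by (simp add: nn_integral_eq_integral)
  also have "\<dots> \<le> (\<Sum>k. ennreal ((1 / 2) ^ k))"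
    by (intro suminf_le ennreal_leI d) auto
  also have "\<dots> = ennreal (\<Sum>k. (1 / 2) ^ k)"
    by (rule suminf_ennreal2) (auto intro: summable_geometric)
  finally have "(\<integral>\<^sup>+x. (\<Sum>k. ennreal \<bar>h (Suc k) x - h k x\<bar>) \<partial>U01) \<noteq> \<infinity>"
    by (auto simp: top_unique)
  then have "AE x in U01. (\<Sum>k. ennreal \<bar>h (Suc k) x - h k x\<bar>) \<noteq> \<infinity>"
    by (intro nn_integral_PInf_AE) auto
  then have conv: "AE x in U01. (\<lambda>k. h k x) \<longlonglongrightarrow> lim (\<lambda>k. h k x)"
  proof eventually_elim
    case (elim x)
    then have "summable (\<lambda>k. \<bar>h (Suc k) x - h k x\<bar>)"
      by (intro summable_suminf_not_top) auto
    then have "summable (\<lambda>k. h (Suc k) x - h k x)" by (rule summable_rabs_cancel)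
    then have "convergent (\<lambda>n. \<Sum>k<n. h (Suc k) x - h k x)" by (simp add: summable_iff_convergent)
    then have "convergent (\<lambda>n. h n x - h 0 x)"
      by (simp add: sum_lessThan_telescope[of "\<lambda>k. h k x"])
    then have "convergent (\<lambda>n. h n x - h 0 x + h 0 x)"
      by (intro convergent_add convergent_const)
    then show ?case by (simp add: convergent_LIMSEQ_iff)
  qed
  define H where "H x = lim (\<lambda>k. h k x)" for x
  have [measurable]: "H \<in> borel_measurable U01" unfolding H_def by measurable
  have close: "(\<integral>\<^sup>+x. ennreal ((g n x - H x)\<^sup>2) \<partial>U01) \<le> ennreal e"
    if e: "0 < e" and M: "\<And>m n. m \<ge> M \<Longrightarrow> n \<ge> M \<Longrightarrow> (LINT x|U01. (g m x - g n x)\<^sup>2) < e" and n: "n \<ge> M" for e M n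
  proof -
    have "(\<integral>\<^sup>+x. ennreal ((g n x - H x)\<^sup>2) \<partial>U01) = (\<integral>\<^sup>+x. liminf (\<lambda>k. ennreal ((g n x - h k x)\<^sup>2)) \<partial>U01)"
    proof (rule nn_integral_cong_AE)
      show "AE x in U01. ennreal ((g n x - H x)\<^sup>2) = liminf (\<lambda>k. ennreal ((g n x - h k x)\<^sup>2))"
        using conv
      proof eventually_elim
        case (elim x)
        then have "(\<lambda>k. ennreal ((g n x - h k x)\<^sup>2)) \<longlonglongrightarrow> ennreal ((g n x - H x)\<^sup>2)"
          unfolding H_def by (intro tendsto_ennrealI tendsto_intros)
        then show ?case by (intro lim_imp_Liminf[symmetric]) auto
      qed
    qed
    also have "\<dots> \<le> liminf (\<lambda>k. \<integral>\<^sup>+x. ennreal ((g n x - h k x)\<^sup>2) \<partial>U01)"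
      by (rule nn_integral_liminf) simp
    also have "\<dots> \<le> ennreal e"
    proof (rule Liminf_le)
      show "\<forall>\<^sub>F k in sequentially. (\<integral>\<^sup>+x. ennreal ((g n x - h k x)\<^sup>2) \<partial>U01) \<le> ennreal e"
        using eventually_ge_at_top[of M]
      proof eventually_elim
        case (elim k)
        then have "s k \<ge> M" using s(3)[of k] by simp
        then have "(LINT x|U01. (g n x - h k x)\<^sup>2) \<le> e" using M[OF n, of "s k"] by (simp add: h_def)
        moreover have "(\<integral>\<^sup>+x. ennreal ((g n x - h k x)\<^sup>2) \<partial>U01) = ennreal (LINT x|U01. (g n x - h k x)\<^sup>2)"
          unfolding h_def by (rule nn_integral_eq_integral[OF gi]) simp
        ultimately show ?case by (simp add: ennreal_leI)
      qed
    qed simp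
    finally show ?thesis .
  qed
  have close': "(\<lambda>x. g n x - H x) \<in> L2_01 \<and> (LINT x|U01. (g n x - H x)\<^sup>2) \<le> e"
    if e: "0 < e" and M: "\<And>m n. m \<ge> M \<Longrightarrow> n \<ge> M \<Longrightarrow> (LINT x|U01. (g m x - g n x)\<^sup>2) < e" and n: "n \<ge> M" for e M n
  proof -
    note c = close[OF e M n]
    have i: "integrable U01 (\<lambda>x. (g n x - H x)\<^sup>2)"
    proof (rule integrableI_bounded)
      show "(\<integral>\<^sup>+x. ennreal (norm ((g n x - H x)\<^sup>2)) \<partial>U01) < \<infinity>"
        using c by (simp add: le_less_trans)
    qed simp
    then have "ennreal (LINT x|U01. (g n x - H x)\<^sup>2) \<le> ennreal e"
      using c by (simp add: nn_integral_eq_integral)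
    then show ?thesis using i e by (simp add: L2_01_iff)
  qed
  have HL: "H \<in> L2_01"
  proof -
    obtain M where "\<forall>m\<ge>M. \<forall>n\<ge>M. (LINT x|U01. (g m x - g n x)\<^sup>2) < 1" using cauchy[of 1] by auto
    then have "(\<lambda>x. g M x - H x) \<in> L2_01" using close'[of 1 M M] by simp
    from L2_diff[OF g[of M] this] show ?thesis by simp
  qed
  moreover have "(\<lambda>n. LINT x|U01. (g n x - H x)\<^sup>2) \<longlonglongrightarrow> 0"
  proof (rule LIMSEQ_I)
    fix e :: real assume e: "0 < e"
    then obtain M where M: "\<forall>m\<ge>M. \<forall>n\<ge>M. (LINT x|U01. (g m x - g n x)\<^sup>2) < e / 2" using cauchy[of "e / 2"] by auto
    have "norm ((LINT x|U01. (g n x - H x)\<^sup>2) - 0) < e" if "n \<ge> M" for n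
    proof -
      have "(LINT x|U01. (g n x - H x)\<^sup>2) \<le> e / 2" using close'[of "e / 2" M n] M that e by simp
      moreover have "0 \<le> (LINT x|U01. (g n x - H x)\<^sup>2)" by (rule integral_nonneg_AE) simp
      ultimately show ?thesis using e by simp
    qed
    then show "\<exists>no. \<forall>n\<ge>no. norm ((LINT x|U01. (g n x - H x)\<^sup>2) - 0) < e" by blast
  qed
  ultimately show ?thesis by blast
qed

text \<open>The positive and negative parts of \<open>k\<close> are the densities of two measures
  that agree on all half-lines and are finite there. The measures are equal, hence so are the
  densities almost everywhere.\<close>

lemma AE_zero_if_interval_integrals_zero:
  assumes k: "k \<in> L2_01"
    and z: "\<And>s t. 0 \<le> s \<Longrightarrow> s < t \<Longrightarrow> t \<le> 1 \<Longrightarrow> (LINT x|U01. indicator {s<..<t} x * k x) = 0"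
  shows "AE x in U01. k x = 0"
proof -
  define k' where "k' x = indicator {0<..<1} x * k x" for x
  have k': "integrable lborel k'"
    using L2_integrable[OF k] unfolding set_integrable_U01[symmetric] by (simp add: set_integrable_def k'_def[abs_def])
  then have [measurable]: "k' \<in> borel_measurable borel" by auto
  define M where "M \<epsilon> = density lborel (\<lambda>x. ennreal (max 0 (\<epsilon> * k' x)))" for \<epsilon> :: real
  have i: "integrable lborel (\<lambda>x. max 0 (\<epsilon> * k' x) * indicator {a<..} x)" for \<epsilon> a :: real
    using k' by (intro integrable_real_mult_indicator) auto
  have em: "emeasure (M \<epsilon>) {a<..} = ennreal (LINT x|lborel. max 0 (\<epsilon> * k' x) * indicator {a<..} x)" for \<epsilon> a
  proof -
    have "emeasure (M \<epsilon>) {a<..} = (\<integral>\<^sup>+x. ennreal (max 0 (\<epsilon> * k' x)) * indicator {a<..} x \<partial>lborel)"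
      unfolding M_def by (rule emeasure_density) auto
    also have "\<dots> = (\<integral>\<^sup>+x. ennreal (max 0 (\<epsilon> * k' x) * indicator {a<..} x) \<partial>lborel)"
      by (intro nn_integral_cong) (auto split: split_indicator)
    also have "\<dots> = ennreal (LINT x|lborel. max 0 (\<epsilon> * k' x) * indicator {a<..} x)"
      by (intro nn_integral_eq_integral i AE_I2) (auto split: split_indicator)
    finally show ?thesis .
  qed
  have eq: "(LINT x|lborel. max 0 (1 * k' x) * indicator {a<..} x) = (LINT x|lborel. max 0 ((-1) * k' x) * indicator {a<..} x)" for a
  proof -
    have "(LINT x|lborel. max 0 (1 * k' x) * indicator {a<..} x) - (LINT x|lborel. max 0 ((-1) * k' x) * indicator {a<..} x)
      = (LINT x|lborel. max 0 (1 * k' x) * indicator {a<..} x - max 0 ((-1) * k' x) * indicator {a<..} x)"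
      using i[of 1 a] i[of "-1" a] by (simp add: Bochner_Integration.integral_diff)
    also have "\<dots> = (LINT x|lborel. indicator {0<..<1} x *\<^sub>R (indicator {max a 0<..<1} x * k x))"
      by (rule Bochner_Integration.integral_cong) (auto simp: k'_def split: split_indicator)
    also have "\<dots> = (LINT x|U01. indicator {max a 0<..<1} x * k x)"
      by (rule integral_restrict_space[symmetric]) auto
    also have "\<dots> = 0"
    proof (cases "a < 1")
      case True
      then show ?thesis by (intro z) auto
    next
      case False
      then have "(LINT x|U01. indicator {max a 0<..<1} x * k x) = (LINT x|U01. 0)"
        by (intro Bochner_Integration.integral_cong) (auto split: split_indicator)
      then show ?thesis by simp
    qed
    finally show ?thesis by simp
  qed
  have "M 1 = M (-1)"
  proof (rule measure_eqI_lessThan)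
    show "sets (M 1) = sets borel" "sets (M (-1)) = sets borel" by (simp_all add: M_def)
    show "emeasure (M 1) {x<..} < \<infinity>" for x by (simp add: em)
    show "emeasure (M 1) {x<..} = emeasure (M (-1)) {x<..}" for x unfolding em eq ..
  qed
  then have "AE x in lborel. ennreal (max 0 (1 * k' x)) = ennreal (max 0 ((-1) * k' x))"
    unfolding M_def by (intro sigma_finite_measure.density_unique[OF sigma_finite_lborel]) auto
  then have "AE x in lborel. k' x = 0"
  proof eventually_elim
    case (elim x)
    then have "max 0 (k' x) = max 0 (- k' x)" by simp
    then show ?case by linarith
  qed
  then show ?thesis by (subst AE_restrict_space_iff) (auto simp: k'_def)
qed

subsection \<open>The dyadic energy of a function on the unit interval\<close>

lemma U01_halves:
  fixes h :: "real \<Rightarrow> real"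
  assumes h: "integrable U01 h"
  shows "integrable U01 (\<lambda>x. h (x / 2))" "integrable U01 (\<lambda>x. h ((x + 1) / 2))"
    "(LINT x|U01. h x) = ((LINT x|U01. h (x / 2)) + (LINT x|U01. h ((x + 1) / 2))) / 2"
proof -
  define k where "k S x = indicator S x * h x" for S and x :: real
  have ki: "integrable lborel (k {0<..<1})"
    using h unfolding set_integrable_U01[symmetric] by (simp add: set_integrable_def k_def[abs_def])
  have sub: "integrable lborel (k S)" if "S \<subseteq> {0<..<1}" "S \<in> sets borel" for S
  proof -
    have "integrable lborel (\<lambda>x. indicator S x *\<^sub>R k {0<..<1} x)"
      using ki that by (intro integrable_mult_indicator) auto
    moreover have "indicator S x *\<^sub>R k {0<..<1} x = k S x" for x
      using that by (auto simp: k_def split: split_indicator)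
    ultimately show ?thesis by simp
  qed
  have l: "k {0<..<1/2} (0 + 1/2 * x) = indicator {0<..<1} x *\<^sub>R h (x / 2)"
    and r: "k {1/2<..<1} (1/2 + 1/2 * x) = indicator {0<..<1} x *\<^sub>R h ((x + 1) / 2)" for x
    by (auto simp: k_def add_divide_distrib add.commute split: split_indicator)
  have li: "integrable lborel (k {0<..<1/2})" and ri: "integrable lborel (k {1/2<..<1})" by (auto intro!: sub)
  have "integrable lborel (\<lambda>x. indicator {0<..<1} x *\<^sub>R h (x / 2))"
    using lborel_integrable_real_affine[OF li, of "1/2" 0] unfolding l by simp
  then show "integrable U01 (\<lambda>x. h (x / 2))" by (subst integrable_restrict_space) auto
  have "integrable lborel (\<lambda>x. indicator {0<..<1} x *\<^sub>R h ((x + 1) / 2))"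
    using lborel_integrable_real_affine[OF ri, of "1/2" "1/2"] unfolding r by simp
  then show "integrable U01 (\<lambda>x. h ((x + 1) / 2))" by (subst integrable_restrict_space) auto
  have "(LINT x|U01. h x) = (LINT x|lborel. k {0<..<1} x)"
    by (simp add: integral_restrict_space k_def)
  also have "\<dots> = (LINT x|lborel. k {0<..<1/2} x + k {1/2<..<1} x)"
  proof (rule integral_cong_AE)
    show "AE x in lborel. k {0<..<1} x = k {0<..<1/2} x + k {1/2<..<1} x"
      using AE_lborel_singleton[of "1/2 :: real"]
      by eventually_elim (auto simp: k_def split: split_indicator)
  qed (use ki li ri in auto)
  also have "\<dots> = (LINT x|lborel. k {0<..<1/2} x) + (LINT x|lborel. k {1/2<..<1} x)"
    by (rule Bochner_Integration.integral_add[OF li ri])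
  also have "(LINT x|lborel. k {0<..<1/2} x) = (LINT x|U01. h (x / 2)) / 2"
    using lborel_integral_real_affine[of "1/2" "k {0<..<1/2}" 0] unfolding l
    by (simp add: integral_restrict_space)
  also have "(LINT x|lborel. k {1/2<..<1} x) = (LINT x|U01. h ((x + 1) / 2)) / 2"
    using lborel_integral_real_affine[of "1/2" "k {1/2<..<1}" "1/2"] unfolding r
    by (simp add: integral_restrict_space)
  finally show "(LINT x|U01. h x) = ((LINT x|U01. h (x / 2)) + (LINT x|U01. h ((x + 1) / 2))) / 2" by simp
qed

lemma L2_halves:
  assumes "f \<in> L2_01"
  shows "(\<lambda>x. f (x / 2)) \<in> L2_01" "(\<lambda>x. f ((x + 1) / 2)) \<in> L2_01"
  using assms U01_halves(1,2)[of "\<lambda>x. (f x)\<^sup>2"] U01_halves(1,2)[OF L2_integrable[OF assms]]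
  by (auto simp: L2_01_iff)

text \<open>This is \<open>2 ^ n\<close> times the sum of the products of increments over the dyadic
  intervals of length \<open>1 / 2 ^ n\<close>: the Dirichlet energy of the piecewise linear
  interpolations. It uses point values only, and the recursion by halves suits inductions.\<close>

fun dyadic_form :: "nat \<Rightarrow> (real \<Rightarrow> real) \<Rightarrow> (real \<Rightarrow> real) \<Rightarrow> real" where
  "dyadic_form 0 f g = (f 1 - f 0) * (g 1 - g 0)"
| "dyadic_form (Suc n) f g = 2 * (dyadic_form n (\<lambda>t. f (t / 2)) (\<lambda>t. g (t / 2))
    + dyadic_form n (\<lambda>t. f ((t + 1) / 2)) (\<lambda>t. g ((t + 1) / 2)))"

text \<open>The derivative of the piecewise linear interpolation, a step function.\<close>

fun dyadic_slope :: "nat \<Rightarrow> (real \<Rightarrow> real) \<Rightarrow> real \<Rightarrow> real" where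
  "dyadic_slope 0 f x = f 1 - f 0"
| "dyadic_slope (Suc n) f x = (if x < 1 / 2 then 2 * dyadic_slope n (\<lambda>t. f (t / 2)) (2 * x)
    else 2 * dyadic_slope n (\<lambda>t. f ((t + 1) / 2)) (2 * x - 1))"

declare dyadic_slope.simps(2) [simp del]

lemma dyadic_slope_half:
  "x < 1 \<Longrightarrow> dyadic_slope (Suc n) f (x / 2) = 2 * dyadic_slope n (\<lambda>t. f (t / 2)) x"
  "0 < x \<Longrightarrow> dyadic_slope (Suc n) f ((x + 1) / 2) = 2 * dyadic_slope n (\<lambda>t. f ((t + 1) / 2)) x"
proof -
  assume "0 < x"
  then have "\<not> (x + 1) / 2 < 1 / 2" "2 * ((x + 1) / 2) - 1 = x" by (auto simp: field_simps)
  then show "dyadic_slope (Suc n) f ((x + 1) / 2) = 2 * dyadic_slope n (\<lambda>t. f ((t + 1) / 2)) x"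
    by (simp only: dyadic_slope.simps(2) if_False)
qed (simp add: dyadic_slope.simps(2))

lemma dyadic_form_mono: "dyadic_form n f f \<le> dyadic_form (Suc n) f f"
proof (induction n arbitrary: f)
  case 0
  have "0 \<le> ((f (1/2) - f 0) - (f 1 - f (1/2)))\<^sup>2" by simp
  then show ?case by (simp add: power2_eq_square algebra_simps)
next
  case (Suc n)
  show ?case
    unfolding dyadic_form.simps(2)[of n f f] dyadic_form.simps(2)[of "Suc n" f f]
    by (intro mult_left_mono add_mono Suc) simp
qed

lemma dyadic_form_nonneg: "0 \<le> dyadic_form n f f"
  by (induction n arbitrary: f) auto

lemma dyadic_slope_measurable: "dyadic_slope n f \<in> borel_measurable borel"
proof (induction n arbitrary: f)
  case (Suc n)
  note [measurable] = Suc
  show ?case unfolding dyadic_slope.simps(2)[abs_def] by measurable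
qed (simp add: dyadic_slope.simps(1)[abs_def])

lemma dyadic_slope_bounded: "\<exists>B. \<forall>x. \<bar>dyadic_slope n f x\<bar> \<le> B"
proof (induction n arbitrary: f)
  case 0
  show ?case by auto
next
  case (Suc n)
  obtain B1 B2 where B: "\<forall>x. \<bar>dyadic_slope n (\<lambda>t. f (t / 2)) x\<bar> \<le> B1"
    "\<forall>x. \<bar>dyadic_slope n (\<lambda>t. f ((t + 1) / 2)) x\<bar> \<le> B2"
    using Suc[of "\<lambda>t. f (t / 2)"] Suc[of "\<lambda>t. f ((t + 1) / 2)"] by (elim exE) (rule that)
  have "\<bar>dyadic_slope (Suc n) f x\<bar> \<le> 2 * max B1 B2" for x
    using B[rule_format] by (auto simp: dyadic_slope.simps(2) abs_mult le_max_iff_disj)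
  then show ?case by blast
qed

lemma dyadic_slope_L2: "dyadic_slope n f \<in> L2_01"
proof -
  obtain B where "\<forall>x. \<bar>dyadic_slope n f x\<bar> \<le> B" using dyadic_slope_bounded by blast
  moreover have "dyadic_slope n f \<in> borel_measurable U01"
    using dyadic_slope_measurable[of n f] by (intro measurable_restrict_space1) simp
  ultimately show ?thesis by (intro L2_bounded[where B = B]) auto
qed

lemma U01_cong:
  fixes f g :: "real \<Rightarrow> real"
  assumes "\<And>x. 0 < x \<Longrightarrow> x < 1 \<Longrightarrow> f x = g x" shows "(LINT x|U01. f x) = (LINT x|U01. g x)"
  using assms by (intro Bochner_Integration.integral_cong) (auto simp: space_restrict_space)

lemma integral_dyadic_slope: "(LINT x|U01. dyadic_slope n f x) = f 1 - f 0"
proof (induction n arbitrary: f)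
  case (Suc n)
  have "(LINT x|U01. dyadic_slope (Suc n) f x) = ((LINT x|U01. 2 * dyadic_slope n (\<lambda>t. f (t / 2)) x)
      + (LINT x|U01. 2 * dyadic_slope n (\<lambda>t. f ((t + 1) / 2)) x)) / 2"
    unfolding U01_halves(3)[OF L2_integrable[OF dyadic_slope_L2]]
    by (intro arg_cong2[where f = "\<lambda>a b. (a + b) / 2"] U01_cong) (auto simp: dyadic_slope_half)
  then show ?case by (simp add: Suc)
qed (simp add: dyadic_slope.simps(1)[abs_def])

lemma integral_dyadic_slope_square: "(LINT x|U01. (dyadic_slope n f x)\<^sup>2) = dyadic_form n f f"
proof (induction n arbitrary: f)
  case (Suc n)
  have i: "integrable U01 (\<lambda>x. (dyadic_slope (Suc n) f x)\<^sup>2)" using dyadic_slope_L2 by (simp add: L2_01_iff)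
  have "(LINT x|U01. (dyadic_slope (Suc n) f x)\<^sup>2)
      = ((LINT x|U01. 4 * (dyadic_slope n (\<lambda>t. f (t / 2)) x)\<^sup>2)
      + (LINT x|U01. 4 * (dyadic_slope n (\<lambda>t. f ((t + 1) / 2)) x)\<^sup>2)) / 2"
    unfolding U01_halves(3)[OF i]
    by (intro arg_cong2[where f = "\<lambda>a b. (a + b) / 2"] U01_cong) (auto simp: dyadic_slope_half power_mult_distrib)
  then show ?case by (simp add: Suc)
qed (simp add: power2_eq_square)

text \<open>The slopes form a martingale for the dyadic partitions, so their increments are
  orthogonal to coarser slopes. The base case is the variance formula.\<close>

lemma integral_dyadic_slope_diff:
  "m \<le> n \<Longrightarrow> (LINT x|U01. (dyadic_slope n f x - dyadic_slope m f x)\<^sup>2) = dyadic_form n f f - dyadic_form m f f"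
proof (induction m arbitrary: n f)
  case 0
  have i: "integrable U01 (\<lambda>x. (dyadic_slope n f x)\<^sup>2)" "integrable U01 (dyadic_slope n f)"
    using dyadic_slope_L2[of n f] L2_integrable[of "dyadic_slope n f"] by (auto simp only: L2_01_iff)
  have "(LINT x|U01. (dyadic_slope n f x - (f 1 - f 0))\<^sup>2)
    = (LINT x|U01. (dyadic_slope n f x)\<^sup>2 - 2 * (f 1 - f 0) * dyadic_slope n f x + (f 1 - f 0)\<^sup>2)"
    by (intro U01_cong) (simp add: power2_eq_square algebra_simps)
  also have "\<dots> = dyadic_form n f f - 2 * (f 1 - f 0) * (f 1 - f 0) + (f 1 - f 0)\<^sup>2"
    using i by (simp add: integral_dyadic_slope_square integral_dyadic_slope space_restrict_space)
  finally show ?case by (simp add: power2_eq_square)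
next
  case (Suc m)
  then obtain k where n: "n = Suc k" "m \<le> k" by (cases n) auto
  have i: "integrable U01 (\<lambda>x. (dyadic_slope (Suc k) f x - dyadic_slope (Suc m) f x)\<^sup>2)"
    using L2_diff[OF dyadic_slope_L2 dyadic_slope_L2] by (simp add: L2_01_iff)
  have "(LINT x|U01. (dyadic_slope (Suc k) f x - dyadic_slope (Suc m) f x)\<^sup>2)
      = ((LINT x|U01. 4 * (dyadic_slope k (\<lambda>t. f (t / 2)) x - dyadic_slope m (\<lambda>t. f (t / 2)) x)\<^sup>2)
      + (LINT x|U01. 4 * (dyadic_slope k (\<lambda>t. f ((t + 1) / 2)) x - dyadic_slope m (\<lambda>t. f ((t + 1) / 2)) x)\<^sup>2)) / 2"
    unfolding U01_halves(3)[OF i]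
    by (intro arg_cong2[where f = "\<lambda>a b. (a + b) / 2"] U01_cong)
       (auto simp: dyadic_slope_half power2_eq_square algebra_simps)
  then show ?case using Suc.IH[OF n(2)] by (simp add: n algebra_simps)
qed

lemma integrable_indicator_mult:
  fixes h :: "real \<Rightarrow> real"
  assumes "integrable U01 h" shows "integrable U01 (\<lambda>x. indicator {s<..<t} x * h x)"
proof (rule Bochner_Integration.integrable_bound[OF assms])
  have "(indicator {s<..<t} :: real \<Rightarrow> real) \<in> borel_measurable lborel" by simp
  then have "(indicator {s<..<t} :: real \<Rightarrow> real) \<in> borel_measurable U01" by (rule measurable_restrict_space1)
  then show "(\<lambda>x. indicator {s<..<t} x * h x) \<in> borel_measurable U01"
    using borel_measurable_integrable[OF assms] by (rule borel_measurable_times)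
  show "AE x in U01. norm (indicator {s<..<t} x * h x) \<le> norm (h x)"
    by (intro AE_I2) (auto split: split_indicator)
qed

text \<open>Jensen's inequality on every dyadic interval. The hypothesis is the integral formula
  rather than \<open>is_weak_deriv\<close>, because it passes to both halves by a change of
  variables.\<close>

lemma dyadic_form_le_weak_deriv:
  assumes "h \<in> L2_01" "\<And>s t. 0 \<le> s \<Longrightarrow> s < t \<Longrightarrow> t \<le> 1 \<Longrightarrow> f t - f s = (LINT x|U01. indicator {s<..<t} x * h x)"
  shows "dyadic_form n f f \<le> (LINT x|U01. (h x)\<^sup>2)"
  using assms
proof (induction n arbitrary: f h)
  case 0
  have "f 1 - f 0 = (LINT x|U01. h x)" using 0(2)[of 0 1] by (simp add: U01_cong[of "\<lambda>x. indicator {0<..<1} x * h x" h])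
  then show ?case using L2_integral_square[OF 0(1)] by (simp add: power2_eq_square)
next
  case (Suc n)
  have int: "integrable U01 (\<lambda>x. indicator {s<..<t} x * h x)" for s t :: real
    by (rule integrable_indicator_mult[OF L2_integrable[OF Suc.prems(1)]])
  have l: "f (t / 2) - f (s / 2) = (LINT x|U01. indicator {s<..<t} x * (h (x / 2) / 2))"
    if st: "0 \<le> s" "s < t" "t \<le> 1" for s t
  proof -
    have "f (t / 2) - f (s / 2) = (LINT x|U01. indicator {s/2<..<t/2} x * h x)" using st by (intro Suc.prems) auto
    also have "\<dots> = ((LINT x|U01. indicator {s<..<t} x * h (x / 2)) + (LINT x|U01. 0)) / 2"
      unfolding U01_halves(3)[OF int] using st
      by (intro arg_cong2[where f = "\<lambda>a b. (a + b) / 2"] U01_cong) (auto split: split_indicator)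
    finally show ?thesis by simp
  qed
  have r: "f ((t + 1) / 2) - f ((s + 1) / 2) = (LINT x|U01. indicator {s<..<t} x * (h ((x + 1) / 2) / 2))"
    if st: "0 \<le> s" "s < t" "t \<le> 1" for s t
  proof -
    have "f ((t + 1) / 2) - f ((s + 1) / 2) = (LINT x|U01. indicator {(s+1)/2<..<(t+1)/2} x * h x)"
      using st by (intro Suc.prems) auto
    also have "\<dots> = ((LINT x|U01. 0) + (LINT x|U01. indicator {s<..<t} x * h ((x + 1) / 2))) / 2"
      unfolding U01_halves(3)[OF int] using st
      by (intro arg_cong2[where f = "\<lambda>a b. (a + b) / 2"] U01_cong) (auto split: split_indicator)
    finally show ?thesis by simp
  qed
  have hl: "(\<lambda>x. h (x / 2) / 2) \<in> L2_01" and hr: "(\<lambda>x. h ((x + 1) / 2) / 2) \<in> L2_01"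
    using L2_scale[OF L2_halves(1)[OF Suc.prems(1)], of "1/2"] L2_scale[OF L2_halves(2)[OF Suc.prems(1)], of "1/2"] by auto
  have i: "integrable U01 (\<lambda>x. (h x)\<^sup>2)" using Suc.prems by (simp add: L2_01_iff)
  have "dyadic_form (Suc n) f f \<le> 2 * ((LINT x|U01. (h (x / 2) / 2)\<^sup>2) + (LINT x|U01. (h ((x + 1) / 2) / 2)\<^sup>2))"
    unfolding dyadic_form.simps(2)
    by (intro mult_left_mono add_mono Suc.IH hl hr l r) auto
  also have "\<dots> = (LINT x|U01. (h x)\<^sup>2)"
    unfolding U01_halves(3)[OF i] by (simp add: power_divide)
  finally show ?case .
qed

text \<open>Rescaling a half interval to the unit interval halves the bound \<open>M\<close>, so the
  errors of the two halves add up to the same bound again, and the boundary terms at the midpoint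
  cancel. Only the oscillation of \<open>f\<close> at scale \<open>1 / 2 ^ n\<close>
  remains.\<close>

lemma dyadic_integration_by_parts:
  assumes "continuous_on {0..1} f" "\<And>x. (\<phi> has_real_derivative \<phi>' x) (at x)" "continuous_on {0..1} \<phi>'"
    and "\<And>x. 0 \<le> x \<Longrightarrow> x \<le> 1 \<Longrightarrow> \<bar>\<phi>' x\<bar> \<le> M"
    and "\<And>x y. 0 \<le> x \<Longrightarrow> x \<le> 1 \<Longrightarrow> 0 \<le> y \<Longrightarrow> y \<le> 1 \<Longrightarrow> \<bar>x - y\<bar> \<le> 1 / 2 ^ n \<Longrightarrow> \<bar>f x - f y\<bar> \<le> \<omega>"
  shows "\<bar>(LINT x|U01. f x * \<phi>' x) + (LINT x|U01. dyadic_slope n f x * \<phi> x) - (f 1 * \<phi> 1 - f 0 * \<phi> 0)\<bar> \<le> 2 * \<omega> * M"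
  using assms
proof (induction n arbitrary: f \<phi> \<phi>' M)
  case 0
  have \<phi>c: "continuous_on S \<phi>" for S using 0(2) DERIV_isCont continuous_at_imp_continuous_on by blast
  have i: "integrable U01 (\<lambda>x. f x * \<phi>' x)" "integrable U01 \<phi>'" "integrable U01 \<phi>"
    "integrable U01 (\<lambda>x. \<bar>(f x - f 0) * \<phi>' x\<bar>)" "integrable U01 (\<lambda>x. \<bar>\<phi> x - \<phi> 1\<bar>)"
    by (intro integrable_U01_continuous continuous_intros 0(1,3) \<phi>c)+
  have M: "0 \<le> M" using 0(4)[of 0] by simp
  have \<omega>: "0 \<le> \<omega>" using 0(5)[of 0 0] by simp
  have "(LINT x|U01. f x * \<phi>' x) + (LINT x|U01. (f 1 - f 0) * \<phi> x) - (f 1 * \<phi> 1 - f 0 * \<phi> 0)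
    = ((LINT x|U01. f x * \<phi>' x) - f 0 * (\<phi> 1 - \<phi> 0)) + (f 1 - f 0) * ((LINT x|U01. \<phi> x) - \<phi> 1)"
    using i by (simp add: algebra_simps)
  also have "(LINT x|U01. f x * \<phi>' x) - f 0 * (\<phi> 1 - \<phi> 0) = (LINT x|U01. (f x - f 0) * \<phi>' x)"
    using i integral_U01_FTC[OF 0(2,3)] by (simp add: left_diff_distrib)
  also have "(LINT x|U01. \<phi> x) - \<phi> 1 = (LINT x|U01. \<phi> x - \<phi> 1)"
    using i by (simp add: space_restrict_space)
  finally have eq: "(LINT x|U01. f x * \<phi>' x) + (LINT x|U01. (f 1 - f 0) * \<phi> x) - (f 1 * \<phi> 1 - f 0 * \<phi> 0)
    = (LINT x|U01. (f x - f 0) * \<phi>' x) + (f 1 - f 0) * (LINT x|U01. \<phi> x - \<phi> 1)" .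
  have 1: "\<bar>LINT x|U01. (f x - f 0) * \<phi>' x\<bar> \<le> \<omega> * M"
  proof -
    have "\<bar>LINT x|U01. (f x - f 0) * \<phi>' x\<bar> \<le> (LINT x|U01. \<bar>(f x - f 0) * \<phi>' x\<bar>)" by (rule integral_abs_bound)
    also have "\<dots> \<le> (LINT x|U01. \<omega> * M)"
    proof (rule integral_mono)
      fix x assume "x \<in> space U01"
      then have "0 \<le> x" "x \<le> 1" by (auto simp: space_restrict_space)
      then show "\<bar>(f x - f 0) * \<phi>' x\<bar> \<le> \<omega> * M"
        unfolding abs_mult using 0(4)[of x] 0(5)[of x 0] \<omega> by (intro mult_mono) auto
    qed (use i in auto)
    finally show ?thesis by (simp add: space_restrict_space)
  qed
  have 2: "\<bar>LINT x|U01. \<phi> x - \<phi> 1\<bar> \<le> M"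
  proof -
    have "\<bar>LINT x|U01. \<phi> x - \<phi> 1\<bar> \<le> (LINT x|U01. \<bar>\<phi> x - \<phi> 1\<bar>)" by (rule integral_abs_bound)
    also have "\<dots> \<le> (LINT x|U01. M)"
    proof (rule integral_mono)
      fix x assume "x \<in> space U01"
      then have x: "0 < x" "x < 1" by (auto simp: space_restrict_space)
      obtain z where z: "x < z" "z < 1" "\<phi> 1 - \<phi> x = (1 - x) * \<phi>' z"
        using MVT2[of x 1 \<phi> \<phi>'] x 0(2) by auto
      have "\<bar>\<phi> x - \<phi> 1\<bar> = (1 - x) * \<bar>\<phi>' z\<bar>" using z(3) x by (simp add: abs_minus_commute[of "\<phi> x"] abs_mult)
      also have "\<dots> \<le> 1 * M" using x z 0(4)[of z] by (intro mult_mono) auto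
      finally show "\<bar>\<phi> x - \<phi> 1\<bar> \<le> M" by simp
    qed (use i in auto)
    finally show ?thesis by (simp add: space_restrict_space)
  qed
  have "\<bar>(f 1 - f 0) * (LINT x|U01. \<phi> x - \<phi> 1)\<bar> \<le> \<omega> * M"
    unfolding abs_mult using 0(5)[of 1 0] 2 \<omega> by (intro mult_mono) auto
  then show ?case unfolding dyadic_slope.simps(1) eq using 1 by linarith
next
  case (Suc n)
  have \<phi>c: "continuous_on S \<phi>" for S using Suc.prems(2) DERIV_isCont continuous_at_imp_continuous_on by blast
  let ?l = "\<lambda>x::real. x / 2" and ?r = "\<lambda>x::real. (x + 1) / 2"
  have D: "((\<lambda>x. \<phi> ((x + c) / 2)) has_real_derivative \<phi>' ((x + c) / 2) / 2) (at x)" for c x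
  proof -
    have "((\<lambda>x. (x + c) / 2) has_real_derivative 1 / 2) (at x)" by (auto intro!: derivative_eq_intros)
    from DERIV_chain2[where f = \<phi>, OF Suc.prems(2) this] show ?thesis by simp
  qed
  have fc: "continuous_on {0..1} (\<lambda>x. f ((x + c) / 2))" "continuous_on {0..1} (\<lambda>x. \<phi>' ((x + c) / 2) / 2)"
    if "0 \<le> c" "c \<le> 1" for c
    using that by (auto intro!: continuous_intros continuous_on_compose2[OF Suc.prems(1)] continuous_on_compose2[OF Suc.prems(3)])
  have b: "\<bar>\<phi>' ((x + c) / 2) / 2\<bar> \<le> M / 2" if "0 \<le> c" "c \<le> 1" "0 \<le> x" "x \<le> 1" for c x
    using Suc.prems(4)[of "(x + c) / 2"] that by simp
  have osc: "\<bar>f ((x + c) / 2) - f ((y + c) / 2)\<bar> \<le> \<omega>"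
    if "0 \<le> c" "c \<le> 1" "0 \<le> x" "x \<le> 1" "0 \<le> y" "y \<le> 1" "\<bar>x - y\<bar> \<le> 1 / 2 ^ n" for c x y
  proof (rule Suc.prems(5))
    have e: "(x + c) / 2 - (y + c) / 2 = (x - y) / 2" by (simp add: field_simps)
    show "\<bar>(x + c) / 2 - (y + c) / 2\<bar> \<le> 1 / 2 ^ Suc n"
      unfolding e using that(7) by (simp add: abs_divide)
  qed (use that in auto)
  note IH = Suc.IH[where \<phi> = "\<lambda>x. \<phi> ((x + c) / 2)" and \<phi>' = "\<lambda>x. \<phi>' ((x + c) / 2) / 2"
      and f = "\<lambda>x. f ((x + c) / 2)" and M = "M / 2" for c, OF fc(1) D fc(2) b osc]
  have i1: "integrable U01 (\<lambda>x. f x * \<phi>' x)"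
    by (intro integrable_U01_continuous continuous_intros Suc.prems)
  have i2: "integrable U01 (\<lambda>x. dyadic_slope (Suc n) f x * \<phi> x)"
    by (intro L2_mult_integrable dyadic_slope_L2 L2_continuous \<phi>c)
  have e1: "(LINT x|U01. f x * \<phi>' x) = (LINT x|U01. f (x / 2) * (\<phi>' (x / 2) / 2))
      + (LINT x|U01. f ((x + 1) / 2) * (\<phi>' ((x + 1) / 2) / 2))"
    unfolding U01_halves(3)[OF i1] by simp
  have e2: "(LINT x|U01. dyadic_slope (Suc n) f x * \<phi> x)
      = ((LINT x|U01. 2 * (dyadic_slope n (\<lambda>t. f (t / 2)) x * \<phi> (x / 2)))
      + (LINT x|U01. 2 * (dyadic_slope n (\<lambda>t. f ((t + 1) / 2)) x * \<phi> ((x + 1) / 2)))) / 2"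
    unfolding U01_halves(3)[OF i2]
    by (intro arg_cong2[where f = "\<lambda>a b. (a + b) / 2"] U01_cong) (auto simp: dyadic_slope_half)
  have w: "2 * \<omega> * M = \<omega> * M + \<omega> * M" by simp
  have ar: "\<bar>p / 2 + q / 2 + (2 * d + 2 * e) / 2 - (y - z)\<bar> \<le> v + v"
    if "\<bar>p / 2 + d - (m - z)\<bar> \<le> v" "\<bar>q / 2 + e - (y - m)\<bar> \<le> v" for p q d e m z y v :: real
  proof -
    have eq: "p / 2 + q / 2 + (2 * d + 2 * e) / 2 - (y - z) = (p / 2 + d - (m - z)) + (q / 2 + e - (y - m))"
      by (simp add: add_divide_distrib)
    show ?thesis unfolding eq by (rule order_trans[OF abs_triangle_ineq add_mono[OF that]])
  qed
  note I0 = IH[of 0, simplified] and I1 = IH[of 1, simplified]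
  show ?case using ar[OF I0 I1] unfolding e1 e2 w by simp
qed

lemma test_function_C1:
  assumes "test_function \<phi>"
  shows "(\<phi> has_real_derivative deriv \<phi> x) (at x)" "continuous_on S (deriv \<phi>)" "\<phi> 0 = 0" "\<phi> 1 = 0"
proof -
  have d: "(deriv ^^ n) \<phi> differentiable_on UNIV" for n using assms by (simp add: test_function_def)
  show "(\<phi> has_real_derivative deriv \<phi> x) (at x)"
    using d[of 0] by (simp add: differentiable_on_def real_differentiable_def DERIV_deriv_iff_real_differentiable)
  show "continuous_on S (deriv \<phi>)"
    using d[of 1] by (auto intro: continuous_on_subset differentiable_imp_continuous_on)
  show "\<phi> 0 = 0" "\<phi> 1 = 0" using assms by (auto simp: test_function_def)
qed

text \<open>Bounded dyadic energy makes the slopes Cauchy in L2 by orthogonality, and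
  \<open>dyadic_integration_by_parts\<close> shows that their limit is a weak derivative. This is
  the bridge from point values to the edge integrals in \<open>DI\<close>.\<close>

lemma H1_dyadic:
  assumes f: "continuous_on {0..1} f" and B: "\<And>n. dyadic_form n f f \<le> B"
  shows "f \<in> H1_01" "(\<lambda>n. dyadic_form n f f) \<longlonglongrightarrow> (LINT x:{0<..<1}|lborel. (weak_deriv f x)\<^sup>2)"
proof -
  have inc: "incseq (\<lambda>n. dyadic_form n f f)" using dyadic_form_mono by (rule incseq_SucI)
  then have "\<exists>J. (\<lambda>n. dyadic_form n f f) \<longlonglongrightarrow> J" using incseq_convergent[OF _ ] B by blast
  then have ca: "Cauchy (\<lambda>n. dyadic_form n f f)" by (auto intro: LIMSEQ_imp_Cauchy)
  have c: "\<exists>N. \<forall>m\<ge>N. \<forall>n\<ge>N. (LINT x|U01. (dyadic_slope m f x - dyadic_slope n f x)\<^sup>2) < e" if "0 < e" for e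
  proof -
    obtain N where N: "\<forall>m\<ge>N. \<forall>n\<ge>N. \<bar>dyadic_form m f f - dyadic_form n f f\<bar> < e"
      using ca \<open>0 < e\<close> unfolding Cauchy_def dist_real_def by blast
    have sym: "(LINT x|U01. (dyadic_slope m f x - dyadic_slope n f x)\<^sup>2) = \<bar>dyadic_form m f f - dyadic_form n f f\<bar>" for m n
    proof (cases "n \<le> m")
      case True
      then show ?thesis using integral_dyadic_slope_diff[of n m f] incseqD[OF inc, of n m] by simp
    next
      case False
      then show ?thesis using integral_dyadic_slope_diff[of m n f] incseqD[OF inc, of m n]
        by (simp add: power2_commute[of "dyadic_slope m f _"])
    qed
    show ?thesis unfolding sym using N by blast
  qed
  obtain g where g: "g \<in> L2_01" and lim: "(\<lambda>n. LINT x|U01. (dyadic_slope n f x - g x)\<^sup>2) \<longlonglongrightarrow> 0"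
    using L2_complete[of "\<lambda>n. dyadic_slope n f", OF dyadic_slope_L2 c] by blast
  have gw: "is_weak_deriv f g"
    unfolding is_weak_deriv_def set_integral_U01
  proof (intro allI impI)
    fix \<phi> assume t: "test_function \<phi>"
    note C1 = test_function_C1[OF t]
    have \<phi>c: "continuous_on S \<phi>" for S using C1(1) DERIV_isCont continuous_at_imp_continuous_on by blast
    have "bounded (deriv \<phi> ` {0..1})" "bounded (\<phi> ` {0..1})"
      using C1(2) \<phi>c by (auto intro!: compact_imp_bounded compact_continuous_image)
    then obtain M M' where M: "\<And>x. 0 \<le> x \<Longrightarrow> x \<le> 1 \<Longrightarrow> \<bar>deriv \<phi> x\<bar> \<le> M"
      and M': "\<And>x. 0 \<le> x \<Longrightarrow> x \<le> 1 \<Longrightarrow> \<bar>\<phi> x\<bar> \<le> M'" unfolding bounded_iff by force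
    have M0: "0 \<le> M" using M[of 0] by simp
    have "(\<lambda>n. LINT x|U01. dyadic_slope n f x * \<phi> x) \<longlonglongrightarrow> (LINT x|U01. g x * \<phi> x)"
    proof (rule LIM_zero_cancel, rule Lim_null_comparison)
      have "(\<lambda>n. sqrt (M'\<^sup>2 * (LINT x|U01. (dyadic_slope n f x - g x)\<^sup>2))) \<longlonglongrightarrow> sqrt (M'\<^sup>2 * 0)"
        by (intro tendsto_real_sqrt tendsto_mult tendsto_const lim)
      then show "(\<lambda>n. sqrt (M'\<^sup>2 * (LINT x|U01. (dyadic_slope n f x - g x)\<^sup>2))) \<longlonglongrightarrow> 0" by simp
      have "norm ((LINT x|U01. dyadic_slope n f x * \<phi> x) - (LINT x|U01. g x * \<phi> x))
          \<le> sqrt (M'\<^sup>2 * (LINT x|U01. (dyadic_slope n f x - g x)\<^sup>2))" for n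
      proof -
        have d: "(\<lambda>x. dyadic_slope n f x - g x) \<in> L2_01" by (intro L2_diff dyadic_slope_L2 g)
        have m: "(\<lambda>x. (dyadic_slope n f x - g x) * \<phi> x) \<in> L2_01"
          unfolding L2_01_iff
        proof
          show [measurable]: "(\<lambda>x. (dyadic_slope n f x - g x) * \<phi> x) \<in> borel_measurable U01"
            using d measurable_U01_continuous[OF \<phi>c] by (auto simp: L2_01_iff)
          show "integrable U01 (\<lambda>x. ((dyadic_slope n f x - g x) * \<phi> x)\<^sup>2)"
          proof (rule Bochner_Integration.integrable_bound)
            show "integrable U01 (\<lambda>x. M'\<^sup>2 * (dyadic_slope n f x - g x)\<^sup>2)" using d by (simp add: L2_01_iff)
            show "AE x in U01. norm (((dyadic_slope n f x - g x) * \<phi> x)\<^sup>2) \<le> norm (M'\<^sup>2 * (dyadic_slope n f x - g x)\<^sup>2)"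
            proof (rule AE_I2)
              fix x assume "x \<in> space U01"
              then have "(\<phi> x)\<^sup>2 \<le> M'\<^sup>2" using power_mono[OF M'[of x], of 2] by (simp add: space_restrict_space)
              then show "norm (((dyadic_slope n f x - g x) * \<phi> x)\<^sup>2) \<le> norm (M'\<^sup>2 * (dyadic_slope n f x - g x)\<^sup>2)"
                by (simp add: power_mult_distrib mult.commute mult_right_mono)
            qed
          qed measurable
        qed
        have "((LINT x|U01. dyadic_slope n f x * \<phi> x) - (LINT x|U01. g x * \<phi> x))\<^sup>2
          = (LINT x|U01. (dyadic_slope n f x - g x) * \<phi> x)\<^sup>2"
          using L2_mult_integrable[OF dyadic_slope_L2 L2_continuous[OF \<phi>c]] L2_mult_integrable[OF g L2_continuous[OF \<phi>c]]
          by (simp add: left_diff_distrib)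
        also have "\<dots> \<le> (LINT x|U01. ((dyadic_slope n f x - g x) * \<phi> x)\<^sup>2)" by (rule L2_integral_square[OF m])
        also have "\<dots> \<le> (LINT x|U01. M'\<^sup>2 * (dyadic_slope n f x - g x)\<^sup>2)"
        proof (rule integral_mono)
          fix x assume "x \<in> space U01"
          then have "(\<phi> x)\<^sup>2 \<le> M'\<^sup>2" using power_mono[OF M'[of x], of 2] by (simp add: space_restrict_space)
          then show "((dyadic_slope n f x - g x) * \<phi> x)\<^sup>2 \<le> M'\<^sup>2 * (dyadic_slope n f x - g x)\<^sup>2"
            by (simp add: power_mult_distrib mult.commute mult_right_mono)
        qed (use m d in \<open>auto simp: L2_01_iff\<close>)
        finally show ?thesis by (intro real_le_rsqrt) simp
      qed
      then show "\<forall>\<^sub>F n in sequentially. norm ((LINT x|U01. dyadic_slope n f x * \<phi> x) - (LINT x|U01. g x * \<phi> x))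
          \<le> sqrt (M'\<^sup>2 * (LINT x|U01. (dyadic_slope n f x - g x)\<^sup>2))" by (intro always_eventually allI)
    qed
    then have l1: "(\<lambda>n. \<bar>(LINT x|U01. f x * deriv \<phi> x) + (LINT x|U01. dyadic_slope n f x * \<phi> x)\<bar>)
        \<longlonglongrightarrow> \<bar>(LINT x|U01. f x * deriv \<phi> x) + (LINT x|U01. g x * \<phi> x)\<bar>"
      by (intro tendsto_intros)
    have "\<bar>(LINT x|U01. f x * deriv \<phi> x) + (LINT x|U01. g x * \<phi> x)\<bar> \<le> \<epsilon>" if \<epsilon>: "0 < \<epsilon>" for \<epsilon>
    proof -
      \<comment> \<open>Brings the error \<open>2 * \<omega> * M\<close> below \<epsilon>;
        \<open>M + 1\<close> guards against \<open>M = 0\<close>.\<close>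
      define \<omega> where "\<omega> = \<epsilon> / (2 * (M + 1))"
      have \<omega>: "0 < \<omega>" using \<epsilon> M0 by (simp add: \<omega>_def)
      have "uniformly_continuous_on {0..1} f" using f by (rule compact_uniformly_continuous) simp
      then obtain d where d: "0 < d" "\<forall>x\<in>{0..1}. \<forall>x'\<in>{0..1}. dist x' x < d \<longrightarrow> dist (f x') (f x) < \<omega>"
        using \<omega> unfolding uniformly_continuous_on_def by blast
      obtain N where N: "(1 / 2) ^ N < d" using real_arch_pow_inv[OF d(1), of "1/2"] by auto
      have "\<bar>(LINT x|U01. f x * deriv \<phi> x) + (LINT x|U01. dyadic_slope n f x * \<phi> x)\<bar> \<le> \<epsilon>" if n: "n \<ge> N" for n
      proof -
        have "\<bar>(LINT x|U01. f x * deriv \<phi> x) + (LINT x|U01. dyadic_slope n f x * \<phi> x) - (f 1 * \<phi> 1 - f 0 * \<phi> 0)\<bar>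
          \<le> 2 * \<omega> * M"
        proof (rule dyadic_integration_by_parts[OF f C1(1) C1(2) M])
          fix x y :: real assume xy: "0 \<le> x" "x \<le> 1" "0 \<le> y" "y \<le> 1" "\<bar>x - y\<bar> \<le> 1 / 2 ^ n"
          have "(1 / 2 :: real) ^ n \<le> (1 / 2) ^ N" using n by (intro power_decreasing) auto
          then have "\<bar>x - y\<bar> < d" using xy(5) N by (simp add: power_divide)
          then show "\<bar>f x - f y\<bar> \<le> \<omega>" using d(2) xy by (auto simp: dist_real_def intro: less_imp_le)
        qed
        also have "\<dots> \<le> 2 * \<omega> * (M + 1)" using \<omega> by simp
        also have "\<dots> = \<epsilon>"
        proof -
          have "M + 1 \<noteq> 0" using M0 by simp
          then show ?thesis unfolding \<omega>_def by (simp add: divide_simps)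
        qed
        finally show ?thesis using C1(3,4) by simp
      qed
      then show ?thesis by (intro LIMSEQ_le_const2[OF l1]) blast
    qed
    then have "\<bar>(LINT x|U01. f x * deriv \<phi> x) + (LINT x|U01. g x * \<phi> x)\<bar> \<le> 0"
      by (rule field_le_epsilon) simp
    then show "(LINT x|U01. f x * deriv \<phi> x) = - (LINT x|U01. g x * \<phi> x)" by simp
  qed
  show "f \<in> H1_01" using g gw L2_continuous[OF f] by (auto simp: H1_01_def)
  have ex: "weak_deriv f \<in> L2_01 \<and> is_weak_deriv f (weak_deriv f)"
  proof -
    have "\<exists>g. g \<in> L2_01 \<and> is_weak_deriv f g" using g gw by blast
    from someI_ex[OF this] show ?thesis unfolding weak_deriv_def .
  qed
  \<comment> \<open>\<open>weak_deriv f\<close> is an arbitrary choice. It agrees with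
    \<open>g\<close> almost everywhere because both integrate to the same increments of
    \<open>f\<close>.\<close>
  have "AE x in U01. weak_deriv f x - g x = 0"
  proof (rule AE_zero_if_interval_integrals_zero)
    show "(\<lambda>x. weak_deriv f x - g x) \<in> L2_01" using ex g by (intro L2_diff) auto
    fix s t :: real assume st: "0 \<le> s" "s < t" "t \<le> 1"
    have i: "integrable U01 (\<lambda>x. indicator {s<..<t} x * h x)" if "h \<in> L2_01" for h :: "real \<Rightarrow> real"
      by (rule integrable_indicator_mult[OF L2_integrable[OF that]])
    show "(LINT x|U01. indicator {s<..<t} x * (weak_deriv f x - g x)) = 0"
      using weak_deriv_FTC[OF f _ _ st, of g] weak_deriv_FTC[OF f _ _ st, of "weak_deriv f"] ex g gw i[of g] i[of "weak_deriv f"]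
      by (simp add: right_diff_distrib)
  qed
  then have "(LINT x|U01. (weak_deriv f x)\<^sup>2) = (LINT x|U01. (g x)\<^sup>2)"
    using ex g by (intro integral_cong_AE) (auto simp: L2_01_iff)
  moreover have "(\<lambda>n. dyadic_form n f f) \<longlonglongrightarrow> (LINT x|U01. (g x)\<^sup>2)"
  proof -
    from \<open>\<exists>J. (\<lambda>n. dyadic_form n f f) \<longlonglongrightarrow> J\<close> obtain J where J: "(\<lambda>n. dyadic_form n f f) \<longlonglongrightarrow> J" ..
    have "(LINT x|U01. g x * g x) = J"
    proof (rule L2.square_limit[OF dyadic_slope_L2 g])
      show "(\<lambda>n. LINT x|U01. (dyadic_slope n f - g) x * (dyadic_slope n f - g) x) \<longlonglongrightarrow> 0"
        using lim by (simp add: power2_eq_square)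
      show "(\<lambda>n. LINT x|U01. dyadic_slope n f x * dyadic_slope n f x) \<longlonglongrightarrow> J"
        using J by (simp add: integral_dyadic_slope_square power2_eq_square[symmetric])
    qed
    then show ?thesis using J by (simp add: power2_eq_square)
  qed
  ultimately show "(\<lambda>n. dyadic_form n f f) \<longlonglongrightarrow> (LINT x:{0<..<1}|lborel. (weak_deriv f x)\<^sup>2)"
    by (simp add: set_integral_U01)
qed

lemma H1_imp_dyadic_bounded:
  assumes f: "continuous_on {0..1} f" and H: "f \<in> H1_01"
  shows "\<exists>B. \<forall>n. dyadic_form n f f \<le> B"
proof -
  obtain h where h: "h \<in> L2_01" "is_weak_deriv f h" using H by (auto simp: H1_01_def)
  have "dyadic_form n f f \<le> (LINT x|U01. (h x)\<^sup>2)" for n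
    by (rule dyadic_form_le_weak_deriv[OF h(1) weak_deriv_FTC[OF f h]])
  then show ?thesis by blast
qed

subsection \<open>Geometry of the gasket\<close>

lemma three_cases: "(j::3) = i \<or> j = i + 1 \<or> j = i + 2"
  using exhaust_3[of i] exhaust_3[of j] by auto

lemma three_distinct [simp]: "(i::3) + 1 \<noteq> i" "i + 2 \<noteq> i" "i + 1 \<noteq> i + 2" "i \<noteq> i + 1" "i \<noteq> i + 2" "i + 2 \<noteq> i + 1"
  using exhaust_3[of i] by auto

lemma sum_three: "(\<Sum>j\<in>UNIV. f j) = f (i::3) + f (i + 1) + (f (i + 2) :: 'a::comm_monoid_add)"
proof -
  have "UNIV = {i, i + 1, i + 2}" using three_cases by blast
  then have "(\<Sum>j\<in>UNIV. f j) = (\<Sum>j\<in>{i, i + 1, i + 2}. f j)" by simp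
  then show ?thesis by (simp add: add.assoc)
qed

locale gasket =
  fixes \<alpha> :: real and p :: "3 \<Rightarrow> real^2"
  assumes \<alpha>: "0 < \<alpha>" "\<alpha> < 1" and eq: "equilateral p"
begin

abbreviation "G \<equiv> Gmap \<alpha> p"
abbreviation "sg \<equiv> seg \<alpha> p"
abbreviation "K \<equiv> SSG \<alpha> p"
definition "\<theta> = (1 - \<alpha>) / 2"

lemma \<theta>: "0 < \<theta>" "\<theta> < 1 / 2" using \<alpha> by (auto simp: \<theta>_def)

lemma G_def: "G i x = \<theta> *\<^sub>R (x - p i) + p i"
  by (simp add: Gmap_def \<theta>_def)

lemma G_fix: "G i (p i) = p i" by (simp add: G_def)

lemma dist_G: "dist (G i x) (G i y) = \<theta> * dist x y"
proof -
  have "G i x - G i y = \<theta> *\<^sub>R (x - y)" by (simp add: G_def algebra_simps)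
  then show ?thesis using \<theta> by (simp add: dist_norm)
qed

lemma G_inj: "G i x = G i y \<longleftrightarrow> x = y"
  using dist_G[of i x y] \<theta> by auto

lemma continuous_G: "continuous_on S (G i)"
  unfolding G_def[abs_def] by (intro continuous_intros)

lemma continuous_sg: "continuous_on S (sg i)"
  unfolding seg_def[abs_def] by (intro continuous_intros)

lemma sg_0: "sg i 0 = G (i + 2) (p (i + 1))" and sg_1: "sg i 1 = G (i + 1) (p (i + 2))"
  by (simp_all add: seg_def)

text \<open>A barycentric coordinate. For side length 1 the inner product drops by
  \<open>3 / 2\<close> from \<open>p i\<close> to either other vertex, hence the factor
  \<open>2 / 3\<close>.\<close>

definition bary :: "3 \<Rightarrow> real^2 \<Rightarrow> real" where
  "bary i x = 1 + (2 / 3) * ((x - p i) \<bullet> ((p i - p (i + 1)) + (p i - p (i + 2))))"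

lemma continuous_bary: "continuous_on S (bary i)"
  unfolding bary_def[abs_def] by (intro continuous_intros)

lemma bary_p: "bary i (p j) = (if i = j then 1 else 0)"
proof -
  define d e where "d = p i - p (i + 1)" and "e = p i - p (i + 2)"
  have n: "norm (p a - p b) = 1" if "a \<noteq> b" for a b using eq that by (simp add: equilateral_def dist_norm)
  have dd: "d \<bullet> d = 1" "e \<bullet> e = 1" using n[of i "i + 1"] n[of i "i + 2"]
    by (auto simp: d_def e_def dot_square_norm)
  have "(e - d) \<bullet> (e - d) = 1" using n[of "i + 1" "i + 2"] by (simp add: d_def e_def dot_square_norm)
  then have de: "d \<bullet> e = 1 / 2" using dd by (simp add: inner_diff_left inner_diff_right inner_commute)
  have b: "bary i x = 1 + (2 / 3) * ((x - p i) \<bullet> (d + e))" for x by (simp add: bary_def d_def e_def)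
  have m: "p (i + 1) - p i = - d" "p (i + 2) - p i = - e" by (simp_all add: d_def e_def)
  consider "j = i" | "j = i + 1" | "j = i + 2" using three_cases by blast
  then show ?thesis
    by cases (simp_all add: b m dd de inner_add_right inner_commute)
qed

lemma bary_affine: "bary i (s *\<^sub>R x + (1 - s) *\<^sub>R y) = s * bary i x + (1 - s) * bary i y"
proof -
  have e: "s *\<^sub>R x + (1 - s) *\<^sub>R y - p i = s *\<^sub>R (x - p i) + (1 - s) *\<^sub>R (y - p i)" by (simp add: algebra_simps)
  show ?thesis unfolding bary_def e inner_add_left inner_scaleR_left by (simp only: algebra_simps)
qed

lemma bary_G: "bary i (G j x) = \<theta> * bary i x + (1 - \<theta>) * (if i = j then 1 else 0)"
proof -
  have "G j x = \<theta> *\<^sub>R x + (1 - \<theta>) *\<^sub>R p j" by (simp add: G_def algebra_simps)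
  then show ?thesis by (simp only: bary_affine bary_p)
qed

lemma bary_sg:
  "bary i (sg i t) = 0"
  "bary (i + 1) (sg i t) = t * (1 - \<theta>) + (1 - t) * \<theta>"
  "bary (i + 2) (sg i t) = t * \<theta> + (1 - t) * (1 - \<theta>)"
  by (simp_all add: seg_def bary_affine bary_G bary_p)

section \<open>The gasket as the closure of its open edges\<close>

definition orbit :: "(real^2) set" where
  "orbit = (\<Union>w i. edge_word \<alpha> p w i)"

lemma edge_word_Cons: "edge_word \<alpha> p (j # w) i = G j ` edge_word \<alpha> p w i"
  by (simp add: edge_word_def image_comp)

lemma orbit_edge: "0 < t \<Longrightarrow> t < 1 \<Longrightarrow> sg i t \<in> orbit"
  unfolding orbit_def edge_word_def edge_def by (intro UN_I[of "[]"] UN_I[of i]) auto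

lemma orbit_G: "x \<in> orbit \<Longrightarrow> G i x \<in> orbit"
proof -
  assume "x \<in> orbit"
  then obtain w j where "x \<in> edge_word \<alpha> p w j" by (auto simp: orbit_def)
  then have "G i x \<in> edge_word \<alpha> p (i # w) j" unfolding edge_word_Cons by (rule imageI)
  then show ?thesis unfolding orbit_def by blast
qed

lemma \<xi>_Nil: "\<xi> \<alpha> p [] i t = sg i t" and \<xi>_Cons: "\<xi> \<alpha> p (j # w) i t = G j (\<xi> \<alpha> p w i t)"
  by (simp_all add: \<xi>_def)

lemma orbit_\<xi>: "0 < t \<Longrightarrow> t < 1 \<Longrightarrow> \<xi> \<alpha> p w i t \<in> orbit"
  by (induction w) (auto simp: \<xi>_Nil \<xi>_Cons orbit_edge orbit_G)

text \<open>Facts about the gasket are checked on edges, propagated to cells and then extended to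
  the closure by continuity, in place of inductions over words.\<close>

lemma orbit_induct [consumes 1, case_names edge cell]:
  assumes x: "x \<in> orbit" and e: "\<And>i t. 0 < t \<Longrightarrow> t < 1 \<Longrightarrow> P (sg i t)"
    and c: "\<And>i x. x \<in> orbit \<Longrightarrow> P x \<Longrightarrow> P (G i x)"
  shows "P x"
proof -
  have *: "P (\<xi> \<alpha> p w i t)" if "0 < t" "t < 1" for w i t
    by (induction w) (auto simp: \<xi>_Nil \<xi>_Cons e c orbit_\<xi> that)
  obtain w i where "x \<in> edge_word \<alpha> p w i" using x by (auto simp: orbit_def)
  then obtain t where "0 < t" "t < 1" "x = \<xi> \<alpha> p w i t" by (auto simp: edge_word_def edge_def \<xi>_def)
  then show ?thesis using * by simp
qed

text \<open>The radius is stable under the cell maps: a contraction by at most \<open>1 / 2\<close>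
  and a displacement of at most \<open>3 / 2\<close> give \<open>2 + 3 / 2 \<le> 4\<close>.\<close>

lemma orbit_bounded: "orbit \<subseteq> cball (p 1) 4"
proof
  have n: "norm (p a - p b) \<le> 1" for a b
    using eq by (cases "a = b") (simp_all add: equilateral_def dist_norm)
  have c: "G i x \<in> cball (p 1) 4" if "x \<in> cball (p 1) 4" for i x
  proof -
    have "G i x - p 1 = \<theta> *\<^sub>R (x - p 1) + (\<theta> *\<^sub>R (p 1 - p i) + (p i - p 1))" by (simp add: G_def algebra_simps)
    then have "norm (G i x - p 1) \<le> norm (\<theta> *\<^sub>R (x - p 1)) + (norm (\<theta> *\<^sub>R (p 1 - p i)) + norm (p i - p 1))"
      by (simp only:) (intro norm_triangle_le add_left_mono norm_triangle_ineq)
    then have "norm (G i x - p 1) \<le> \<theta> * norm (x - p 1) + (\<theta> * norm (p 1 - p i) + norm (p i - p 1))"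
      using \<theta> by simp
    also have "\<dots> \<le> (1 / 2) * 4 + ((1 / 2) * 1 + 1)"
      using \<theta> that n by (intro add_mono mult_mono) (auto simp: dist_norm norm_minus_commute)
    finally show ?thesis by (simp add: dist_norm norm_minus_commute)
  qed
  have pc: "p i \<in> cball (p 1) 4" for i using n[of 1 i] by (simp add: dist_norm)
  fix x assume "x \<in> orbit"
  then show "x \<in> cball (p 1) 4"
  proof (induction rule: orbit_induct)
    case (edge i t)
    then show ?case unfolding seg_def by (intro convexD[OF convex_cball] c pc) auto
  qed (rule c)
qed

lemma orbit_nonempty: "sg 1 (1/2) \<in> orbit"
  by (rule orbit_edge) auto

text \<open>The vertices lie on no open edge. They are approached by iterating \<open>G k\<close>,
  which contracts any orbit point to its fixed point \<open>p k\<close>.\<close>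

lemma p_closure: "p k \<in> closure orbit"
proof -
  have a: "\<exists>x\<in>orbit. dist x (p k) \<le> \<theta> ^ n * 8" for n
  proof (induction n)
    case 0
    have 1: "dist (sg 1 (1/2)) (p 1) \<le> 4"
      using subsetD[OF orbit_bounded orbit_nonempty] by (simp add: dist_commute)
    have 2: "dist (p 1) (p k) \<le> 1" using eq by (cases "k = 1") (auto simp: equilateral_def)
    have "dist (sg 1 (1/2)) (p k) \<le> dist (sg 1 (1/2)) (p 1) + dist (p 1) (p k)" by (rule dist_triangle)
    also have "\<dots> \<le> 4 + 1" using 1 2 by (rule add_mono)
    finally show ?case using orbit_nonempty by (intro bexI[of _ "sg 1 (1/2)"]) auto
  next
    case (Suc n)
    then obtain x where x: "x \<in> orbit" "dist x (p k) \<le> \<theta> ^ n * 8" by blast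
    have "dist (G k x) (p k) = \<theta> * dist x (p k)" using dist_G[of k x "p k"] by (simp add: G_fix)
    then show ?case using x \<theta> by (intro bexI[of _ "G k x"] orbit_G) (auto simp: mult.assoc)
  qed
  show ?thesis unfolding closure_approachable
  proof (intro allI impI)
    fix e :: real assume "0 < e"
    then obtain n where "\<theta> ^ n < e / 8" using real_arch_pow_inv[of "e / 8" \<theta>] \<theta> by auto
    then show "\<exists>y\<in>orbit. dist y (p k) < e" using a[of n] by force
  qed
qed

lemma closure_G: "x \<in> closure orbit \<Longrightarrow> G i x \<in> closure orbit"
proof -
  have "G i ` closure orbit \<subseteq> closure orbit"
    by (rule image_closure_subset[OF continuous_G closed_closure])
       (use orbit_G closure_subset in blast)
  then show "x \<in> closure orbit \<Longrightarrow> G i x \<in> closure orbit" by blast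
qed

lemma closure_sg: "0 \<le> t \<Longrightarrow> t \<le> 1 \<Longrightarrow> sg i t \<in> closure orbit"
proof -
  assume t: "0 \<le> t" "t \<le> 1"
  consider "t = 0" | "t = 1" | "0 < t" "t < 1" using t by linarith
  then show "sg i t \<in> closure orbit"
    using orbit_edge closure_subset by cases (auto simp: sg_0 sg_1 closure_G p_closure)
qed

lemma closure_orbit_eq: "closure orbit = (\<Union>i. G i ` closure orbit) \<union> (\<Union>i. edge \<alpha> p i)"
proof
  let ?F = "(\<Union>i. G i ` closure orbit) \<union> (\<Union>i. edge \<alpha> p i)"
  have comp: "compact (closure orbit)"
    using orbit_bounded by (simp add: bounded_subset[OF bounded_cball])
  \<comment> \<open>The end points of an edge are vertices of cells, so closing the edges adds
    nothing, and the right-hand side is visibly closed.\<close>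
  have F: "?F = (\<Union>i. G i ` closure orbit) \<union> (\<Union>i. sg i ` {0..1})"
  proof (intro equalityI subsetI)
    fix x assume "x \<in> ?F"
    then show "x \<in> (\<Union>i. G i ` closure orbit) \<union> (\<Union>i. sg i ` {0..1})"
      by (auto simp: edge_def) (metis atLeastAtMost_iff greaterThanLessThan_iff imageI less_imp_le)
  next
    fix x assume "x \<in> (\<Union>i. G i ` closure orbit) \<union> (\<Union>i. sg i ` {0..1})"
    then consider i y where "y \<in> closure orbit" "x = G i y" | i t where "0 \<le> t" "t \<le> 1" "x = sg i t" by auto
    then show "x \<in> ?F"
    proof cases
      case 1
      then show ?thesis by blast
    next
      case 2
      consider "t = 0" | "t = 1" | "0 < t" "t < 1" using 2 by linarith
      then show ?thesis
      proof cases
        case 1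
        then show ?thesis using 2 p_closure by (auto simp: sg_0)
      next
        case a: 2
        then show ?thesis using 2 p_closure by (auto simp: sg_1)
      next
        case 3
        then have "x \<in> edge \<alpha> p i" unfolding edge_def 2(3) by (intro imageI) simp
        then show ?thesis by blast
      qed
    qed
  qed
  have "closed ?F"
    unfolding F by (intro closed_Un closed_UN finite ballI compact_imp_closed compact_continuous_image
        continuous_G continuous_sg comp compact_Icc)
  moreover have "orbit \<subseteq> ?F"
  proof
    fix x assume "x \<in> orbit"
    then show "x \<in> ?F"
    proof (induction rule: orbit_induct)
      case (edge i t)
      then have "sg i t \<in> edge \<alpha> p i" unfolding edge_def by (intro imageI) simp
      then show ?case by blast
    next
      case (cell i x)
      then show ?case using closure_subset[of orbit] by blast
    qed
  qed
  ultimately show "closure orbit \<subseteq> ?F" by (rule closure_minimal[rotated])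
  show "?F \<subseteq> closure orbit" using closure_G closure_sg by (auto simp: edge_def)
qed

text \<open>Justifies the definite description in \<open>SSG\<close>. Any solution contains the
  orbit and, by \<open>n\<close> uses of its equation, lies within \<open>\<theta> ^ n * D\<close>
  of it.\<close>

lemma K_closure: "K = closure orbit"
  unfolding SSG_def
proof (rule the_equality)
  show "closure orbit \<noteq> {} \<and> compact (closure orbit) \<and>
     closure orbit = (\<Union>i. G i ` closure orbit) \<union> (\<Union>i. edge \<alpha> p i)"
    using orbit_nonempty orbit_bounded closure_orbit_eq by (auto simp: bounded_subset[OF bounded_cball])
next
  fix X assume X: "X \<noteq> {} \<and> compact X \<and> X = (\<Union>i. G i ` X) \<union> (\<Union>i. edge \<alpha> p i)"
  then have comp: "compact X" and Xeq: "X = (\<Union>i. G i ` X) \<union> (\<Union>i. edge \<alpha> p i)" by blast+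
  have OX: "orbit \<subseteq> X"
  proof
    fix x assume "x \<in> orbit"
    then show "x \<in> X"
    proof (induction rule: orbit_induct)
      case (edge i t)
      then have "sg i t \<in> edge \<alpha> p i" unfolding edge_def by (intro imageI) simp
      then show ?case by (subst Xeq) blast
    next
      case (cell i x)
      then show ?case by (subst Xeq) blast
    qed
  qed
  then have 1: "closure orbit \<subseteq> X" using comp by (simp add: closure_minimal compact_imp_closed)
  obtain D where D: "\<And>x. x \<in> X \<Longrightarrow> dist (sg 1 (1/2)) x \<le> D"
    using compact_imp_bounded[OF comp] unfolding bounded_any_center[where a = "sg 1 (1/2)"] by blast
  have a: "\<exists>y\<in>orbit. dist y x \<le> \<theta> ^ n * D" if "x \<in> X" for n x
    using that
  proof (induction n arbitrary: x)
    case 0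
    then show ?case using D orbit_nonempty by auto
  next
    case (Suc n)
    then have "x \<in> (\<Union>i. G i ` X) \<union> (\<Union>i. edge \<alpha> p i)" using Xeq by blast
    then consider i y where "y \<in> X" "x = G i y" | i t where "0 < t" "t < 1" "x = sg i t" by (auto simp: edge_def)
    then show ?case
    proof cases
      case 1
      obtain z where z: "z \<in> orbit" "dist z y \<le> \<theta> ^ n * D" using Suc.IH[OF 1(1)] by blast
      then show ?thesis using 1(2) \<theta> by (intro bexI[of _ "G i z"] orbit_G) (auto simp: dist_G mult.assoc)
    next
      case 2
      have "0 \<le> D" using D[of "sg 1 (1/2)"] OX orbit_nonempty by auto
      then show ?thesis using 2 \<theta> by (intro bexI[of _ x]) (auto simp: orbit_edge)
    qed
  qed
  have "x \<in> closure orbit" if "x \<in> X" for x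
    unfolding closure_approachable
  proof (intro allI impI)
    fix e :: real assume e: "0 < e"
    have D0: "0 < \<bar>D\<bar> + 1" by simp
    obtain n where "\<theta> ^ n < e / (\<bar>D\<bar> + 1)" using real_arch_pow_inv[of "e / (\<bar>D\<bar> + 1)" \<theta>] \<theta> e by auto
    then have "\<theta> ^ n * (\<bar>D\<bar> + 1) < e" using D0 by (simp add: pos_less_divide_eq)
    moreover have "\<theta> ^ n * D \<le> \<theta> ^ n * (\<bar>D\<bar> + 1)" using \<theta> by (intro mult_left_mono) auto
    ultimately show "\<exists>y\<in>orbit. dist y x < e" using a[OF that, of n] by force
  qed
  then show "X = closure orbit" using 1 by blast
qed

lemma K_compact: "compact K"
  unfolding K_closure using orbit_bounded by (simp add: bounded_subset[OF bounded_cball])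

lemma orbit_K: "x \<in> orbit \<Longrightarrow> x \<in> K"
  unfolding K_closure using closure_subset by blast

lemma p_K: "p i \<in> K" by (simp add: K_closure p_closure)
lemma G_K: "x \<in> K \<Longrightarrow> G i x \<in> K" by (simp add: K_closure closure_G)
lemma sg_K: "0 \<le> t \<Longrightarrow> t \<le> 1 \<Longrightarrow> sg i t \<in> K" by (simp add: K_closure closure_sg)

lemma \<xi>_K: "0 \<le> t \<Longrightarrow> t \<le> 1 \<Longrightarrow> \<xi> \<alpha> p w i t \<in> K"
  by (induction w) (auto simp: \<xi>_Nil \<xi>_Cons sg_K G_K)

lemma continuous_\<xi>: "continuous_on S (\<xi> \<alpha> p w i)"
proof (induction w)
  case Nil
  then show ?case using continuous_sg by (simp add: \<xi>_Nil[abs_def] cong: continuous_on_cong)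
next
  case (Cons j w)
  have "continuous_on S (\<lambda>t. G j (\<xi> \<alpha> p w i t))"
    using continuous_on_compose2[OF continuous_G[of UNIV j] Cons] by simp
  then show ?case by (simp add: \<xi>_Cons cong: continuous_on_cong)
qed

lemma K_cases:
  assumes "x \<in> K"
  obtains (cell) i y where "y \<in> K" "x = G i y" | (edge) i t where "0 < t" "t < 1" "x = sg i t"
proof -
  have "x \<in> (\<Union>i. G i ` K) \<union> (\<Union>i. edge \<alpha> p i)"
    using assms closure_orbit_eq unfolding K_closure by blast
  then show thesis using cell edge by (auto simp: edge_def)
qed

lemma K_limit: "x \<in> K \<Longrightarrow> \<exists>s. (\<forall>n. s n \<in> orbit) \<and> s \<longlonglongrightarrow> x"
  unfolding K_closure closure_sequential by blast

lemma K_limit_le: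
  fixes u :: "real^2 \<Rightarrow> real"
  assumes u: "continuous_on K u" and x: "x \<in> K" and le: "\<And>y. y \<in> orbit \<Longrightarrow> u y \<le> c"
  shows "u x \<le> c"
proof -
  obtain s where s: "\<forall>n. s n \<in> orbit" "s \<longlonglongrightarrow> x" using K_limit[OF x] by blast
  have "(\<lambda>n. u (s n)) \<longlonglongrightarrow> u x"
    using u x s(1) orbit_K by (intro continuous_on_tendsto_compose[OF u s(2)]) auto
  then show ?thesis by (rule LIMSEQ_le_const2) (use le s in blast)
qed

lemma K_limit_eq:
  fixes u :: "real^2 \<Rightarrow> real"
  assumes "continuous_on K u" "continuous_on K v" "x \<in> K" "\<And>y. y \<in> orbit \<Longrightarrow> u y = v y"
  shows "u x = v x"
proof -
  have "u x - v x \<le> 0"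
    by (rule K_limit_le[where u = "\<lambda>x. u x - v x", OF continuous_on_diff[OF assms(1,2)] assms(3)]) (simp add: assms(4))
  moreover have "v x - u x \<le> 0"
    by (rule K_limit_le[where u = "\<lambda>x. v x - u x", OF continuous_on_diff[OF assms(2,1)] assms(3)]) (simp add: assms(4))
  ultimately show ?thesis by simp
qed

section \<open>Separation of cells and edges by barycentric coordinates\<close>

lemma bary_K: assumes "x \<in> K" shows "0 \<le> bary i x" "bary i x \<le> 1"
proof -
  have o: "0 \<le> bary i y \<and> bary i y \<le> 1" if "y \<in> orbit" for y
    using that
  proof (induction rule: orbit_induct)
    case (edge k t)
    have "t * (1 - \<theta>) + (1 - t) * \<theta> \<le> t * 1 + (1 - t) * 1"
      using edge \<theta> by (intro add_mono mult_left_mono) auto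
    moreover have "t * \<theta> + (1 - t) * (1 - \<theta>) \<le> t * 1 + (1 - t) * 1"
      using edge \<theta> by (intro add_mono mult_left_mono) auto
    moreover have "0 \<le> t * (1 - \<theta>) + (1 - t) * \<theta>" "0 \<le> t * \<theta> + (1 - t) * (1 - \<theta>)"
      using edge \<theta> by simp_all
    ultimately have b: "0 \<le> bary j (sg k t) \<and> bary j (sg k t) \<le> 1" if "j \<in> {k, k + 1, k + 2}" for j
      using that by (auto simp only: bary_sg insert_iff empty_iff) auto
    show ?case by (rule b) (use three_cases[of i k] in blast)
  next
    case (cell k x)
    then have l: "\<theta> * bary i x \<le> \<theta>" "0 \<le> \<theta> * bary i x" using \<theta> by auto
    have e: "bary i (G k x) = (if i = k then \<theta> * bary i x + (1 - \<theta>) else \<theta> * bary i x)" by (simp add: bary_G)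
    show ?case
    proof (cases "i = k")
      case True
      then show ?thesis unfolding e if_P[OF True] using l \<theta> by linarith
    next
      case False
      then show ?thesis unfolding e if_not_P[OF False] using l \<theta> by linarith
    qed
  qed
  show "bary i x \<le> 1" by (rule K_limit_le[OF continuous_bary assms]) (simp add: o)
  have "- bary i x \<le> 0" 
    by (rule K_limit_le[where u = "\<lambda>x. - bary i x", OF continuous_on_minus[OF continuous_bary] assms]) (simp add: o)
  then show "0 \<le> bary i x" by simp
qed

lemma bary_cell:
  assumes "y \<in> K" shows "1 - \<theta> \<le> bary i (G i y)" "j \<noteq> i \<Longrightarrow> bary j (G i y) \<le> \<theta>"
proof -
  show "1 - \<theta> \<le> bary i (G i y)" using bary_K(1)[OF assms, of i] \<theta> by (simp add: bary_G)
  have "\<theta> * bary j y \<le> \<theta>" using bary_K(2)[OF assms, of j] \<theta> by simp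
  then show "j \<noteq> i \<Longrightarrow> bary j (G i y) \<le> \<theta>" by (simp add: bary_G)
qed

text \<open>The stretching enters here: coordinate \<open>i\<close> is at least
  \<open>1 - \<theta>\<close> on cell \<open>i\<close> and at most \<theta> on the other cells, and
  \<open>\<theta> < 1 / 2\<close>.\<close>

lemma cells_disjoint:
  assumes "x \<in> K" "y \<in> K" "G i x = G j y" shows "i = j" "x = y"
proof -
  show "i = j"
  proof (rule ccontr)
    assume "i \<noteq> j"
    then show False using bary_cell(1)[OF assms(1), of i] bary_cell(2)[OF assms(2), of i j] assms(3) \<theta> by simp
  qed
  then show "x = y" using assms(3) by (simp add: G_inj)
qed

text \<open>On an open edge all three coordinates stay strictly below \<open>1 - \<theta>\<close>,
  the lower bound for coordinate \<open>j\<close> on cell \<open>j\<close>.\<close>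

lemma sg_not_cell:
  assumes "0 < t" "t < 1" "y \<in> K" shows "sg i t \<noteq> G j y"
proof
  assume e: "sg i t = G j y"
  have b: "1 - \<theta> \<le> bary j (sg i t)" unfolding e by (rule bary_cell(1)[OF assms(3)])
  have "t * \<theta> < t * (1 - \<theta>)" "(1 - t) * \<theta> < (1 - t) * (1 - \<theta>)" using assms \<theta> by auto
  then have lt: "t * \<theta> + (1 - t) * (1 - \<theta>) < 1 - \<theta>" "t * (1 - \<theta>) + (1 - t) * \<theta> < 1 - \<theta>"
    by (auto simp: algebra_simps)
  consider "j = i" | "j = i + 1" | "j = i + 2" using three_cases by blast
  then show False using b lt \<theta> by cases (auto simp: bary_sg)
qed

lemma p_eq_G: "y \<in> K \<Longrightarrow> G j y = p i \<longleftrightarrow> j = i \<and> y = p i"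
  using cells_disjoint[of y "p i" j i] p_K[of i] G_fix by auto

lemma \<xi>_not_V0: assumes "0 < t" "t < 1" shows "\<xi> \<alpha> p w i t \<notin> V0 p"
proof -
  have "\<xi> \<alpha> p w i t \<noteq> p k" for k
  proof (induction w)
    case Nil
    then show ?case using sg_not_cell[OF assms p_K[of k], of i k] by (simp add: \<xi>_Nil G_fix)
  next
    case (Cons j w)
    then show ?case using assms by (auto simp: \<xi>_Cons p_eq_G \<xi>_K)
  qed
  then show ?thesis by (auto simp: V0_def)
qed

lemma \<xi>_inj: "\<xi> \<alpha> p w i s = \<xi> \<alpha> p w i t \<longleftrightarrow> s = t"
proof (induction w)
  case Nil
  have "s = t" if "sg i s = sg i t"
  proof -
    have "s * (1 - \<theta>) + (1 - s) * \<theta> = t * (1 - \<theta>) + (1 - t) * \<theta>" using bary_sg(2)[of i s] bary_sg(2)[of i t] that by simp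
    then have "(s - t) * (1 - 2 * \<theta>) = 0" by (simp add: algebra_simps)
    then show ?thesis using \<theta> by simp
  qed
  then show ?case by (auto simp: \<xi>_Nil)
qed (simp add: \<xi>_Cons G_inj)

end

subsection \<open>The energy as an increasing limit of quadratic forms in point values\<close>

lemma dyadic_form_cong:
  "(\<And>t. 0 \<le> t \<Longrightarrow> t \<le> 1 \<Longrightarrow> f t = f' t) \<Longrightarrow> (\<And>t. 0 \<le> t \<Longrightarrow> t \<le> 1 \<Longrightarrow> g t = g' t) \<Longrightarrow>
    dyadic_form n f g = dyadic_form n f' g'"
proof (induction n arbitrary: f f' g g')
  case (Suc n)
  show ?case unfolding dyadic_form.simps(2)
    by (intro arg_cong2[where f = "\<lambda>a b. 2 * (a + b)"] Suc.IH Suc.prems) auto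
qed simp

lemma dyadic_form_linear:
  "dyadic_form n (\<lambda>t. a * f t + b * g t) h = a * dyadic_form n f h + b * dyadic_form n g h"
  by (induction n arbitrary: f g h) (simp_all add: algebra_simps)

lemma dyadic_form_sym: "dyadic_form n f g = dyadic_form n g f"
proof (induction n arbitrary: f g)
  case (Suc n)
  show ?case unfolding dyadic_form.simps(2) by (intro arg_cong2[where f = "\<lambda>a b. 2 * (a + b)"] Suc)
qed simp

lemma sum_words_Suc:
  fixes F :: "3 list \<Rightarrow> 'a::comm_monoid_add"
  shows "(\<Sum>w | length w = Suc m. F w) = (\<Sum>j\<in>UNIV. \<Sum>w | length w = m. F (j # w))"
proof -
  have fin: "finite {w :: 3 list. length w = m}" using finite_lists_length_eq[of "UNIV :: 3 set" m] by simp
  have "{w :: 3 list. length w = Suc m} = (\<lambda>(j, w). j # w) ` (UNIV \<times> {w. length w = m})"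
    by (auto simp: length_Suc_conv image_iff)
  moreover have "inj_on (\<lambda>(j :: 3, w). j # w) (UNIV \<times> {w. length w = m})" by (auto simp: inj_on_def)
  ultimately have "(\<Sum>w | length w = Suc m. F w) = (\<Sum>x\<in>UNIV \<times> {w. length w = m}. F ((\<lambda>(j, w). j # w) x))"
    by (simp only: sum.reindex o_def)
  also have "\<dots> = (\<Sum>j\<in>UNIV. \<Sum>w | length w = m. F (j # w))"
    using fin by (simp add: sum.cartesian_product split_def)
  finally show ?thesis .
qed

text \<open>In network terms: two resistances \<open>s\<close> and \<open>t\<close> in
  series.\<close>

lemma titu:
  fixes x y s t :: real
  assumes "0 < s" "0 < t" shows "(x + y)\<^sup>2 / (s + t) \<le> x\<^sup>2 / s + y\<^sup>2 / t"
proof -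
  have "x\<^sup>2 / s + y\<^sup>2 / t - (x + y)\<^sup>2 / (s + t) = (t * x - s * y)\<^sup>2 / (s * t * (s + t))"
    using assms by (simp add: divide_simps) (simp add: power2_eq_square algebra_simps)
  moreover have "0 \<le> (t * x - s * y)\<^sup>2 / (s * t * (s + t))" using assms by simp
  ultimately show ?thesis by linarith
qed

text \<open>The star has its centre at equilibrium, the mean of the three values;
  \<open>triangle_le_star\<close> allows any other centre.\<close>

lemma triangle_star:
  fixes a b c :: real
  shows "(a - b)\<^sup>2 + (b - c)\<^sup>2 + (c - a)\<^sup>2
    = 3 * ((a - (a + b + c) / 3)\<^sup>2 + (b - (a + b + c) / 3)\<^sup>2 + (c - (a + b + c) / 3)\<^sup>2)"
  by (simp add: power2_eq_square field_simps)

lemma triangle_le_star: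
  fixes a b c z :: real
  shows "(a - b)\<^sup>2 + (b - c)\<^sup>2 + (c - a)\<^sup>2 \<le> 3 * ((a - z)\<^sup>2 + (b - z)\<^sup>2 + (c - z)\<^sup>2)"
proof -
  have "0 \<le> (a + b + c - 3 * z)\<^sup>2" by simp
  then show ?thesis by (simp add: power2_eq_square algebra_simps)
qed

text \<open>The triangle-star transform turns the network of the first level into three stars, whose
  legs of resistance \<open>r / 3\<close> are in series with the edges of resistance \<open>\<rho>\<close>. The centres of the
  stars form a triangle with edges of resistance \<open>2 r / 3 + \<rho> = 1 - r\<close>.\<close>

lemma network_inequality:
  fixes a1 a2 a3 x12 x13 x21 x23 x31 x32 r \<rho> :: real
  assumes r: "0 < r" "0 < \<rho>" "\<rho> = 1 - 5 / 3 * r"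
  shows "(a1 - a2)\<^sup>2 + (a2 - a3)\<^sup>2 + (a3 - a1)\<^sup>2
    \<le> (1 / r) * (((a1 - x12)\<^sup>2 + (x12 - x13)\<^sup>2 + (x13 - a1)\<^sup>2) + ((a2 - x23)\<^sup>2 + (x23 - x21)\<^sup>2 + (x21 - a2)\<^sup>2)
        + ((a3 - x31)\<^sup>2 + (x31 - x32)\<^sup>2 + (x32 - a3)\<^sup>2))
      + (1 / \<rho>) * ((x23 - x32)\<^sup>2 + (x31 - x13)\<^sup>2 + (x12 - x21)\<^sup>2)"
proof -
  define z1 z2 z3 where "z1 = (a1 + x12 + x13) / 3" and "z2 = (a2 + x23 + x21) / 3" and "z3 = (a3 + x31 + x32) / 3"
  define z where "z = (z1 + z2 + z3) / 3"
  have r1: "0 < 1 - r" using r by simp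
  have path: "(u - v)\<^sup>2 / (1 - r) \<le> (3 / r) * (u - x)\<^sup>2 + (1 / \<rho>) * (x - y)\<^sup>2 + (3 / r) * (y - v)\<^sup>2" for u v x y
  proof -
    have "(u - v)\<^sup>2 / (r / 3 + (\<rho> + r / 3)) \<le> (u - x)\<^sup>2 / (r / 3) + (x - v)\<^sup>2 / (\<rho> + r / 3)"
      using titu[of "r / 3" "\<rho> + r / 3" "u - x" "x - v"] r(1,2) by simp
    moreover have "(x - v)\<^sup>2 / (\<rho> + r / 3) \<le> (x - y)\<^sup>2 / \<rho> + (y - v)\<^sup>2 / (r / 3)"
      using titu[of \<rho> "r / 3" "x - y" "y - v"] r(1,2) by simp
    moreover have "r / 3 + (\<rho> + r / 3) = 1 - r" using r(3) by simp
    ultimately show ?thesis by (simp add: mult.commute)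
  qed
  \<comment> \<open>The outer leg \<open>r / 3\<close> and the inner leg \<open>(1 - r) / 3\<close>
    add up to \<open>1 / 3\<close>, the leg of the star equivalent to a triangle of unit
    resistances; a common factor 3 is taken out.\<close>
  have leg: "(a - z)\<^sup>2 \<le> (1 / r) * (a - y)\<^sup>2 + (y - z)\<^sup>2 / (1 - r)" for a y
    using titu[of r "1 - r" "a - y" "y - z"] r(1) r1 by simp
  have "(a1 - a2)\<^sup>2 + (a2 - a3)\<^sup>2 + (a3 - a1)\<^sup>2 \<le> 3 * ((a1 - z)\<^sup>2 + (a2 - z)\<^sup>2 + (a3 - z)\<^sup>2)"
    by (rule triangle_le_star)
  also have "\<dots> \<le> 3 * (((1 / r) * (a1 - z1)\<^sup>2 + (z1 - z)\<^sup>2 / (1 - r)) + ((1 / r) * (a2 - z2)\<^sup>2 + (z2 - z)\<^sup>2 / (1 - r))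
      + ((1 / r) * (a3 - z3)\<^sup>2 + (z3 - z)\<^sup>2 / (1 - r)))"
    by (intro mult_left_mono add_mono leg) simp
  also have "\<dots> = (3 / r) * ((a1 - z1)\<^sup>2 + (a2 - z2)\<^sup>2 + (a3 - z3)\<^sup>2)
      + (3 * ((z1 - z)\<^sup>2 + (z2 - z)\<^sup>2 + (z3 - z)\<^sup>2)) / (1 - r)"
    by (simp add: algebra_simps add_divide_distrib)
  also have "3 * ((z1 - z)\<^sup>2 + (z2 - z)\<^sup>2 + (z3 - z)\<^sup>2) = (z1 - z2)\<^sup>2 + (z2 - z3)\<^sup>2 + (z3 - z1)\<^sup>2"
    unfolding z_def by (rule triangle_star[symmetric])
  also have "((z1 - z2)\<^sup>2 + (z2 - z3)\<^sup>2 + (z3 - z1)\<^sup>2) / (1 - r)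
      = (z1 - z2)\<^sup>2 / (1 - r) + (z2 - z3)\<^sup>2 / (1 - r) + (z3 - z1)\<^sup>2 / (1 - r)"
    by (simp add: add_divide_distrib)
  also have "(3 / r) * ((a1 - z1)\<^sup>2 + (a2 - z2)\<^sup>2 + (a3 - z3)\<^sup>2) + \<dots>
    \<le> (3 / r) * ((a1 - z1)\<^sup>2 + (a2 - z2)\<^sup>2 + (a3 - z3)\<^sup>2)
      + (((3 / r) * (z1 - x12)\<^sup>2 + (1 / \<rho>) * (x12 - x21)\<^sup>2 + (3 / r) * (x21 - z2)\<^sup>2)
      + ((3 / r) * (z2 - x23)\<^sup>2 + (1 / \<rho>) * (x23 - x32)\<^sup>2 + (3 / r) * (x32 - z3)\<^sup>2)
      + ((3 / r) * (z3 - x31)\<^sup>2 + (1 / \<rho>) * (x31 - x13)\<^sup>2 + (3 / r) * (x13 - z1)\<^sup>2))"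
    by (intro add_left_mono add_mono path)
  also have "\<dots> = (1 / r) * (3 * ((a1 - z1)\<^sup>2 + (x12 - z1)\<^sup>2 + (x13 - z1)\<^sup>2) + 3 * ((a2 - z2)\<^sup>2 + (x23 - z2)\<^sup>2 + (x21 - z2)\<^sup>2)
        + 3 * ((a3 - z3)\<^sup>2 + (x31 - z3)\<^sup>2 + (x32 - z3)\<^sup>2))
      + (1 / \<rho>) * ((x23 - x32)\<^sup>2 + (x31 - x13)\<^sup>2 + (x12 - x21)\<^sup>2)"
    by (simp add: power2_commute[of z1] power2_commute[of z2 x23] power2_commute[of z3 x31] distrib_left)
  finally show ?thesis unfolding z1_def z2_def z3_def triangle_star .
qed

locale gasket_form = gasket +
  fixes r :: real
  assumes r: "0 < r" "r < 3 / 5"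
begin

definition "\<rho> = 1 - 5 / 3 * r"

lemma \<rho>: "0 < \<rho>" using r by (simp add: \<rho>_def)

text \<open>Level \<open>m\<close> consists of the vertex differences in the cells of level
  \<open>m\<close> and, on the edges of level \<open>k < m\<close>, of the dyadic forms of level
  \<open>m - 1 - k\<close>. Each step refines both. Since only finitely many point values enter,
  linearity, symmetry and passage to pointwise limits are plain inductions.\<close>

primrec A :: "nat \<Rightarrow> (real^2 \<Rightarrow> real) \<Rightarrow> (real^2 \<Rightarrow> real) \<Rightarrow> real" where
  "A 0 u v = (\<Sum>i\<in>UNIV. (u (p i) - u (p (i + 1))) * (v (p i) - v (p (i + 1))))"
| "A (Suc m) u v = (1 / r) * (\<Sum>j\<in>UNIV. A m (\<lambda>x. u (G j x)) (\<lambda>x. v (G j x)))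
    + (1 / \<rho>) * (\<Sum>i\<in>UNIV. dyadic_form m (\<lambda>t. u (sg i t)) (\<lambda>t. v (sg i t)))"

lemma A_cong: "(\<And>x. x \<in> K \<Longrightarrow> u x = u' x) \<Longrightarrow> (\<And>x. x \<in> K \<Longrightarrow> v x = v' x) \<Longrightarrow> A m u v = A m u' v'"
proof (induction m arbitrary: u u' v v')
  case 0
  then show ?case by (simp add: p_K)
next
  case (Suc m)
  have "A m (\<lambda>x. u (G j x)) (\<lambda>x. v (G j x)) = A m (\<lambda>x. u' (G j x)) (\<lambda>x. v' (G j x))" for j
    by (intro Suc.IH Suc.prems G_K)
  moreover have "dyadic_form m (\<lambda>t. u (sg i t)) (\<lambda>t. v (sg i t)) = dyadic_form m (\<lambda>t. u' (sg i t)) (\<lambda>t. v' (sg i t))" for i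
    by (intro dyadic_form_cong Suc.prems sg_K)
  ultimately show ?case by simp
qed

lemma A_linear: "A m (\<lambda>x. a * u x + b * v x) w = a * A m u w + b * A m v w"
proof (induction m arbitrary: u v w)
  case 0
  show ?case by (simp add: sum_3 algebra_simps)
qed (simp add: dyadic_form_linear sum.distrib sum_distrib_left algebra_simps)

lemma A_sym: "A m u v = A m v u"
proof (induction m arbitrary: u v)
  case (Suc m)
  show ?case unfolding A.simps(2) using Suc dyadic_form_sym by (intro arg_cong2[where f = "\<lambda>a b. (1 / r) * a + (1 / \<rho>) * b"] sum.cong refl)
qed (simp add: mult.commute)

lemma A_nonneg: "0 \<le> A m u u"
proof (induction m arbitrary: u)
  case (Suc m)
  show ?case unfolding A.simps(2) using r \<rho>
    by (intro add_nonneg_nonneg mult_nonneg_nonneg sum_nonneg Suc dyadic_form_nonneg) auto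
qed (simp add: sum_nonneg)

text \<open>The base case is \<open>network_inequality\<close>, where the matching condition is
  used; the refinement of the edges is covered by \<open>dyadic_form_mono\<close>.\<close>

lemma A_mono: "A m u u \<le> A (Suc m) u u"
proof (induction m arbitrary: u)
  case 0
  have e: "(3::3) + 1 = 1" "(3::3) + 2 = 2" "(2::3) + 2 = 1" "(1::3) + 2 = 3" "(2::3) + 1 = 3" "(1::3) + 1 = 2" "(4::3) = 1" "(5::3) = 2" by simp_all
  have "A 0 u u = (u (p 1) - u (p 2))\<^sup>2 + (u (p 2) - u (p 3))\<^sup>2 + (u (p 3) - u (p 1))\<^sup>2"
    by (simp add: sum_3 e power2_eq_square)
  also have "\<dots> \<le> A (Suc 0) u u"
    using network_inequality[where ?a1.0 = "u (p 1)" and ?a2.0 = "u (p 2)" and ?a3.0 = "u (p 3)" and ?x12.0 = "u (G 1 (p 2))"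
      and ?x13.0 = "u (G 1 (p 3))" and ?x21.0 = "u (G 2 (p 1))" and ?x23.0 = "u (G 2 (p 3))"
      and ?x31.0 = "u (G 3 (p 1))" and ?x32.0 = "u (G 3 (p 2))", OF r(1) \<rho> \<rho>_def]
    by (simp add: sum_3 sg_0 sg_1 e G_fix power2_eq_square add_ac)
  finally show ?case .
next
  case (Suc m)
  show ?case unfolding A.simps(2)[of m u u] A.simps(2)[of "Suc m" u u] using r \<rho>
    by (intro add_mono mult_left_mono sum_mono Suc dyadic_form_mono) auto
qed

lemma A_add: "A m (\<lambda>x. a * u x + b * v x) (\<lambda>x. a * u x + b * v x)
    = a\<^sup>2 * A m u u + 2 * a * b * A m u v + b\<^sup>2 * A m v v"
proof -
  define w where "w = (\<lambda>x. a * u x + b * v x)"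
  have "A m w w = a * A m u w + b * A m v w" unfolding w_def by (rule A_linear)
  moreover have "A m u w = a * A m u u + b * A m v u" "A m v w = a * A m u v + b * A m v v"
    unfolding A_sym[of m u w] A_sym[of m v w] unfolding w_def A_linear by (simp_all add: A_sym)
  ultimately show ?thesis unfolding w_def by (simp add: A_sym[of m v u] power2_eq_square algebra_simps)
qed

lemma A_add_le: "A m (\<lambda>x. a * u x + b * v x) (\<lambda>x. a * u x + b * v x) \<le> 2 * a\<^sup>2 * A m u u + 2 * b\<^sup>2 * A m v v"
  using A_nonneg[of m "\<lambda>x. a * u x + (- b) * v x"] unfolding A_add by simp

definition D :: "(real^2 \<Rightarrow> real) set" where
  "D = {u. continuous_on K u \<and> (\<forall>x. x \<notin> K \<longrightarrow> u x = 0) \<and> (\<exists>B. \<forall>m. A m u u \<le> B)}"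

text \<open>By \<open>A_tendsto_E\<close> the limit exists when both arguments have bounded
  approximations. Taking the limit of bilinear forms yields a bilinear \<open>E\<close>
  directly.\<close>

definition E :: "(real^2 \<Rightarrow> real) \<Rightarrow> (real^2 \<Rightarrow> real) \<Rightarrow> real" where
  "E u v = lim (\<lambda>m. A m u v)"

lemma A_tendsto_E_same:
  assumes "\<And>m. A m u u \<le> B" shows "(\<lambda>m. A m u u) \<longlonglongrightarrow> E u u"
proof -
  have "incseq (\<lambda>m. A m u u)" using A_mono by (rule incseq_SucI)
  then obtain l where "(\<lambda>m. A m u u) \<longlonglongrightarrow> l" using assms incseq_convergent by blast
  then show ?thesis unfolding E_def by (simp add: limI)
qed

lemma A_le_E: "(\<And>m. A m u u \<le> B) \<Longrightarrow> A m u u \<le> E u u"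
  using incseq_le[OF incseq_SucI[of "\<lambda>m. A m u u"] A_tendsto_E_same] A_mono by blast

lemma A_tendsto_E:
  assumes u: "\<And>m. A m u u \<le> B" and v: "\<And>m. A m v v \<le> C"
  shows "(\<lambda>m. A m u v) \<longlonglongrightarrow> E u v"
proof -
  have b: "A m (\<lambda>x. 1 * u x + s * v x) (\<lambda>x. 1 * u x + s * v x) \<le> 2 * 1\<^sup>2 * B + 2 * s\<^sup>2 * C" for m s
    by (rule order_trans[OF A_add_le]) (intro add_mono mult_left_mono u v, auto)
  note b1 = b[of _ 1] and b2 = b[of _ "-1"]
  have eq: "A m u v = (A m (\<lambda>x. 1 * u x + 1 * v x) (\<lambda>x. 1 * u x + 1 * v x)
      - A m (\<lambda>x. 1 * u x + (-1) * v x) (\<lambda>x. 1 * u x + (-1) * v x)) / 4" for m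
    unfolding A_add by simp
  have "(\<lambda>m. A m u v) \<longlonglongrightarrow> (E (\<lambda>x. 1 * u x + 1 * v x) (\<lambda>x. 1 * u x + 1 * v x)
      - E (\<lambda>x. 1 * u x + (-1) * v x) (\<lambda>x. 1 * u x + (-1) * v x)) / 4"
    unfolding eq by (rule tendsto_divide[OF tendsto_diff[OF A_tendsto_E_same[OF b1] A_tendsto_E_same[OF b2]] tendsto_const]) simp
  then show ?thesis unfolding E_def[of u v] by (simp add: limI)
qed

lemma A_cell_bounded:
  assumes u: "\<And>m. A m u u \<le> B" shows "A m (\<lambda>x. u (G j x)) (\<lambda>x. u (G j x)) \<le> r * B"
proof -
  have "(1 / r) * A m (\<lambda>x. u (G j x)) (\<lambda>x. u (G j x)) \<le> (1 / r) * (\<Sum>j\<in>UNIV. A m (\<lambda>x. u (G j x)) (\<lambda>x. u (G j x)))"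
    using r A_nonneg by (intro mult_left_mono member_le_sum) auto
  also have "\<dots> \<le> A (Suc m) u u" using \<rho> by (simp add: sum_nonneg dyadic_form_nonneg)
  also have "\<dots> \<le> B" by (rule u)
  finally show ?thesis using r by (simp add: field_simps)
qed

lemma dyadic_bounded:
  assumes u: "\<And>m. A m u u \<le> B" shows "dyadic_form m (\<lambda>t. u (sg i t)) (\<lambda>t. u (sg i t)) \<le> \<rho> * B"
proof -
  have "(1 / \<rho>) * dyadic_form m (\<lambda>t. u (sg i t)) (\<lambda>t. u (sg i t))
      \<le> (1 / \<rho>) * (\<Sum>i\<in>UNIV. dyadic_form m (\<lambda>t. u (sg i t)) (\<lambda>t. u (sg i t)))"
    using \<rho> dyadic_form_nonneg by (intro mult_left_mono member_le_sum) auto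
  also have "\<dots> \<le> A (Suc m) u u" using r by (simp add: sum_nonneg A_nonneg)
  also have "\<dots> \<le> B" by (rule u)
  finally show ?thesis using \<rho> by (simp add: field_simps)
qed

definition J :: "(real \<Rightarrow> real) \<Rightarrow> real" where
  "J f = lim (\<lambda>m. dyadic_form m f f)"

lemma dyadic_tendsto_J:
  assumes "\<And>m. dyadic_form m f f \<le> B" shows "(\<lambda>m. dyadic_form m f f) \<longlonglongrightarrow> J f"
proof -
  have "incseq (\<lambda>m. dyadic_form m f f)" using dyadic_form_mono by (rule incseq_SucI)
  then obtain l where "(\<lambda>m. dyadic_form m f f) \<longlonglongrightarrow> l" using assms incseq_convergent by blast
  then show ?thesis unfolding J_def by (simp add: limI)
qed

lemma dyadic_le_J: "(\<And>m. dyadic_form m f f \<le> B) \<Longrightarrow> dyadic_form m f f \<le> J f"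
  using incseq_le[OF incseq_SucI[of "\<lambda>m. dyadic_form m f f"] dyadic_tendsto_J] dyadic_form_mono by blast

lemma E_self_similar:
  assumes u: "\<And>m. A m u u \<le> B"
  shows "E u u = (1 / r) * (\<Sum>j\<in>UNIV. E (\<lambda>x. u (G j x)) (\<lambda>x. u (G j x))) + (1 / \<rho>) * (\<Sum>i\<in>UNIV. J (\<lambda>t. u (sg i t)))"
proof -
  have "(\<lambda>m. A (Suc m) u u) \<longlonglongrightarrow> (1 / r) * (\<Sum>j\<in>UNIV. E (\<lambda>x. u (G j x)) (\<lambda>x. u (G j x)))
      + (1 / \<rho>) * (\<Sum>i\<in>UNIV. J (\<lambda>t. u (sg i t)))"
    unfolding A.simps(2)
    by (intro tendsto_add tendsto_mult tendsto_const tendsto_sum A_tendsto_E_same[OF A_cell_bounded[OF u]]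
        dyadic_tendsto_J[OF dyadic_bounded[OF u]])
  moreover have "(\<lambda>m. A (Suc m) u u) \<longlonglongrightarrow> E u u" by (rule LIMSEQ_Suc[OF A_tendsto_E_same[OF u]])
  ultimately show ?thesis by (rule LIMSEQ_unique[rotated])
qed

subsection \<open>Identification of the form domain\<close>

text \<open>The edge energy as it occurs in \<open>DI\<close>; \<open>J\<close> is its counterpart
  in point values, and \<open>J'_eq\<close> identifies them.\<close>

definition J' :: "(real \<Rightarrow> real) \<Rightarrow> real" where
  "J' f = (LINT x:{0<..<1}|lborel. (weak_deriv f x)\<^sup>2)"

text \<open>A partial sum of \<open>energy\<close>. It shares the vertex part with
  \<open>A m\<close> but has full edge integrals, so it is squeezed between \<open>A m u u\<close>
  and \<open>E u u\<close>.\<close>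

definition truncated :: "nat \<Rightarrow> (real^2 \<Rightarrow> real) \<Rightarrow> real" where
  "truncated m u = Q \<alpha> p m u / r ^ m + (\<Sum>k<m. DI \<alpha> p (Suc k) u / (r ^ k * \<rho>))"

definition edgewise_H1 :: "(real^2 \<Rightarrow> real) \<Rightarrow> bool" where
  "edgewise_H1 u \<longleftrightarrow> continuous_on K u \<and> (\<forall>w i. u \<circ> \<xi> \<alpha> p w i \<in> H1_01)"

lemma Q_0: "Q \<alpha> p 0 u = A 0 u u"
proof -
  have e: "(3::3) + 1 = 1" "(2::3) + 1 = 3" "(1::3) + 1 = 2" "(4::3) = 1" "(5::3) = 2" by simp_all
  show ?thesis by (simp add: Q_def Q0_def sum_3 e power2_eq_square)
qed

lemma Q_Suc: "Q \<alpha> p (Suc m) u = (\<Sum>j\<in>UNIV. Q \<alpha> p m (\<lambda>x. u (G j x)))"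
  unfolding Q_def sum_words_Suc by (simp add: o_def Q0_def)

lemma DI_1: "DI \<alpha> p (Suc 0) u = (\<Sum>i\<in>UNIV. J' (\<lambda>t. u (sg i t)))"
  by (simp add: DI_def J'_def o_def \<xi>_Nil)

lemma DI_Suc: "DI \<alpha> p (Suc (Suc k)) u = (\<Sum>j\<in>UNIV. DI \<alpha> p (Suc k) (\<lambda>x. u (G j x)))"
proof -
  have "Suc (Suc k) - 1 = Suc k" "Suc k - 1 = k" by simp_all
  then show ?thesis unfolding DI_def by (simp only: sum_words_Suc o_def \<xi>_Cons)
qed

lemma truncated_Suc: "truncated (Suc m) u = (1 / r) * (\<Sum>j\<in>UNIV. truncated m (\<lambda>x. u (G j x)))
    + (1 / \<rho>) * (\<Sum>i\<in>UNIV. J' (\<lambda>t. u (sg i t)))"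
proof -
  have "(\<Sum>k<Suc m. DI \<alpha> p (Suc k) u / (r ^ k * \<rho>)) = DI \<alpha> p (Suc 0) u / \<rho>
      + (\<Sum>k<m. DI \<alpha> p (Suc (Suc k)) u / (r ^ Suc k * \<rho>))"
    by (subst sum.lessThan_Suc_shift) simp
  also have "(\<Sum>k<m. DI \<alpha> p (Suc (Suc k)) u / (r ^ Suc k * \<rho>))
      = (1 / r) * (\<Sum>j\<in>UNIV. \<Sum>k<m. DI \<alpha> p (Suc k) (\<lambda>x. u (G j x)) / (r ^ k * \<rho>))"
    unfolding DI_Suc by (subst sum.swap) (simp add: sum_divide_distrib sum_distrib_left divide_simps mult.assoc)
  finally show ?thesis
    unfolding truncated_def Q_Suc DI_1 by (simp add: sum.distrib sum_divide_distrib sum_distrib_left algebra_simps)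
qed

lemma edgewise_H1_cell: "edgewise_H1 u \<Longrightarrow> edgewise_H1 (\<lambda>x. u (G j x))"
  unfolding edgewise_H1_def
proof (elim conjE, intro conjI allI)
  assume c: "continuous_on K u" and H: "\<forall>w i. u \<circ> \<xi> \<alpha> p w i \<in> H1_01"
  show "continuous_on K (\<lambda>x. u (G j x))"
    by (rule continuous_on_compose2[OF c continuous_G]) (auto simp: G_K)
  show "(\<lambda>x. u (G j x)) \<circ> \<xi> \<alpha> p w i \<in> H1_01" for w i
    using H[rule_format, of "j # w" i] by (simp add: o_def \<xi>_Cons)
qed

lemma continuous_edge: "continuous_on K u \<Longrightarrow> continuous_on {0..1} (\<lambda>t. u (sg i t))"
  by (rule continuous_on_compose2[OF _ continuous_sg]) (auto simp: sg_K)

lemma J'_eq: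
  assumes "continuous_on {0..1} f" "\<And>m. dyadic_form m f f \<le> B" shows "J' f = J f"
  unfolding J'_def J_def using H1_dyadic(2)[OF assms] by (simp add: limI)

lemma edgewise_H1_dyadic:
  assumes "edgewise_H1 u"
  shows "dyadic_form m (\<lambda>t. u (sg i t)) (\<lambda>t. u (sg i t)) \<le> J' (\<lambda>t. u (sg i t))"
proof -
  have c: "continuous_on {0..1} (\<lambda>t. u (sg i t))" using assms continuous_edge[of u i] by (simp add: edgewise_H1_def)
  have "u \<circ> \<xi> \<alpha> p [] i \<in> H1_01" using assms unfolding edgewise_H1_def by blast
  then have "(\<lambda>t. u (sg i t)) \<in> H1_01" by (simp add: o_def \<xi>_Nil)
  then obtain B where B: "\<forall>m. dyadic_form m (\<lambda>t. u (sg i t)) (\<lambda>t. u (sg i t)) \<le> B"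
    using H1_imp_dyadic_bounded[OF c] by blast
  then show ?thesis using dyadic_le_J[OF B[rule_format]] J'_eq[OF c B[rule_format]] by simp
qed

lemma A_le_truncated: "edgewise_H1 u \<Longrightarrow> A m u u \<le> truncated m u"
proof (induction m arbitrary: u)
  case 0
  show ?case by (simp add: truncated_def Q_0 del: A.simps)
next
  case (Suc m)
  show ?case unfolding A.simps(2) truncated_Suc using r \<rho>
    by (intro add_mono mult_left_mono sum_mono Suc.IH edgewise_H1_cell edgewise_H1_dyadic Suc.prems) auto
qed

lemma truncated_mono: "edgewise_H1 u \<Longrightarrow> truncated m u \<le> truncated (Suc m) u"
proof (induction m arbitrary: u)
  case 0
  have "truncated 0 u \<le> A (Suc 0) u u" using A_mono[of 0 u] by (simp add: truncated_def Q_0 del: A.simps)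
  also have "\<dots> \<le> truncated (Suc 0) u" by (rule A_le_truncated[OF 0])
  finally show ?case .
next
  case (Suc m)
  show ?case unfolding truncated_Suc[of "Suc m" u] truncated_Suc[of m u] using r \<rho>
    by (intro add_mono mult_left_mono sum_mono Suc.IH edgewise_H1_cell Suc.prems order_refl) auto
qed

lemma truncated_le_E:
  "continuous_on K u \<Longrightarrow> (\<And>m. A m u u \<le> B) \<Longrightarrow> truncated m u \<le> E u u"
proof (induction m arbitrary: u B)
  case 0
  then show ?case using A_le_E[OF 0(2), of 0] by (simp add: truncated_def Q_0 del: A.simps)
next
  case (Suc m)
  have c: "continuous_on K (\<lambda>x. u (G j x))" for j
    by (rule continuous_on_compose2[OF Suc.prems(1) continuous_G]) (auto simp: G_K)
  have "J' (\<lambda>t. u (sg i t)) = J (\<lambda>t. u (sg i t))" for i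
    by (rule J'_eq[OF continuous_edge[OF Suc.prems(1)] dyadic_bounded[OF Suc.prems(2)]])
  then show ?case unfolding truncated_Suc E_self_similar[OF Suc.prems(2)] using r \<rho>
    by (intro add_mono mult_left_mono sum_mono Suc.IH[OF c A_cell_bounded[OF Suc.prems(2)]]) auto
qed

lemma bounded_imp_edgewise_H1:
  assumes "continuous_on K u" "\<And>m. A m u u \<le> B" shows "edgewise_H1 u"
proof -
  have "u \<circ> \<xi> \<alpha> p w i \<in> H1_01" for w i
    using assms
  proof (induction w arbitrary: u B)
    case Nil
    then show ?case using H1_dyadic(1)[OF continuous_edge[OF Nil(1)] dyadic_bounded[OF Nil(2)], of i] by (simp add: o_def \<xi>_Nil)
  next
    case (Cons j w)
    have c: "continuous_on K (\<lambda>x. u (G j x))"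
      by (rule continuous_on_compose2[OF Cons.prems(1) continuous_G]) (auto simp: G_K)
    show ?case using Cons.IH[OF c A_cell_bounded[OF Cons.prems(2)]] by (simp add: o_def \<xi>_Cons)
  qed
  then show ?thesis using assms(1) by (simp add: edgewise_H1_def)
qed

context
  fixes R :: "nat \<Rightarrow> real \<times> real"
  assumes R: "\<And>i. 1 \<le> i \<Longrightarrow> R i = (r, \<rho>)"
begin

lemma \<delta>_eq: "\<delta> R m = r ^ m" unfolding \<delta>_def by (simp add: R)

lemma \<gamma>_eq: "\<gamma> R (Suc k) = r ^ k * \<rho>" unfolding \<gamma>_def by (simp add: R)

lemma DI_nonneg: "0 \<le> DI \<alpha> p k u"
  unfolding DI_def set_integral_U01 by (intro sum_nonneg integral_nonneg_AE) auto

lemma Q_nonneg: "0 \<le> Q \<alpha> p k u"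
  unfolding Q_def Q0_def by (intro sum_nonneg) auto

text \<open>The partial sums converge by the squeeze and the series by boundedness, so the vertex
  part converges as their difference; thus \<open>lim\<close> in \<open>energy\<close> is a genuine
  limit.\<close>

lemma energy_eq_E:
  assumes c: "continuous_on K u" and B: "\<And>m. A m u u \<le> B"
  shows "energy \<alpha> p R u = ennreal (E u u)"
proof -
  have H: "edgewise_H1 u" by (rule bounded_imp_edgewise_H1[OF c B])
  define d where "d k = DI \<alpha> p (Suc k) u / (r ^ k * \<rho>)" for k
  have d0: "0 \<le> d k" for k using DI_nonneg r \<rho> by (simp add: d_def)
  have t: "(\<lambda>m. truncated m u) \<longlonglongrightarrow> E u u"
    by (rule tendsto_sandwich[OF _ _ A_tendsto_E_same[OF B] tendsto_const])
       (auto intro!: always_eventually A_le_truncated[OF H] truncated_le_E[OF c B])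
  have Sle: "(\<Sum>k<m. d k) \<le> E u u" for m
  proof -
    have "(\<Sum>k<m. d k) \<le> truncated m u" using Q_nonneg r by (simp add: truncated_def d_def)
    also have "\<dots> \<le> E u u" by (rule truncated_le_E[OF c B])
    finally show ?thesis .
  qed
  then have sm: "summable d" by (intro summableI_nonneg_bounded[of d "E u u"] d0)
  have "(\<lambda>m. truncated m u - (\<Sum>k<m. d k)) \<longlonglongrightarrow> E u u - suminf d"
    by (intro tendsto_diff t summable_LIMSEQ sm)
  then have "(\<lambda>m. ennreal (Q \<alpha> p m u / r ^ m)) \<longlonglongrightarrow> ennreal (E u u - suminf d)"
    by (intro tendsto_ennrealI) (simp add: truncated_def d_def)
  then have 1: "lim (\<lambda>m. ennreal (Q \<alpha> p m u / \<delta> R m)) = ennreal (E u u - suminf d)"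
    unfolding \<delta>_eq by (rule limI)
  have 2: "(\<Sum>k. ennreal (DI \<alpha> p (Suc k) u / \<gamma> R (Suc k))) = ennreal (suminf d)"
    unfolding \<gamma>_eq d_def[symmetric] by (rule suminf_ennreal2[OF d0 sm])
  have "suminf d \<le> E u u" by (rule suminf_le_const[OF sm Sle])
  then show ?thesis unfolding energy_def 1 2 using suminf_nonneg[OF sm d0] by (simp flip: ennreal_plus)
qed

lemma form_dom_eq: "form_dom \<alpha> p R = D"
proof (intro equalityI subsetI)
  fix u assume "u \<in> D"
  then obtain B where c: "continuous_on K u" and z: "\<forall>x. x \<notin> K \<longrightarrow> u x = 0" and B: "\<forall>m. A m u u \<le> B"
    unfolding D_def by blast
  have "energy \<alpha> p R u < \<infinity>" using energy_eq_E[OF c B[rule_format]] by simp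
  moreover have "edgewise_H1 u" by (rule bounded_imp_edgewise_H1[OF c B[rule_format]])
  ultimately show "u \<in> form_dom \<alpha> p R" using c z unfolding form_dom_def edgewise_H1_def by blast
next
  fix u assume "u \<in> form_dom \<alpha> p R"
  then have c: "continuous_on K u" and z: "\<forall>x. x \<notin> K \<longrightarrow> u x = 0" and H: "edgewise_H1 u"
    and fin: "energy \<alpha> p R u < \<infinity>" unfolding form_dom_def edgewise_H1_def by blast+
  define d where "d k = DI \<alpha> p (Suc k) u / (r ^ k * \<rho>)" for k
  have d0: "0 \<le> d k" for k using DI_nonneg r \<rho> by (simp add: d_def)
  have f1: "lim (\<lambda>m. ennreal (Q \<alpha> p m u / r ^ m)) < \<infinity>" and f2: "(\<Sum>k. ennreal (d k)) < \<infinity>"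
    using fin unfolding energy_def \<delta>_eq \<gamma>_eq d_def[symmetric] by (auto simp: less_top)
  have sm: "summable d" using f2 d0 by (intro summable_suminf_not_top) auto
  have Sle: "(\<Sum>k<m. d k) \<le> suminf d" for m by (rule sum_le_suminf[OF sm]) (auto simp: d0)
  have inc: "incseq (\<lambda>m. truncated m u)" using truncated_mono[OF H] by (rule incseq_SucI)
  \<comment> \<open>If the partial sums were unbounded although the series is finite, the vertex
    part would tend to infinity. Then \<open>lim\<close> is a genuine limit with value infinity,
    against finite energy.\<close>
  have "\<exists>B. \<forall>m. truncated m u \<le> B"
  proof (rule ccontr)
    assume nb: "\<nexists>B. \<forall>m. truncated m u \<le> B"
    have "filterlim (\<lambda>m. truncated m u) at_top sequentially"
      unfolding filterlim_at_top eventually_sequentially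
    proof
      fix Z
      obtain m where "Z < truncated m u" using nb by (meson not_le)
      then have "\<forall>n\<ge>m. Z \<le> truncated n u" using incseqD[OF inc] by (meson less_imp_le order_trans)
      then show "\<exists>N. \<forall>n\<ge>N. Z \<le> truncated n u" by blast
    qed
    then have "filterlim (\<lambda>m. (- suminf d) + truncated m u) at_top sequentially"
      by (intro filterlim_tendsto_add_at_top[OF tendsto_const])
    then have "filterlim (\<lambda>m. Q \<alpha> p m u / r ^ m) at_top sequentially"
    proof (rule filterlim_at_top_mono)
      show "\<forall>\<^sub>F m in sequentially. - suminf d + truncated m u \<le> Q \<alpha> p m u / r ^ m"
        using Sle by (intro always_eventually allI) (simp add: truncated_def d_def)
    qed
    then have "(\<lambda>m. ennreal (Q \<alpha> p m u / r ^ m)) \<longlonglongrightarrow> \<infinity>"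
      by (simp add: ennreal_tendsto_top_eq_at_top infinity_ennreal_def)
    then have "lim (\<lambda>m. ennreal (Q \<alpha> p m u / r ^ m)) = \<infinity>" by (rule limI)
    then show False using f1 by simp
  qed
  then obtain B where "\<forall>m. truncated m u \<le> B" ..
  then have "\<forall>m. A m u u \<le> B" using A_le_truncated[OF H] order_trans by blast
  then show "u \<in> D" using c z unfolding D_def by blast
qed

end

end

subsection \<open>The measure\<close>

lemma integral_U01_Icc:
  fixes f :: "real \<Rightarrow> real"
  assumes f: "continuous_on {0..1} f"
  shows "(LINT x|U01. f x) = integral {0..1} f"
proof -
  have "(LINT x|U01. f x) = integral {0<..<1} f"
    unfolding set_integral_U01[symmetric]
    using integrable_U01_continuous[OF f] unfolding set_integrable_U01[symmetric]
    by (rule set_borel_integral_eq_integral)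
  then show ?thesis by (simp add: integral_open_interval_real)
qed

lemma integral_U01_zero_imp_zero:
  fixes f :: "real \<Rightarrow> real"
  assumes f: "continuous_on {0..1} f" "\<And>x. 0 \<le> f x" "(LINT x|U01. f x) = 0" and t: "0 \<le> t" "t \<le> 1"
  shows "f t = 0"
proof (rule has_integral_0_cbox_imp_0[of 0 1 f])
  have "(f has_integral integral {0..1} f) {0..1}"
    using f(1) by (intro integrable_integral integrable_continuous_real)
  then show "(f has_integral 0) (cbox 0 1)" using integral_U01_Icc[OF f(1)] f(3) by simp
qed (use f t in auto)

locale gasket_measure = gasket +
  fixes \<beta> :: real
  assumes \<beta>: "0 < \<beta>" "\<beta> < 1 / 3"
begin

section \<open>Integration of continuous functions over the edges\<close>

definition "a = 1 / 3 - \<beta>"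

lemma a: "0 < a" using \<beta> by (simp add: a_def)

text \<open>The sum of the mean values over all edges of level \<open>m\<close>. The recursion over
  cells replaces words, which return in \<open>S_words\<close>.\<close>

primrec S :: "nat \<Rightarrow> (real^2 \<Rightarrow> real) \<Rightarrow> real" where
  "S 0 h = (\<Sum>i\<in>UNIV. LINT t|U01. h (sg i t))"
| "S (Suc m) h = (\<Sum>j\<in>UNIV. S m (\<lambda>x. h (G j x)))"

lemma S_words: "S m h = (\<Sum>w | length w = m. \<Sum>i\<in>UNIV. LINT t|U01. h (\<xi> \<alpha> p w i t))"
proof (induction m arbitrary: h)
  case 0
  show ?case by (simp add: \<xi>_Nil)
next
  case (Suc m)
  show ?case unfolding S.simps(2) Suc sum_words_Suc by (simp add: \<xi>_Cons)
qed

lemma S_cong: "(\<And>x. x \<in> K \<Longrightarrow> h x = h' x) \<Longrightarrow> S m h = S m h'"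
proof (induction m arbitrary: h h')
  case 0
  show ?case unfolding S.simps(1) by (intro sum.cong refl U01_cong 0 sg_K) auto
next
  case (Suc m)
  show ?case unfolding S.simps(2) by (intro sum.cong refl Suc.IH Suc.prems G_K)
qed

lemma continuous_cell: "continuous_on K h \<Longrightarrow> continuous_on K (\<lambda>x. h (G j x))"
  by (rule continuous_on_compose2[OF _ continuous_G]) (auto simp: G_K)

lemma continuous_edge0: "continuous_on K h \<Longrightarrow> continuous_on {0..1} (\<lambda>t. h (sg i t))"
  by (rule continuous_on_compose2[OF _ continuous_sg]) (auto simp: sg_K)

lemma continuous_\<xi>_comp: "continuous_on K h \<Longrightarrow> continuous_on {0..1} (\<lambda>t. h (\<xi> \<alpha> p w i t))"
  by (rule continuous_on_compose2[OF _ continuous_\<xi>]) (auto simp: \<xi>_K)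

lemma S_linear:
  "continuous_on K g \<Longrightarrow> continuous_on K h \<Longrightarrow> S m (\<lambda>x. b * g x + c * h x) = b * S m g + c * S m h"
proof (induction m arbitrary: g h)
  case 0
  have "integrable U01 (\<lambda>t. g (sg i t))" "integrable U01 (\<lambda>t. h (sg i t))" for i
    by (intro integrable_U01_continuous continuous_edge0 0)+
  then show ?case by (simp add: sum.distrib sum_distrib_left)
next
  case (Suc m)
  show ?case unfolding S.simps(2) Suc.IH[OF continuous_cell[OF Suc.prems(1)] continuous_cell[OF Suc.prems(2)]]
    by (simp add: sum.distrib sum_distrib_left)
qed

lemma S_mono:
  "continuous_on K g \<Longrightarrow> continuous_on K h \<Longrightarrow> (\<And>x. x \<in> K \<Longrightarrow> g x \<le> h x) \<Longrightarrow> S m g \<le> S m h"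
proof (induction m arbitrary: g h)
  case 0
  show ?case unfolding S.simps(1)
    by (intro sum_mono integral_mono integrable_U01_continuous continuous_edge0 0 sg_K)
       (auto simp: space_restrict_space)
next
  case (Suc m)
  show ?case unfolding S.simps(2) by (intro sum_mono Suc.IH continuous_cell Suc.prems G_K)
qed

lemma S_const: "S m (\<lambda>x. c) = 3 ^ Suc m * c"
  by (induction m) simp_all

lemma S_nonneg: "continuous_on K h \<Longrightarrow> (\<And>x. x \<in> K \<Longrightarrow> 0 \<le> h x) \<Longrightarrow> 0 \<le> S m h"
  using S_mono[of "\<lambda>x. 0" h m] by (simp add: S_const)

lemma continuous_K_bounded:
  assumes "continuous_on K h" shows "\<exists>B\<ge>0. \<forall>x\<in>K. \<bar>h x\<bar> \<le> (B::real)"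
proof -
  have "bounded (h ` K)" using assms K_compact by (intro compact_imp_bounded compact_continuous_image)
  then obtain B where "\<forall>x\<in>K. \<bar>h x\<bar> \<le> B" by (auto simp: bounded_iff)
  then show ?thesis by (intro exI[of _ "max B 0"]) (auto simp: le_max_iff_disj)
qed

lemma S_abs_le:
  assumes c: "continuous_on K h" and B: "\<And>x. x \<in> K \<Longrightarrow> \<bar>h x\<bar> \<le> B" shows "\<bar>S m h\<bar> \<le> 3 ^ Suc m * B"
proof -
  have b: "- B \<le> h x" "h x \<le> B" if "x \<in> K" for x using B[OF that] by auto
  have "S m h \<le> S m (\<lambda>x. B)" "S m (\<lambda>x. - B) \<le> S m h" by (intro S_mono c continuous_on_const b; assumption)+
  then show ?thesis unfolding S_const by (simp add: abs_le_iff)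
qed

text \<open>The integral of a continuous function against the measure. As a series it inherits
  self-similarity and symmetry from \<open>S\<close> by elementary means; \<open>integral_N\<close>
  makes the link.\<close>

definition I :: "(real^2 \<Rightarrow> real) \<Rightarrow> real" where
  "I h = (\<Sum>m. a * \<beta> ^ m * S m h)"

lemma summable_S:
  assumes c: "continuous_on K h" shows "summable (\<lambda>m. a * \<beta> ^ m * S m h)"
proof -
  obtain B where B: "0 \<le> B" "\<forall>x\<in>K. \<bar>h x\<bar> \<le> B" using continuous_K_bounded[OF c] by blast
  show ?thesis
  proof (rule summable_comparison_test'[where N = 0])
    show "summable (\<lambda>m. a * (3 * B) * (3 * \<beta>) ^ m)" using \<beta> by (intro summable_mult summable_geometric) auto
    fix m
    have "\<bar>a * \<beta> ^ m * S m h\<bar> = a * \<beta> ^ m * \<bar>S m h\<bar>" using a \<beta> by (simp add: abs_mult)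
    also have "\<dots> \<le> a * \<beta> ^ m * (3 ^ Suc m * B)"
      using a \<beta> S_abs_le[OF c B(2)[rule_format]] by (intro mult_left_mono) auto
    finally show "norm (a * \<beta> ^ m * S m h) \<le> a * (3 * B) * (3 * \<beta>) ^ m"
      by (simp add: power_mult_distrib mult_ac)
  qed
qed

lemma I_linear:
  assumes g: "continuous_on K g" and h: "continuous_on K h"
  shows "I (\<lambda>x. b * g x + c * h x) = b * I g + c * I h"
proof -
  have "(\<lambda>m. a * \<beta> ^ m * S m (\<lambda>x. b * g x + c * h x)) = (\<lambda>m. b * (a * \<beta> ^ m * S m g) + c * (a * \<beta> ^ m * S m h))"
    unfolding S_linear[OF g h] by (simp add: algebra_simps)
  then show ?thesis unfolding I_def
    using suminf_add[OF summable_mult[OF summable_S[OF g], of b] summable_mult[OF summable_S[OF h], of c]]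
    by (simp add: suminf_mult summable_S g h)
qed

lemma I_mono:
  assumes g: "continuous_on K g" and h: "continuous_on K h" and le: "\<And>x. x \<in> K \<Longrightarrow> g x \<le> h x"
  shows "I g \<le> I h"
  unfolding I_def using a \<beta>
  by (intro suminf_le summable_S g h mult_left_mono S_mono le) auto

lemma I_const: "I (\<lambda>x. c) = c"
proof -
  have "(\<lambda>m. (3 * \<beta>) ^ m) sums (1 / (1 - 3 * \<beta>))" using \<beta> by (intro geometric_sums) auto
  then have "(\<lambda>m. (3 * a * c) * (3 * \<beta>) ^ m) sums ((3 * a * c) * (1 / (1 - 3 * \<beta>)))" by (rule sums_mult)
  \<comment> \<open>Total mass one: there are \<open>3 ^ Suc m\<close> edges of level
    \<open>m\<close> with weight \<open>a * \<beta> ^ m\<close>, and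
    \<open>3 * a = 1 - 3 * \<beta>\<close>.\<close>
  moreover have "(3 * a * c) * (1 / (1 - 3 * \<beta>)) = c" using \<beta> by (simp add: a_def field_simps)
  moreover have "(\<lambda>m. (3 * a * c) * (3 * \<beta>) ^ m) = (\<lambda>m. a * \<beta> ^ m * S m (\<lambda>x. c))"
    unfolding S_const by (simp add: power_mult_distrib mult_ac)
  ultimately show ?thesis unfolding I_def by (simp add: sums_iff)
qed

lemma I_cong: "(\<And>x. x \<in> K \<Longrightarrow> g x = h x) \<Longrightarrow> I g = I h"
  unfolding I_def using S_cong[of g h] by simp

lemma I_self_similar:
  assumes h: "continuous_on K h"
  shows "I h = a * (\<Sum>i\<in>UNIV. LINT t|U01. h (sg i t)) + \<beta> * (\<Sum>j\<in>UNIV. I (\<lambda>x. h (G j x)))"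
proof -
  have "I h = (\<Sum>m. a * \<beta> ^ Suc m * S (Suc m) h) + a * \<beta> ^ 0 * S 0 h"
    unfolding I_def using suminf_split_head[OF summable_S[OF h]] by simp
  also have "(\<lambda>m. a * \<beta> ^ Suc m * S (Suc m) h) = (\<lambda>m. \<beta> * (\<Sum>j\<in>UNIV. a * \<beta> ^ m * S m (\<lambda>x. h (G j x))))"
    by (simp add: sum_distrib_left mult_ac)
  also have "(\<Sum>m. \<beta> * (\<Sum>j\<in>UNIV. a * \<beta> ^ m * S m (\<lambda>x. h (G j x)))) = \<beta> * (\<Sum>j\<in>UNIV. I (\<lambda>x. h (G j x)))"
    unfolding I_def
    by (subst suminf_mult) (auto intro!: summable_sum summable_S continuous_cell h
        simp: suminf_sum[OF summable_S[OF continuous_cell[OF h]]])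
  finally show ?thesis by simp
qed

text \<open>Full support of the measure: every edge has positive weight and the edges are dense. The
  induction generalises over the function, since passing to a cell replaces \<open>v\<close> by its
  restriction.\<close>

lemma I_square_zero:
  assumes u: "continuous_on K u" and z: "I (\<lambda>x. (u x)\<^sup>2) = 0" and x: "x \<in> K"
  shows "u x = 0"
proof -
  have c: "continuous_on K (\<lambda>x. (u x)\<^sup>2)" using u by (intro continuous_intros)
  have nn: "0 \<le> a * \<beta> ^ m * S m (\<lambda>x. (u x)\<^sup>2)" for m
    using a \<beta> by (intro mult_nonneg_nonneg S_nonneg c) auto
  have S0: "\<forall>m. S m (\<lambda>x. (u x)\<^sup>2) = 0"
    using suminf_eq_zero_iff[OF summable_S[OF c] nn] z a \<beta> unfolding I_def by auto
  have "v y = 0" if "y \<in> orbit" "continuous_on K v" "\<forall>m. S m (\<lambda>x. (v x)\<^sup>2) = 0" for v y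
    using that
  proof (induction y arbitrary: v rule: orbit_induct)
    case (edge i t)
    have ce: "continuous_on {0..1} (\<lambda>t. (v (sg i t))\<^sup>2)" for i
      using edge(3) by (intro continuous_edge0[where h = "\<lambda>x. (v x)\<^sup>2"] continuous_intros)
    have "(\<Sum>i\<in>UNIV. LINT t|U01. (v (sg i t))\<^sup>2) = 0" using edge(4)[rule_format, of 0] by simp
    then have "(LINT t|U01. (v (sg i t))\<^sup>2) = 0"
      by (subst (asm) sum_nonneg_eq_0_iff) (auto intro: integral_nonneg_AE)
    then have "(v (sg i t))\<^sup>2 = 0"
      using edge(1,2) by (intro integral_U01_zero_imp_zero[OF ce]) auto
    then show ?case by simp
  next
    case (cell i y)
    have "S m (\<lambda>x. (v (G i x))\<^sup>2) = 0" for m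
    proof -
      have "(\<Sum>j\<in>UNIV. S m (\<lambda>x. (v (G j x))\<^sup>2)) = 0" using cell(4)[rule_format, of "Suc m"] by simp
      moreover have "0 \<le> S m (\<lambda>x. (v (G j x))\<^sup>2)" for j
        using continuous_cell[OF cell(3), of j] by (intro S_nonneg continuous_intros) auto
      ultimately show ?thesis by (subst (asm) sum_nonneg_eq_0_iff) auto
    qed
    then show ?case using cell.IH[of "\<lambda>x. v (G i x)"] continuous_cell[OF cell(3)] by blast
  qed
  then show ?thesis using K_limit_eq[OF u continuous_on_const[of K 0] x] u S0 by blast
qed

text \<open>Weighted Lebesgue measure on words, letters and the unit interval, pushed forward by the
  edge parametrisations. It is a measure by construction, whereas \<open>measure_of\<close> in
  \<open>mu_l\<close> returns the intended set function only once that is known to be countably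
  additive.\<close>

definition N :: "(real^2) measure" where
  "N = distr (density (count_space (UNIV :: (3 list \<times> 3) set) \<Otimes>\<^sub>M U01) (\<lambda>x. ennreal (a * \<beta> ^ length (fst (fst x)))))
     (restrict_space borel K) (\<lambda>x. \<xi> \<alpha> p (fst (fst x)) (snd (fst x)) (snd x))"

lemma space_N: "space N = K" and sets_N: "sets N = sets (restrict_space borel K)"
  by (simp_all add: N_def space_restrict_space)

lemma \<xi>_measurable: "\<xi> \<alpha> p w i \<in> measurable U01 (restrict_space borel K)"
proof (rule measurable_restrict_space2)
  show "\<xi> \<alpha> p w i \<in> space U01 \<rightarrow> K" by (auto simp: space_restrict_space intro!: \<xi>_K)
  have "\<xi> \<alpha> p w i \<in> borel_measurable lborel"
    using borel_measurable_continuous_onI[OF continuous_\<xi>] by simp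
  then show "\<xi> \<alpha> p w i \<in> borel_measurable U01" by (rule measurable_restrict_space1)
qed

lemma \<Xi>_measurable:
  "(\<lambda>x. \<xi> \<alpha> p (fst (fst x)) (snd (fst x)) (snd x)) \<in> measurable (count_space UNIV \<Otimes>\<^sub>M U01) (restrict_space borel K)"
  by (rule measurable_pair_measure_countable1) (auto simp: \<xi>_measurable)

lemma weight_measurable:
  "(\<lambda>x. ennreal (a * \<beta> ^ length (fst (fst x)))) \<in> borel_measurable (count_space (UNIV :: (3 list \<times> 3) set) \<Otimes>\<^sub>M U01)"
  by (rule measurable_pair_measure_countable1) auto

lemma nn_integral_words:
  fixes F :: "3 list \<times> 3 \<Rightarrow> ennreal"
  shows "(\<integral>\<^sup>+x. F x \<partial>count_space UNIV) = (\<Sum>m. \<Sum>w | length w = m. \<Sum>i\<in>UNIV. F (w, i))"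
proof -
  define X where "X m = {w :: 3 list. length w = m} \<times> (UNIV :: 3 set)" for m
  have fin: "finite {w :: 3 list. length w = m}" for m using finite_lists_length_eq[of "UNIV :: 3 set" m] by simp
  have disj: "disjoint_family X" by (auto simp: disjoint_family_on_def X_def)
  have "F x = (\<Sum>m. F x * indicator (X m) x)" for x
    using suminf_cmult_indicator[OF disj, of x "length (fst x)" "\<lambda>_. F x"] by (simp add: X_def mem_Times_iff)
  then have "(\<integral>\<^sup>+x. F x \<partial>count_space UNIV) = (\<integral>\<^sup>+x. (\<Sum>m. F x * indicator (X m) x) \<partial>count_space UNIV)" by simp
  also have "\<dots> = (\<Sum>m. \<integral>\<^sup>+x. F x * indicator (X m) x \<partial>count_space UNIV)" by (rule nn_integral_suminf) simp
  also have "\<dots> = (\<Sum>m. \<Sum>w | length w = m. \<Sum>i\<in>UNIV. F (w, i))"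
  proof (rule arg_cong[where f = suminf], rule ext)
    fix m
    have "(\<integral>\<^sup>+x. F x * indicator (X m) x \<partial>count_space UNIV) = (\<Sum>x\<in>X m. F x * indicator (X m) x)"
      using fin by (intro nn_integral_count_space'[where A = "X m"]) (auto simp: X_def)
    also have "\<dots> = (\<Sum>x\<in>X m. F x)" by (intro sum.cong) auto
    also have "\<dots> = (\<Sum>w | length w = m. \<Sum>i\<in>UNIV. F (w, i))"
      unfolding X_def using fin by (simp add: sum.cartesian_product)
    finally show "(\<integral>\<^sup>+x. F x * indicator (X m) x \<partial>count_space UNIV) = (\<Sum>w | length w = m. \<Sum>i\<in>UNIV. F (w, i))" .
  qed
  finally show ?thesis .
qed

lemma nn_integral_N:
  assumes f: "f \<in> borel_measurable (restrict_space borel K)"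
  shows "(\<integral>\<^sup>+x. f x \<partial>N) = (\<Sum>m. \<Sum>w | length w = m. \<Sum>i\<in>UNIV. ennreal (a * \<beta> ^ m) * (\<integral>\<^sup>+t. f (\<xi> \<alpha> p w i t) \<partial>U01))"
proof -
  interpret U: sigma_finite_measure U01 using finite_measure_U01 by (rule finite_measure.axioms(1))
  let ?P = "count_space (UNIV :: (3 list \<times> 3) set) \<Otimes>\<^sub>M U01"
  let ?w = "\<lambda>x. ennreal (a * \<beta> ^ length (fst (fst x)))" and ?\<Xi> = "\<lambda>x. \<xi> \<alpha> p (fst (fst x)) (snd (fst x)) (snd x)"
  have m: "(\<lambda>x. f (?\<Xi> x)) \<in> borel_measurable ?P" using measurable_compose[OF \<Xi>_measurable f] .
  have "(\<integral>\<^sup>+x. f x \<partial>N) = (\<integral>\<^sup>+x. f (?\<Xi> x) \<partial>density ?P ?w)"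
    unfolding N_def by (rule nn_integral_distr) (use \<Xi>_measurable f in \<open>auto simp: measurable_cong_sets[OF sets_density refl]\<close>)
  also have "\<dots> = (\<integral>\<^sup>+x. ?w x * f (?\<Xi> x) \<partial>?P)" by (rule nn_integral_density[OF weight_measurable m])
  also have "\<dots> = (\<integral>\<^sup>+y. \<integral>\<^sup>+t. ?w (y, t) * f (?\<Xi> (y, t)) \<partial>U01 \<partial>count_space UNIV)"
    by (rule U.nn_integral_fst[symmetric]) (intro borel_measurable_times_ennreal weight_measurable m)
  also have "\<dots> = (\<Sum>m. \<Sum>w | length w = m. \<Sum>i\<in>UNIV. \<integral>\<^sup>+t. ennreal (a * \<beta> ^ length w) * f (\<xi> \<alpha> p w i t) \<partial>U01)"
    unfolding nn_integral_words by simp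
  also have "\<dots> = (\<Sum>m. \<Sum>w | length w = m. \<Sum>i\<in>UNIV. ennreal (a * \<beta> ^ m) * (\<integral>\<^sup>+t. f (\<xi> \<alpha> p w i t) \<partial>U01))"
    by (intro arg_cong[where f = suminf] ext sum.cong refl)
       (auto intro!: nn_integral_cmult measurable_compose[OF \<xi>_measurable f])
  finally show ?thesis .
qed

lemma edge_length_ratio:
  "edge_length \<alpha> p w i B / edge_length \<alpha> p w i (edge_word \<alpha> p w i) = emeasure lborel {t \<in> {0<..<1}. \<xi> \<alpha> p w i t \<in> B}"
proof -
  have "{t \<in> {0<..<1}. \<xi> \<alpha> p w i t \<in> edge_word \<alpha> p w i} = {0<..<1}"
    by (auto simp: edge_word_def edge_def \<xi>_def)
  moreover have "0 < dist (\<xi> \<alpha> p w i 0) (\<xi> \<alpha> p w i 1)" by (simp add: \<xi>_inj)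
  ultimately show ?thesis unfolding edge_length_def
    by (simp add: mult.commute[of "ennreal _"] mult_divide_eq_ennreal)
qed

lemma mu_l_eq: "mu_l \<alpha> p \<beta> = N"
proof -
  have "mu_l \<alpha> p \<beta> = measure_of (space N) (sets N) (emeasure N)"
    unfolding mu_l_def space_N sets_N
  proof (rule measure_of_eq)
    show "sets (restrict_space borel K) \<subseteq> Pow K" using sets.space_closed[of "restrict_space borel K"] by (simp add: space_restrict_space)
    fix B assume "B \<in> sigma_sets K (sets (restrict_space borel K))"
    then have B: "B \<in> sets (restrict_space borel K)"
      using sets.sigma_sets_eq[of "restrict_space borel K"] by (simp add: space_restrict_space)
    have "emeasure N B = (\<integral>\<^sup>+x. indicator B x \<partial>N)" using B by (simp add: sets_N)
    also have "\<dots> = (\<Sum>m. \<Sum>w | length w = m. \<Sum>i\<in>UNIV. ennreal (a * \<beta> ^ m) * (\<integral>\<^sup>+t. indicator B (\<xi> \<alpha> p w i t) \<partial>U01))"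
      using B by (intro nn_integral_N) simp
    also have "\<dots> = (\<Sum>m. \<Sum>w | length w = m. \<Sum>i\<in>UNIV. ennreal (a * \<beta> ^ m) * emeasure lborel {t \<in> {0<..<1}. \<xi> \<alpha> p w i t \<in> B})"
    proof (intro arg_cong[where f = suminf] ext sum.cong refl arg_cong2[where f = "(*)"])
      fix w i
      have s: "{t \<in> {0<..<1}. \<xi> \<alpha> p w i t \<in> B} \<in> sets U01"
        using measurable_sets[OF \<xi>_measurable[of w i] B] by (simp add: space_restrict_space vimage_def Int_def conj_commute)
      have "(\<integral>\<^sup>+t. indicator B (\<xi> \<alpha> p w i t) \<partial>U01) = (\<integral>\<^sup>+t. indicator {t \<in> {0<..<1}. \<xi> \<alpha> p w i t \<in> B} t \<partial>U01)"
        by (intro nn_integral_cong) (auto simp: space_restrict_space split: split_indicator)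
      also have "\<dots> = emeasure U01 {t \<in> {0<..<1}. \<xi> \<alpha> p w i t \<in> B}" by (rule nn_integral_indicator[OF s])
      also have "\<dots> = emeasure lborel {t \<in> {0<..<1}. \<xi> \<alpha> p w i t \<in> B}" by (rule emeasure_restrict_space) auto
      finally show "(\<integral>\<^sup>+t. indicator B (\<xi> \<alpha> p w i t) \<partial>U01) = emeasure lborel {t \<in> {0<..<1}. \<xi> \<alpha> p w i t \<in> B}" .
    qed
    finally show "(\<Sum>m. \<Sum>w | length w = m. \<Sum>i\<in>UNIV. ennreal ((1 / 3 - \<beta>) * \<beta> ^ m) *
        (edge_length \<alpha> p w i B / edge_length \<alpha> p w i (edge_word \<alpha> p w i))) = emeasure N B"
      unfolding edge_length_ratio a_def ..
  qed
  then show ?thesis by (simp add: measure_of_of_measure)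
qed

lemma continuous_measurable_N: "continuous_on K h \<Longrightarrow> h \<in> borel_measurable N"
  for h :: "real^2 \<Rightarrow> real"
  using borel_measurable_continuous_on_restrict[of K h] measurable_cong_sets[OF sets_N refl] by blast

lemma integral_N_nonneg:
  assumes c: "continuous_on K h" and nn: "\<And>x. x \<in> K \<Longrightarrow> 0 \<le> h x"
  shows "integrable N h" "(LINT x|N. h x) = I h"
proof -
  have m: "h \<in> borel_measurable N" by (rule continuous_measurable_N[OF c])
  have i: "integrable U01 (\<lambda>t. h (\<xi> \<alpha> p w i t))" for w i by (intro integrable_U01_continuous continuous_\<xi>_comp c)
  have "(\<integral>\<^sup>+x. ennreal (h x) \<partial>N) = (\<Sum>m. \<Sum>w | length w = m. \<Sum>i\<in>UNIV. ennreal (a * \<beta> ^ m) * (\<integral>\<^sup>+t. ennreal (h (\<xi> \<alpha> p w i t)) \<partial>U01))"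
    by (rule nn_integral_N) (use borel_measurable_continuous_on_restrict[OF c] in simp)
  also have "\<dots> = (\<Sum>m. ennreal (a * \<beta> ^ m * S m h))"
  proof (rule arg_cong[where f = suminf], rule ext)
    fix m
    have 1: "(\<integral>\<^sup>+t. ennreal (h (\<xi> \<alpha> p w i t)) \<partial>U01) = ennreal (LINT t|U01. h (\<xi> \<alpha> p w i t))" for w i
      by (rule nn_integral_eq_integral[OF i]) (auto simp: space_restrict_space intro!: AE_I2 nn \<xi>_K)
    have 2: "0 \<le> (LINT t|U01. h (\<xi> \<alpha> p w i t))" for w i
      by (rule integral_nonneg_AE) (auto simp: space_restrict_space intro!: AE_I2 nn \<xi>_K)
    show "(\<Sum>w | length w = m. \<Sum>i\<in>UNIV. ennreal (a * \<beta> ^ m) * (\<integral>\<^sup>+t. ennreal (h (\<xi> \<alpha> p w i t)) \<partial>U01))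
        = ennreal (a * \<beta> ^ m * S m h)"
      unfolding 1 S_words using a \<beta> 2
      by (simp add: sum_ennreal sum_nonneg sum_distrib_left[symmetric] ennreal_mult[symmetric])
  qed
  also have "\<dots> = ennreal (I h)"
    unfolding I_def using a \<beta> by (intro suminf_ennreal2 summable_S c mult_nonneg_nonneg S_nonneg nn) auto
  finally have e: "(\<integral>\<^sup>+x. ennreal (h x) \<partial>N) = ennreal (I h)" .
  have I0: "0 \<le> I h" using I_mono[OF continuous_on_const[of K 0] c nn] by (simp add: I_const)
  have "AE x in N. 0 \<le> h x" by (rule AE_I2) (simp add: space_N nn)
  then show "integrable N h" "(LINT x|N. h x) = I h"
    using nn_integral_eq_integrable[OF m _ I0] e by auto
qed

lemma integral_N:
  assumes c: "continuous_on K h"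
  shows "integrable N h" "(LINT x|N. h x) = I h"
proof -
  obtain B where B: "0 \<le> B" "\<forall>x\<in>K. \<bar>h x\<bar> \<le> B" using continuous_K_bounded[OF c] by blast
  have "0 \<le> h x + B" if "x \<in> K" for x using B(2)[rule_format, OF that] by simp
  note p = integral_N_nonneg[where h = "\<lambda>x. h x + B", OF continuous_on_add[OF c continuous_on_const] this]
  note q = integral_N_nonneg[where h = "\<lambda>x. B", OF continuous_on_const B(1)]
  have "integrable N (\<lambda>x. (h x + B) - B)" by (rule Bochner_Integration.integrable_diff[OF p(1) q(1)])
  then show "integrable N h" by simp
  have "(LINT x|N. (h x + B) - B) = (LINT x|N. h x + B) - (LINT x|N. B)"
    by (rule Bochner_Integration.integral_diff[OF p(1) q(1)])
  also have "\<dots> = I (\<lambda>x. h x + B) - I (\<lambda>x. B)" by (simp only: p(2) q(2))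
  also have "\<dots> = I h" using I_linear[OF c continuous_on_const[of K B], of 1 1] by simp
  finally show "(LINT x|N. h x) = I h" by simp
qed

text \<open>The vertices form a null set, since no open edge contains one.\<close>

lemma integral_interior:
  assumes c: "continuous_on K h"
  shows "integrable (restrict_space (mu_l \<alpha> p \<beta>) (K - V0 p)) h"
    "(LINT x|restrict_space (mu_l \<alpha> p \<beta>) (K - V0 p). h x) = I h"
proof -
  have V: "V0 p \<subseteq> K" "finite (V0 p)" by (auto simp: V0_def p_K)
  have sV: "V0 p \<in> sets N"
  proof -
    have "K \<inter> space borel \<in> sets borel" using K_compact by (simp add: borel_compact)
    moreover have "V0 p \<in> sets borel" by (intro borel_closed finite_imp_closed V)
    ultimately show ?thesis unfolding sets_N using V(1) by (simp only: sets_restrict_space_iff)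
  qed
  have KV: "K - V0 p \<in> sets N" using sets.compl_sets[OF sV] unfolding space_N .
  moreover have "(K - V0 p) \<inter> space N = K - V0 p" unfolding space_N by blast
  ultimately have sK: "(K - V0 p) \<inter> space N \<in> sets N" by (simp only:)
  have "emeasure N (V0 p) = (\<integral>\<^sup>+x. indicator (V0 p) x \<partial>N)" using sV by simp
  also have "\<dots> = (\<Sum>m. \<Sum>w | length w = m. \<Sum>i\<in>UNIV. ennreal (a * \<beta> ^ m) * (\<integral>\<^sup>+t. indicator (V0 p) (\<xi> \<alpha> p w i t) \<partial>U01))"
    using sV by (intro nn_integral_N) (simp add: sets_N)
  also have "\<dots> = 0"
  proof -
    have "(\<integral>\<^sup>+t. indicator (V0 p) (\<xi> \<alpha> p w i t) \<partial>U01) = (\<integral>\<^sup>+t. 0 \<partial>U01)" for w i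
      by (intro nn_integral_cong) (auto simp: space_restrict_space \<xi>_not_V0)
    then show ?thesis by simp
  qed
  finally have "V0 p \<in> null_sets N" using sV by (simp add: null_sets_def)
  then have ae: "AE x in N. x \<notin> V0 p" by (rule AE_not_in)
  have hm: "h \<in> borel_measurable N" by (rule continuous_measurable_N[OF c])
  have mm: "(\<lambda>x. indicator (K - V0 p) x *\<^sub>R h x) \<in> borel_measurable N"
    by (rule borel_measurable_scaleR[OF borel_measurable_indicator[OF KV] hm])
  have ae2: "AE x in N. indicator (K - V0 p) x *\<^sub>R h x = h x"
    using ae AE_space by eventually_elim (simp add: space_N)
  show "integrable (restrict_space (mu_l \<alpha> p \<beta>) (K - V0 p)) h"
    unfolding mu_l_eq integrable_restrict_space[OF sK]
    using integrable_cong_AE[OF mm hm ae2] integral_N(1)[OF c] by (simp only:)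
  show "(LINT x|restrict_space (mu_l \<alpha> p \<beta>) (K - V0 p). h x) = I h"
    unfolding mu_l_eq integral_restrict_space[OF sK] integral_N(2)[OF c, symmetric]
    by (rule integral_cong_AE[OF mm hm ae2])
qed

lemma continuous_measurable_interior:
  fixes h :: "real^2 \<Rightarrow> real"
  assumes c: "continuous_on K h"
  shows "h \<in> borel_measurable (restrict_space (mu_l \<alpha> p \<beta>) (K - V0 p))"
  using borel_measurable_integrable[OF integral_interior(1)[OF c]] .

end

subsection \<open>Functions on an edge\<close>

text \<open>Cauchy-Schwarz for the integral of the weak derivative over \<open>{s<..<t}\<close>,
  with the length of the interval estimated by 1.\<close>

lemma dyadic_oscillation:
  assumes f: "continuous_on {0..1} f" and B: "\<And>m. dyadic_form m f f \<le> B"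
    and st: "0 \<le> s" "s \<le> t" "t \<le> 1"
  shows "(f t - f s)\<^sup>2 \<le> B"
proof (cases "s = t")
  case True
  then show ?thesis using order_trans[OF dyadic_form_nonneg B] by simp
next
  case False
  have "f \<in> H1_01" by (rule H1_dyadic(1)[OF f B])
  then have ex: "\<exists>g. g \<in> L2_01 \<and> is_weak_deriv f g" by (auto simp: H1_01_def)
  have g: "weak_deriv f \<in> L2_01" "is_weak_deriv f (weak_deriv f)"
    using someI_ex[OF ex] unfolding weak_deriv_def by auto
  have J: "(LINT x|U01. (weak_deriv f x)\<^sup>2) \<le> B"
    using H1_dyadic(2)[OF f B] B unfolding set_integral_U01 by (intro LIMSEQ_le_const2) auto
  define h where "h x = indicator {s<..<t} x * weak_deriv f x" for x
  have hm: "integrable U01 h" unfolding h_def by (rule integrable_indicator_mult[OF L2_integrable[OF g(1)]])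
  have gi: "integrable U01 (\<lambda>x. (weak_deriv f x)\<^sup>2)" using g(1) by (simp add: L2_01_iff)
  have hle: "(h x)\<^sup>2 \<le> (weak_deriv f x)\<^sup>2" for x by (auto simp: h_def split: split_indicator)
  have hi: "integrable U01 (\<lambda>x. (h x)\<^sup>2)"
    by (rule Bochner_Integration.integrable_bound[OF gi])
       (use hm hle in \<open>auto intro!: borel_measurable_power borel_measurable_integrable\<close>)
  have hL: "h \<in> L2_01" using hm hi by (auto simp: L2_01_iff)
  have "(f t - f s)\<^sup>2 = (LINT x|U01. h x)\<^sup>2"
    using weak_deriv_FTC[OF f g, of s t] st False by (simp add: h_def)
  also have "\<dots> \<le> (LINT x|U01. (h x)\<^sup>2)" by (rule L2_integral_square[OF hL])
  also have "\<dots> \<le> (LINT x|U01. (weak_deriv f x)\<^sup>2)" by (rule integral_mono[OF hi gi hle])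
  finally show ?thesis using J by simp
qed

text \<open>The \<open>2 ^ n\<close> left end points of the dyadic intervals; 1 is omitted, as each
  interval is controlled from its left end.\<close>

primrec grid :: "nat \<Rightarrow> real list" where
  "grid 0 = [0]"
| "grid (Suc n) = map (\<lambda>x. x / 2) (grid n) @ map (\<lambda>x. (x + 1) / 2) (grid n)"

lemma length_grid: "length (grid n) = 2 ^ n"
  by (induction n) auto

lemma set_grid: "x \<in> set (grid n) \<Longrightarrow> 0 \<le> x \<and> x \<le> 1"
proof (induction n arbitrary: x)
  case (Suc n)
  then show ?case by (auto dest!: Suc.IH)
qed simp

lemma summands_le:
  fixes x y B :: real
  assumes "2 * (x + y) \<le> B" "0 \<le> x" "0 \<le> y" shows "x \<le> B" "y \<le> B"
  using assms by auto

lemma half_sum_bound: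
  fixes x y b c s t d :: real
  assumes "b + c \<le> d" "x \<le> b + 2 * s" "y \<le> c + 2 * t"
  shows "(x + y) / 2 \<le> (d + 2 * s + 2 * t) / 2"
  using assms by simp

lemma grid_poincare:
  assumes "continuous_on {0..1} f" "\<And>m. dyadic_form m f f \<le> B"
  shows "(LINT t|U01. (f t)\<^sup>2) \<le> 2 / 4 ^ n * B + 2 * (\<Sum>x\<leftarrow>grid n. (f x)\<^sup>2)"
  using assms
proof (induction n arbitrary: f B)
  case 0
  have "(f t)\<^sup>2 \<le> 2 * B + 2 * (f 0)\<^sup>2" if "0 < t" "t < 1" for t
  proof -
    have "(f t - f 0)\<^sup>2 \<le> B" using that by (intro dyadic_oscillation[OF 0]) auto
    moreover have "0 \<le> (f t - 2 * f 0)\<^sup>2" by simp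
    ultimately show ?thesis by (simp add: power2_eq_square algebra_simps)
  qed
  then have "(LINT t|U01. (f t)\<^sup>2) \<le> (LINT t|U01. 2 * B + 2 * (f 0)\<^sup>2)"
    by (intro integral_mono integrable_U01_continuous continuous_intros 0) (auto simp: space_restrict_space)
  then show ?case by (simp add: space_restrict_space)
next
  case (Suc n)
  let ?l = "\<lambda>t. f (t / 2)" and ?r = "\<lambda>t. f ((t + 1) / 2)"
  have c: "continuous_on {0..1} ?l" "continuous_on {0..1} ?r"
    by (auto intro!: continuous_on_compose2[OF Suc.prems(1)] continuous_intros)
  have s: "2 * (dyadic_form m ?l ?l + dyadic_form m ?r ?r) \<le> B" for m using Suc.prems(2)[of "Suc m"] by simp
  have b1: "dyadic_form m ?l ?l \<le> B" for m
    by (rule summands_le(1)[OF s dyadic_form_nonneg dyadic_form_nonneg])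
  have b2: "dyadic_form m ?r ?r \<le> B" for m
    by (rule summands_le(2)[OF s dyadic_form_nonneg dyadic_form_nonneg])
  have inc: "incseq (\<lambda>m. dyadic_form m g g)" for g using dyadic_form_mono by (rule incseq_SucI)
  \<comment> \<open>The induction hypothesis is applied with the separate limits \<open>Bl\<close>
    and \<open>Br\<close>, for which \<open>2 * (Bl + Br) \<le> B\<close>. With \<open>B\<close> on
    both halves the decay in \<open>n\<close> would be lost.\<close>
  have "\<exists>Bl. (\<lambda>m. dyadic_form m ?l ?l) \<longlonglongrightarrow> Bl" using incseq_convergent[OF inc] b1 by blast
  then obtain Bl where Bl: "(\<lambda>m. dyadic_form m ?l ?l) \<longlonglongrightarrow> Bl" ..
  have "\<exists>Br. (\<lambda>m. dyadic_form m ?r ?r) \<longlonglongrightarrow> Br" using incseq_convergent[OF inc] b2 by blast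
  then obtain Br where Br: "(\<lambda>m. dyadic_form m ?r ?r) \<longlonglongrightarrow> Br" ..
  have "(\<lambda>m. 2 * (dyadic_form m ?l ?l + dyadic_form m ?r ?r)) \<longlonglongrightarrow> 2 * (Bl + Br)"
    by (intro tendsto_mult tendsto_add tendsto_const Bl Br)
  then have sum: "2 * (Bl + Br) \<le> B" by (rule LIMSEQ_le_const2) (use s in blast)
  have l: "(LINT t|U01. (?l t)\<^sup>2) \<le> 2 / 4 ^ n * Bl + 2 * (\<Sum>x\<leftarrow>grid n. (?l x)\<^sup>2)"
    by (rule Suc.IH[OF c(1)]) (rule incseq_le[OF inc Bl])
  have r: "(LINT t|U01. (?r t)\<^sup>2) \<le> 2 / 4 ^ n * Br + 2 * (\<Sum>x\<leftarrow>grid n. (?r x)\<^sup>2)"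
    by (rule Suc.IH[OF c(2)]) (rule incseq_le[OF inc Br])
  have i: "integrable U01 (\<lambda>t. (f t)\<^sup>2)" by (intro integrable_U01_continuous continuous_intros Suc.prems)
  have nn: "0 \<le> (\<Sum>x\<leftarrow>grid n. (?l x)\<^sup>2)" "0 \<le> (\<Sum>x\<leftarrow>grid n. (?r x)\<^sup>2)" by (auto intro!: sum_list_nonneg)
  have g: "(\<Sum>x\<leftarrow>grid (Suc n). (f x)\<^sup>2) = (\<Sum>x\<leftarrow>grid n. (?l x)\<^sup>2) + (\<Sum>x\<leftarrow>grid n. (?r x)\<^sup>2)"
    by (simp add: o_def)
  have "2 / 4 ^ n * Bl + 2 / 4 ^ n * Br = (1 / 4 ^ n) * (2 * (Bl + Br))" by (simp add: algebra_simps)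
  also have "\<dots> \<le> (1 / 4 ^ n) * B" using sum by (intro mult_left_mono) auto
  finally have "(LINT t|U01. (f t)\<^sup>2) \<le> (1 / 4 ^ n * B + 2 * (\<Sum>x\<leftarrow>grid n. (?l x)\<^sup>2) + 2 * (\<Sum>x\<leftarrow>grid n. (?r x)\<^sup>2)) / 2"
    unfolding U01_halves(3)[OF i] using l r by (rule half_sum_bound)
  also have "\<dots> \<le> 2 / 4 ^ Suc n * B + 2 * (\<Sum>x\<leftarrow>grid (Suc n). (f x)\<^sup>2)"
    unfolding g using nn by simp
  finally show ?case .
qed

subsection \<open>The form on its domain\<close>

locale gasket_spectral = gasket_form \<alpha> p r + gasket_measure \<alpha> p \<beta> for \<alpha> p r \<beta>
begin

text \<open>The domain without the convention on values outside \<open>K\<close>: restriction to a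
  cell, \<open>u (G j x)\<close>, preserves this property but not vanishing outside
  \<open>K\<close>.\<close>

definition adm :: "(real^2 \<Rightarrow> real) \<Rightarrow> bool" where
  "adm u \<longleftrightarrow> continuous_on K u \<and> (\<exists>B. \<forall>m. A m u u \<le> B)"

lemma D_adm: "D = {u. adm u \<and> (\<forall>x. x \<notin> K \<longrightarrow> u x = 0)}"
  unfolding D_def adm_def by blast

lemma adm_continuous: "adm u \<Longrightarrow> continuous_on K u"
  by (simp add: adm_def)

lemma adm_A_le: "adm u \<Longrightarrow> A m u u \<le> E u u"
  unfolding adm_def using A_le_E by blast

lemma adm_I: "continuous_on K u \<Longrightarrow> (\<And>m. A m u u \<le> B) \<Longrightarrow> adm u"
  unfolding adm_def by blast

lemma adm_tendsto: "adm u \<Longrightarrow> adm v \<Longrightarrow> (\<lambda>m. A m u v) \<longlonglongrightarrow> E u v"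
  using A_tendsto_E[OF adm_A_le adm_A_le] .

lemma E_le: "adm u \<Longrightarrow> (\<And>m. A m u u \<le> B) \<Longrightarrow> E u u \<le> B"
  by (rule LIMSEQ_le_const2[OF adm_tendsto]) auto

lemma adm_comb:
  assumes "adm u" "adm v" shows "adm (\<lambda>x. b * u x + c * v x)"
proof (rule adm_I)
  show "continuous_on K (\<lambda>x. b * u x + c * v x)" using assms adm_continuous by (intro continuous_intros) auto
  show "A m (\<lambda>x. b * u x + c * v x) (\<lambda>x. b * u x + c * v x) \<le> 2 * b\<^sup>2 * E u u + 2 * c\<^sup>2 * E v v" for m
    by (rule order_trans[OF A_add_le]) (intro add_mono mult_left_mono adm_A_le assms, auto)
qed

lemma adm_cell: "adm u \<Longrightarrow> adm (\<lambda>x. u (G j x))"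
  using A_cell_bounded[OF adm_A_le] continuous_cell[OF adm_continuous] by (intro adm_I) auto

lemma adm_dyadic: "adm u \<Longrightarrow> dyadic_form m (\<lambda>t. u (sg i t)) (\<lambda>t. u (sg i t)) \<le> J (\<lambda>t. u (sg i t))"
  by (rule dyadic_le_J[OF dyadic_bounded[OF adm_A_le]])

lemma adm_self_similar: "adm u \<Longrightarrow> E u u
    = (1 / r) * (\<Sum>j\<in>UNIV. E (\<lambda>x. u (G j x)) (\<lambda>x. u (G j x))) + (1 / \<rho>) * (\<Sum>i\<in>UNIV. J (\<lambda>t. u (sg i t)))"
  by (rule E_self_similar[OF adm_A_le])

lemma J_le: "adm u \<Longrightarrow> J (\<lambda>t. u (sg i t)) \<le> \<rho> * E u u"
proof -
  assume u: "adm u"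
  show ?thesis
    by (rule LIMSEQ_le_const2[OF dyadic_tendsto_J[OF dyadic_bounded[OF adm_A_le[OF u]]]])
       (intro exI allI impI dyadic_bounded adm_A_le u)
qed

lemma J_nonneg: "adm u \<Longrightarrow> 0 \<le> J (\<lambda>t. u (sg i t))"
  using adm_dyadic[of u 0 i] dyadic_form_nonneg[of 0 "\<lambda>t. u (sg i t)"] by linarith

lemma E_nonneg: "adm u \<Longrightarrow> 0 \<le> E u u"
  using adm_A_le[of u 0] A_nonneg[of 0 u] by linarith

lemma E_cell_le: "adm u \<Longrightarrow> E (\<lambda>x. u (G j x)) (\<lambda>x. u (G j x)) \<le> r * E u u"
  by (rule E_le[OF adm_cell A_cell_bounded[OF adm_A_le]])

lemma E_cong: "(\<And>x. x \<in> K \<Longrightarrow> u x = u' x) \<Longrightarrow> (\<And>x. x \<in> K \<Longrightarrow> v x = v' x) \<Longrightarrow> E u v = E u' v'"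
  unfolding E_def using A_cong[of u u' v v'] by simp

lemma adm_cong: "adm u \<Longrightarrow> (\<And>x. x \<in> K \<Longrightarrow> u x = u' x) \<Longrightarrow> adm u'"
  unfolding adm_def using A_cong[of u u' u u'] continuous_on_cong[of K K u u'] by simp

lemma E_linear: "adm u \<Longrightarrow> adm v \<Longrightarrow> adm w \<Longrightarrow> E (\<lambda>x. b * u x + c * v x) w = b * E u w + c * E v w"
proof -
  assume a: "adm u" "adm v" "adm w"
  have "(\<lambda>m. A m (\<lambda>x. b * u x + c * v x) w) \<longlonglongrightarrow> b * E u w + c * E v w"
    unfolding A_linear by (intro tendsto_intros adm_tendsto a)
  then show ?thesis using adm_tendsto[OF adm_comb[OF a(1,2)] a(3)] LIMSEQ_unique by blast
qed

lemma E_sym: "E u v = E v u"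
  unfolding E_def by (simp add: A_sym)

lemma vertex_difference:
  assumes "adm u" shows "\<bar>u (p i) - u (p j)\<bar> \<le> sqrt (E u u)"
proof -
  have s: "(u (p i) - u (p (i + 1)))\<^sup>2 \<le> E u u" for i
  proof -
    have "(u (p i) - u (p (i + 1))) * (u (p i) - u (p (i + 1))) \<le> A 0 u u"
      unfolding A.simps(1) by (rule member_le_sum) auto
    then show ?thesis using adm_A_le[OF assms, of 0] by (simp add: power2_eq_square del: A.simps)
  qed
  have e: "j + 2 + 1 = j" for j :: 3 using exhaust_3[of j] by auto
  consider "j = i" | "j = i + 1" | "j = i + 2" using three_cases by blast
  then have "(u (p i) - u (p j))\<^sup>2 \<le> E u u"
    using s[of i] s[of "i + 2"] E_nonneg[OF assms] by cases (auto simp: e power2_commute)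
  then show ?thesis by (intro real_le_rsqrt) (simp only: power2_abs)
qed

text \<open>The 3 covers the moves from an edge point to a vertex: along the edge, across a cell,
  between two vertices. The denominator sums a geometric series over nested cells, each of which
  scales the root of the energy by \<open>sqrt r\<close>.\<close>

definition "C = 3 / (1 - sqrt r)"

lemma sqrt_r: "0 < sqrt r" "sqrt r < 1" using r by (auto simp: real_less_lsqrt)

lemma C: "3 \<le> C" "C * sqrt r + 1 \<le> C"
proof -
  have 1: "0 < 1 - sqrt r" using sqrt_r by simp
  show "3 \<le> C" unfolding C_def using 1 sqrt_r by (simp add: le_divide_eq)
  have "3 / z * z = 3" if "0 < z" for z :: real using that by simp
  from this[OF 1] have "C * (1 - sqrt r) = 3" unfolding C_def .
  then show "C * sqrt r + 1 \<le> C" by (simp add: algebra_simps)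
qed

lemma oscillation_bound:
  assumes u: "adm u" and x: "x \<in> K" shows "\<bar>u x - u (p i)\<bar> \<le> C * sqrt (E u u)"
proof (rule K_limit_le[OF _ x])
  show "continuous_on K (\<lambda>x. \<bar>u x - u (p i)\<bar>)" using adm_continuous[OF u] by (intro continuous_intros)
  fix y assume "y \<in> orbit"
  then show "\<bar>u y - u (p i)\<bar> \<le> C * sqrt (E u u)"
    using u
  proof (induction y arbitrary: u i rule: orbit_induct)
    case (edge k t)
    have r1: "r \<le> 1" "\<rho> \<le> 1" using r by (auto simp: \<rho>_def)
    have E0: "0 \<le> E u u" by (rule E_nonneg[OF edge(3)])
    have "(u (sg k t) - u (sg k 0))\<^sup>2 \<le> J (\<lambda>t. u (sg k t))"
      using edge by (intro dyadic_oscillation[OF continuous_edge[OF adm_continuous] adm_dyadic]) auto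
    also have "\<dots> \<le> \<rho> * E u u" by (rule J_le[OF edge(3)])
    also have "\<dots> \<le> 1 * E u u" using r1 E0 by (intro mult_right_mono)
    finally have 1: "\<bar>u (sg k t) - u (sg k 0)\<bar> \<le> sqrt (E u u)" by (intro real_le_rsqrt) simp
    have "\<bar>u (G (k + 2) (p (k + 1))) - u (G (k + 2) (p (k + 2)))\<bar> \<le> sqrt (E (\<lambda>x. u (G (k + 2) x)) (\<lambda>x. u (G (k + 2) x)))"
      by (rule vertex_difference[OF adm_cell[OF edge(3)]])
    also have "\<dots> \<le> sqrt (E u u)"
      using E_cell_le[OF edge(3), of "k + 2"] mult_right_mono[OF r1(1) E0] by (intro real_sqrt_le_mono) linarith
    finally have 2: "\<bar>u (sg k 0) - u (p (k + 2))\<bar> \<le> sqrt (E u u)" by (simp add: sg_0 G_fix)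
    have 3: "\<bar>u (p (k + 2)) - u (p i)\<bar> \<le> sqrt (E u u)" by (rule vertex_difference[OF edge(3)])
    have "3 * sqrt (E u u) \<le> C * sqrt (E u u)" using C(1) E0 by (intro mult_right_mono) auto
    then show ?case using 1 2 3 by linarith
  next
    case (cell j y)
    have E0: "0 \<le> E u u" by (rule E_nonneg[OF cell(3)])
    have "\<bar>u (G j y) - u (G j (p j))\<bar> \<le> C * sqrt (E (\<lambda>x. u (G j x)) (\<lambda>x. u (G j x)))"
      by (rule cell.IH[OF adm_cell[OF cell(3)]])
    also have "\<dots> \<le> C * sqrt (r * E u u)"
      using C(1) E_cell_le[OF cell(3)] by (intro mult_left_mono real_sqrt_le_mono) auto
    finally have 1: "\<bar>u (G j y) - u (p j)\<bar> \<le> (C * sqrt r) * sqrt (E u u)" by (simp add: G_fix real_sqrt_mult)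
    have 2: "\<bar>u (p j) - u (p i)\<bar> \<le> 1 * sqrt (E u u)" using vertex_difference[OF cell(3)] by simp
    have "(C * sqrt r) * sqrt (E u u) + 1 * sqrt (E u u) \<le> C * sqrt (E u u)"
      using mult_right_mono[OF C(2), of "sqrt (E u u)"] E0 by (simp add: distrib_right)
    then show ?case using 1 2 by linarith
  qed
qed

lemma continuous_square: "adm u \<Longrightarrow> continuous_on K (\<lambda>x. (u x)\<^sup>2)"
  by (intro continuous_intros adm_continuous)

text \<open>The source of the assumption \<open>compact\<close>. Sample points form a list, so that
  samples in cells and on edges are joined by concatenation and repetitions do no harm.\<close>

definition compactness :: "real \<Rightarrow> bool" where
  "compactness \<epsilon> \<longleftrightarrow> (\<exists>X c. set X \<subseteq> K \<and> 0 \<le> c \<and>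
    (\<forall>u. adm u \<longrightarrow> I (\<lambda>x. (u x)\<^sup>2) \<le> \<epsilon> * E u u + c * (\<Sum>x\<leftarrow>X. (u x)\<^sup>2)))"

lemma compactness_base: "compactness (2 * C\<^sup>2)"
  unfolding compactness_def
proof (intro exI[of _ "[p 1]"] exI[of _ 2] conjI allI impI)
  fix u assume u: "adm u"
  have "(u x)\<^sup>2 \<le> 2 * C\<^sup>2 * E u u + 2 * (u (p 1))\<^sup>2" if "x \<in> K" for x
  proof -
    have "\<bar>u x - u (p 1)\<bar>\<^sup>2 \<le> (C * sqrt (E u u))\<^sup>2" by (rule power_mono[OF oscillation_bound[OF u that]]) simp
    then have "(u x - u (p 1))\<^sup>2 \<le> C\<^sup>2 * E u u" using E_nonneg[OF u] by (simp add: power_mult_distrib)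
    moreover have "0 \<le> (u x - 2 * u (p 1))\<^sup>2" by simp
    ultimately show ?thesis by (simp add: power2_eq_square algebra_simps)
  qed
  then have "I (\<lambda>x. (u x)\<^sup>2) \<le> I (\<lambda>x. 2 * C\<^sup>2 * E u u + 2 * (u (p 1))\<^sup>2)"
    by (rule I_mono[OF continuous_square[OF u] continuous_on_const])
  then show "I (\<lambda>x. (u x)\<^sup>2) \<le> 2 * C\<^sup>2 * E u u + 2 * (\<Sum>x\<leftarrow>[p 1]. (u x)\<^sup>2)" by (simp add: I_const)
qed (auto simp: p_K)

lemma edge_poincare:
  assumes u: "adm u"
  shows "(LINT t|U01. (u (sg i t))\<^sup>2) \<le> 2 / 4 ^ n * J (\<lambda>t. u (sg i t)) + 2 * (\<Sum>x\<leftarrow>grid n. (u (sg i x))\<^sup>2)"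
  by (rule grid_poincare[OF continuous_edge[OF adm_continuous[OF u]] adm_dyadic[OF u]])

text \<open>The cells contribute the factor \<open>\<beta> * r\<close> by self-similarity, and on
  the edges a fine grid makes the constant as small as desired.\<close>

lemma compactness_step:
  assumes "compactness \<epsilon>" "0 < \<epsilon>" shows "compactness (\<beta> * r * \<epsilon>)"
proof -
  obtain X c where X: "set X \<subseteq> K" "0 \<le> c"
    and le: "\<forall>u. adm u \<longrightarrow> I (\<lambda>x. (u x)\<^sup>2) \<le> \<epsilon> * E u u + c * (\<Sum>x\<leftarrow>X. (u x)\<^sup>2)"
    using assms(1) unfolding compactness_def by blast
  have pos: "0 < \<beta> * r * \<epsilon> / (2 * a * \<rho>)" using \<beta> r a \<rho> assms(2) by simp
  \<comment> \<open>At this level the bound of \<open>edge_poincare\<close>, weighted by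
    \<open>a\<close>, costs at most \<open>\<beta> * r * \<epsilon>\<close> times the edge part of
    the energy, whose weight is \<open>1 / \<rho>\<close>.\<close>
  obtain n where "(1 / 4) ^ n < \<beta> * r * \<epsilon> / (2 * a * \<rho>)" using real_arch_pow_inv[OF pos, of "1 / 4"] by auto
  then have n: "a * (2 / 4 ^ n) \<le> \<beta> * r * \<epsilon> * (1 / \<rho>)" using a \<rho> by (simp add: power_divide field_simps)
  define P where "P u = (\<Sum>i\<in>UNIV. \<Sum>x\<leftarrow>grid n. (u (sg i x))\<^sup>2)" for u :: "real^2 \<Rightarrow> real"
  define R where "R u = (\<Sum>j\<in>UNIV. \<Sum>x\<leftarrow>X. (u (G j x))\<^sup>2)" for u :: "real^2 \<Rightarrow> real"
  define c' where "c' = max (2 * a) (\<beta> * c)"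
  define Y where "Y = concat (map (\<lambda>i. map (sg i) (grid n)) [1, 2, 3]) @ concat (map (\<lambda>j. map (G j) X) [1, 2, 3])"
  have Y: "set Y \<subseteq> K" using set_grid X(1) by (auto simp: Y_def intro!: sg_K G_K)
  have PY: "(\<Sum>x\<leftarrow>Y. (u x)\<^sup>2) = P u + R u" for u by (simp add: Y_def P_def R_def sum_3 o_def)
  have nn: "0 \<le> P u" "0 \<le> R u" for u by (auto simp: P_def R_def intro!: sum_nonneg sum_list_nonneg)
  have "I (\<lambda>x. (u x)\<^sup>2) \<le> \<beta> * r * \<epsilon> * E u u + c' * (\<Sum>x\<leftarrow>Y. (u x)\<^sup>2)" if u: "adm u" for u
  proof -
    let ?E = "\<lambda>j. E (\<lambda>x. u (G j x)) (\<lambda>x. u (G j x))" and ?J = "\<lambda>i. J (\<lambda>t. u (sg i t))"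
    have e1: "a * (\<Sum>i\<in>UNIV. LINT t|U01. (u (sg i t))\<^sup>2) \<le> \<beta> * r * \<epsilon> * ((1 / \<rho>) * (\<Sum>i\<in>UNIV. ?J i)) + 2 * a * P u"
    proof -
      have "a * (\<Sum>i\<in>UNIV. LINT t|U01. (u (sg i t))\<^sup>2)
          \<le> a * (\<Sum>i\<in>UNIV. 2 / 4 ^ n * ?J i + 2 * (\<Sum>x\<leftarrow>grid n. (u (sg i x))\<^sup>2))"
        using a by (intro mult_left_mono sum_mono edge_poincare u) auto
      also have "\<dots> = (a * (2 / 4 ^ n)) * (\<Sum>i\<in>UNIV. ?J i) + 2 * a * P u"
        by (simp add: P_def sum.distrib sum_distrib_left sum_divide_distrib algebra_simps)
      also have "\<dots> \<le> (\<beta> * r * \<epsilon> * (1 / \<rho>)) * (\<Sum>i\<in>UNIV. ?J i) + 2 * a * P u"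
        using n by (intro add_right_mono mult_right_mono sum_nonneg J_nonneg u)
      finally show ?thesis by (simp only: mult.assoc)
    qed
    have e2: "\<beta> * (\<Sum>j\<in>UNIV. I (\<lambda>x. (u (G j x))\<^sup>2)) \<le> \<beta> * r * \<epsilon> * ((1 / r) * (\<Sum>j\<in>UNIV. ?E j)) + \<beta> * c * R u"
    proof -
      have "\<beta> * (\<Sum>j\<in>UNIV. I (\<lambda>x. (u (G j x))\<^sup>2)) \<le> \<beta> * (\<Sum>j\<in>UNIV. \<epsilon> * ?E j + c * (\<Sum>x\<leftarrow>X. (u (G j x))\<^sup>2))"
        using \<beta> by (intro mult_left_mono sum_mono le[rule_format] adm_cell u) auto
      also have "\<dots> = \<beta> * r * \<epsilon> * ((1 / r) * (\<Sum>j\<in>UNIV. ?E j)) + \<beta> * c * R u"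
        using r by (simp add: R_def sum.distrib sum_distrib_left algebra_simps)
      finally show ?thesis .
    qed
    have "2 * a * P u + \<beta> * c * R u \<le> c' * P u + c' * R u"
      using nn by (intro add_mono mult_right_mono) (auto simp: c'_def)
    then have "I (\<lambda>x. (u x)\<^sup>2) \<le> \<beta> * r * \<epsilon> * ((1 / r) * (\<Sum>j\<in>UNIV. ?E j) + (1 / \<rho>) * (\<Sum>i\<in>UNIV. ?J i)) + c' * (P u + R u)"
      unfolding I_self_similar[OF continuous_square[OF u]] distrib_left using e1 e2 by linarith
    then show ?thesis unfolding PY adm_self_similar[OF u] .
  qed
  moreover have "0 \<le> c'" using a by (simp add: c'_def)
  ultimately show ?thesis unfolding compactness_def using Y by blast
qed

lemma \<beta>r: "0 < \<beta> * r" "\<beta> * r < 1"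
proof -
  show "0 < \<beta> * r" using \<beta> r by simp
  have "\<beta> * r < 1 * 1" by (rule mult_strict_mono) (use \<beta> r in auto)
  then show "\<beta> * r < 1" by simp
qed

lemma compactness_all:
  assumes "0 < \<epsilon>" shows "compactness \<epsilon>"
proof -
  have C0: "0 < 2 * C\<^sup>2" using C(1) by simp
  have it: "compactness ((\<beta> * r) ^ n * (2 * C\<^sup>2))" for n
  proof (induction n)
    case 0
    then show ?case using compactness_base by simp
  next
    case (Suc n)
    then show ?case using compactness_step[OF Suc] \<beta>r C0 by (simp add: mult_ac)
  qed
  have "0 < \<epsilon> / (2 * C\<^sup>2)" using assms C0 by (rule divide_pos_pos)
  then obtain n where "(\<beta> * r) ^ n < \<epsilon> / (2 * C\<^sup>2)" using real_arch_pow_inv \<beta>r(2) by blast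
  then have n: "(\<beta> * r) ^ n * (2 * C\<^sup>2) \<le> \<epsilon>" using C0 by (simp add: pos_less_divide_eq)
  from it[of n] obtain X c where X: "set X \<subseteq> K" "0 \<le> c"
    and le: "\<forall>u. adm u \<longrightarrow> I (\<lambda>x. (u x)\<^sup>2) \<le> (\<beta> * r) ^ n * (2 * C\<^sup>2) * E u u + c * (\<Sum>x\<leftarrow>X. (u x)\<^sup>2)"
    unfolding compactness_def by blast
  have "I (\<lambda>x. (u x)\<^sup>2) \<le> \<epsilon> * E u u + c * (\<Sum>x\<leftarrow>X. (u x)\<^sup>2)" if "adm u" for u
    using le[rule_format, OF that] mult_right_mono[OF n E_nonneg[OF that]] by linarith
  then show ?thesis unfolding compactness_def using X by blast
qed

text \<open>Each \<open>A m\<close> involves finitely many point values. In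
  \<open>complete_H\<close> this gives lower semicontinuity of the energy.\<close>

lemma A_pointwise_limit:
  assumes "\<And>x. x \<in> K \<Longrightarrow> (\<lambda>n. u n x) \<longlonglongrightarrow> v x" shows "(\<lambda>n. A m (u n) (u n)) \<longlonglongrightarrow> A m v v"
  using assms
proof (induction m arbitrary: u v)
  case 0
  have l: "(\<lambda>n. u n (p i)) \<longlonglongrightarrow> v (p i)" for i by (rule 0[OF p_K])
  show ?case unfolding A.simps(1) by (intro tendsto_intros l)
next
  case (Suc m)
  have d: "(\<lambda>n. dyadic_form k (f n) (f n)) \<longlonglongrightarrow> dyadic_form k g g"
    if "\<And>t. 0 \<le> t \<Longrightarrow> t \<le> 1 \<Longrightarrow> (\<lambda>n. f n t) \<longlonglongrightarrow> g t" for k and f :: "nat \<Rightarrow> real \<Rightarrow> real" and g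
    using that
  proof (induction k arbitrary: f g)
    case 0
    show ?case unfolding dyadic_form.simps(1) by (intro tendsto_intros 0) auto
  next
    case (Suc k)
    show ?case unfolding dyadic_form.simps(2) by (intro tendsto_intros Suc.IH Suc.prems) auto
  qed
  show ?case unfolding A.simps(2) by (intro tendsto_intros Suc.IH d Suc.prems G_K sg_K)
qed

section \<open>The Dirichlet domain as a pair of forms\<close>

definition H :: "(real^2 \<Rightarrow> real) set" where
  "H = {u. adm u \<and> (\<forall>x. x \<notin> K \<longrightarrow> u x = 0) \<and> (\<forall>i. u (p i) = 0)}"

lemma H_adm: "u \<in> H \<Longrightarrow> adm u" and H_p: "u \<in> H \<Longrightarrow> u (p i) = 0" and H_out: "u \<in> H \<Longrightarrow> x \<notin> K \<Longrightarrow> u x = 0"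
  by (simp_all add: H_def)

lemma H_eqI: "u \<in> H \<Longrightarrow> v \<in> H \<Longrightarrow> (\<And>x. x \<in> K \<Longrightarrow> u x = v x) \<Longrightarrow> u = v"
proof
  fix x assume "u \<in> H" "v \<in> H" "\<And>x. x \<in> K \<Longrightarrow> u x = v x"
  then show "u x = v x" by (cases "x \<in> K") (simp_all add: H_out)
qed

lemma comb_fun: "b *\<^sub>R u + c *\<^sub>R v = (\<lambda>x. b * u x + c * v x)" for u v :: "real^2 \<Rightarrow> real"
  by (simp add: scaleR_fun_def plus_fun_def)

lemma H_comb: "u \<in> H \<Longrightarrow> v \<in> H \<Longrightarrow> b *\<^sub>R u + c *\<^sub>R v \<in> H"
  unfolding comb_fun using adm_comb[of u v b c] by (simp add: H_def)

lemma H_bound: "u \<in> H \<Longrightarrow> x \<in> K \<Longrightarrow> (u x)\<^sup>2 \<le> C\<^sup>2 * E u u"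
proof -
  assume u: "u \<in> H" and x: "x \<in> K"
  have "\<bar>u x - u (p 1)\<bar>\<^sup>2 \<le> (C * sqrt (E u u))\<^sup>2"
    by (rule power_mono[OF oscillation_bound[OF H_adm[OF u] x]]) simp
  then show ?thesis using E_nonneg[OF H_adm[OF u]] H_p[OF u] by (simp add: power_mult_distrib)
qed

lemma zero_adm: "adm (\<lambda>x. 0)"
proof (rule adm_I)
  show "A m (\<lambda>x. 0) (\<lambda>x. 0) \<le> 0" for m
    using A_linear[of m 0 "\<lambda>x. 0" 0 "\<lambda>x. 0" "\<lambda>x. 0"] by simp
qed (rule continuous_on_const)

lemma subspace_H: "subspace H"
  unfolding subspace_def
proof (intro conjI ballI allI)
  show "0 \<in> H" using zero_adm by (simp add: H_def zero_fun_def)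
  show "u + v \<in> H" if "u \<in> H" "v \<in> H" for u v using H_comb[OF that, of 1 1] by simp
  show "c *\<^sub>R u \<in> H" if "u \<in> H" for c u using H_comb[OF that that, of c 0] by simp
qed

definition L :: "(real^2 \<Rightarrow> real) \<Rightarrow> (real^2 \<Rightarrow> real) \<Rightarrow> real" where
  "L u v = I (\<lambda>x. u x * v x)"

lemma L_linear:
  assumes "adm u" "adm v" "adm w" shows "L (\<lambda>x. b * u x + c * v x) w = b * L u w + c * L v w"
proof -
  have "L (\<lambda>x. b * u x + c * v x) w = I (\<lambda>x. b * (u x * w x) + c * (v x * w x))"
    by (simp add: L_def algebra_simps)
  also have "\<dots> = b * L u w + c * L v w"
    unfolding L_def using assms adm_continuous by (intro I_linear continuous_intros) auto
  finally show ?thesis .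
qed

lemma L_square: "L u u = I (\<lambda>x. (u x)\<^sup>2)"
  by (simp add: L_def power2_eq_square)

lemma L_nonneg: "adm u \<Longrightarrow> 0 \<le> L u u"
  using I_mono[OF continuous_on_const[of K 0] continuous_square[of u]] by (simp add: L_square I_const)

sublocale EF: sym_form H E
proof
  show "E (b *\<^sub>R u + c *\<^sub>R v) w = b * E u w + c * E v w" if "u \<in> H" "v \<in> H" "w \<in> H" for u v w b c
    unfolding comb_fun by (rule E_linear[OF that[THEN H_adm]])
qed (use subspace_H E_sym E_nonneg H_adm in auto)

sublocale LF: sym_form H L
proof
  show "L (b *\<^sub>R u + c *\<^sub>R v) w = b * L u w + c * L v w" if "u \<in> H" "v \<in> H" "w \<in> H" for u v w b c
    unfolding comb_fun by (rule L_linear[OF that[THEN H_adm]])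
  show "L u v = L v u" for u v by (simp add: L_def mult.commute)
qed (use subspace_H L_nonneg H_adm in auto)

text \<open>The instance of \<open>bdd\<close>, named ahead of the interpretation so that point
  evaluations can be shown to satisfy it.\<close>

definition bddH :: "((real^2 \<Rightarrow> real) \<Rightarrow> real) \<Rightarrow> bool" where
  "bddH \<psi> \<longleftrightarrow> (\<forall>u\<in>H. \<forall>v\<in>H. \<forall>a b. \<psi> (a *\<^sub>R u + b *\<^sub>R v) = a * \<psi> u + b * \<psi> v) \<and>
      (\<exists>C\<ge>0. \<forall>u\<in>H. (\<psi> u)\<^sup>2 \<le> C * E u u)"

lemma bddH_point: "x \<in> K \<Longrightarrow> bddH (\<lambda>u. u x)"
  unfolding bddH_def
proof (intro conjI ballI allI exI[of _ "C\<^sup>2"])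
  show "(u x)\<^sup>2 \<le> C\<^sup>2 * E u u" if "x \<in> K" "u \<in> H" for u using H_bound that by blast
qed (auto simp: comb_fun)

lemma compact_H:
  assumes "0 < \<epsilon>"
  shows "\<exists>\<Phi> C. finite \<Phi> \<and> (\<forall>\<psi>\<in>\<Phi>. bddH \<psi>) \<and> 0 \<le> C \<and>
      (\<forall>u\<in>H. L u u \<le> \<epsilon> * E u u + C * (\<Sum>\<psi>\<in>\<Phi>. (\<psi> u)\<^sup>2))"
proof -
  from compactness_all[OF assms] obtain X c where X: "set X \<subseteq> K" "0 \<le> c"
    and le: "\<forall>u. adm u \<longrightarrow> I (\<lambda>x. (u x)\<^sup>2) \<le> \<epsilon> * E u u + c * (\<Sum>x\<leftarrow>X. (u x)\<^sup>2)"
    unfolding compactness_def by blast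
  define \<Phi> where "\<Phi> = (\<lambda>x u. u x :: real) ` set X"
  have fin: "finite \<Phi>" by (simp add: \<Phi>_def)
  have b: "\<forall>\<psi>\<in>\<Phi>. bddH \<psi>" using X(1) bddH_point by (auto simp: \<Phi>_def)
  have s: "(\<Sum>x\<leftarrow>Y. (u x)\<^sup>2) \<le> real (length Y) * (\<Sum>\<psi>\<in>\<Phi>. (\<psi> u)\<^sup>2)" if "set Y \<subseteq> set X" for Y u
    using that
  proof (induction Y)
    case (Cons y Y)
    then have "(\<lambda>u. u y) \<in> \<Phi>" by (auto simp: \<Phi>_def)
    then have "(u y)\<^sup>2 \<le> (\<Sum>\<psi>\<in>\<Phi>. (\<psi> u)\<^sup>2)"
      using member_le_sum[of "\<lambda>u. u y" \<Phi> "\<lambda>\<psi>. (\<psi> u)\<^sup>2"] fin by simp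
    then show ?case using Cons by (simp add: distrib_right)
  qed simp
  have "L u u \<le> \<epsilon> * E u u + (c * real (length X)) * (\<Sum>\<psi>\<in>\<Phi>. (\<psi> u)\<^sup>2)" if "u \<in> H" for u
    using le[rule_format, OF H_adm[OF that]] mult_left_mono[OF s[of X u] X(2)] by (simp add: L_square mult.assoc)
  moreover have "0 \<le> c * real (length X)" using X(2) by simp
  ultimately show ?thesis using fin b by blast
qed

text \<open>By \<open>H_bound\<close> energy convergence forces uniform convergence, which produces
  the limit. The bound on the energy of the differences passes to the limit separately at each level
  \<open>k\<close> of \<open>A k\<close>.\<close>

lemma complete_H:
  assumes X: "\<And>n. X n \<in> H"
    and cauchy: "\<And>e. e > 0 \<Longrightarrow> \<exists>N. \<forall>m\<ge>N. \<forall>n\<ge>N. E (X m - X n) (X m - X n) < e"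
  shows "\<exists>u\<in>H. (\<lambda>n. E (X n - u) (X n - u)) \<longlonglongrightarrow> 0"
proof -
  have dH: "X m - X n \<in> H" for m n by (intro EF.diff_in X)
  have C0: "0 < C" using C(1) by simp
  have uc: "\<exists>N. \<forall>m\<ge>N. \<forall>n\<ge>N. \<forall>x\<in>K. \<bar>X m x - X n x\<bar> < e" if e: "0 < e" for e
  proof -
    have "0 < (e / C)\<^sup>2" using e C0 by simp
    from cauchy[OF this] obtain N where N: "\<forall>m\<ge>N. \<forall>n\<ge>N. E (X m - X n) (X m - X n) < (e / C)\<^sup>2" ..
    have "\<bar>X m x - X n x\<bar> < e" if "m \<ge> N" "n \<ge> N" "x \<in> K" for m n x
    proof -
      have "((X m - X n) x)\<^sup>2 \<le> C\<^sup>2 * E (X m - X n) (X m - X n)" by (rule H_bound[OF dH that(3)])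
      also have "\<dots> < C\<^sup>2 * (e / C)\<^sup>2" using N that C0 by (intro mult_strict_left_mono) auto
      also have "\<dots> = e\<^sup>2" using C0 by (simp add: power_divide)
      finally have "\<bar>X m x - X n x\<bar>\<^sup>2 < e\<^sup>2" by simp
      then show ?thesis by (rule power2_less_imp_less) (use e in simp)
    qed
    then show ?thesis by blast
  qed
  define u where "u x = (if x \<in> K then lim (\<lambda>n. X n x) else 0)" for x
  have pt: "(\<lambda>n. X n x) \<longlonglongrightarrow> u x" if x: "x \<in> K" for x
  proof -
    have "Cauchy (\<lambda>n. X n x)" unfolding Cauchy_def dist_real_def using uc x by meson
    then show ?thesis using x by (simp add: u_def Cauchy_convergent_iff convergent_LIMSEQ_iff)
  qed
  have "uniform_limit K X u sequentially"
    unfolding uniform_limit_sequentially_iff dist_real_def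
  proof (intro allI impI)
    fix e :: real assume e: "0 < e"
    then obtain N where N: "\<forall>m\<ge>N. \<forall>n\<ge>N. \<forall>x\<in>K. \<bar>X m x - X n x\<bar> < e / 2" using uc[of "e / 2"] by auto
    have "\<bar>X n x - u x\<bar> < e" if n: "n \<ge> N" and x: "x \<in> K" for n x
    proof -
      have "(\<lambda>m. \<bar>X n x - X m x\<bar>) \<longlonglongrightarrow> \<bar>X n x - u x\<bar>" by (intro tendsto_intros pt x)
      then have "\<bar>X n x - u x\<bar> \<le> e / 2" by (rule LIMSEQ_le_const2) (use N n x less_imp_le in blast)
      then show ?thesis using e by simp
    qed
    then show "\<exists>N. \<forall>n\<ge>N. \<forall>x\<in>K. \<bar>X n x - u x\<bar> < e" by blast
  qed
  then have cu: "continuous_on K u"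
    by (rule uniform_limit_theorem[rotated]) (use X H_adm adm_continuous in \<open>auto intro!: always_eventually\<close>)
  have close: "A k (X n - u) (X n - u) \<le> e"
    if N: "\<forall>m\<ge>N. \<forall>n\<ge>N. E (X m - X n) (X m - X n) < e" and n: "n \<ge> N" for e N n k
  proof -
    have l: "(\<lambda>m. A k (X n - X m) (X n - X m)) \<longlonglongrightarrow> A k (X n - u) (X n - u)"
      by (rule A_pointwise_limit) (simp, intro tendsto_intros pt)
    have le: "A k (X n - X m) (X n - X m) \<le> e" if "m \<ge> N" for m
      using adm_A_le[OF H_adm[OF dH[of n m]], of k] N n that less_imp_le order_trans by meson
    show ?thesis by (rule LIMSEQ_le_const2[OF l]) (intro exI[of _ N] allI impI le)
  qed
  have cd: "continuous_on K (X n - u)" for n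
  proof -
    have "continuous_on K (\<lambda>x. X n x - u x)" using X H_adm adm_continuous cu by (intro continuous_intros) auto
    then show ?thesis by (simp add: fun_diff_def)
  qed
  obtain N1 where N1: "\<forall>m\<ge>N1. \<forall>n\<ge>N1. E (X m - X n) (X m - X n) < 1" using cauchy[of 1] by auto
  have ad: "adm (X N1 - u)" by (rule adm_I[OF cd close[OF N1 order_refl]])
  have "adm (\<lambda>x. 1 * X N1 x + (-1) * (X N1 - u) x)" by (rule adm_comb[OF H_adm[OF X] ad])
  then have "adm u" by simp
  moreover have "u (p i) = 0" for i
    using pt[OF p_K[of i]] unfolding H_p[OF X] by (simp add: LIMSEQ_const_iff)
  ultimately have uH: "u \<in> H" by (simp add: H_def u_def)
  moreover have "(\<lambda>n. E (X n - u) (X n - u)) \<longlonglongrightarrow> 0"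
  proof (rule LIMSEQ_I)
    fix e :: real assume e: "0 < e"
    then obtain N where N: "\<forall>m\<ge>N. \<forall>n\<ge>N. E (X m - X n) (X m - X n) < e / 2" using cauchy[of "e / 2"] by auto
    have "norm (E (X n - u) (X n - u) - 0) < e" if "n \<ge> N" for n
    proof -
      have ad: "adm (X n - u)" by (rule H_adm[OF EF.diff_in[OF X uH]])
      have "E (X n - u) (X n - u) \<le> e / 2" by (rule E_le[OF ad close[OF N that]])
      then show ?thesis using E_nonneg[OF ad] e by simp
    qed
    then show "\<exists>no. \<forall>n\<ge>no. norm (E (X n - u) (X n - u) - 0) < e" by blast
  qed
  ultimately show ?thesis by blast
qed

sublocale FP: form_pair H E L bddH
proof -
  show "form_pair H E L"
  proof
    show "u = 0" if u: "u \<in> H" "L u u = 0" for u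
    proof (rule H_eqI[OF u(1) EF.zero_in])
      show "u x = 0 x" if "x \<in> K" for x
        using I_square_zero[OF adm_continuous[OF H_adm[OF u(1)]] _ that] u(2) by (simp add: L_square)
    qed
  next
    fix \<epsilon> :: real assume "0 < \<epsilon>"
    from compact_H[OF this, unfolded bddH_def]
    show "\<exists>\<Phi> C. finite \<Phi> \<and> (\<forall>\<psi>\<in>\<Phi>. (\<forall>u\<in>H. \<forall>v\<in>H. \<forall>a b. \<psi> (a *\<^sub>R u + b *\<^sub>R v) = a * \<psi> u + b * \<psi> v) \<and>
      (\<exists>C\<ge>0. \<forall>u\<in>H. (\<psi> u)\<^sup>2 \<le> C * E u u)) \<and> 0 \<le> C \<and>
      (\<forall>u\<in>H. L u u \<le> \<epsilon> * E u u + C * (\<Sum>\<psi>\<in>\<Phi>. (\<psi> u)\<^sup>2))" .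
  next
    fix X :: "nat \<Rightarrow> real^2 \<Rightarrow> real"
    assume "\<And>n. X n \<in> H" "\<And>e. 0 < e \<Longrightarrow> \<exists>N. \<forall>m\<ge>N. \<forall>n\<ge>N. E (X m - X n) (X m - X n) < e"
    then show "\<exists>u\<in>H. (\<lambda>n. E (X n - u) (X n - u)) \<longlonglongrightarrow> 0" by (rule complete_H)
  qed
  show "bddH \<psi> \<equiv> (\<forall>u\<in>H. \<forall>v\<in>H. \<forall>a b. \<psi> (a *\<^sub>R u + b *\<^sub>R v) = a * \<psi> u + b * \<psi> v) \<and>
      (\<exists>C\<ge>0. \<forall>u\<in>H. (\<psi> u)\<^sup>2 \<le> C * E u u)" for \<psi>
    by (rule eq_reflection) (rule bddH_def)
qed

section \<open>Identification with the operator of the statement\<close>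

context
  fixes R :: "nat \<Rightarrow> real \<times> real"
  assumes R: "\<And>i. 1 \<le> i \<Longrightarrow> R i = (r, \<rho>)"
begin

lemma form_dom0_eq: "form_dom0 \<alpha> p R = H"
proof -
  have "form_dom \<alpha> p R = D" by (rule form_dom_eq) (rule R)
  then show ?thesis unfolding form_dom0_def D_adm H_def V0_def by auto
qed

lemma energy_form_eq:
  assumes u: "adm u" and v: "adm v" shows "energy_form \<alpha> p R u v = E u v"
proof -
  have "energy \<alpha> p R w = ennreal (E w w)" if "adm w" for w
    by (rule energy_eq_E) (rule R adm_continuous[OF that] adm_A_le[OF that]; assumption?)+
  then have e: "enn2real (energy \<alpha> p R w) = E w w" if "adm w" for w
    using that E_nonneg[OF that] by simp
  have s: "adm (\<lambda>x. 1 * u x + 1 * v x)" "adm (\<lambda>x. 1 * u x + (-1) * v x)" by (intro adm_comb u v)+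
  have "energy_form \<alpha> p R u v
      = (E (\<lambda>x. 1 * u x + 1 * v x) (\<lambda>x. 1 * u x + 1 * v x) - E (\<lambda>x. 1 * u x + (-1) * v x) (\<lambda>x. 1 * u x + (-1) * v x)) / 4"
    unfolding energy_form_def using e[OF s(1)] e[OF s(2)] by simp
  moreover have "(\<lambda>m. (A m (\<lambda>x. 1 * u x + 1 * v x) (\<lambda>x. 1 * u x + 1 * v x)
      - A m (\<lambda>x. 1 * u x + (-1) * v x) (\<lambda>x. 1 * u x + (-1) * v x)) / 4) \<longlonglongrightarrow>
      (E (\<lambda>x. 1 * u x + 1 * v x) (\<lambda>x. 1 * u x + 1 * v x) - E (\<lambda>x. 1 * u x + (-1) * v x) (\<lambda>x. 1 * u x + (-1) * v x)) / 4"
    by (intro tendsto_divide tendsto_diff adm_tendsto s tendsto_const) simp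
  moreover have "(\<lambda>m. (A m (\<lambda>x. 1 * u x + 1 * v x) (\<lambda>x. 1 * u x + 1 * v x)
      - A m (\<lambda>x. 1 * u x + (-1) * v x) (\<lambda>x. 1 * u x + (-1) * v x)) / 4) = (\<lambda>m. A m u v)"
    unfolding A_add by (simp add: fun_eq_iff)
  ultimately have "(\<lambda>m. A m u v) \<longlonglongrightarrow> energy_form \<alpha> p R u v" by (simp only:)
  then show ?thesis using adm_tendsto[OF u v] by (rule LIMSEQ_unique)
qed

lemma eigenspace_eq: "eigenspace \<alpha> p R (mu_l \<alpha> p \<beta>) \<kappa> = FP.ES \<kappa>"
proof -
  have 1: "(LINT x|restrict_space (mu_l \<alpha> p \<beta>) (K - V0 p). \<kappa> * u x * v x) = \<kappa> * L u v"
    if "u \<in> H" "v \<in> H" for u v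
  proof -
    have "continuous_on K (\<lambda>x. u x * v x)" using that H_adm adm_continuous by (intro continuous_intros) auto
    then show ?thesis using integral_interior(2) by (simp add: L_def mult.assoc)
  qed
  have 2: "(\<lambda>x. \<kappa> * u x) \<in> L2_fun (restrict_space (mu_l \<alpha> p \<beta>) (K - V0 p))" if "u \<in> H" for u
  proof -
    have c: "continuous_on K u" using that H_adm adm_continuous by blast
    show ?thesis unfolding L2_fun_def
      using integral_interior(1)[of "\<lambda>x. (\<kappa> * u x)\<^sup>2"] continuous_measurable_interior[of "\<lambda>x. \<kappa> * u x"] c
      by (simp add: continuous_intros)
  qed
  show ?thesis
    unfolding eigenspace_def dirichlet_op_def Let_def form_dom0_eq FP.ES_def
    using 1 2 energy_form_eq H_adm by auto
qed

lemma N_D_eq: "N_D \<alpha> p R (mu_l \<alpha> p \<beta>) x = FP.counting x"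
proof -
  have sc: "(\<lambda>(c::real) (u::real^2 \<Rightarrow> real) x. c * u x) = scaleR" by (simp add: scaleR_fun_def fun_eq_iff)
  show ?thesis
    unfolding N_D_def FP.counting_def eigenvalues_def multiplicity_of_def eigenspace_eq sc dim_raw_def
    by (simp add: zero_fun_def)
qed

end

end

subsection \<open>Extension by zero from a cell\<close>

lemma sum_fun_apply: "(\<Sum>i\<in>I. f i) x = (\<Sum>i\<in>I. f i x)" for f :: "'i \<Rightarrow> 'a \<Rightarrow> real"
  by (induction I rule: infinite_finite_induct) (simp_all add: plus_fun_def zero_fun_def)

lemma sum_scaleR_fun_apply: "(\<Sum>i\<in>I. c i *\<^sub>R f i) x = (\<Sum>i\<in>I. c i * f i x)" for f :: "'i \<Rightarrow> 'a \<Rightarrow> real"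
  by (simp add: sum_fun_apply scaleR_fun_def)

text \<open>Supplies the grid level for the upper bound: fine enough for the given spectral
  parameter, yet with a number of points of the order of its square root.\<close>

lemma power_of_4_between:
  assumes "0 \<le> y" shows "\<exists>n. y < 4 ^ n \<and> 2 ^ n \<le> 2 * sqrt y + 1"
proof -
  have "\<exists>n. y < 4 ^ n" using real_arch_pow[of 4 y] by simp
  then have l: "y < 4 ^ (LEAST n. y < 4 ^ n)" by (rule LeastI_ex)
  have "2 ^ (LEAST n. y < 4 ^ n) \<le> 2 * sqrt y + 1"
  proof (cases "LEAST n. y < 4 ^ n")
    case 0
    then show ?thesis using assms by simp
  next
    case (Suc m)
    then have "\<not> y < 4 ^ m" using not_less_Least[of m "\<lambda>n. y < 4 ^ n"] by simp
    then have "sqrt (4 ^ m) \<le> sqrt y" by simp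
    moreover have "sqrt (4 ^ m) = 2 ^ m" by (simp add: real_sqrt_power)
    ultimately show ?thesis unfolding Suc by simp
  qed
  then show ?thesis using l by blast
qed

context gasket_spectral
begin

definition Ginv :: "3 \<Rightarrow> real^2 \<Rightarrow> real^2" where
  "Ginv j x = p j + (1 / \<theta>) *\<^sub>R (x - p j)"

lemma Ginv_G: "Ginv j (G j x) = x"
  using \<theta> by (simp add: Ginv_def G_def)

lemma continuous_Ginv: "continuous_on X (Ginv j)"
  unfolding Ginv_def[abs_def] by (intro continuous_intros)

definition ext :: "3 \<Rightarrow> (real^2 \<Rightarrow> real) \<Rightarrow> real^2 \<Rightarrow> real" where
  "ext j b x = (if x \<in> G j ` K then b (Ginv j x) else 0)"

lemma ext_same: "y \<in> K \<Longrightarrow> ext j b (G j y) = b y"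
  by (simp add: ext_def Ginv_G)

lemma ext_other: "y \<in> K \<Longrightarrow> k \<noteq> j \<Longrightarrow> ext j b (G k y) = 0"
  using cells_disjoint(1)[of y _ k j] by (auto simp: ext_def)

text \<open>Open edges miss the cells, and their end points are vertices of cells, where
  \<open>b\<close> contributes zero. Hence extended functions on different cells do not
  interact.\<close>

lemma ext_edge:
  assumes b: "b \<in> H" and t: "0 \<le> t" "t \<le> 1" shows "ext j b (sg i t) = 0"
proof -
  have c: "ext j b (G k (p l)) = 0" for k l
    using ext_same[OF p_K, of j b l] ext_other[OF p_K, of k j b l] H_p[OF b] by (cases "k = j") auto
  consider "t = 0" | "t = 1" | "0 < t" "t < 1" using t by linarith
  then show ?thesis
  proof cases
    case 3
    then have "sg i t \<notin> G j ` K" using sg_not_cell by blast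
    then show ?thesis by (simp add: ext_def)
  qed (simp_all add: sg_0 sg_1 c)
qed

lemma ext_out: "x \<notin> K \<Longrightarrow> ext j b x = 0"
  using G_K by (auto simp: ext_def)

lemma continuous_ext:
  assumes b: "b \<in> H" shows "continuous_on K (ext j b)"
proof -
  \<comment> \<open>The rest of the gasket, with closed edges so that \<open>T\<close> is closed and
    the function can be glued along closed pieces.\<close>
  define T where "T = (\<Union>k\<in>-{j}. G k ` K) \<union> (\<Union>i. sg i ` {0..1})"
  have cG: "closed (G k ` K)" for k
    by (intro compact_imp_closed compact_continuous_image continuous_G K_compact)
  have cT: "closed T" unfolding T_def
    by (intro closed_Un closed_UN finite ballI cG compact_imp_closed compact_continuous_image continuous_sg compact_Icc)
  have z: "ext j b x = 0" if "x \<in> T" for x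
    using that ext_other ext_edge[OF b] by (auto simp: T_def)
  have K: "K \<subseteq> G j ` K \<union> T"
  proof
    fix x assume "x \<in> K"
    then show "x \<in> G j ` K \<union> T"
    proof (cases rule: K_cases)
      case (cell i y)
      then show ?thesis by (cases "i = j") (auto simp: T_def)
    next
      case (edge i t)
      then have "x \<in> sg i ` {0..1}" by auto
      then show ?thesis unfolding T_def by blast
    qed
  qed
  have "continuous_on (G j ` K \<union> T) (\<lambda>x. if x \<in> G j ` K then b (Ginv j x) else 0)"
  proof (rule continuous_on_cases[OF cG cT])
    show "continuous_on (G j ` K) (\<lambda>x. b (Ginv j x))"
      by (rule continuous_on_compose2[OF adm_continuous[OF H_adm[OF b]] continuous_Ginv]) (auto simp: Ginv_G)
    show "\<forall>x. x \<in> G j ` K \<and> x \<notin> G j ` K \<or> x \<in> T \<and> x \<in> G j ` K \<longrightarrow> b (Ginv j x) = 0"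
    proof (intro allI impI)
      fix x assume "x \<in> G j ` K \<and> x \<notin> G j ` K \<or> x \<in> T \<and> x \<in> G j ` K"
      then have "x \<in> T" "x \<in> G j ` K" by blast+
      then show "b (Ginv j x) = 0" using z[of x] by (simp add: ext_def)
    qed
  qed (rule continuous_on_const)
  then have "continuous_on (G j ` K \<union> T) (ext j b)" by (simp add: ext_def[abs_def])
  then show ?thesis by (rule continuous_on_subset[OF _ K])
qed

lemma A_zero: "A m (\<lambda>x. 0) v = 0"
  using A_linear[of m 0 "\<lambda>x. 0" 0 "\<lambda>x. 0" v] by simp

lemma dyadic_form_zero: "dyadic_form m (\<lambda>x. 0) g = 0"
  using dyadic_form_linear[of m 0 "\<lambda>x. 0" 0 "\<lambda>x. 0" g] by simp

lemma A_ext: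
  assumes b: "b \<in> H" shows "A (Suc m) (ext j b) v = (1 / r) * A m b (\<lambda>x. v (G j x))"
proof -
  have s: "A m (\<lambda>x. ext j b (G j x)) (\<lambda>x. v (G j x)) = A m b (\<lambda>x. v (G j x))"
    by (rule A_cong) (simp_all add: ext_same)
  have "A m (\<lambda>x. ext j b (G k x)) (\<lambda>x. v (G k x)) = A m (\<lambda>x. 0) (\<lambda>x. v (G k x))" if "k \<noteq> j" for k
    by (rule A_cong) (simp_all add: ext_other that)
  then have z: "A m (\<lambda>x. ext j b (G k x)) (\<lambda>x. v (G k x)) = 0" if "k \<noteq> j" for k using that by (simp add: A_zero)
  have d: "dyadic_form m (\<lambda>t. ext j b (sg i t)) (\<lambda>t. v (sg i t)) = 0" for i
  proof -
    have "dyadic_form m (\<lambda>t. ext j b (sg i t)) (\<lambda>t. v (sg i t)) = dyadic_form m (\<lambda>t. 0) (\<lambda>t. v (sg i t))"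
      by (rule dyadic_form_cong) (simp_all add: ext_edge[OF b])
    then show ?thesis by (simp add: dyadic_form_zero)
  qed
  show ?thesis unfolding A.simps(2) d sum_three[of _ j] s using z by simp
qed

lemma adm_ext:
  assumes b: "b \<in> H" shows "adm (ext j b)"
proof (rule adm_I[OF continuous_ext[OF b]])
  fix m
  have "A m (ext j b) (ext j b) \<le> A (Suc m) (ext j b) (ext j b)" by (rule A_mono)
  also have "\<dots> = (1 / r) * A m b (\<lambda>x. ext j b (G j x))" by (rule A_ext[OF b])
  also have "A m b (\<lambda>x. ext j b (G j x)) = A m b b" by (rule A_cong) (simp_all add: ext_same)
  also have "(1 / r) * A m b b \<le> (1 / r) * E b b" using r by (intro mult_left_mono adm_A_le H_adm b) auto
  finally show "A m (ext j b) (ext j b) \<le> (1 / r) * E b b" .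
qed

lemma ext_H: assumes b: "b \<in> H" shows "ext j b \<in> H"
proof -
  have "ext j b (p i) = 0" for i
    using ext_same[OF p_K, of j b i] ext_other[OF p_K, of i j b i] H_p[OF b] by (cases "i = j") (auto simp: G_fix)
  then show ?thesis using adm_ext[OF b] ext_out by (simp add: H_def)
qed

lemma E_ext:
  assumes b: "b \<in> H" and v: "adm v" shows "E (ext j b) v = (1 / r) * E b (\<lambda>x. v (G j x))"
proof -
  have "(\<lambda>m. A (Suc m) (ext j b) v) \<longlonglongrightarrow> E (ext j b) v"
    by (rule LIMSEQ_Suc[OF adm_tendsto[OF adm_ext[OF b] v]])
  moreover have "(\<lambda>m. A (Suc m) (ext j b) v) \<longlonglongrightarrow> (1 / r) * E b (\<lambda>x. v (G j x))"
    unfolding A_ext[OF b] by (intro tendsto_intros adm_tendsto H_adm b adm_cell v)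
  ultimately show ?thesis by (rule LIMSEQ_unique)
qed

lemma I_zero: "(\<And>x. x \<in> K \<Longrightarrow> h x = 0) \<Longrightarrow> I h = 0"
  using I_cong[of h "\<lambda>x. 0"] by (simp add: I_const)

lemma L_ext:
  assumes b: "b \<in> H" and v: "adm v" shows "L (ext j b) v = \<beta> * L b (\<lambda>x. v (G j x))"
proof -
  have c: "continuous_on K (\<lambda>x. ext j b x * v x)"
    using continuous_ext[OF b] adm_continuous[OF v] by (intro continuous_intros)
  have "(LINT t|U01. ext j b (sg i t) * v (sg i t)) = (LINT t|U01. 0)" for i
    by (rule U01_cong) (simp add: ext_edge[OF b])
  then have e: "(LINT t|U01. ext j b (sg i t) * v (sg i t)) = 0" for i by simp
  have s: "I (\<lambda>x. ext j b (G j x) * v (G j x)) = L b (\<lambda>x. v (G j x))"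
    unfolding L_def by (rule I_cong) (simp add: ext_same)
  have z: "I (\<lambda>x. ext j b (G k x) * v (G k x)) = 0" if "k \<noteq> j" for k
    by (rule I_zero) (simp add: ext_other that)
  show ?thesis unfolding L_def[of "ext j b"] I_self_similar[OF c] e sum_three[of _ j] s using z by simp
qed

subsection \<open>The counting function under rescaling\<close>

lemma J_zero: "(\<And>t. 0 \<le> t \<Longrightarrow> t \<le> 1 \<Longrightarrow> f t = 0) \<Longrightarrow> J f = 0"
proof -
  assume z: "\<And>t. 0 \<le> t \<Longrightarrow> t \<le> 1 \<Longrightarrow> f t = 0"
  have "dyadic_form m f f = dyadic_form m (\<lambda>t. 0) (\<lambda>t. 0)" for m by (rule dyadic_form_cong) (simp_all add: z)
  then show ?thesis unfolding J_def by (simp add: dyadic_form_zero limI)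
qed

lemma L_self_similar:
  assumes u: "adm u"
  shows "L u u = a * (\<Sum>i\<in>UNIV. LINT t|U01. (u (sg i t))\<^sup>2) + \<beta> * (\<Sum>j\<in>UNIV. L (\<lambda>x. u (G j x)) (\<lambda>x. u (G j x)))"
  unfolding L_square I_self_similar[OF continuous_square[OF u]] ..

lemma L_cong: "(\<And>x. x \<in> K \<Longrightarrow> u x = u' x) \<Longrightarrow> (\<And>x. x \<in> K \<Longrightarrow> v x = v' x) \<Longrightarrow> L u v = L u' v'"
  unfolding L_def by (rule I_cong) simp

text \<open>The trial functions are three copies of the spectral basis below
  \<open>\<beta> * r * x\<close>. On their span the cells decouple, and the Rayleigh quotient grows
  by the factor \<open>1 / (\<beta> * r)\<close>.\<close>

lemma counting_scale_lower: "3 * FP.counting (\<beta> * r * x) \<le> FP.counting x"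
proof -
  obtain B where B: "FP.orthonormal B" "card B = FP.counting (\<beta> * r * x)" "\<forall>b\<in>B. \<exists>\<kappa>\<le>\<beta> * r * x. b \<in> FP.ES \<kappa>"
    using FP.spectral_basis[of "\<beta> * r * x"] by (elim exE conjE) (rule that)
  have fin: "finite B" and BH: "\<And>b. b \<in> B \<Longrightarrow> b \<in> H" using B(1) by (auto simp: FP.orthonormal_def)
  define e where "e = (\<lambda>(j, b). ext j b)"
  define Z where "Z c = (\<Sum>i\<in>UNIV \<times> B. c i *\<^sub>R e i)" for c :: "3 \<times> (real^2 \<Rightarrow> real) \<Rightarrow> real"
  define Zj where "Zj c j = (\<Sum>b\<in>B. c (j, b) *\<^sub>R b)" for c :: "3 \<times> (real^2 \<Rightarrow> real) \<Rightarrow> real" and j :: 3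
  have eH: "e i \<in> H" if "i \<in> UNIV \<times> B" for i using that BH ext_H by (auto simp: e_def)
  have ZH: "Z c \<in> H" for c unfolding Z_def by (intro EF.sum_in eH)
  have ZjH: "Zj c j \<in> H" for c j unfolding Zj_def by (intro EF.sum_in BH)
  have Zx: "Z c x = (\<Sum>j\<in>UNIV. \<Sum>b\<in>B. c (j, b) * ext j b x)" for c x
    unfolding Z_def sum_scaleR_fun_apply e_def by (simp add: sum.cartesian_product split_def)
  have cell: "Z c (G k y) = Zj c k y" if "y \<in> K" for c k y
  proof -
    have "(\<Sum>b\<in>B. c (j, b) * ext j b (G k y)) = (if j = k then Zj c k y else 0)" for j
      using that by (auto simp: ext_same ext_other Zj_def sum_scaleR_fun_apply)
    then show ?thesis unfolding Zx by simp
  qed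
  have edge: "Z c (sg i t) = 0" if "0 \<le> t" "t \<le> 1" for c i t
    unfolding Zx using that BH by (simp add: ext_edge)
  have "card ((UNIV :: 3 set) \<times> B) \<le> FP.counting x"
  proof (rule FP.counting_lower[where e = e])
    show "finite ((UNIV :: 3 set) \<times> B)" using fin by simp
    show "e i \<in> H" if "i \<in> UNIV \<times> B" for i using eH that .
  next
    fix c
    have E: "E (Z c) (Z c) = (1 / r) * (\<Sum>j\<in>UNIV. E (Zj c j) (Zj c j))"
    proof -
      have "J (\<lambda>t. Z c (sg i t)) = 0" for i by (rule J_zero) (rule edge)
      moreover have "E (\<lambda>x. Z c (G j x)) (\<lambda>x. Z c (G j x)) = E (Zj c j) (Zj c j)" for j
        by (rule E_cong) (simp_all add: cell)
      ultimately show ?thesis unfolding adm_self_similar[OF H_adm[OF ZH]] by simp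
    qed
    have L: "L (Z c) (Z c) = \<beta> * (\<Sum>j\<in>UNIV. L (Zj c j) (Zj c j))"
    proof -
      have "(LINT t|U01. (Z c (sg i t))\<^sup>2) = (LINT t|U01. 0)" for i by (rule U01_cong) (simp add: edge)
      moreover have "L (\<lambda>x. Z c (G j x)) (\<lambda>x. Z c (G j x)) = L (Zj c j) (Zj c j)" for j
        by (rule L_cong) (simp_all add: cell)
      ultimately show ?thesis unfolding L_self_similar[OF H_adm[OF ZH]] by simp
    qed
    have le: "E (Zj c j) (Zj c j) \<le> \<beta> * r * x * L (Zj c j) (Zj c j)" for j
      by (rule FP.span_energy_le[OF B(1) bspec[OF B(3)], where c = "\<lambda>b. c (j, b)"]) (simp_all add: Zj_def)
    have "E (Z c) (Z c) \<le> (1 / r) * (\<Sum>j\<in>UNIV. \<beta> * r * x * L (Zj c j) (Zj c j))"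
      unfolding E using r by (intro mult_left_mono sum_mono le) auto
    also have "\<dots> = x * L (Z c) (Z c)" unfolding L using r by (simp add: sum_distrib_left mult_ac)
    finally show "E (\<Sum>i\<in>UNIV \<times> B. c i *\<^sub>R e i) (\<Sum>i\<in>UNIV \<times> B. c i *\<^sub>R e i)
      \<le> x * L (\<Sum>i\<in>UNIV \<times> B. c i *\<^sub>R e i) (\<Sum>i\<in>UNIV \<times> B. c i *\<^sub>R e i)" unfolding Z_def .
  next
    fix c i assume z: "(\<Sum>i\<in>UNIV \<times> B. c i *\<^sub>R e i) = 0" and i: "i \<in> (UNIV :: 3 set) \<times> B"
    obtain j b where jb: "i = (j, b)" "b \<in> B" using i by auto
    have "Zj c j y = 0 y" if "y \<in> K" for y
    proof -
      have "Z c = 0" using z by (simp add: Z_def)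
      then show ?thesis using cell[OF that, of c j] by (simp add: zero_fun_def)
    qed
    then have "Zj c j = 0" by (intro H_eqI[OF ZjH EF.zero_in])
    then show "c i = 0"
      using FP.orthonormal_coeff[OF B(1) jb(2), of "\<lambda>b. c (j, b)"] LF.zero_left[OF BH[OF jb(2)]] jb(1) by (simp add: Zj_def)
  qed
  then show ?thesis using B(2) by (simp add: card_cartesian_product)
qed

lemma cell_H:
  assumes u: "u \<in> H" and z: "\<And>i. u (G j (p i)) = 0"
  shows "(\<lambda>x. if x \<in> K then u (G j x) else 0) \<in> H"
proof -
  have "adm (\<lambda>x. if x \<in> K then u (G j x) else 0)"
    by (rule adm_cong[OF adm_cell[OF H_adm[OF u], of j]]) simp
  then show ?thesis using z p_K by (simp add: H_def)
qed

text \<open>The conditions are \<open>3 * card B\<close> orthogonality relations in the cells, 9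
  values at the vertices of the cells and \<open>3 * 2 ^ n\<close> grid values on the edges. They
  split \<open>E u u - x * L u u\<close> into nonnegative contributions of cells and edges.\<close>

lemma counting_scale_upper:
  assumes n: "2 * a * \<rho> * x < 4 ^ n"
  shows "FP.counting x \<le> 3 * FP.counting (\<beta> * r * x) + 9 + 3 * 2 ^ n"
proof -
  obtain B where B: "FP.orthonormal B" "card B = FP.counting (\<beta> * r * x)"
    and perp: "\<forall>v\<in>H. (\<forall>b\<in>B. L v b = 0) \<longrightarrow> E v v \<le> \<beta> * r * x * L v v \<longrightarrow> v = 0"
    using FP.spectral_basis[of "\<beta> * r * x"] by (elim exE conjE) (rule that)
  have fin: "finite B" and BH: "\<And>b. b \<in> B \<Longrightarrow> b \<in> H" using B(1) by (auto simp: FP.orthonormal_def)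
  define \<Psi>1 where "\<Psi>1 = (\<lambda>(j, b) u. L (\<lambda>x. u (G j x)) b) ` (UNIV \<times> B)"
  define \<Psi>2 where "\<Psi>2 = (\<lambda>(j, i) u. u (G j (p i)) :: real) ` UNIV"
  define \<Psi>3 where "\<Psi>3 = (\<lambda>(i, t) u. u (sg i t) :: real) ` (UNIV \<times> set (grid n))"
  define \<Psi> where "\<Psi> = \<Psi>1 \<union> \<Psi>2 \<union> \<Psi>3"
  have finP: "finite \<Psi>1" "finite \<Psi>2" "finite \<Psi>3" using fin by (simp_all add: \<Psi>1_def \<Psi>2_def \<Psi>3_def)
  have "card \<Psi>1 \<le> 3 * card B" unfolding \<Psi>1_def
    by (rule order_trans[OF card_image_le]) (use fin in \<open>simp_all add: card_cartesian_product\<close>)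
  moreover have "card \<Psi>2 \<le> 9" unfolding \<Psi>2_def
    by (rule order_trans[OF card_image_le]) simp_all
  moreover have "card \<Psi>3 \<le> 3 * 2 ^ n"
  proof -
    have "card \<Psi>3 \<le> 3 * card (set (grid n))" unfolding \<Psi>3_def
      by (rule order_trans[OF card_image_le]) (simp_all add: card_cartesian_product)
    then show ?thesis using card_length[of "grid n"] by (simp add: length_grid)
  qed
  moreover have "card \<Psi> \<le> card \<Psi>1 + card \<Psi>2 + card \<Psi>3"
    unfolding \<Psi>_def using card_Un_le[of "\<Psi>1 \<union> \<Psi>2" \<Psi>3] card_Un_le[of \<Psi>1 \<Psi>2] by linarith
  moreover have "FP.counting x \<le> card \<Psi>"
  proof (rule FP.counting_upper[where \<psi> = "\<lambda>\<psi>. \<psi>"])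
    show "finite \<Psi>" using finP by (simp add: \<Psi>_def)
  next
    fix \<psi> u v and b c :: real assume \<psi>: "\<psi> \<in> \<Psi>" and uv: "u \<in> H" "v \<in> H"
    have "L (\<lambda>x. b * u (G j x) + c * v (G j x)) w = b * L (\<lambda>x. u (G j x)) w + c * L (\<lambda>x. v (G j x)) w" if "w \<in> B" for j w
      by (rule L_linear) (intro adm_cell H_adm uv BH that)+
    then show "\<psi> (b *\<^sub>R u + c *\<^sub>R v) = b * \<psi> u + c * \<psi> v"
      using \<psi> unfolding comb_fun \<Psi>_def \<Psi>1_def \<Psi>2_def \<Psi>3_def by auto
  next
    fix u assume u: "u \<in> H" and z: "\<And>\<psi>. \<psi> \<in> \<Psi> \<Longrightarrow> \<psi> u = 0" and le: "E u u \<le> x * L u u"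
    have z1: "L (\<lambda>x. u (G j x)) b = 0" if "b \<in> B" for j b
      using z[of "\<lambda>u. L (\<lambda>x. u (G j x)) b"] that unfolding \<Psi>_def \<Psi>1_def by force
    have z2: "u (G j (p i)) = 0" for i j using z[of "\<lambda>u. u (G j (p i))"] unfolding \<Psi>_def \<Psi>2_def by force
    have z3: "u (sg i t) = 0" if "t \<in> set (grid n)" for i t
      using z[of "\<lambda>u. u (sg i t)"] that unfolding \<Psi>_def \<Psi>3_def by force
    have ua: "adm u" by (rule H_adm[OF u])
    define v where "v j = (\<lambda>x. if x \<in> K then u (G j x) else 0)" for j
    have vH: "v j \<in> H" for j unfolding v_def by (rule cell_H[OF u z2])
    have vE: "E (\<lambda>x. u (G j x)) (\<lambda>x. u (G j x)) = E (v j) (v j)" for j by (rule E_cong) (simp_all add: v_def)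
    have vL: "L (\<lambda>x. u (G j x)) (\<lambda>x. u (G j x)) = L (v j) (v j)" for j by (rule L_cong) (simp_all add: v_def)
    have vp: "L (v j) b = 0" if "b \<in> B" for j b
      using z1[OF that, of j] L_cong[of "v j" "\<lambda>x. u (G j x)" b b] by (simp add: v_def)
    have v0: "v j = 0" if "E (v j) (v j) \<le> \<beta> * r * x * L (v j) (v j)" for j
      using perp vH vp that by blast
    \<comment> \<open>The surplus of cell \<open>j\<close> in \<open>E u u - x * L u u\<close>. The
      vertex conditions put \<open>v j\<close> into \<open>H\<close>, the orthogonality relations
      make the surplus nonnegative, and it vanishes only for \<open>v j = 0\<close>.\<close>
    define ej where "ej j = (1 / r) * (E (v j) (v j) - \<beta> * r * x * L (v j) (v j))" for j
    have ej: "0 \<le> ej j" for j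
    proof (cases "v j = 0")
      case True
      then show ?thesis using EF.zero_left[OF EF.zero_in] LF.zero_left[OF LF.zero_in] by (simp add: ej_def)
    next
      case False
      then have "\<not> E (v j) (v j) \<le> \<beta> * r * x * L (v j) (v j)" using v0 by blast
      then show ?thesis using r by (simp add: ej_def)
    qed
    define Q where "Q i = (LINT t|U01. (u (sg i t))\<^sup>2)" for i
    \<comment> \<open>The surplus of edge \<open>i\<close>. With zero grid values the Poincare
      inequality bounds \<open>Q i\<close> by the edge energy, and the hypothesis on
      \<open>n\<close> makes the surplus control a positive multiple of \<open>Q i\<close>.\<close>
    define fi where "fi i = (1 / \<rho>) * J (\<lambda>t. u (sg i t)) - x * a * Q i" for i
    have Q0: "0 \<le> Q i" for i unfolding Q_def by (rule integral_nonneg_AE) simp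
    have fi: "(4 ^ n / (2 * \<rho>) - x * a) * Q i \<le> fi i" for i
    proof -
      have "(\<Sum>t\<leftarrow>grid n. (u (sg i t))\<^sup>2) = (\<Sum>t\<leftarrow>grid n. 0)"
        by (rule arg_cong[where f = sum_list], rule map_cong) (simp_all add: z3)
      then have "Q i \<le> 2 / 4 ^ n * J (\<lambda>t. u (sg i t))" using edge_poincare[OF ua, of i n] by (simp add: Q_def)
      then have "4 ^ n / (2 * \<rho>) * Q i \<le> 4 ^ n / (2 * \<rho>) * (2 / 4 ^ n * J (\<lambda>t. u (sg i t)))"
        using \<rho> by (intro mult_left_mono) auto
      also have "\<dots> = (1 / \<rho>) * J (\<lambda>t. u (sg i t))" by simp
      finally show ?thesis by (simp add: fi_def left_diff_distrib)
    qed
    have pos: "0 < 4 ^ n / (2 * \<rho>) - x * a"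
    proof -
      have "x * a * (2 * \<rho>) < 4 ^ n" using n by (simp add: mult_ac)
      then show ?thesis using \<rho> by (simp add: pos_less_divide_eq)
    qed
    have fi0: "0 \<le> fi i" for i using fi[of i] pos Q0[of i] by (meson mult_nonneg_nonneg less_imp_le order_trans)
    have "(\<Sum>j\<in>UNIV. ej j) + (\<Sum>i\<in>UNIV. fi i) = E u u - x * L u u"
    proof -
      have "(\<Sum>j\<in>UNIV. ej j) = (1 / r) * (\<Sum>j\<in>UNIV. E (v j) (v j)) - x * (\<beta> * (\<Sum>j\<in>UNIV. L (v j) (v j)))"
        using r by (simp add: ej_def sum_subtractf sum_distrib_left right_diff_distrib mult_ac)
      moreover have "(\<Sum>i\<in>UNIV. fi i) = (1 / \<rho>) * (\<Sum>i\<in>UNIV. J (\<lambda>t. u (sg i t))) - x * (a * (\<Sum>i\<in>UNIV. Q i))"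
        by (simp add: fi_def sum_subtractf sum_distrib_left mult_ac)
      ultimately show ?thesis unfolding adm_self_similar[OF ua] L_self_similar[OF ua] vE vL Q_def[symmetric]
        by (simp add: distrib_left)
    qed
    then have s0: "(\<Sum>j\<in>UNIV. ej j) + (\<Sum>i\<in>UNIV. fi i) \<le> 0" using le by simp
    have sn: "0 \<le> (\<Sum>j\<in>UNIV. ej j)" "0 \<le> (\<Sum>i\<in>UNIV. fi i)" by (auto intro!: sum_nonneg ej fi0)
    have e0: "ej j = 0" for j
    proof -
      have "(\<Sum>j\<in>UNIV. ej j) = 0" using s0 sn by linarith
      then show ?thesis using ej by (simp add: sum_nonneg_eq_0_iff)
    qed
    have f0: "fi i = 0" for i
    proof -
      have "(\<Sum>i\<in>UNIV. fi i) = 0" using s0 sn by linarith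
      then show ?thesis using fi0 by (simp add: sum_nonneg_eq_0_iff)
    qed
    have "v j = 0" for j using e0[of j] r by (intro v0) (simp add: ej_def)
    then have "L (v j) (v j) = 0" for j using LF.zero_left[OF LF.zero_in] by simp
    moreover have "Q i = 0" for i
    proof -
      have "(4 ^ n / (2 * \<rho>) - x * a) * Q i \<le> (4 ^ n / (2 * \<rho>) - x * a) * 0" using fi[of i] f0[of i] by simp
      then show ?thesis using pos Q0[of i] by (simp only: mult_le_cancel_left_pos)
    qed
    ultimately have "L u u = 0" unfolding L_self_similar[OF ua] vL Q_def[symmetric] by simp
    then show "u = 0" by (rule FP.L_zero[OF u])
  qed
  ultimately show ?thesis using B(2) by linarith
qed

lemma counting_scale_upper_sqrt:
  assumes x: "0 < x"
  shows "real (FP.counting x) \<le> 3 * real (FP.counting (\<beta> * r * x)) + (12 + 6 * sqrt (2 * a * \<rho>)) * (sqrt x + 1)"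
proof -
  have y: "0 \<le> 2 * a * \<rho> * x" using a \<rho> x by simp
  from power_of_4_between[OF y] obtain n where n: "2 * a * \<rho> * x < 4 ^ n" "2 ^ n \<le> 2 * sqrt (2 * a * \<rho> * x) + 1" by blast
  have "real (FP.counting x) \<le> real (3 * FP.counting (\<beta> * r * x) + 9 + 3 * 2 ^ n)"
    using counting_scale_upper[OF n(1)] by (simp only: of_nat_le_iff)
  also have "\<dots> = 3 * real (FP.counting (\<beta> * r * x)) + 9 + 3 * 2 ^ n" by simp
  also have "\<dots> \<le> 3 * real (FP.counting (\<beta> * r * x)) + 9 + 3 * (2 * sqrt (2 * a * \<rho> * x) + 1)"
    using n(2) by simp
  also have "\<dots> = 3 * real (FP.counting (\<beta> * r * x)) + (12 + 6 * sqrt (2 * a * \<rho>) * sqrt x)"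
    by (simp add: real_sqrt_mult)
  also have "\<dots> \<le> 3 * real (FP.counting (\<beta> * r * x)) + (12 + 6 * sqrt (2 * a * \<rho>)) * (sqrt x + 1)"
  proof -
    have "0 \<le> sqrt x" "0 \<le> sqrt (2 * a * \<rho>)" using x a \<rho> by simp_all
    then show ?thesis by (simp add: distrib_left distrib_right)
  qed
  finally show ?thesis .
qed

subsection \<open>Localised eigenfunctions\<close>

text \<open>Testing against all admissible \<open>v\<close>, not only those in \<open>H\<close>, is
  the weak form of vanishing flux at the vertices. It survives extension by zero, because a test
  function restricted to a cell is admissible but need not vanish at its vertices.\<close>

definition neumann_eigenfunction :: "real \<Rightarrow> (real^2 \<Rightarrow> real) \<Rightarrow> bool" where
  "neumann_eigenfunction \<kappa> u \<longleftrightarrow> u \<in> H \<and> (\<forall>v. adm v \<longrightarrow> E u v = \<kappa> * L u v)"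

lemma neumann_eigenfunction_ext:
  assumes u: "neumann_eigenfunction \<kappa> u" shows "neumann_eigenfunction (\<kappa> / (\<beta> * r)) (ext j u)"
proof -
  have uH: "u \<in> H" and ev: "\<And>v. adm v \<Longrightarrow> E u v = \<kappa> * L u v" using u by (auto simp: neumann_eigenfunction_def)
  have "E (ext j u) v = \<kappa> / (\<beta> * r) * L (ext j u) v" if v: "adm v" for v
    unfolding E_ext[OF uH v] L_ext[OF uH v] ev[OF adm_cell[OF v]] using \<beta> r by simp
  then show ?thesis using ext_H[OF uH] by (simp add: neumann_eigenfunction_def)
qed

primrec ext_word :: "3 list \<Rightarrow> (real^2 \<Rightarrow> real) \<Rightarrow> real^2 \<Rightarrow> real" where
  "ext_word [] u = u"
| "ext_word (j # w) u = ext j (ext_word w u)"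

lemma neumann_eigenfunction_ext_word:
  "neumann_eigenfunction \<kappa> u \<Longrightarrow> neumann_eigenfunction (\<kappa> / (\<beta> * r) ^ length w) (ext_word w u)"
proof (induction w)
  case (Cons j w)
  show ?case using neumann_eigenfunction_ext[OF Cons.IH[OF Cons.prems], of j] by (simp add: mult.commute)
qed simp

lemma Gword_K: "y \<in> K \<Longrightarrow> Gword \<alpha> p w y \<in> K"
  by (induction w) (auto simp: G_K)

lemma ext_word_Gword:
  "y \<in> K \<Longrightarrow> length w = length w' \<Longrightarrow> ext_word w u (Gword \<alpha> p w' y) = (if w = w' then u y else 0)"
proof (induction w w' rule: list_induct2')
  case (4 j w k w')
  then show ?case by (cases "j = k") (auto simp: ext_same ext_other Gword_K)
qed auto

lemma counting_jump_localised:
  assumes u: "neumann_eigenfunction \<kappa> u" "u \<noteq> 0" and y: "y < \<kappa> / (\<beta> * r) ^ n"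
  shows "FP.counting y + 3 ^ n \<le> FP.counting (\<kappa> / (\<beta> * r) ^ n)"
proof -
  let ?W = "{w :: 3 list. length w = n}"
  have uH: "u \<in> H" using u by (simp add: neumann_eigenfunction_def)
  have fin: "finite ?W" and card: "card ?W = 3 ^ n"
    using finite_lists_length_eq[of "UNIV :: 3 set" n] card_lists_length_eq[of "UNIV :: 3 set" n] by simp_all
  \<comment> \<open>Evaluating a combination at the copy of \<open>z\<close> in the cell of
    \<open>w\<close> isolates the coefficient of \<open>w\<close>.\<close>
  obtain z where z: "u z \<noteq> 0" using u(2) by (auto simp: fun_eq_iff zero_fun_def)
  then have zK: "z \<in> K" using H_out[OF uH] by blast
  have "FP.counting y + card ?W \<le> FP.counting (\<kappa> / (\<beta> * r) ^ n)"
  proof (rule FP.counting_jump[OF fin _ y])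
    show "ext_word w u \<in> FP.ES (\<kappa> / (\<beta> * r) ^ n)" if "w \<in> ?W" for w
      using neumann_eigenfunction_ext_word[OF u(1), of w] that H_adm
      unfolding neumann_eigenfunction_def FP.ES_def by simp
  next
    fix c w assume s: "(\<Sum>w\<in>?W. c w *\<^sub>R ext_word w u) = 0" and w: "w \<in> ?W"
    have "(\<Sum>w\<in>?W. c w *\<^sub>R ext_word w u) (Gword \<alpha> p w z) = (\<Sum>w'\<in>?W. if w' = w then c w * u z else 0)"
      unfolding sum_scaleR_fun_apply using w zK by (intro sum.cong) (auto simp: ext_word_Gword)
    also have "\<dots> = c w * u z" using fin w by simp
    finally show "c w = 0" using s z by (simp add: zero_fun_def)
  qed
  then show ?thesis using card by simp
qed

end

subsection \<open>Symmetries of the gasket\<close>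

lemma U01_reverse:
  fixes f :: "real \<Rightarrow> real" shows "(LINT t|U01. f (1 - t)) = (LINT t|U01. f t)"
proof -
  have "(\<integral>x. indicator {0<..<1} x *\<^sub>R f x \<partial>lborel) = (\<integral>x. indicator {0<..<1} (1 - x) *\<^sub>R f (1 - x) \<partial>lborel)"
    using lborel_integral_real_affine[of "-1" "\<lambda>x. indicator {0<..<1} x *\<^sub>R f x" 1] by simp
  also have "(\<lambda>x::real. indicator {0<..<1} (1 - x) *\<^sub>R f (1 - x)) = (\<lambda>x. indicator {0<..<1} x *\<^sub>R f (1 - x))"
    by (auto simp: fun_eq_iff split: split_indicator)
  finally show ?thesis unfolding set_integral_U01[symmetric] set_lebesgue_integral_def by simp
qed

lemma dyadic_form_reverse: "dyadic_form n (\<lambda>t. f (1 - t)) (\<lambda>t. g (1 - t)) = dyadic_form n f g"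
proof (induction n arbitrary: f g)
  case (Suc n)
  have l: "1 - t / 2 = ((1 - t) + 1) / 2" and r: "1 - (t + 1) / 2 = (1 - t) / 2" for t :: real
    by (simp_all add: field_simps)
  have "dyadic_form n (\<lambda>t. f (1 - t / 2)) (\<lambda>t. g (1 - t / 2)) = dyadic_form n (\<lambda>t. f ((t + 1) / 2)) (\<lambda>t. g ((t + 1) / 2))"
    unfolding l by (rule Suc.IH)
  moreover have "dyadic_form n (\<lambda>t. f (1 - (t + 1) / 2)) (\<lambda>t. g (1 - (t + 1) / 2)) = dyadic_form n (\<lambda>t. f (t / 2)) (\<lambda>t. g (t / 2))"
    unfolding r by (rule Suc.IH)
  ultimately show ?case by simp
qed (simp add: algebra_simps)

lemma sum_permutes: "\<pi> permutes (UNIV :: 3 set) \<Longrightarrow> (\<Sum>i\<in>UNIV. f (\<pi> i)) = (\<Sum>i\<in>UNIV. f i :: real)"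
  by (rule sum.reindex_bij_betw) (rule permutes_imp_bij)

lemma permutes_three:
  assumes "\<pi> permutes (UNIV :: 3 set)"
  shows "\<pi> (i + 1) = \<pi> i + 1 \<and> \<pi> (i + 2) = \<pi> i + 2 \<or> \<pi> (i + 1) = \<pi> i + 2 \<and> \<pi> (i + 2) = \<pi> i + 1"
proof -
  have "\<pi> (i + 1) \<noteq> \<pi> i" "\<pi> (i + 2) \<noteq> \<pi> i" "\<pi> (i + 1) \<noteq> \<pi> (i + 2)"
    by (simp_all add: inj_eq[OF permutes_inj[OF assms]])
  then show ?thesis using three_cases[of "\<pi> (i + 1)" "\<pi> i"] three_cases[of "\<pi> (i + 2)" "\<pi> i"] by auto
qed

context gasket
begin

text \<open>The symmetry of the triangle that permutes the vertices by \<pi>. In barycentric form it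
  is affine by inspection and intertwines \<open>G j\<close> with \<open>G (\<pi> j)\<close>; the
  group law on \<open>K\<close> follows by density of the orbit.\<close>

definition \<sigma> :: "(3 \<Rightarrow> 3) \<Rightarrow> real^2 \<Rightarrow> real^2" where
  "\<sigma> \<pi> x = (\<Sum>i\<in>UNIV. bary i x *\<^sub>R p (\<pi> i))"

lemma continuous_\<sigma>: "continuous_on X (\<sigma> \<pi>)"
  unfolding \<sigma>_def[abs_def] by (intro continuous_intros continuous_bary)

lemma \<sigma>_p: "\<sigma> \<pi> (p j) = p (\<pi> j)"
proof -
  have "\<sigma> \<pi> (p j) = (\<Sum>i\<in>UNIV. if i = j then p (\<pi> i) else 0)"
    unfolding \<sigma>_def bary_p by (intro sum.cong) auto
  then show ?thesis by simp
qed

lemma \<sigma>_affine: "\<sigma> \<pi> (s *\<^sub>R x + (1 - s) *\<^sub>R y) = s *\<^sub>R \<sigma> \<pi> x + (1 - s) *\<^sub>R \<sigma> \<pi> y"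
  unfolding \<sigma>_def bary_affine by (simp only: scaleR_add_left sum.distrib scaleR_sum_right scaleR_scaleR)

lemma G_affine: "G j x = \<theta> *\<^sub>R x + (1 - \<theta>) *\<^sub>R p j"
  by (simp add: G_def algebra_simps)

lemma \<sigma>_G: "\<sigma> \<pi> (G j x) = G (\<pi> j) (\<sigma> \<pi> x)"
  unfolding G_affine \<sigma>_affine \<sigma>_p ..

text \<open>\<open>sg i\<close> runs from cell \<open>i + 2\<close> to cell \<open>i + 1\<close>,
  and a permutation that breaks the cyclic order reverses it; hence the reversal lemmas for
  integrals and dyadic forms.\<close>

lemma \<sigma>_sg:
  assumes "\<pi> permutes UNIV"
  shows "(\<forall>t. \<sigma> \<pi> (sg i t) = sg (\<pi> i) t) \<or> (\<forall>t. \<sigma> \<pi> (sg i t) = sg (\<pi> i) (1 - t))"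
  using permutes_three[OF assms, of i] by (auto simp: seg_def \<sigma>_affine \<sigma>_G \<sigma>_p)

lemma \<sigma>_K:
  assumes \<pi>: "\<pi> permutes UNIV" and x: "x \<in> K" shows "\<sigma> \<pi> x \<in> K"
proof -
  have "\<sigma> \<pi> y \<in> K" if "y \<in> orbit" for y
    using that
  proof (induction rule: orbit_induct)
    case (edge i t)
    then show ?case using \<sigma>_sg[OF \<pi>, of i] sg_K[of t "\<pi> i"] sg_K[of "1 - t" "\<pi> i"] by auto
  qed (simp add: \<sigma>_G G_K)
  then have "\<sigma> \<pi> ` closure orbit \<subseteq> K"
    by (intro image_closure_subset continuous_\<sigma> compact_imp_closed K_compact) auto
  then show ?thesis using x by (auto simp: K_closure)
qed

lemma \<sigma>_comp: assumes "x \<in> K" shows "\<sigma> \<pi> (\<sigma> \<pi>' x) = \<sigma> (\<pi> \<circ> \<pi>') x"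
proof -
  have "y \<in> {y. \<sigma> \<pi> (\<sigma> \<pi>' y) = \<sigma> (\<pi> \<circ> \<pi>') y}" if "y \<in> orbit" for y
    using that by (induction rule: orbit_induct) (auto simp: seg_def \<sigma>_affine \<sigma>_G \<sigma>_p)
  moreover have "closed {y. \<sigma> \<pi> (\<sigma> \<pi>' y) = \<sigma> (\<pi> \<circ> \<pi>') y}"
    by (intro closed_Collect_eq continuous_\<sigma> continuous_on_compose2[OF continuous_\<sigma>[of UNIV]] subset_UNIV)
  ultimately show ?thesis using assms closure_minimal[of orbit "{y. \<sigma> \<pi> (\<sigma> \<pi>' y) = \<sigma> (\<pi> \<circ> \<pi>') y}"]
    unfolding K_closure by blast
qed

lemma \<sigma>_id: assumes "x \<in> K" shows "\<sigma> id x = x"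
proof -
  have "y \<in> {y. \<sigma> id y = y}" if "y \<in> orbit" for y
    using that by (induction rule: orbit_induct) (auto simp: seg_def \<sigma>_affine \<sigma>_G \<sigma>_p)
  moreover have "closed {y. \<sigma> id y = y}"
    by (intro closed_Collect_eq continuous_\<sigma> continuous_on_id)
  ultimately show ?thesis using assms closure_minimal[of orbit "{y. \<sigma> id y = y}"] unfolding K_closure by blast
qed

lemma bary_\<sigma>: assumes \<pi>: "\<pi> permutes UNIV" and x: "x \<in> K" shows "bary (\<pi> i) (\<sigma> \<pi> x) = bary i x"
proof (rule K_limit_eq[OF _ continuous_bary x])
  show "continuous_on K (\<lambda>x. bary (\<pi> i) (\<sigma> \<pi> x))"
    by (rule continuous_on_compose2[OF continuous_bary[of UNIV] continuous_\<sigma>]) simp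
  fix y assume "y \<in> orbit"
  then show "bary (\<pi> i) (\<sigma> \<pi> y) = bary i y"
    by (induction rule: orbit_induct)
       (simp_all add: seg_def \<sigma>_affine \<sigma>_G \<sigma>_p bary_affine bary_G bary_p inj_eq[OF permutes_inj[OF \<pi>]])
qed

end

lemma (in gasket_form) A_\<sigma>:
  assumes \<pi>: "\<pi> permutes UNIV" shows "A m (\<lambda>x. u (\<sigma> \<pi> x)) (\<lambda>x. v (\<sigma> \<pi> x)) = A m u v"
proof (induction m arbitrary: u v)
  case 0
  have e: "(3::3) + 1 = 1" "(2::3) + 1 = 3" "(1::3) + 1 = 2" "(4::3) = 1" by simp_all
  \<comment> \<open>The cyclic sum in \<open>A 0\<close> is not visibly invariant under odd
    permutations; half the sum over all ordered pairs is.\<close>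
  define F where "F u v i j = (u (p i) - u (p j)) * (v (p i) - v (p j))" for u v :: "real^2 \<Rightarrow> real" and i j :: 3
  have half: "A 0 u v = (\<Sum>i\<in>UNIV. \<Sum>j\<in>UNIV. F u v i j) / 2" for u v
    by (simp add: sum_3 e F_def algebra_simps)
  have "(\<Sum>i\<in>UNIV. \<Sum>j\<in>UNIV. F (\<lambda>x. u (\<sigma> \<pi> x)) (\<lambda>x. v (\<sigma> \<pi> x)) i j) = (\<Sum>i\<in>UNIV. \<Sum>j\<in>UNIV. F u v (\<pi> i) (\<pi> j))"
    by (simp add: F_def \<sigma>_p)
  also have "\<dots> = (\<Sum>i\<in>UNIV. \<Sum>j\<in>UNIV. F u v (\<pi> i) j)" by (intro sum.cong refl sum_permutes \<pi>)
  also have "\<dots> = (\<Sum>i\<in>UNIV. \<Sum>j\<in>UNIV. F u v i j)" by (rule sum_permutes[OF \<pi>])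
  finally show ?case unfolding half by (rule arg_cong)
next
  case (Suc m)
  let ?u = "\<lambda>x. u (\<sigma> \<pi> x)" and ?v = "\<lambda>x. v (\<sigma> \<pi> x)"
  have 1: "A m (\<lambda>x. ?u (G j x)) (\<lambda>x. ?v (G j x)) = A m (\<lambda>x. u (G (\<pi> j) x)) (\<lambda>x. v (G (\<pi> j) x))" for j
    unfolding \<sigma>_G by (rule Suc.IH)
  have 2: "dyadic_form m (\<lambda>t. ?u (sg i t)) (\<lambda>t. ?v (sg i t)) = dyadic_form m (\<lambda>t. u (sg (\<pi> i) t)) (\<lambda>t. v (sg (\<pi> i) t))" for i
    using \<sigma>_sg[OF \<pi>, of i]
  proof
    assume s: "\<forall>t. \<sigma> \<pi> (sg i t) = sg (\<pi> i) (1 - t)"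
    show ?thesis unfolding s[rule_format] by (rule dyadic_form_reverse)
  qed simp
  show ?case unfolding A.simps(2) 1 2 sum_permutes[OF \<pi>, of "\<lambda>j. A m (\<lambda>x. u (G j x)) (\<lambda>x. v (G j x))"]
      sum_permutes[OF \<pi>, of "\<lambda>i. dyadic_form m (\<lambda>t. u (sg i t)) (\<lambda>t. v (sg i t))"] ..
qed

lemma (in gasket_measure) S_\<sigma>:
  assumes \<pi>: "\<pi> permutes UNIV" shows "S m (\<lambda>x. h (\<sigma> \<pi> x)) = S m h"
proof (induction m arbitrary: h)
  case 0
  have "(LINT t|U01. h (\<sigma> \<pi> (sg i t))) = (LINT t|U01. h (sg (\<pi> i) t))" for i
    using \<sigma>_sg[OF \<pi>, of i]
  proof
    assume s: "\<forall>t. \<sigma> \<pi> (sg i t) = sg (\<pi> i) (1 - t)"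
    show ?thesis unfolding s[rule_format] by (rule U01_reverse)
  qed simp
  then show ?case using sum_permutes[OF \<pi>, of "\<lambda>i. LINT t|U01. h (sg i t)"] by simp
next
  case (Suc m)
  have "S m (\<lambda>x. h (\<sigma> \<pi> (G j x))) = S m (\<lambda>x. h (G (\<pi> j) x))" for j
    unfolding \<sigma>_G by (rule Suc.IH)
  then show ?case using sum_permutes[OF \<pi>, of "\<lambda>j. S m (\<lambda>x. h (G j x))"] by simp
qed

subsection \<open>An antisymmetric Neumann eigenfunction\<close>

text \<open>Boundedness and the Lipschitz condition share one constant, which makes the class stable
  under products.\<close>

definition edge_regular :: "(real \<Rightarrow> real) \<Rightarrow> bool" where
  "edge_regular f \<longleftrightarrow> (\<exists>M\<ge>0. \<forall>s\<in>{0..1}. \<forall>t\<in>{0..1}. \<bar>f s\<bar> \<le> M \<and> \<bar>f s - f t\<bar> \<le> M * \<bar>s - t\<bar>)"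

lemma edge_regular_affine: "edge_regular (\<lambda>t. t * b + (1 - t) * c)"
  unfolding edge_regular_def
proof (intro exI[of _ "\<bar>b\<bar> + \<bar>c\<bar>"] conjI ballI)
  fix s t :: real assume s: "s \<in> {0..1}" and t: "t \<in> {0..1}"
  have "\<bar>s * b + (1 - s) * c\<bar> \<le> \<bar>s * b\<bar> + \<bar>(1 - s) * c\<bar>" by (rule abs_triangle_ineq)
  also have "\<dots> \<le> 1 * \<bar>b\<bar> + 1 * \<bar>c\<bar>" unfolding abs_mult using s by (intro add_mono mult_right_mono) auto
  finally show "\<bar>s * b + (1 - s) * c\<bar> \<le> \<bar>b\<bar> + \<bar>c\<bar>" by simp
  have "s * b + (1 - s) * c - (t * b + (1 - t) * c) = (b - c) * (s - t)" by (simp add: algebra_simps)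
  then have "\<bar>s * b + (1 - s) * c - (t * b + (1 - t) * c)\<bar> = \<bar>b - c\<bar> * \<bar>s - t\<bar>" by (simp only: abs_mult)
  also have "\<dots> \<le> (\<bar>b\<bar> + \<bar>c\<bar>) * \<bar>s - t\<bar>" by (intro mult_right_mono) auto
  finally show "\<bar>s * b + (1 - s) * c - (t * b + (1 - t) * c)\<bar> \<le> (\<bar>b\<bar> + \<bar>c\<bar>) * \<bar>s - t\<bar>" .
qed simp

lemma edge_regular_max:
  assumes "edge_regular f" shows "edge_regular (\<lambda>t. max 0 (f t))"
proof -
  obtain M where M: "0 \<le> M" "\<And>s t. s \<in> {0..1} \<Longrightarrow> t \<in> {0..1} \<Longrightarrow> \<bar>f s\<bar> \<le> M \<and> \<bar>f s - f t\<bar> \<le> M * \<bar>s - t\<bar>"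
    using assms unfolding edge_regular_def by blast
  have "\<bar>max 0 (f s)\<bar> \<le> M \<and> \<bar>max 0 (f s) - max 0 (f t)\<bar> \<le> M * \<bar>s - t\<bar>" if "s \<in> {0..1}" "t \<in> {0..1}" for s t
  proof -
    have "\<bar>max 0 (f s)\<bar> \<le> \<bar>f s\<bar>" "\<bar>max 0 (f s) - max 0 (f t)\<bar> \<le> \<bar>f s - f t\<bar>" by auto
    then show ?thesis using M(2)[OF that] by linarith
  qed
  then show ?thesis unfolding edge_regular_def using M(1) by blast
qed

lemma edge_regular_diff:
  assumes "edge_regular f" "edge_regular g" shows "edge_regular (\<lambda>t. f t - g t)"
proof -
  obtain M where M: "0 \<le> M" "\<And>s t. s \<in> {0..1} \<Longrightarrow> t \<in> {0..1} \<Longrightarrow> \<bar>f s\<bar> \<le> M \<and> \<bar>f s - f t\<bar> \<le> M * \<bar>s - t\<bar>"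
    using assms(1) unfolding edge_regular_def by blast
  obtain N where N: "0 \<le> N" "\<And>s t. s \<in> {0..1} \<Longrightarrow> t \<in> {0..1} \<Longrightarrow> \<bar>g s\<bar> \<le> N \<and> \<bar>g s - g t\<bar> \<le> N * \<bar>s - t\<bar>"
    using assms(2) unfolding edge_regular_def by blast
  have "\<bar>f s - g s\<bar> \<le> M + N \<and> \<bar>(f s - g s) - (f t - g t)\<bar> \<le> (M + N) * \<bar>s - t\<bar>" if "s \<in> {0..1}" "t \<in> {0..1}" for s t
    using M(2)[OF that] N(2)[OF that] unfolding distrib_right by linarith
  then show ?thesis unfolding edge_regular_def using M(1) N(1) by (intro exI[of _ "M + N"]) auto
qed

lemma edge_regular_mult:
  assumes "edge_regular f" "edge_regular g" shows "edge_regular (\<lambda>t. f t * g t)"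
proof -
  obtain M where M: "0 \<le> M" "\<And>s t. s \<in> {0..1} \<Longrightarrow> t \<in> {0..1} \<Longrightarrow> \<bar>f s\<bar> \<le> M \<and> \<bar>f s - f t\<bar> \<le> M * \<bar>s - t\<bar>"
    using assms(1) unfolding edge_regular_def by blast
  obtain N where N: "0 \<le> N" "\<And>s t. s \<in> {0..1} \<Longrightarrow> t \<in> {0..1} \<Longrightarrow> \<bar>g s\<bar> \<le> N \<and> \<bar>g s - g t\<bar> \<le> N * \<bar>s - t\<bar>"
    using assms(2) unfolding edge_regular_def by blast
  have MN: "0 \<le> M * N" using M(1) N(1) by simp
  have "\<bar>f s * g s\<bar> \<le> 2 * M * N \<and> \<bar>f s * g s - f t * g t\<bar> \<le> 2 * M * N * \<bar>s - t\<bar>"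
    if st: "s \<in> {0..1}" "t \<in> {0..1}" for s t
  proof
    have "\<bar>f s * g s\<bar> \<le> M * N" unfolding abs_mult using M N st by (intro mult_mono) auto
    then show "\<bar>f s * g s\<bar> \<le> 2 * M * N" using MN by linarith
    have "f s * g s - f t * g t = f s * (g s - g t) + (f s - f t) * g t" by (simp add: algebra_simps)
    then have "\<bar>f s * g s - f t * g t\<bar> \<le> \<bar>f s\<bar> * \<bar>g s - g t\<bar> + \<bar>f s - f t\<bar> * \<bar>g t\<bar>"
      by (simp only: abs_mult[symmetric] abs_triangle_ineq)
    also have "\<dots> \<le> M * (N * \<bar>s - t\<bar>) + (M * \<bar>s - t\<bar>) * N"
      using M(1) N(1) M(2)[OF st] N(2)[OF st] N(2)[OF st(2) st(1)] by (intro add_mono mult_mono) auto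
    also have "\<dots> = 2 * M * N * \<bar>s - t\<bar>" by simp
    finally show "\<bar>f s * g s - f t * g t\<bar> \<le> 2 * M * N * \<bar>s - t\<bar>" .
  qed
  then show ?thesis unfolding edge_regular_def using MN by (intro exI[of _ "2 * M * N"]) auto
qed

lemma dyadic_form_Lipschitz:
  assumes "0 \<le> M" "\<And>s t. s \<in> {0..1} \<Longrightarrow> t \<in> {0..1} \<Longrightarrow> \<bar>f s - f t\<bar> \<le> M * \<bar>s - t\<bar>"
  shows "dyadic_form n f f \<le> M\<^sup>2"
  using assms
proof (induction n arbitrary: f M)
  case 0
  have "\<bar>f 1 - f 0\<bar>\<^sup>2 \<le> M\<^sup>2" using 0(2)[of 1 0] by (intro power_mono) auto
  then show ?case by (simp add: power2_eq_square)
next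
  case (Suc n)
  have "dyadic_form n (\<lambda>t. f (t / 2)) (\<lambda>t. f (t / 2)) \<le> (M / 2)\<^sup>2"
  proof (rule Suc.IH)
    fix s t :: real assume "s \<in> {0..1}" "t \<in> {0..1}"
    then have "\<bar>f (s / 2) - f (t / 2)\<bar> \<le> M * \<bar>s / 2 - t / 2\<bar>" by (intro Suc.prems) auto
    also have "\<dots> = M / 2 * \<bar>s - t\<bar>" by (simp add: diff_divide_distrib[symmetric])
    finally show "\<bar>f (s / 2) - f (t / 2)\<bar> \<le> M / 2 * \<bar>s - t\<bar>" .
  qed (use Suc.prems in simp)
  moreover have "dyadic_form n (\<lambda>t. f ((t + 1) / 2)) (\<lambda>t. f ((t + 1) / 2)) \<le> (M / 2)\<^sup>2"
  proof (rule Suc.IH)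
    fix s t :: real assume "s \<in> {0..1}" "t \<in> {0..1}"
    then have "\<bar>f ((s + 1) / 2) - f ((t + 1) / 2)\<bar> \<le> M * \<bar>(s + 1) / 2 - (t + 1) / 2\<bar>" by (intro Suc.prems) auto
    also have "\<dots> = M / 2 * \<bar>s - t\<bar>" by (simp add: diff_divide_distrib[symmetric])
    finally show "\<bar>f ((s + 1) / 2) - f ((t + 1) / 2)\<bar> \<le> M / 2 * \<bar>s - t\<bar>" .
  qed (use Suc.prems in simp)
  ultimately show ?case by (simp add: power_divide)
qed

lemma edge_regular_dyadic_form: "edge_regular f \<Longrightarrow> \<exists>B. \<forall>n. dyadic_form n f f \<le> B"
  unfolding edge_regular_def using dyadic_form_Lipschitz[of _ f] by blast

lemma quarter_bounds:
  fixes t :: real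
  assumes "0 < t" "t < 1 / 2"
  shows "3 / 4 * t + 1 / 4 * (1 - t) < 3 / 4 * (1 - t) + 1 / 4 * t" "0 < 3 / 4 * t + 1 / 4 * (1 - t)"
    "3 / 4 * (1 - t) + 1 / 4 * t < 1 - t" "3 / 4 * t + 1 / 4 * (1 - t) < 1 - t"
  using assms by (auto simp: field_simps)

context gasket_spectral
begin

section \<open>Antisymmetrisation and the minimiser among antisymmetric functions\<close>

abbreviation "Sym \<equiv> {\<pi> :: 3 \<Rightarrow> 3. \<pi> permutes UNIV}"
abbreviation sgn\<pi> :: "(3 \<Rightarrow> 3) \<Rightarrow> real" where "sgn\<pi> \<pi> \<equiv> real_of_int (sign \<pi>)"

lemma finite_Sym: "finite Sym" by (rule finite_permutations) simp

lemma sgn\<pi>_comp: "\<pi> \<in> Sym \<Longrightarrow> \<pi>' \<in> Sym \<Longrightarrow> sgn\<pi> (\<pi> \<circ> \<pi>') = sgn\<pi> \<pi> * sgn\<pi> \<pi>'"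
  by (subst sign_compose) (auto intro: permutes_imp_permutation)

lemma sgn\<pi>_square: "sgn\<pi> \<pi> * sgn\<pi> \<pi> = 1"
  by (simp flip: of_int_mult)

lemma adm_\<sigma>: assumes \<pi>: "\<pi> \<in> Sym" and u: "adm u" shows "adm (\<lambda>x. u (\<sigma> \<pi> x))"
proof (rule adm_I)
  show "continuous_on K (\<lambda>x. u (\<sigma> \<pi> x))"
    by (rule continuous_on_compose2[OF adm_continuous[OF u] continuous_\<sigma>]) (use \<sigma>_K \<pi> in auto)
  show "A m (\<lambda>x. u (\<sigma> \<pi> x)) (\<lambda>x. u (\<sigma> \<pi> x)) \<le> E u u" for m
    using adm_A_le[OF u] A_\<sigma> \<pi> by simp
qed

lemma E_\<sigma>: "\<pi> \<in> Sym \<Longrightarrow> E (\<lambda>x. u (\<sigma> \<pi> x)) (\<lambda>x. v (\<sigma> \<pi> x)) = E u v"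
  unfolding E_def using A_\<sigma> by simp

lemma L_\<sigma>: "\<pi> \<in> Sym \<Longrightarrow> L (\<lambda>x. u (\<sigma> \<pi> x)) (\<lambda>x. v (\<sigma> \<pi> x)) = L u v"
  unfolding L_def I_def using S_\<sigma>[of \<pi> _ "\<lambda>x. u x * v x"] by simp

text \<open>The projection onto antisymmetric functions without division by the order of the group,
  which reappears as \<open>card Sym\<close> in \<open>pairing_alt\<close>.\<close>

definition alt :: "(real^2 \<Rightarrow> real) \<Rightarrow> real^2 \<Rightarrow> real" where
  "alt v x = (if x \<in> K then \<Sum>\<pi>\<in>Sym. sgn\<pi> \<pi> * v (\<sigma> \<pi> x) else 0)"

text \<open>Antisymmetry is written as a common kernel of bounded functionals to match
  \<open>minimiser_exists\<close>; \<open>W_iff\<close> is the readable form.\<close>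

definition W :: "(real^2 \<Rightarrow> real) set" where
  "W = {u \<in> H. \<forall>\<psi>\<in>(\<lambda>(\<pi>, x) u. u (\<sigma> \<pi> x) - sgn\<pi> \<pi> * u x) ` (Sym \<times> K). \<psi> u = 0}"

lemma W_iff: "u \<in> W \<longleftrightarrow> u \<in> H \<and> (\<forall>\<pi>\<in>Sym. \<forall>x\<in>K. u (\<sigma> \<pi> x) = sgn\<pi> \<pi> * u x)"
  by (auto simp: W_def)

lemma adm_sum:
  assumes "finite F" "\<And>i. i \<in> F \<Longrightarrow> adm (f i)"
  shows "adm (\<lambda>x. \<Sum>i\<in>F. c i * f i x)"
  using assms
proof (induction F rule: finite_induct)
  case empty
  show ?case by (rule adm_I[where B = 0]) (simp_all add: A_zero)
next
  case (insert i F)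
  then show ?case using adm_comb[of "f i" "\<lambda>x. \<Sum>i\<in>F. c i * f i x" "c i" 1] by simp
qed

lemma pairing_sum:
  assumes lin: "\<And>u v b c. adm u \<Longrightarrow> adm v \<Longrightarrow> B (\<lambda>x. b * u x + c * v x) w = b * B u w + c * B v w"
    and F: "finite F" "\<And>i. i \<in> F \<Longrightarrow> adm (f i)"
  shows "B (\<lambda>x. \<Sum>i\<in>F. c i * f i x) w = (\<Sum>i\<in>F. c i * B (f i) w :: real)"
  using F
proof (induction F rule: finite_induct)
  case empty
  have z: "adm (\<lambda>x. 0)" by (rule adm_I[where B = 0]) (simp_all add: A_zero)
  show ?case using lin[OF z z, of 0 0] by simp
next
  case (insert i F)
  then show ?case using lin[of "f i" "\<lambda>x. \<Sum>i\<in>F. c i * f i x" "c i" 1] adm_sum[of F f c] by simp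
qed

lemma alt_W: assumes v: "adm v" shows "alt v \<in> W"
proof -
  have "adm (\<lambda>x. \<Sum>\<pi>\<in>Sym. sgn\<pi> \<pi> * v (\<sigma> \<pi> x))" by (intro adm_sum finite_Sym adm_\<sigma> v)
  then have a: "adm (alt v)" by (rule adm_cong) (simp add: alt_def)
  have "alt v (p i) = 0" for i
  proof -
    \<comment> \<open>The reflection that fixes \<open>p i\<close>. Composing with it changes every
      sign, so the value at \<open>p i\<close> equals its own negative.\<close>
    let ?\<tau> = "Transposition.transpose (i + 1) (i + 2)"
    have \<tau>: "?\<tau> permutes UNIV" by (rule permutes_swap_id) simp_all
    have "(\<Sum>\<pi>\<in>Sym. sgn\<pi> \<pi> * v (p (\<pi> i))) = (\<Sum>\<pi>\<in>Sym. sgn\<pi> (\<pi> \<circ> ?\<tau>) * v (p ((\<pi> \<circ> ?\<tau>) i)))"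
      by (rule sum_permutations_compose_right[OF \<tau>])
    also have "\<dots> = (\<Sum>\<pi>\<in>Sym. - (sgn\<pi> \<pi> * v (p (\<pi> i))))"
      by (intro sum.cong refl) (use \<tau> in \<open>simp add: sgn\<pi>_comp sign_swap_id Transposition.transpose_apply_other\<close>)
    also have "\<dots> = - (\<Sum>\<pi>\<in>Sym. sgn\<pi> \<pi> * v (p (\<pi> i)))" by (rule sum_negf)
    finally show ?thesis by (simp add: alt_def p_K \<sigma>_p)
  qed
  moreover have "alt v (\<sigma> \<pi>' x) = sgn\<pi> \<pi>' * alt v x" if \<pi>': "\<pi>' \<in> Sym" and x: "x \<in> K" for \<pi>' x
  proof -
    have "(\<Sum>\<pi>\<in>Sym. sgn\<pi> \<pi> * v (\<sigma> \<pi> x)) = (\<Sum>\<pi>\<in>Sym. sgn\<pi> (\<pi> \<circ> \<pi>') * v (\<sigma> (\<pi> \<circ> \<pi>') x))"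
      by (rule sum_permutations_compose_right) (use \<pi>' in simp)
    also have "\<dots> = (\<Sum>\<pi>\<in>Sym. sgn\<pi> \<pi>' * (sgn\<pi> \<pi> * v (\<sigma> \<pi> (\<sigma> \<pi>' x))))"
      by (intro sum.cong refl) (use \<pi>' in \<open>simp add: sgn\<pi>_comp \<sigma>_comp[OF x]\<close>)
    finally have "alt v x = sgn\<pi> \<pi>' * alt v (\<sigma> \<pi>' x)"
      using x \<sigma>_K[of \<pi>' x] \<pi>' by (simp add: alt_def sum_distrib_left)
    then have "sgn\<pi> \<pi>' * alt v x = (sgn\<pi> \<pi>' * sgn\<pi> \<pi>') * alt v (\<sigma> \<pi>' x)" by simp
    then show ?thesis unfolding sgn\<pi>_square by simp
  qed
  ultimately show ?thesis using a by (auto simp: W_iff H_def alt_def)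
qed

text \<open>Symmetric criticality, for \<open>E\<close> and \<open>L\<close> alike: by invariance
  each term of the antisymmetrisation pairs with \<open>u\<close> as \<open>v\<close> does. Testing
  \<open>u\<close> against \<open>alt v\<close>, which vanishes at the vertices, therefore amounts
  to testing against \<open>v\<close> with arbitrary boundary values.\<close>

lemma pairing_alt:
  assumes u: "u \<in> W" and v: "adm v"
    and lin: "\<And>u v w b c. adm u \<Longrightarrow> adm v \<Longrightarrow> adm w \<Longrightarrow> B (\<lambda>x. b * u x + c * v x) w = b * B u w + c * B v w"
    and sym: "\<And>u v. B u v = B v u"
    and cong: "\<And>u u' v v'. (\<And>x. x \<in> K \<Longrightarrow> u x = u' x) \<Longrightarrow> (\<And>x. x \<in> K \<Longrightarrow> v x = v' x) \<Longrightarrow> B u v = B u' v'"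
    and inv: "\<And>\<pi> u v. \<pi> \<in> Sym \<Longrightarrow> B (\<lambda>x. u (\<sigma> \<pi> x)) (\<lambda>x. v (\<sigma> \<pi> x)) = B u v"
  shows "B u (alt v) = real (card Sym) * B u v"
proof -
  have ua: "adm u" using u H_adm by (simp add: W_iff)
  have s: "B (\<lambda>x. v (\<sigma> \<pi> x)) u = sgn\<pi> \<pi> * B v u" if \<pi>: "\<pi> \<in> Sym" for \<pi>
  proof -
    have "B u (\<lambda>x. v (\<sigma> \<pi> x)) = B (\<lambda>x. sgn\<pi> \<pi> * u (\<sigma> \<pi> x) + 0 * u x) (\<lambda>x. v (\<sigma> \<pi> x))"
    proof (rule cong)
      fix x assume "x \<in> K"
      then have "u (\<sigma> \<pi> x) = sgn\<pi> \<pi> * u x" using u \<pi> unfolding W_iff by blast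
      then have "sgn\<pi> \<pi> * u (\<sigma> \<pi> x) = (sgn\<pi> \<pi> * sgn\<pi> \<pi>) * u x" by simp
      then show "u x = sgn\<pi> \<pi> * u (\<sigma> \<pi> x) + 0 * u x" unfolding sgn\<pi>_square by simp
    qed simp
    also have "\<dots> = sgn\<pi> \<pi> * B (\<lambda>x. u (\<sigma> \<pi> x)) (\<lambda>x. v (\<sigma> \<pi> x))"
      using lin[OF adm_\<sigma>[OF \<pi> ua] ua adm_\<sigma>[OF \<pi> v], of "sgn\<pi> \<pi>" 0] by simp
    also have "\<dots> = sgn\<pi> \<pi> * B u v" by (simp only: inv[OF \<pi>])
    finally show ?thesis by (simp only: sym)
  qed
  have "B (alt v) u = B (\<lambda>x. \<Sum>\<pi>\<in>Sym. sgn\<pi> \<pi> * v (\<sigma> \<pi> x)) u" by (rule cong) (simp_all add: alt_def)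
  also have "\<dots> = (\<Sum>\<pi>\<in>Sym. sgn\<pi> \<pi> * B (\<lambda>x. v (\<sigma> \<pi> x)) u)"
    by (rule pairing_sum) (intro lin ua finite_Sym adm_\<sigma> v | assumption)+
  also have "\<dots> = (\<Sum>\<pi>\<in>Sym. B v u)"
    by (intro sum.cong refl) (simp only: s mult.assoc[symmetric] sgn\<pi>_square mult_1)
  also have "\<dots> = real (card Sym) * B v u" by simp
  finally show ?thesis by (simp only: sym)
qed

text \<open>Supported in the interior of one half of one edge: its images under the six symmetries have
  disjoint supports, so antisymmetrising it cannot cancel it.\<close>

definition bump :: "real^2 \<Rightarrow> real" where
  "bump x = max 0 (1 - \<theta> - bary 1 x) * max 0 (1 - \<theta> - bary 2 x) * max 0 (1 - \<theta> - bary 3 x)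
     * max 0 (bary 1 x - bary 2 x) * max 0 (bary 2 x - bary 3 x)"

lemma bump_cell: assumes "y \<in> K" shows "bump (G j y) = 0"
  using bary_cell(1)[OF assms, of j] exhaust_3[of j] by (auto simp: bump_def)

lemma edge_regular_bump: "edge_regular (\<lambda>t. bump (sg i t))"
proof -
  have b: "edge_regular (\<lambda>t. bary k (sg i t))" for k unfolding seg_def bary_affine by (rule edge_regular_affine)
  have c: "edge_regular (\<lambda>t. 1 - \<theta>)" using edge_regular_affine[of "1 - \<theta>" "1 - \<theta>"] by (simp add: algebra_simps)
  show ?thesis unfolding bump_def by (intro edge_regular_mult edge_regular_max edge_regular_diff b c)
qed

lemma adm_bump: "adm bump"
proof -
  have "\<exists>B. \<forall>i m. dyadic_form m (\<lambda>t. bump (sg i t)) (\<lambda>t. bump (sg i t)) \<le> B"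
  proof -
    have "\<forall>i. \<exists>B. \<forall>m. dyadic_form m (\<lambda>t. bump (sg i t)) (\<lambda>t. bump (sg i t)) \<le> B"
      using edge_regular_dyadic_form[OF edge_regular_bump] by blast
    then obtain F where F: "\<forall>i m. dyadic_form m (\<lambda>t. bump (sg i t)) (\<lambda>t. bump (sg i t)) \<le> F i" by metis
    have "F i \<le> Max (range F)" for i by (intro Max_ge) auto
    then show ?thesis using F by (meson order_trans)
  qed
  then obtain B where B: "\<And>i m. dyadic_form m (\<lambda>t. bump (sg i t)) (\<lambda>t. bump (sg i t)) \<le> B" by blast
  show ?thesis
  proof (rule adm_I)
    show "continuous_on K bump" unfolding bump_def[abs_def] by (intro continuous_intros continuous_bary)
    fix m
    have z: "A m (\<lambda>x. bump (G j x)) (\<lambda>x. bump (G j x)) = 0" for j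
      using A_cong[of "\<lambda>x. bump (G j x)" "\<lambda>x. 0" "\<lambda>x. bump (G j x)" "\<lambda>x. 0" m] by (simp add: bump_cell A_zero)
    have "A m bump bump \<le> A (Suc m) bump bump" by (rule A_mono)
    also have "\<dots> = (1 / \<rho>) * (\<Sum>i\<in>UNIV. dyadic_form m (\<lambda>t. bump (sg i t)) (\<lambda>t. bump (sg i t)))"
      unfolding A.simps(2) z by simp
    also have "\<dots> \<le> (1 / \<rho>) * (\<Sum>i\<in>(UNIV::3 set). B)" using \<rho> by (intro mult_left_mono sum_mono B) simp
    finally show "A m bump bump \<le> (1 / \<rho>) * (\<Sum>i\<in>(UNIV::3 set). B)" .
  qed
qed

lemma strict_order_three:
  fixes f :: "3 \<Rightarrow> real" and \<pi> :: "3 \<Rightarrow> 3"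
  assumes "f 2 < f 1" "f 3 < f 2" "f (\<pi> 2) < f (\<pi> 1)" "f (\<pi> 3) < f (\<pi> 2)" shows "\<pi> = id"
proof -
  have "\<pi> 1 = 1 \<and> \<pi> 2 = 2 \<and> \<pi> 3 = 3"
    using assms exhaust_3[of "\<pi> 1"] exhaust_3[of "\<pi> 2"] exhaust_3[of "\<pi> 3"] by auto
  then show ?thesis using exhaust_3 by (auto simp: fun_eq_iff) metis
qed

lemma alt_bump_nonzero: "alt bump \<noteq> 0"
proof -
  \<comment> \<open>On the edge between cells 1 and 2, nearer to cell 1, the three coordinates are
    strictly ordered. As \<open>bump\<close> vanishes where this order fails, only the identity
    contributes to \<open>alt bump z\<close>.\<close>
  define z where "z = sg 3 (3 / 4)"
  have zK: "z \<in> K" unfolding z_def by (rule sg_K) auto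
  have e: "(3::3) + 1 = 1" "(3::3) + 2 = 2" "(4::3) = 1" "(5::3) = 2" by simp_all
  have b: "bary 3 z = 0" "bary 1 z = 3 / 4 * (1 - \<theta>) + 1 / 4 * \<theta>" "bary 2 z = 3 / 4 * \<theta> + 1 / 4 * (1 - \<theta>)"
    using bary_sg[of 3 "3 / 4"] by (simp_all add: z_def e)
  have lt: "bary 2 z < bary 1 z" "bary 3 z < bary 2 z" "bary 1 z < 1 - \<theta>" "bary 2 z < 1 - \<theta>" "bary 3 z < 1 - \<theta>"
    unfolding b by (rule quarter_bounds[OF \<theta>])+ (use \<theta> in simp)
  have pos: "0 < bump z" unfolding bump_def using lt by (intro mult_pos_pos) auto
  have zero: "bump (\<sigma> \<pi> z) = 0" if \<pi>: "\<pi> \<in> Sym" "\<pi> \<noteq> id" for \<pi>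
  proof (rule ccontr)
    assume n: "bump (\<sigma> \<pi> z) \<noteq> 0"
    have p1: "\<pi> permutes UNIV" using \<pi> by simp
    have i: "bary i (\<sigma> \<pi> z) = bary (inv \<pi> i) z" for i
      using bary_\<sigma>[OF p1 zK, of "inv \<pi> i"] permutes_inverses(1)[OF p1] by simp
    have "bary 2 (\<sigma> \<pi> z) < bary 1 (\<sigma> \<pi> z)" "bary 3 (\<sigma> \<pi> z) < bary 2 (\<sigma> \<pi> z)"
      using n by (auto simp: bump_def max_def split: if_splits)
    then have "inv \<pi> = id" unfolding i by (intro strict_order_three[of "\<lambda>i. bary i z"] lt)
    then have "\<pi> = id" using permutes_inv_inv[OF p1] by (metis inv_id)
    then show False using \<pi> by simp
  qed
  have "alt bump z = (\<Sum>\<pi>\<in>Sym. if \<pi> = id then bump z else 0)"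
    unfolding alt_def if_P[OF zK] by (intro sum.cong refl) (auto simp: zero \<sigma>_id[OF zK] sign_id)
  also have "\<dots> = bump z" using finite_Sym by (simp add: permutes_id)
  finally show ?thesis using pos by (auto simp: zero_fun_def)
qed

lemma bddH_antisymmetry:
  assumes "x \<in> K" "y \<in> K" shows "bddH (\<lambda>u. u y - c * u x)"
  unfolding bddH_def
proof (intro conjI ballI allI exI[of _ "2 * (1 + c\<^sup>2) * C\<^sup>2"])
  fix u assume u: "u \<in> H"
  have "0 \<le> (u y + c * u x)\<^sup>2" by simp
  then have "(u y - c * u x)\<^sup>2 \<le> 2 * (u y)\<^sup>2 + 2 * c\<^sup>2 * (u x)\<^sup>2" by (simp add: power2_eq_square algebra_simps)
  also have "\<dots> \<le> 2 * (C\<^sup>2 * E u u) + 2 * c\<^sup>2 * (C\<^sup>2 * E u u)"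
    using H_bound assms u by (intro add_mono mult_left_mono) auto
  also have "\<dots> = 2 * (1 + c\<^sup>2) * C\<^sup>2 * E u u" by (simp add: algebra_simps)
  finally show "(u y - c * u x)\<^sup>2 \<le> 2 * (1 + c\<^sup>2) * C\<^sup>2 * E u u" .
qed (auto simp: comb_fun algebra_simps)

text \<open>Minimising the Rayleigh quotient over \<open>W\<close> gives the equation against
  antisymmetric functions, and \<open>pairing_alt\<close> transfers it to every admissible test
  function.\<close>

lemma neumann_eigenfunction_exists: "\<exists>\<kappa> u. 0 < \<kappa> \<and> neumann_eigenfunction \<kappa> u \<and> u \<noteq> 0"
proof -
  have bdd: "bddH \<psi>" if \<psi>: "\<psi> \<in> (\<lambda>(\<pi>, x) u. u (\<sigma> \<pi> x) - sgn\<pi> \<pi> * u x) ` (Sym \<times> K)" for \<psi>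
  proof -
    obtain \<pi> x where "\<pi> \<in> Sym" "x \<in> K" "\<psi> = (\<lambda>u. u (\<sigma> \<pi> x) - sgn\<pi> \<pi> * u x)" using \<psi> by auto
    then show ?thesis using bddH_antisymmetry[of x "\<sigma> \<pi> x"] \<sigma>_K[of \<pi> x] by simp
  qed
  have "\<exists>u\<in>W. L u u = 1 \<and> (\<forall>v\<in>W. E u u * L v v \<le> E v v)"
    by (rule FP.minimiser_exists[OF bdd W_def alt_W[OF adm_bump] alt_bump_nonzero])
  then obtain u where u: "u \<in> W" "L u u = 1" and min: "\<And>v. v \<in> W \<Longrightarrow> E u u * L v v \<le> E v v" by blast
  have uH: "u \<in> H" using u by (simp add: W_iff)
  obtain c where c: "0 \<le> c" "L u u \<le> c * E u u" using FP.L_le_E uH by blast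
  \<comment> \<open>Zero energy would force \<open>L u u = 0\<close> by the Poincare
    inequality.\<close>
  have "0 < E u u"
  proof (rule ccontr)
    assume "\<not> 0 < E u u"
    then have "c * E u u \<le> 0" using c(1) by (intro mult_nonneg_nonpos) auto
    then show False using c(2) u(2) by simp
  qed
  moreover have "E u v = E u u * L u v" if v: "adm v" for v
  proof -
    have "E u (alt v) = E u u * L u (alt v)"
      by (rule FP.minimiser_euler_lagrange[OF bdd W_def u min alt_W[OF v]])
    moreover have "E u (alt v) = real (card Sym) * E u v"
      by (rule pairing_alt[OF u(1) v E_linear E_sym E_cong E_\<sigma>])
    moreover have "L u (alt v) = real (card Sym) * L u v"
      by (rule pairing_alt[OF u(1) v L_linear _ L_cong L_\<sigma>]) (simp_all add: L_def mult.commute)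
    moreover have "card Sym \<noteq> 0" using finite_Sym permutes_id[of UNIV] unfolding card_eq_0_iff by blast
    ultimately show ?thesis by simp
  qed
  moreover have "u \<noteq> 0" using u(2) LF.zero_left[OF LF.zero_in] by auto
  ultimately show ?thesis using uH unfolding neumann_eigenfunction_def by blast
qed

subsection \<open>Asymptotics of the counting function\<close>

lemma counting_asymptotics:
  assumes "1 / 9 < \<beta> * r" "dS = ln 9 / (- ln (\<beta> * r))" "T = - ln (sqrt (\<beta> * r))"
  shows "\<exists>G :: real \<Rightarrow> real. \<not> G constant_on UNIV \<and> (\<forall>t. G (t + T) = G t) \<and>
    (\<lambda>x. real (FP.counting x) - G (ln x / 2) * x powr (dS / 2)) \<in> O[at_top](\<lambda>x. x powr (1 / 2))"
proof -
  obtain \<kappa> u where u: "0 < \<kappa>" "neumann_eigenfunction \<kappa> u" "u \<noteq> 0" using neumann_eigenfunction_exists by blast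
  show ?thesis
  proof (rule renewal[where N = FP.counting and C = "12 + 6 * sqrt (2 * a * \<rho>)" and \<kappa> = \<kappa>])
    show "0 \<le> 12 + 6 * sqrt (2 * a * \<rho>)" using a \<rho> by simp
    show "FP.counting y + 3 ^ n \<le> FP.counting (\<kappa> / (\<beta> * r) ^ n)" if "y < \<kappa> / (\<beta> * r) ^ n" for n y
      by (rule counting_jump_localised[OF u(2,3) that])
  qed (use assms \<beta>r u counting_scale_lower counting_scale_upper_sqrt in auto)
qed

end

theorem mainTheorem4:
  fixes \<alpha> r \<rho> \<beta> dS T :: real
    and p :: "3 \<Rightarrow> real^2"
    and R :: "nat \<Rightarrow> real \<times> real"
    and \<mu> :: "(real^2) measure"
  assumes "0 < \<alpha>" "\<alpha> < 1"
    and "equilateral p"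
    and "1 / 3 \<le> r" "r < 3 / 5"
    and "\<rho> = 1 - 5 / 3 * r"
    and "\<And>i. i \<ge> 1 \<Longrightarrow> R i = (r, \<rho>)"
    and "0 < \<beta>" "\<beta> < 1 / 3" "\<beta> > 1 / (9 * r)"
    and "\<mu> = mu_l \<alpha> p \<beta>"
    and "dS = ln 9 / (- ln (\<beta> * r))"
    and "T = - ln (sqrt (\<beta> * r))"
  shows "\<exists>G :: real \<Rightarrow> real. \<not> G constant_on UNIV \<and> (\<forall>t. G (t + T) = G t) \<and>
    (\<lambda>x. real (N_D \<alpha> p R \<mu> x) - G (ln x / 2) * x powr (dS / 2)) \<in> O[at_top](\<lambda>x. x powr (1 / 2))"
proof -
  interpret X: gasket_spectral \<alpha> p r \<beta>
    using assms by unfold_locales auto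
  \<comment> \<open>For \<open>c = \<beta> * r\<close> the lower bound on \<beta> is the condition
    \<open>1 / 9 < c\<close> of the renewal argument.\<close>
  have "1 / (9 * r) * r < \<beta> * r" using assms(4,10) by (intro mult_strict_right_mono) auto
  then have "1 / 9 < \<beta> * r" using assms(4) by simp
  moreover have "N_D \<alpha> p R \<mu> x = X.FP.counting x" for x
    unfolding assms(11) by (rule X.N_D_eq) (simp add: X.\<rho>_def assms(6,7))
  ultimately show ?thesis using X.counting_asymptotics assms(12,13) by simp
qed

end
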